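(* Let $k \ge 2$ be an integer and let $\mathbb{F}_k$ be the free group of rank $k$. Then there exists a subgroup $H$ of type $\mathrm{F}_{\lfloor k/2 \rfloor - 1}$ of $\mathrm{Out}(\mathbb{F}_k)$ such that $H$ contains infinitely many conjugacy classes of elements of order $2$.
   Context: $\mathrm{Out}(\mathbb{F}_k) = \mathrm{Aut}(\mathbb{F}_k)/\mathrm{Inn}(\mathbb{F}_k)$ is the outer automorphism group, and $\lfloor k/2 \rfloor$ denotes the floor of $k/2$. A group $H$ is of type $\mathrm{F}_n$ ($n \ge 0$) if there is a $K(H,1)$ CW-complex with finite $n$-skeleton; in particular every group is of type $\mathrm{F}_0$. Conjugacy classes in $H$ are taken with respect to conjugation by elements of $H$ itself. *)

theory Defs
  imports "HOL-Analysis.Analysis" "HOL-Algebra.Bij" "HOL-Algebra.Multiplicative_Group"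
begin

section \<open>Free groups\<close>

text \<open>A letter \<open>(s, True)\<close> is the generator \<open>s\<close>, and \<open>(s, False)\<close> is its formal inverse.\<close>

type_synonym 's word = "('s \<times> bool) list"

definition inv_letter :: "'s \<times> bool \<Rightarrow> 's \<times> bool" where
  "inv_letter l = (fst l, \<not> snd l)"

definition freely_reduced :: "'s word \<Rightarrow> bool" where
  "freely_reduced w \<longleftrightarrow> successively (\<lambda>l m. m \<noteq> inv_letter l) w"

fun cons_reduce :: "'s \<times> bool \<Rightarrow> 's word \<Rightarrow> 's word" where
  "cons_reduce l [] = [l]"
| "cons_reduce l (m # w) = (if m = inv_letter l then w else l # m # w)"

definition free_group :: "'s set \<Rightarrow> 's word monoid" where
  "free_group S =
     \<lparr>carrier = {w. set w \<subseteq> S \<times> UNIV \<and> freely_reduced w},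
      mult = (\<lambda>u v. foldr cons_reduce u v),
      one = []\<rparr>"

lemma inv_letter_inv_letter [simp]: "inv_letter (inv_letter l) = l"
  by (simp add: inv_letter_def)

lemma inv_letter_neq [simp]: "inv_letter l \<noteq> l"
  by (cases l) (simp add: inv_letter_def)

lemma inv_letter_in_iff [simp]: "inv_letter l \<in> S \<times> UNIV \<longleftrightarrow> l \<in> S \<times> UNIV"
  by (cases l) (simp add: inv_letter_def)

lemma reduced_Nil [simp]: "freely_reduced []"
  by (simp add: freely_reduced_def)

lemma reduced_ConsD: "freely_reduced (l # w) \<Longrightarrow> freely_reduced w"
  by (cases w) (auto simp: freely_reduced_def)

lemma reduced_cons_reduce: "freely_reduced w \<Longrightarrow> freely_reduced (cons_reduce l w)"
  by (cases w) (auto simp: freely_reduced_def successively_Cons)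

lemma set_cons_reduce: "set (cons_reduce l w) \<subseteq> insert l (set w)"
  by (cases w) auto

lemma cons_reduce_cancel: "freely_reduced w \<Longrightarrow> cons_reduce l (cons_reduce (inv_letter l) w) = w"
proof (cases w)
  case (Cons m v)
  assume "freely_reduced w"
  then show ?thesis
    using Cons by (cases v; cases "m = l") (auto simp: freely_reduced_def)
qed simp

lemma cons_reduce_reduced: "freely_reduced (l # w) \<Longrightarrow> cons_reduce l w = l # w"
  by (cases w) (auto simp: freely_reduced_def)

lemma reduced_foldr: "freely_reduced v \<Longrightarrow> freely_reduced (foldr cons_reduce u v)"
  by (induction u) (auto intro: reduced_cons_reduce)

lemma set_foldr: "set (foldr cons_reduce u v) \<subseteq> set u \<union> set v"
proof (induction u)
  case (Cons l u)
  then show ?case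
    using set_cons_reduce [of l "foldr cons_reduce u v"] by auto
qed simp

lemma foldr_cons_reduce_cons_reduce:
  "freely_reduced w \<Longrightarrow> foldr cons_reduce (cons_reduce l u) w = cons_reduce l (foldr cons_reduce u w)"
proof (cases u)
  case (Cons m v)
  assume "freely_reduced w"
  then show ?thesis
    using Cons by (auto simp: cons_reduce_cancel reduced_foldr)
qed simp

lemma foldr_cons_reduce_assoc:
  "freely_reduced w \<Longrightarrow>
     foldr cons_reduce (foldr cons_reduce u v) w = foldr cons_reduce u (foldr cons_reduce v w)"
  by (induction u) (auto simp: foldr_cons_reduce_cons_reduce)

lemma foldr_cons_reduce_Nil: "freely_reduced u \<Longrightarrow> foldr cons_reduce u [] = u"
  by (induction u) (simp_all add: cons_reduce_reduced reduced_ConsD)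

lemma foldr_cons_reduce_rev_inv:
  "freely_reduced v \<Longrightarrow> foldr cons_reduce (rev (map inv_letter u)) (foldr cons_reduce u v) = v"
proof (induction u)
  case (Cons l u)
  then show ?case
    using cons_reduce_cancel [of "foldr cons_reduce u v" "inv_letter l"]
    by (simp add: reduced_foldr)
qed simp

theorem group_free_group: "group (free_group S)"
proof (rule groupI)
  fix u assume u: "u \<in> carrier (free_group S)"
  let ?v = "foldr cons_reduce (rev (map inv_letter u)) []"
  have "set (rev (map inv_letter u)) \<subseteq> S \<times> UNIV"
    using u by (force simp: free_group_def inv_letter_def)
  then have "?v \<in> carrier (free_group S)"
    using set_foldr [of "rev (map inv_letter u)" "[]"]
    by (auto simp: free_group_def reduced_foldr)
  moreover have "?v \<otimes>\<^bsub>free_group S\<^esub> u = \<one>\<^bsub>free_group S\<^esub>"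
  proof -
    have "foldr cons_reduce ?v u
        = foldr cons_reduce (rev (map inv_letter u)) (foldr cons_reduce [] u)"
      using u by (intro foldr_cons_reduce_assoc) (simp add: free_group_def)
    also have "\<dots> = foldr cons_reduce (rev (map inv_letter u)) (foldr cons_reduce u [])"
      using u by (simp add: free_group_def foldr_cons_reduce_Nil)
    also have "\<dots> = []"
      by (rule foldr_cons_reduce_rev_inv) simp
    finally show ?thesis
      by (simp add: free_group_def)
  qed
  ultimately show "\<exists>v \<in> carrier (free_group S). v \<otimes>\<^bsub>free_group S\<^esub> u = \<one>\<^bsub>free_group S\<^esub>"
    by blast
next
  fix u v assume "u \<in> carrier (free_group S)" "v \<in> carrier (free_group S)"
  then show "u \<otimes>\<^bsub>free_group S\<^esub> v \<in> carrier (free_group S)"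
    using set_foldr [of u v] by (auto simp: free_group_def reduced_foldr)
qed (auto simp: free_group_def foldr_cons_reduce_assoc)


section \<open>Outer automorphisms and conjugacy classes\<close>

definition Inn :: "('a, 'b) monoid_scheme \<Rightarrow> ('a \<Rightarrow> 'a) set" where
  "Inn G = {\<lambda>x\<in>carrier G. g \<otimes>\<^bsub>G\<^esub> x \<otimes>\<^bsub>G\<^esub> inv\<^bsub>G\<^esub> g | g. g \<in> carrier G}"

definition Out :: "('a, 'b) monoid_scheme \<Rightarrow> ('a \<Rightarrow> 'a) set monoid" where
  "Out G = AutoGroup G Mod Inn G"

definition conjugacy_class :: "('a, 'b) monoid_scheme \<Rightarrow> 'a \<Rightarrow> 'a set" where
  "conjugacy_class G x = {g \<otimes>\<^bsub>G\<^esub> x \<otimes>\<^bsub>G\<^esub> inv\<^bsub>G\<^esub> g | g. g \<in> carrier G}"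

lemma carrier_AutoGroup: "carrier (AutoGroup G) = auto G"
  by (simp add: AutoGroup_def)

lemma mult_AutoGroup:
  "f \<in> auto G \<Longrightarrow> h \<in> auto G \<Longrightarrow> f \<otimes>\<^bsub>AutoGroup G\<^esub> h = compose (carrier G) f h"
  by (simp add: AutoGroup_def BijGroup_def auto_def)

context group
begin

lemma auto_eqI:
  assumes "f \<in> auto G" "h \<in> auto G" "\<And>x. x \<in> carrier G \<Longrightarrow> f x = h x"
  shows "f = h"
  using assms by (auto simp: auto_def Bij_def intro: extensionalityI)

lemma conj_in_auto:
  assumes g: "g \<in> carrier G"
  shows "(\<lambda>x\<in>carrier G. g \<otimes> x \<otimes> inv g) \<in> auto G"
proof -
  have "g \<otimes> (inv g \<otimes> x \<otimes> g) \<otimes> inv g = x" if "x \<in> carrier G" for x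
    using g that by (simp add: m_assoc) (simp flip: m_assoc)
  moreover have "inv g \<otimes> (g \<otimes> x \<otimes> inv g) \<otimes> g = x" if "x \<in> carrier G" for x
    using g that by (simp add: m_assoc) (simp flip: m_assoc)
  ultimately have "bij_betw (\<lambda>x\<in>carrier G. g \<otimes> x \<otimes> inv g) (carrier G) (carrier G)"
    using g by (intro bij_betw_byWitness [where f' = "\<lambda>x. inv g \<otimes> x \<otimes> g"]) auto
  moreover have "g \<otimes> (x \<otimes> y) \<otimes> inv g = (g \<otimes> x \<otimes> inv g) \<otimes> (g \<otimes> y \<otimes> inv g)"
    if "x \<in> carrier G" "y \<in> carrier G" for x y
  proof -
    have "inv g \<otimes> (g \<otimes> (y \<otimes> inv g)) = y \<otimes> inv g"
      using g that by (simp flip: m_assoc)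
    then show ?thesis
      using g that by (simp add: m_assoc)
  qed
  ultimately show ?thesis
    using g by (auto simp: auto_def Bij_def hom_def)
qed

lemma Inn_normal: "Inn G \<lhd> AutoGroup G"
proof -
  interpret A: group "AutoGroup G"
    by (rule AutoGroup)
  let ?c = "\<lambda>g. \<lambda>x\<in>carrier G. g \<otimes> x \<otimes> inv g"
  have mult: "?c g \<otimes>\<^bsub>AutoGroup G\<^esub> ?c h = ?c (g \<otimes> h)"
    if "g \<in> carrier G" "h \<in> carrier G" for g h
    using that by (subst mult_AutoGroup)
      (auto simp: conj_in_auto compose_def m_assoc inv_mult_group intro!: restrict_ext)
  have one: "?c \<one> = \<one>\<^bsub>AutoGroup G\<^esub>"
    by (auto simp: AutoGroup_def BijGroup_def)
  have sub: "subgroup (Inn G) (AutoGroup G)"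
  proof (rule A.subgroupI)
    show "Inn G \<subseteq> carrier (AutoGroup G)"
      using conj_in_auto by (auto simp: Inn_def carrier_AutoGroup)
    show "Inn G \<noteq> {}"
      unfolding Inn_def by blast
  next
    fix a assume "a \<in> Inn G"
    then obtain g where g: "g \<in> carrier G" "a = ?c g"
      unfolding Inn_def by blast
    have "?c (inv g) \<otimes>\<^bsub>AutoGroup G\<^esub> a = \<one>\<^bsub>AutoGroup G\<^esub>"
      using g mult [of "inv g" g] one by simp
    then have "inv\<^bsub>AutoGroup G\<^esub> a = ?c (inv g)"
      using g conj_in_auto [of g] conj_in_auto [of "inv g"]
      by (intro A.inv_equality) (auto simp: carrier_AutoGroup)
    then show "inv\<^bsub>AutoGroup G\<^esub> a \<in> Inn G"
      using g unfolding Inn_def by blast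
  next
    fix a b assume "a \<in> Inn G" "b \<in> Inn G"
    then obtain g h where "g \<in> carrier G" "a = ?c g" "h \<in> carrier G" "b = ?c h"
      unfolding Inn_def by blast
    then show "a \<otimes>\<^bsub>AutoGroup G\<^esub> b \<in> Inn G"
      using mult [of g h] unfolding Inn_def by blast
  qed
  have "f \<otimes>\<^bsub>AutoGroup G\<^esub> a \<otimes>\<^bsub>AutoGroup G\<^esub> inv\<^bsub>AutoGroup G\<^esub> f \<in> Inn G"
    if f: "f \<in> carrier (AutoGroup G)" and a: "a \<in> Inn G" for f a
  proof -
    obtain g where g: "g \<in> carrier G" "a = ?c g"
      using a unfolding Inn_def by blast
    have fA: "f \<in> auto G" and fh: "f \<in> hom G G"
      using f by (auto simp: carrier_AutoGroup auto_def)
    then interpret f: group_hom G G f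
      by unfold_locales
    have fg: "f g \<in> carrier G"
      using g by simp
    have "f \<otimes>\<^bsub>AutoGroup G\<^esub> a = ?c (f g) \<otimes>\<^bsub>AutoGroup G\<^esub> f"
      using g fg fA conj_in_auto
      by (auto simp: mult_AutoGroup compose_def intro!: restrict_ext)
    then have "f \<otimes>\<^bsub>AutoGroup G\<^esub> a \<otimes>\<^bsub>AutoGroup G\<^esub> inv\<^bsub>AutoGroup G\<^esub> f = ?c (f g)"
      using f conj_in_auto [OF fg] by (simp add: A.m_assoc flip: carrier_AutoGroup)
    then show ?thesis
      using fg unfolding Inn_def by blast
  qed
  then show ?thesis
    using sub by (simp add: A.normal_inv_iff)
qed

theorem group_Out: "group (Out G)"
  unfolding Out_def by (rule normal.factorgroup_is_group [OF Inn_normal])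

end


section \<open>CW complexes\<close>

definition disc :: "nat \<Rightarrow> (nat \<Rightarrow> real) topology" where
  "disc n = subtopology (Euclidean_space n) {x. (\<Sum>i<n. (x i)\<^sup>2) \<le> 1}"

definition disc_interior :: "nat \<Rightarrow> (nat \<Rightarrow> real) set" where
  "disc_interior n = {x \<in> topspace (disc n). (\<Sum>i<n. (x i)\<^sup>2) < 1}"

definition disc_boundary :: "nat \<Rightarrow> (nat \<Rightarrow> real) set" where
  "disc_boundary n = {x \<in> topspace (disc n). (\<Sum>i<n. (x i)\<^sup>2) = 1}"

text \<open>
  \<open>E n\<close> is the set of characteristic maps of the \<open>n\<close>-cells, which serve as indices of the cells:
  by \<open>disjoint\<close>, distinct elements of \<open>E n\<close> have distinct open cells.
\<close>

locale cw_complex =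
  fixes X :: "'p topology" and E :: "nat \<Rightarrow> ((nat \<Rightarrow> real) \<Rightarrow> 'p) set"
  assumes Hausdorff: "Hausdorff_space X"
    and continuous: "\<And>n \<phi>. \<phi> \<in> E n \<Longrightarrow> continuous_map (disc n) X \<phi>"
    and embedding:
      "\<And>n \<phi>. \<phi> \<in> E n \<Longrightarrow> embedding_map (subtopology (disc n) (disc_interior n)) X \<phi>"
    and disjoint:
      "\<And>n m \<phi> \<psi>. \<lbrakk>\<phi> \<in> E n; \<psi> \<in> E m; (n, \<phi>) \<noteq> (m, \<psi>)\<rbrakk>
         \<Longrightarrow> disjnt (\<phi> ` disc_interior n) (\<psi> ` disc_interior m)"
    and cover: "topspace X = (\<Union>n. \<Union>\<phi>\<in>E n. \<phi> ` disc_interior n)"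
    and closure_finite:
      "\<And>n \<phi>. \<phi> \<in> E n \<Longrightarrow>
         \<exists>F. finite F \<and> F \<subseteq> (SIGMA m:{..<n}. E m) \<and>
             \<phi> ` disc_boundary n \<subseteq> (\<Union>(m, \<psi>)\<in>F. \<psi> ` disc_interior m)"
    and weak_topology:
      "\<And>A. A \<subseteq> topspace X \<Longrightarrow>
         closedin X A \<longleftrightarrow> (\<forall>n. \<forall>\<phi>\<in>E n. closedin X (A \<inter> \<phi> ` topspace (disc n)))"


section \<open>Homotopy groups\<close>

definition cube :: "nat \<Rightarrow> (nat \<Rightarrow> real) topology" where
  "cube n = product_topology (\<lambda>_. top_of_set {0..1}) {..<n}"

definition cube_boundary :: "nat \<Rightarrow> (nat \<Rightarrow> real) set" where
  "cube_boundary n = {x \<in> topspace (cube n). \<exists>i<n. x i = 0 \<or> x i = 1}"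

definition cube_maps :: "nat \<Rightarrow> 'p topology \<Rightarrow> 'p \<Rightarrow> ((nat \<Rightarrow> real) \<Rightarrow> 'p) set" where
  "cube_maps n X a = {f. continuous_map (cube n) X f \<and> (\<forall>x\<in>cube_boundary n. f x = a)}"

definition cube_homotopy ::
  "nat \<Rightarrow> 'p topology \<Rightarrow> 'p \<Rightarrow> (((nat \<Rightarrow> real) \<Rightarrow> 'p) \<times> ((nat \<Rightarrow> real) \<Rightarrow> 'p)) set" where
  "cube_homotopy n X a =
     {(f, g). f \<in> cube_maps n X a \<and> g \<in> cube_maps n X a \<and>
        homotopic_with (\<lambda>h. \<forall>x\<in>cube_boundary n. h x = a) (cube n) X f g}"

definition cube_concat ::
  "((nat \<Rightarrow> real) \<Rightarrow> 'p) \<Rightarrow> ((nat \<Rightarrow> real) \<Rightarrow> 'p) \<Rightarrow> (nat \<Rightarrow> real) \<Rightarrow> 'p" where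
  "cube_concat f g x =
     (if x 0 \<le> 1/2 then f (x(0 := 2 * x 0)) else g (x(0 := 2 * x 0 - 1)))"

text \<open>The group \<open>\<pi>\<^sub>n(X, a)\<close>, for \<open>n \<ge> 1\<close>; for \<open>n = 1\<close> this is the fundamental group.\<close>

definition homotopy_group ::
  "nat \<Rightarrow> 'p topology \<Rightarrow> 'p \<Rightarrow> ((nat \<Rightarrow> real) \<Rightarrow> 'p) set monoid" where
  "homotopy_group n X a =
     \<lparr>carrier = cube_maps n X a // cube_homotopy n X a,
      mult = (\<lambda>A B. \<Union>f\<in>A. \<Union>g\<in>B. cube_homotopy n X a `` {cube_concat f g}),
      one = cube_homotopy n X a `` {\<lambda>_. a}\<rparr>"


section \<open>Finiteness properties of groups\<close>

definition Eilenberg_MacLane_1 :: "('a, 'b) monoid_scheme \<Rightarrow> 'p topology \<Rightarrow> bool" where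
  "Eilenberg_MacLane_1 H X \<longleftrightarrow>
     topspace X \<noteq> {} \<and> path_connected_space X \<and>
     (\<forall>a\<in>topspace X.
        homotopy_group 1 X a \<cong> H \<and>
        (\<forall>n\<ge>2. carrier (homotopy_group n X a) = {\<one>\<^bsub>homotopy_group n X a\<^esub>}))"

text \<open>
  HOL does not allow quantification over the type of points of \<open>X\<close>. The type \<open>'a \<times> real\<close> is large
  enough: attaching cells of dimension greater than \<open>n\<close> suffices to turn a finite \<open>n\<close>-skeleton
  of a \<open>K(H, 1)\<close> into a \<open>K(H, 1)\<close>, and at most \<open>max |H| \<aleph>\<^sub>0\<close> of them are needed. So whenever a
  \<open>K(H, 1)\<close> with finite \<open>n\<close>-skeleton exists, one exists with at most \<open>max |H| |\<real>|\<close> points.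
\<close>

definition type_F :: "nat \<Rightarrow> ('a, 'b) monoid_scheme \<Rightarrow> bool" where
  "type_F n H \<longleftrightarrow>
     (\<exists>(X :: ('a \<times> real) topology) E.
        cw_complex X E \<and> Eilenberg_MacLane_1 H X \<and> (\<forall>i\<le>n. finite (E i)))"

end

theory Submission
  imports Defs
begin

text \<open>
  Put \<open>m = k div 2\<close> and let \<open>H\<close> be the group of pairs of a tuple \<open>w\<close> in the \<open>m\<close>-th power of the free
  group on two letters, of total exponent sum 0, and a sign that swaps the two letters in all
  coordinates. It embeds into \<open>Out(F\<^sub>k)\<close>: in the \<open>i\<close>-th of \<open>m\<close> blocks of two generators \<open>x\<close>, \<open>y\<close> the two
  letters act by \<open>x \<mapsto> x y\<^sup>2\<close> and \<open>y \<mapsto> y x\<^sup>2\<close>, and ping-pong on exponent sums shows that the action is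
  faithful even on the abelianization.

  The involutions \<open>u t u\<^sup>-\<^sup>1\<close>, with \<open>t\<close> the swap and \<open>u = (a\<^sup>n, 1, \<dots>, 1)\<close>, lie in \<open>H\<close>. Words fixed by the swap
  are trivial, so the elements conjugating \<open>t\<close> to \<open>u t u\<^sup>-\<^sup>1\<close> have coordinates \<open>u\<close>, whose exponent sum is
  \<open>n\<close>; hence different \<open>n\<close> give different conjugacy classes of \<open>H\<close>.

  For the finiteness property, \<open>H\<close> acts on the product of \<open>m\<close> copies of the Cayley tree, and cocompactly
  on the slab spanned by the vertices of height between 0 and \<open>m - 1\<close>. Through each vertex \<open>v\<close> outside
  the slab there is a flat, a product of \<open>m\<close> lines, on which the height runs from \<open>v\<close> towards the slab.
  A polyhedral ball of this flat around \<open>v\<close> has its boundary in the slab; glue an \<open>m\<close>-cell, the dome of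
  \<open>v\<close>, to this boundary. The dome and the ball bound an \<open>(m + 1)\<close>-dimensional lens in which the star of \<open>v\<close>
  is a free face, so the vertices outside the slab can be removed in the order of decreasing distance,
  starting from the contractible product of trees with all lenses attached. Hence the slab with all
  domes is contractible. There are infinitely many orbits of domes, but these have dimension \<open>m\<close>. The
  product with the infinite sphere, on which the swap acts by the antipodal map, is a contractible
  complex with a free action of \<open>H\<close>, and its quotient has a finite \<open>(m - 1)\<close>-skeleton.
\<close>

text \<open>On the side facing the slab every vertex of a tree has exactly two neighbours, one for
  each letter. So the link of an outer vertex in this direction is a join of \<open>m\<close> pairs
  of points, an (m - 1)-sphere, and the flat is the sheet through it: one disc per outer vertex, the
  dome, is the right cell to add. The height \<open>m - 1\<close> of the slab is forced by the
  polyhedral ball: the cubes in the boundary of the ball of a vertex of level \<open>n\<close> have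
  vertices between \<open>n\<close> and \<open>n + m - 1\<close> steps away from the centre.
  Contractibility is not approached through homotopy groups of the complex. It is an extension
  property for maps of compact sets, which passes to unions along intersections that have it, and
  which is carried through a lens by a retraction onto its rim. A compact image meets finitely many
  cells, so only finitely many lenses have to be emptied for each map. The condition on the exponent
  sum does two things at once: without it all \<open>u t u^-1\<close> would be conjugate, and it is
  what makes the action preserve the slab.\<close>

section \<open>Absolute extensors and cubes\<close>

text \<open>Contractibility is used only in this form, for compact sets of sequences, which contain all cubes.\<close>

definition abs_ext :: "'p topology \<Rightarrow> bool" where
  "abs_ext Y \<longleftrightarrow>
     (\<forall>(C :: (nat \<Rightarrow> real) set) D f.
        compact C \<and> compact D \<and> C \<subseteq> D \<and> continuous_map (top_of_set C) Y f \<longrightarrow>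
        (\<exists>g. continuous_map (top_of_set D) Y g \<and> (\<forall>x\<in>C. g x = f x)))"

lemma abs_extE:
  fixes C D :: "(nat \<Rightarrow> real) set"
  assumes "abs_ext Y" "compact C" "compact D" "C \<subseteq> D" "continuous_map (top_of_set C) Y f"
  obtains g where "continuous_map (top_of_set D) Y g" "\<And>x. x \<in> C \<Longrightarrow> g x = f x"
  using assms(1)[unfolded abs_ext_def, rule_format, of C D f] assms(2-) that by blast

text \<open>Coordinates outside \<open>I\<close> are constantly \<open>undefined\<close> on
  \<open>PiE I S\<close>, hence continuous. In this form cubes are subspaces of the space of real
  sequences, where compactness and pasting along closed sets are available.\<close>

lemma product_topology_top_of_set:
  fixes S :: "'i \<Rightarrow> 'a::topological_space set"
  shows "product_topology (\<lambda>i. top_of_set (S i)) I = top_of_set (PiE I S)"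
proof -
  have 1: "continuous_map (product_topology (\<lambda>i. top_of_set (S i)) I) (top_of_set (PiE I S)) id"
  proof -
    have "continuous_map (product_topology (\<lambda>i. top_of_set (S i)) I) euclidean (\<lambda>x. x k)" for k
    proof (cases "k \<in> I")
      case True
      then have "continuous_map (product_topology (\<lambda>i. top_of_set (S i)) I) (top_of_set (S k)) (\<lambda>x. x k)"
        by (rule continuous_map_product_projection)
      then show ?thesis
        using continuous_map_into_fulltopology by blast
    next
      case False
      have "continuous_map (product_topology (\<lambda>i. top_of_set (S i)) I) euclidean (\<lambda>x. undefined :: 'a)"
        by simp
      then show ?thesis
        by (rule continuous_map_eq) (use False in \<open>auto simp: PiE_def extensional_def\<close>)
    qed
    then have "continuous_map (product_topology (\<lambda>i. top_of_set (S i)) I)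
        (product_topology (\<lambda>_. euclidean) UNIV) id"
      by (simp add: continuous_map_componentwise_UNIV)
    then show ?thesis
      by (auto simp: euclidean_product_topology intro!: continuous_map_into_subtopology)
  qed
  have 2: "continuous_map (top_of_set (PiE I S)) (product_topology (\<lambda>i. top_of_set (S i)) I) id"
  proof -
    have "continuous_map (top_of_set (PiE I S)) (top_of_set (S k)) (\<lambda>x. x k)" if "k \<in> I" for k
      using that by (auto intro: continuous_on_product_coordinates continuous_on_subset)
    then show ?thesis
      by (auto simp: continuous_map_componentwise PiE_iff)
  qed
  have "homeomorphic_maps (product_topology (\<lambda>i. top_of_set (S i)) I) (top_of_set (PiE I S)) id id"
    using 1 2 by (simp add: homeomorphic_maps_def)
  then show ?thesis
    by (simp add: homeomorphic_maps_id)
qed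

lemma connected_PiE:
  fixes S :: "'i \<Rightarrow> 'a::topological_space set"
  assumes "\<And>i. i \<in> I \<Longrightarrow> connected (S i)"
  shows "connected (PiE I S)"
proof -
  have "connected_space (product_topology (\<lambda>i. top_of_set (S i)) I)"
    using assms by (auto simp: connected_space_product_topology connected_space_subtopology)
  then show ?thesis
    by (metis connectedin_iff_connected connectedin_topspace product_topology_top_of_set topspace_euclidean_subtopology connectedin_subtopology)
qed

lemma compact_PiE:
  fixes S :: "'i \<Rightarrow> 'a::topological_space set"
  assumes "\<And>i. i \<in> I \<Longrightarrow> compact (S i)"
  shows "compact (PiE I S)"
proof -
  have "compact_space (product_topology (\<lambda>i. top_of_set (S i)) I)"
    using assms by (auto simp: compact_space_product_topology compact_space_subtopology)
  then show ?thesis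
    by (metis compactin_euclidean_iff compactin_subspace product_topology_top_of_set subset_UNIV topspace_euclidean)
qed

lemma cube_eq: "cube n = top_of_set (PiE {..<n} (\<lambda>_. {0..1}))"
  by (simp add: cube_def product_topology_top_of_set)

lemma topspace_cube: "topspace (cube n) = PiE {..<n} (\<lambda>_. {0..1})"
  by (simp add: cube_eq)

lemma compact_cube: "compact (topspace (cube n))"
  by (simp add: topspace_cube compact_PiE)

lemma continuous_on_coord: "continuous_on S (\<lambda>x. x i)"
  by (rule continuous_on_subset[OF continuous_on_product_coordinates]) simp

lemma closed_coord: "closed {x :: nat \<Rightarrow> real. x i = c}"
  by (intro closed_Collect_eq continuous_on_coord continuous_on_const)

lemma compact_cube_boundary: "compact (cube_boundary n)"
proof -
  have "cube_boundary n = topspace (cube n) \<inter> (\<Union>i\<in>{..<n}. {x. x i = 0} \<union> {x. x i = 1})"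
    unfolding cube_boundary_def by auto
  then show ?thesis
    by (auto intro!: compact_Int_closed compact_cube closed_UN closed_Un closed_coord)
qed

lemma paste_closed:
  fixes A B :: "'a::topological_space set"
  assumes "closed A" "closed B"
    and f: "continuous_map (top_of_set A) Y f" and g: "continuous_map (top_of_set B) Y g"
    and eq: "\<And>x. x \<in> A \<Longrightarrow> x \<in> B \<Longrightarrow> f x = g x"
  shows "continuous_map (top_of_set (A \<union> B)) Y (\<lambda>x. if x \<in> A then f x else g x)"
  unfolding continuous_map_closedin
proof (intro conjI allI impI)
  show "(\<lambda>x. if x \<in> A then f x else g x) \<in> topspace (top_of_set (A \<union> B)) \<rightarrow> topspace Y"
    using f g by (auto simp: continuous_map_def)
  fix C assume C: "closedin Y C"
  have "closedin (top_of_set A) {x \<in> A. f x \<in> C}" "closedin (top_of_set B) {x \<in> B. g x \<in> C}"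
    using f g C by (auto simp: continuous_map_closedin)
  then have "closed {x \<in> A. f x \<in> C}" "closed {x \<in> B. g x \<in> C}"
    using assms closedin_closed_trans by blast+
  then have "closed ({x \<in> A. f x \<in> C} \<union> {x \<in> B. g x \<in> C})"
    by blast
  moreover have "{x \<in> topspace (top_of_set (A \<union> B)). (if x \<in> A then f x else g x) \<in> C}
     = {x \<in> A. f x \<in> C} \<union> {x \<in> B. g x \<in> C}"
    using eq by auto
  ultimately show "closedin (top_of_set (A \<union> B))
      {x \<in> topspace (top_of_set (A \<union> B)). (if x \<in> A then f x else g x) \<in> C}"
    by (metis (no_types, lifting) Un_mono closed_subset mem_Collect_eq subsetI sup.mono)
qed

definition pt :: "real \<Rightarrow> nat \<Rightarrow> real" where
  "pt t = (\<lambda>i\<in>{..<1}. t)"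

lemma pt_0 [simp]: "pt t 0 = t" by (simp add: pt_def)

lemma pt_inject [simp]: "pt s = pt t \<longleftrightarrow> s = t"
  by (metis pt_0)

lemma cube_1: "x \<in> topspace (cube 1) \<Longrightarrow> x = pt (x 0)"
  by (auto simp: topspace_cube pt_def PiE_def extensional_def)

lemma pt_in_cube [simp]: "pt t \<in> topspace (cube (Suc 0)) \<longleftrightarrow> 0 \<le> t \<and> t \<le> 1"
  by (auto simp: topspace_cube pt_def)

lemma cube_boundary_1: "cube_boundary 1 = {pt 0, pt 1}"
  using cube_1 by (fastforce simp: cube_boundary_def)

lemma continuous_pt: "continuous_map (top_of_set {0..1}) (cube 1) pt"
proof -
  have "continuous_on {0..1} pt"
  proof (rule continuous_on_coordinatewise_then_product)
    show "continuous_on {0..1} (\<lambda>t. pt t i)" for i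
      by (cases "i < 1") (auto simp: pt_def)
  qed
  then show ?thesis
    by (auto simp: cube_eq pt_def)
qed

lemma cube_Suc_upd:
  assumes "x \<in> topspace (cube n)" "0 \<le> t" "t \<le> 1"
  shows "x(n := t) \<in> topspace (cube (Suc n))"
  using assms by (auto simp: topspace_cube PiE_def extensional_def Pi_def less_Suc_eq)

lemma cube_Suc_restrict:
  assumes "z \<in> topspace (cube (Suc n))"
  shows "z(n := undefined) \<in> topspace (cube n)"
  using assms by (auto simp: topspace_cube PiE_def extensional_def Pi_def less_Suc_eq)

text \<open>The homotopy parameter becomes the last coordinate of a larger cube, so that extension
  and lifting for cubes also apply to homotopies and the first \<open>n\<close> coordinates keep
  their indices.\<close>

lemma continuous_map_upd:
  "continuous_map (prod_topology (top_of_set {0..1}) (cube n)) (cube (Suc n)) (\<lambda>(t,x). x(n := t))"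
proof -
  have *: "continuous_on ({0..1} \<times> topspace (cube n)) (\<lambda>(t,x). x(n := t :: real))"
    unfolding case_prod_unfold
  proof (rule continuous_on_coordinatewise_then_product)
    fix i
    show "continuous_on ({0..1} \<times> topspace (cube n)) (\<lambda>x. ((snd x)(n := fst x)) i)"
    proof (cases "i = n")
      case False
      have "continuous_on ({0..1} \<times> topspace (cube n)) (\<lambda>x. snd x i)"
        by (rule continuous_on_product_then_coordinatewise) (rule continuous_on_snd[OF continuous_on_id])
      then show ?thesis using False by simp
    qed (simp add: continuous_on_fst[OF continuous_on_id])
  qed
  have "prod_topology (top_of_set {0..1::real}) (cube n) = top_of_set ({0..1} \<times> topspace (cube n))"
    by (simp add: cube_eq[of n] topspace_cube prod_topology_subtopology_eu)
  moreover have "(\<lambda>(t,x). x(n := t)) ` ({0..1} \<times> topspace (cube n)) \<subseteq> topspace (cube (Suc n))"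
    using cube_Suc_upd by auto
  ultimately show ?thesis
    using * by (simp add: cube_eq[of "Suc n"] image_subset_iff_funcset topspace_cube)
qed

text \<open>The values on the bottom, on the top and on the sides over the boundary are prescribed
  and compatible, so they form a map on a compact part of the larger cube.\<close>

lemma abs_ext_homotopy:
  assumes Y: "abs_ext Y"
    and f: "continuous_map (cube n) Y f" and g: "continuous_map (cube n) Y g"
    and eq: "\<And>x. x \<in> cube_boundary n \<Longrightarrow> f x = g x"
  obtains G where "continuous_map (cube (Suc n)) Y G"
    "\<And>x. x \<in> topspace (cube n) \<Longrightarrow> G (x(n := 0)) = f x"
    "\<And>x. x \<in> topspace (cube n) \<Longrightarrow> G (x(n := 1)) = g x"
    "\<And>x t. x \<in> cube_boundary n \<Longrightarrow> 0 \<le> t \<Longrightarrow> t \<le> 1 \<Longrightarrow> G (x(n := t)) = f x"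
proof -
  define r :: "(nat \<Rightarrow> real) \<Rightarrow> nat \<Rightarrow> real" where "r = (\<lambda>z. z(n := undefined))"
  define D where "D = topspace (cube (Suc n))"
  have contr: "continuous_on S r" for S
  proof (rule continuous_on_coordinatewise_then_product)
    show "continuous_on S (\<lambda>z. r z i)" for i
      by (cases "i = n") (auto simp: r_def continuous_on_coord)
  qed
  have contr': "continuous_map (top_of_set S) (cube n) r" if "S \<subseteq> D" for S
  proof -
    have "r ` S \<subseteq> topspace (cube n)"
      using that cube_Suc_restrict unfolding r_def D_def by blast
    then show ?thesis
      using contr[of S] by (auto simp: cube_eq[of n] topspace_cube)
  qed
  have "closed (cube_boundary n)"
    by (simp add: compact_cube_boundary compact_imp_closed)
  then have cl: "closed (r -` cube_boundary n)"
    using contr by (rule closed_vimage)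
  \<comment> \<open>Bottom and sides form \<open>A\<close>, the top is \<open>B\<close>. The map
    \<open>r\<close> forgets the last coordinate; \<open>undefined\<close> is the value that points
    of \<open>cube n\<close> have at the index \<open>n\<close>.\<close>
  define A where "A = D \<inter> ({z. z n = 0} \<union> r -` cube_boundary n)"
  define B where "B = D \<inter> {z. z n = 1}"
  have D: "compact D" "closed D"
    by (auto simp: D_def compact_cube compact_imp_closed)
  have cA: "compact A" and cB: "compact B"
    unfolding A_def B_def using D cl closed_coord by (auto intro!: compact_Int_closed closed_Un)
  have rupd: "r (x(n := t)) = x" if "x \<in> topspace (cube n)" for x t
    using that by (auto simp: r_def topspace_cube PiE_def extensional_def fun_eq_iff)
  have fg: "continuous_map (top_of_set A) Y (f \<circ> r)" "continuous_map (top_of_set B) Y (g \<circ> r)"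
    using f g contr'[of A] contr'[of B] by (auto simp: A_def B_def intro: continuous_map_compose)
  have AD: "A \<union> B \<subseteq> D"
    by (auto simp: A_def B_def)
  have "continuous_map (top_of_set (A \<union> B)) Y (\<lambda>z. if z \<in> A then (f \<circ> r) z else (g \<circ> r) z)"
  proof (rule paste_closed[OF compact_imp_closed[OF cA] compact_imp_closed[OF cB] fg])
    show "(f \<circ> r) z = (g \<circ> r) z" if "z \<in> A" "z \<in> B" for z
      using that by (auto simp: A_def B_def eq)
  qed
  from abs_extE[OF Y compact_Un[OF cA cB] D(1) AD this]
  obtain G where G0: "continuous_map (top_of_set D) Y G"
     "\<And>z. z \<in> A \<union> B \<Longrightarrow> G z = (if z \<in> A then (f \<circ> r) z else (g \<circ> r) z)"
    by blast
  have G: "continuous_map (top_of_set D) Y G"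
     "z \<in> A \<union> B \<Longrightarrow> G z = (if z \<in> A then f (r z) else g (r z))" for z
    using G0(1) G0(2)[of z] by simp_all
  show thesis
  proof
    show "continuous_map (cube (Suc n)) Y G"
      using G(1) by (simp add: D_def cube_eq topspace_cube)
    have inA: "x(n := t) \<in> A \<longleftrightarrow> t = 0 \<or> x \<in> cube_boundary n" and inB: "x(n := t) \<in> B \<longleftrightarrow> t = 1"
      if "x \<in> topspace (cube n)" "0 \<le> t" "t \<le> 1" for x t
      using rupd[OF that(1), of t] cube_Suc_upd[OF that] by (simp_all add: A_def B_def D_def)
    show "G (x(n := 0)) = f x" if "x \<in> topspace (cube n)" for x
      using G(2)[of "x(n := 0)"] inA[OF that, of 0] by (simp add: rupd that)
    show "G (x(n := 1)) = g x" if x: "x \<in> topspace (cube n)" for x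
      using G(2)[of "x(n := 1)"] inA[OF that, of 1] inB[OF that, of 1] eq[of x]
      by (cases "x \<in> cube_boundary n") (simp_all add: rupd that)
    show "G (x(n := t)) = f x" if x: "x \<in> cube_boundary n" and t: "0 \<le> t" "t \<le> 1" for x t
    proof -
      have x': "x \<in> topspace (cube n)" using x by (simp add: cube_boundary_def)
      show ?thesis using G(2)[of "x(n := t)"] inA[OF x' t] x by (simp add: rupd x')
    qed
  qed
qed

lemma abs_ext_path:
  assumes Y: "abs_ext Y" and "y \<in> topspace Y" "z \<in> topspace Y"
  obtains g where "continuous_map (cube 1) Y g" "g (pt 0) = y" "g (pt 1) = z"
proof -
  let ?f = "\<lambda>x. if x \<in> {pt 0} then y else z"
  have "continuous_map (top_of_set ({pt 0} \<union> {pt 1})) Y ?f"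
    by (intro paste_closed) (use assms in auto)
  moreover have "{pt 0, pt 1} \<subseteq> topspace (cube 1)" by auto
  ultimately obtain g where "continuous_map (top_of_set (topspace (cube 1))) Y g"
     "\<And>x. x \<in> {pt 0, pt 1} \<Longrightarrow> g x = ?f x"
    using abs_extE[OF Y, of "{pt 0, pt 1}" "topspace (cube 1)" ?f] compact_cube
    by (auto simp: insert_commute)
  then show thesis
    by (intro that[of g]) (auto simp: cube_eq topspace_cube)
qed

text \<open>The distance of sequences is at most twice the maximum over finitely many coordinates
  plus a tail \<open>(1/2)^N\<close>, which can be made arbitrarily small.\<close>

lemma dist_fun_le:
  fixes x y :: "nat \<Rightarrow> real"
  assumes "\<And>i. dist (x i) (y i) \<le> e"
  shows "dist x y \<le> 2 * e"
proof (rule field_le_epsilon)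
  fix d :: real assume "d > 0"
  then obtain N where N: "(1/2)^N < d"
    using real_arch_pow_inv[of d "1/2"] by auto
  have "dist x y \<le> 2 * Max {dist (x (from_nat n)) (y (from_nat n))|n. n \<le> N} + (1/2)^N"
    by (rule dist_fun_le_dist_first_terms)
  moreover have "Max {dist (x (from_nat n)) (y (from_nat n))|n. n \<le> N} \<le> e"
    using assms by (subst Max_le_iff) auto
  ultimately show "dist x y \<le> 2 * e + d"
    using N by linarith
qed

lemma all_upd_le:
  fixes a b x :: "nat \<Rightarrow> real"
  assumes "i < n" "c \<le> b i"
  shows "(\<forall>j<n. a j \<le> x j \<and> x j \<le> (b(i := c)) j) \<longleftrightarrow> (\<forall>j<n. a j \<le> x j \<and> x j \<le> b j) \<and> x i \<le> c"
    (is "?L \<longleftrightarrow> ?R")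
proof
  assume L: ?L
  have "x j \<le> b j" if "j < n" for j
    using L[rule_format, OF that] assms by (cases "j = i") auto
  moreover have "x i \<le> c" using L[rule_format, OF assms(1)] by simp
  ultimately show ?R using L by simp
qed simp

lemma all_upd_ge:
  fixes a b x :: "nat \<Rightarrow> real"
  assumes "i < n" "a i \<le> c"
  shows "(\<forall>j<n. (a(i := c)) j \<le> x j \<and> x j \<le> b j) \<longleftrightarrow> (\<forall>j<n. a j \<le> x j \<and> x j \<le> b j) \<and> c \<le> x i"
    (is "?L \<longleftrightarrow> ?R")
proof
  assume L: ?L
  have "a j \<le> x j" if "j < n" for j
    using L[rule_format, OF that] assms by (cases "j = i") auto
  moreover have "c \<le> x i" using L[rule_format, OF assms(1)] by simp
  ultimately show ?R using L by simp
qed simp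

section \<open>Covering space theory of the quotient by a free action\<close>

section \<open>Properly discontinuous free actions\<close>

text \<open>The map \<open>p\<close> is any function whose fibres on \<open>topspace Y\<close> are
  the orbits. Its codomain is a free type, because the quotient must finally have the point type
  that \<open>type_F\<close> prescribes.\<close>

locale deck_action = group H for H :: "('a, 'c) monoid_scheme" (structure) +
  fixes Y :: "'b topology" and act :: "'a \<Rightarrow> 'b \<Rightarrow> 'b" and p :: "'b \<Rightarrow> 'p"
  assumes act_cont: "h \<in> carrier H \<Longrightarrow> continuous_map Y Y (act h)"
    and act_one: "y \<in> topspace Y \<Longrightarrow> act \<one> y = y"
    and act_mult: "g \<in> carrier H \<Longrightarrow> h \<in> carrier H \<Longrightarrow> y \<in> topspace Y \<Longrightarrow> act (g \<otimes> h) y = act g (act h y)"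
    and properly_discontinuous: "y \<in> topspace Y \<Longrightarrow> z \<in> topspace Y \<Longrightarrow>
       \<exists>U V. openin Y U \<and> openin Y V \<and> y \<in> U \<and> z \<in> V \<and> finite {h \<in> carrier H. act h ` U \<inter> V \<noteq> {}}"
    and free: "h \<in> carrier H \<Longrightarrow> y \<in> topspace Y \<Longrightarrow> act h y = y \<Longrightarrow> h = \<one>"
    and Hausdorff_Y: "Hausdorff_space Y"
    and fibres: "y \<in> topspace Y \<Longrightarrow> z \<in> topspace Y \<Longrightarrow> p y = p z \<longleftrightarrow> (\<exists>h\<in>carrier H. z = act h y)"
begin

definition X :: "'p topology" where
  "X = topology (\<lambda>U. U \<subseteq> p ` topspace Y \<and> openin Y {y \<in> topspace Y. p y \<in> U})"

lemma openin_X: "openin X U \<longleftrightarrow> U \<subseteq> p ` topspace Y \<and> openin Y {y \<in> topspace Y. p y \<in> U}"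
proof -
  have "istopology (\<lambda>U. U \<subseteq> p ` topspace Y \<and> openin Y {y \<in> topspace Y. p y \<in> U})"
    unfolding istopology_def
  proof (intro conjI allI impI; (elim conjE)?)
    fix S T assume "openin Y {y \<in> topspace Y. p y \<in> S}" "openin Y {y \<in> topspace Y. p y \<in> T}"
    then have "openin Y ({y \<in> topspace Y. p y \<in> S} \<inter> {y \<in> topspace Y. p y \<in> T})" by blast
    then show "openin Y {y \<in> topspace Y. p y \<in> S \<inter> T}"
      by (rule back_subst[of "openin Y"]) auto
  next
    fix K assume K: "\<forall>S\<in>K. S \<subseteq> p ` topspace Y \<and> openin Y {y \<in> topspace Y. p y \<in> S}"
    then have "openin Y (\<Union>S\<in>K. {y \<in> topspace Y. p y \<in> S})" by blast
    then show "openin Y {y \<in> topspace Y. p y \<in> \<Union> K}"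
      by (rule back_subst[of "openin Y"]) auto
    show "\<Union> K \<subseteq> p ` topspace Y" using K by blast
  qed auto
  then show ?thesis
    by (simp add: X_def topology_inverse')
qed

lemma topspace_X: "topspace X = p ` topspace Y"
proof
  show "topspace X \<subseteq> p ` topspace Y"
    using openin_X openin_topspace by blast
  have "{y \<in> topspace Y. p y \<in> p ` topspace Y} = topspace Y" by auto
  then have "openin X (p ` topspace Y)" by (simp add: openin_X)
  then show "p ` topspace Y \<subseteq> topspace X" by (rule openin_subset)
qed

lemma act_closed: "h \<in> carrier H \<Longrightarrow> y \<in> topspace Y \<Longrightarrow> act h y \<in> topspace Y"
  using act_cont continuous_map_image_subset_topspace by blast

lemma act_inv: "h \<in> carrier H \<Longrightarrow> y \<in> topspace Y \<Longrightarrow> act (inv h) (act h y) = y"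
  by (metis act_mult act_one inv_closed l_inv)

lemma act_inv': "h \<in> carrier H \<Longrightarrow> y \<in> topspace Y \<Longrightarrow> act h (act (inv h) y) = y"
  by (metis act_mult act_one inv_closed r_inv)

lemma p_act: "h \<in> carrier H \<Longrightarrow> y \<in> topspace Y \<Longrightarrow> p (act h y) = p y"
  by (metis act_closed fibres)

lemma act_image: "h \<in> carrier H \<Longrightarrow> U \<subseteq> topspace Y \<Longrightarrow> act h ` U = {y \<in> topspace Y. act (inv h) y \<in> U}"
proof (intro equalityI subsetI)
  fix y assume "h \<in> carrier H" "U \<subseteq> topspace Y" "y \<in> act h ` U"
  then show "y \<in> {y \<in> topspace Y. act (inv h) y \<in> U}"
    by (auto simp: act_inv act_closed subset_iff)
next
  fix y assume "h \<in> carrier H" "U \<subseteq> topspace Y" "y \<in> {y \<in> topspace Y. act (inv h) y \<in> U}"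
  then show "y \<in> act h ` U"
    by (intro image_eqI[of _ _ "act (inv h) y"]) (auto simp: act_inv')
qed

lemma openin_act_image:
  assumes "h \<in> carrier H" "openin Y U" shows "openin Y (act h ` U)"
  using assms act_cont[of "inv h"] by (simp add: act_image openin_subset continuous_map)

lemma continuous_p: "continuous_map Y X p"
  by (auto simp: continuous_map openin_X topspace_X)

lemma saturation: "U \<subseteq> topspace Y \<Longrightarrow> {y \<in> topspace Y. p y \<in> p ` U} = (\<Union>h\<in>carrier H. act h ` U)"
proof (intro equalityI subsetI)
  fix y assume "U \<subseteq> topspace Y" "y \<in> {y \<in> topspace Y. p y \<in> p ` U}"
  then obtain u where "u \<in> U" "u \<in> topspace Y" "y \<in> topspace Y" "p u = p y" by auto
  moreover from this obtain h where "h \<in> carrier H" "y = act h u" using fibres[of u y] by blast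
  ultimately show "y \<in> (\<Union>h\<in>carrier H. act h ` U)" by blast
next
  fix y assume "U \<subseteq> topspace Y" "y \<in> (\<Union>h\<in>carrier H. act h ` U)"
  then show "y \<in> {y \<in> topspace Y. p y \<in> p ` U}" using act_closed p_act by auto
qed

lemma open_p: "openin Y U \<Longrightarrow> openin X (p ` U)"
  using saturation[of U] openin_act_image openin_subset[of Y U] by (auto simp: openin_X)

text \<open>Only finitely many \<open>h\<close> move a point of \<open>U\<close> into
  \<open>V\<close>. Each of them except \<open>\<one>\<close> moves \<open>y\<close> by freeness,
  and the Hausdorff property gives a neighbourhood \<open>W h\<close> disjoint from its translate;
  the intersection of all these sets works.\<close>

lemma evenly_covered:
  assumes "y \<in> topspace Y"
  obtains U where "openin Y U" "y \<in> U" "\<And>h u. h \<in> carrier H \<Longrightarrow> u \<in> U \<Longrightarrow> act h u \<in> U \<Longrightarrow> h = \<one>"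
proof -
  obtain U V where UV: "openin Y U" "openin Y V" "y \<in> U" "y \<in> V"
     and fin: "finite {h \<in> carrier H. act h ` U \<inter> V \<noteq> {}}"
    using properly_discontinuous[OF assms assms] by blast
  define F where "F = {h \<in> carrier H. act h ` U \<inter> V \<noteq> {}} - {\<one>}"
  have "\<exists>W. openin Y W \<and> y \<in> W \<and> (\<forall>u\<in>W. act h u \<notin> W)" if "h \<in> F" for h
  proof -
    have h: "h \<in> carrier H" "act h y \<noteq> y" "act h y \<in> topspace Y"
      using that free assms act_closed by (auto simp: F_def)
    obtain A B where AB: "openin Y A" "openin Y B" "y \<in> A" "act h y \<in> B" "disjnt A B"
      using Hausdorff_Y h assms unfolding Hausdorff_space_def by metis
    then have "openin Y (A \<inter> {u \<in> topspace Y. act h u \<in> B})"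
      using act_cont[OF h(1)] by (auto simp: continuous_map)
    then show ?thesis
      using AB assms by (intro exI[of _ "A \<inter> {u \<in> topspace Y. act h u \<in> B}"]) (auto simp: disjnt_iff)
  qed
  then obtain W where W: "\<And>h. h \<in> F \<Longrightarrow> openin Y (W h) \<and> y \<in> W h \<and> (\<forall>u\<in>W h. act h u \<notin> W h)"
    by metis
  \<comment> \<open>The factor \<open>topspace Y\<close> makes the intersection open also when
    \<open>F\<close> is empty.\<close>
  define N where "N = (U \<inter> V) \<inter> (topspace Y \<inter> \<Inter> (W ` F))"
  show thesis
  proof
    have "finite F" using fin by (simp add: F_def)
    then have "openin Y (topspace Y \<inter> \<Inter> (W ` F))"
      using W by (cases "F = {}") (auto intro!: openin_Int openin_Inter)
    then show "openin Y N" using UV by (auto simp: N_def)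
    show "y \<in> N" using UV W assms by (auto simp: N_def)
    show "h = \<one>" if "h \<in> carrier H" "u \<in> N" "act h u \<in> N" for h u
      using that W by (fastforce simp: N_def F_def)
  qed
qed

text \<open>For points in different orbits none of the finitely many relevant \<open>h\<close> takes
  \<open>y\<close> to \<open>z\<close>, so \<open>U\<close> and \<open>V\<close> can be shrunk until
  no translate of the first meets the second.\<close>

lemma Hausdorff_X: "Hausdorff_space X"
  unfolding Hausdorff_space_def
proof (intro allI impI, elim conjE)
  fix a b assume "a \<in> topspace X" "b \<in> topspace X" "a \<noteq> b"
  then obtain y z where yz: "y \<in> topspace Y" "z \<in> topspace Y" "a = p y" "b = p z" "p y \<noteq> p z"
    unfolding topspace_X by blast
  obtain U V where UV: "openin Y U" "openin Y V" "y \<in> U" "z \<in> V"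
     and fin: "finite {h \<in> carrier H. act h ` U \<inter> V \<noteq> {}}"
    using properly_discontinuous[OF yz(1,2)] by blast
  define F where "F = {h \<in> carrier H. act h ` U \<inter> V \<noteq> {}}"
  have "\<exists>A B. openin Y A \<and> openin Y B \<and> y \<in> A \<and> z \<in> B \<and> (\<forall>u\<in>A. act h u \<notin> B)" if "h \<in> F" for h
  proof -
    have h: "h \<in> carrier H" "act h y \<noteq> z" "act h y \<in> topspace Y"
      using that yz fibres act_closed by (auto simp: F_def)
    obtain A B where AB: "openin Y A" "openin Y B" "act h y \<in> A" "z \<in> B" "disjnt A B"
      using Hausdorff_Y h yz unfolding Hausdorff_space_def by metis
    then have "openin Y {u \<in> topspace Y. act h u \<in> A}"
      using act_cont[OF h(1)] by (auto simp: continuous_map)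
    then show ?thesis
      using AB yz by (intro exI[of _ "{u \<in> topspace Y. act h u \<in> A}"] exI[of _ B]) (auto simp: disjnt_iff)
  qed
  then obtain A B where AB: "\<And>h. h \<in> F \<Longrightarrow> openin Y (A h) \<and> openin Y (B h) \<and> y \<in> A h \<and> z \<in> B h \<and> (\<forall>u\<in>A h. act h u \<notin> B h)"
    by metis
  define M where "M = U \<inter> (topspace Y \<inter> \<Inter> (A ` F))"
  define N where "N = V \<inter> (topspace Y \<inter> \<Inter> (B ` F))"
  have "finite F" using fin by (simp add: F_def)
  then have "openin Y (topspace Y \<inter> \<Inter> (A ` F))" "openin Y (topspace Y \<inter> \<Inter> (B ` F))"
    using AB by (cases "F = {}"; auto intro!: openin_Int openin_Inter)+
  then have op: "openin Y M" "openin Y N" using UV by (auto simp: M_def N_def)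
  have MN: "act h u \<notin> N" if hu: "h \<in> carrier H" "u \<in> M" for h u
  proof
    assume N: "act h u \<in> N"
    then have "h \<in> F" using hu by (auto simp: F_def M_def N_def)
    then have "u \<in> A h" "act h u \<in> B h" using hu N by (auto simp: M_def N_def)
    then show False using AB[OF \<open>h \<in> F\<close>] by blast
  qed
  have "disjnt (p ` M) (p ` N)"
  proof -
    have "p u \<noteq> p v" if "u \<in> M" "v \<in> N" for u v
    proof
      assume "p u = p v"
      moreover have "u \<in> topspace Y" "v \<in> topspace Y" using that op openin_subset by blast+
      ultimately obtain h where "h \<in> carrier H" "v = act h u" using fibres by blast
      then show False using MN that by blast
    qed
    then show ?thesis by (auto simp: disjnt_def)
  qed
  moreover have "y \<in> M" "z \<in> N" using AB UV yz by (auto simp: M_def N_def)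
  ultimately show "\<exists>U V. openin X U \<and> openin X V \<and> a \<in> U \<and> b \<in> V \<and> disjnt U V"
    using open_p op yz by (intro exI[of _ "p ` M"] exI[of _ "p ` N"]) auto
qed

subsection \<open>Lifting\<close>

text \<open>The set where the lifts agree is open and closed. Near \<open>z\<close> the first lift
  stays in an evenly covered \<open>U\<close> and the second in one translate
  \<open>act h U\<close>, where both are determined by their projections; so they differ by the same
  \<open>h\<close> at all nearby points.\<close>

lemma lift_unique:
  assumes Z: "connected_space Z" and g: "continuous_map Z Y g" and g': "continuous_map Z Y g'"
    and eq: "\<And>x. x \<in> topspace Z \<Longrightarrow> p (g x) = p (g' x)"
    and x0: "x0 \<in> topspace Z" "g x0 = g' x0" and x: "x \<in> topspace Z"
  shows "g x = g' x"
proof (rule ccontr)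
  assume "g x \<noteq> g' x"
  define S where "S = {x \<in> topspace Z. g x = g' x}"
  have *: "\<exists>W. openin Z W \<and> z \<in> W \<and> (\<forall>w\<in>W. g w = g' w \<longleftrightarrow> g z = g' z)" if z: "z \<in> topspace Z" for z
  proof -
    have gz: "g z \<in> topspace Y" "g' z \<in> topspace Y"
      using g g' z continuous_map_image_subset_topspace by blast+
    then obtain h where h: "h \<in> carrier H" "g' z = act h (g z)"
      using eq[OF z] fibres by blast
    obtain U where U: "openin Y U" "g z \<in> U" "\<And>k u. k \<in> carrier H \<Longrightarrow> u \<in> U \<Longrightarrow> act k u \<in> U \<Longrightarrow> k = \<one>"
      using evenly_covered gz by metis
    define W where "W = {w \<in> topspace Z. g w \<in> U} \<inter> {w \<in> topspace Z. g' w \<in> act h ` U}"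
    have "openin Z W"
      using g g' U openin_act_image[OF h(1) U(1)] unfolding W_def continuous_map by auto
    moreover have "z \<in> W" using z U h by (auto simp: W_def)
    moreover have "g w = g' w \<longleftrightarrow> g z = g' z" if w: "w \<in> W" for w
    proof -
      have wZ: "w \<in> topspace Z" "g w \<in> U" "g w \<in> topspace Y" using w U(1) openin_subset by (auto simp: W_def)
      obtain u where u: "u \<in> U" "g' w = act h u" "u \<in> topspace Y" using w U(1) openin_subset by (auto simp: W_def)
      have "p (g w) = p u" using eq[OF wZ(1)] u h p_act by simp
      then obtain k where "k \<in> carrier H" "u = act k (g w)" using fibres wZ u by blast
      then have uu: "u = g w" using U(3) u wZ act_one by metis
      show ?thesis
      proof
        assume "g w = g' w"
        then have "h = \<one>" using free[OF h(1)] u uu by metis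
        then show "g z = g' z" using h gz act_one by simp
      next
        assume "g z = g' z"
        then have "h = \<one>" using free[OF h(1)] h gz by metis
        then show "g w = g' w" using u uu act_one by simp
      qed
    qed
    ultimately show ?thesis by blast
  qed
  have "openin Z S"
  proof (subst openin_subopen, intro ballI)
    fix z assume z: "z \<in> S"
    then obtain W where "openin Z W" "z \<in> W" "\<forall>w\<in>W. g w = g' w" using *[of z] by (auto simp: S_def)
    then show "\<exists>T. openin Z T \<and> z \<in> T \<and> T \<subseteq> S"
      using openin_subset[of Z W] by (intro exI[of _ W]) (auto simp: S_def)
  qed
  moreover have "openin Z (topspace Z - S)"
  proof (subst openin_subopen, intro ballI)
    fix z assume z: "z \<in> topspace Z - S"
    then obtain W where "openin Z W" "z \<in> W" "\<forall>w\<in>W. g w \<noteq> g' w" using *[of z] by (auto simp: S_def)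
    then show "\<exists>T. openin Z T \<and> z \<in> T \<and> T \<subseteq> topspace Z - S"
      using openin_subset[of Z W] by (intro exI[of _ W]) (auto simp: S_def)
  qed
  ultimately have "S = {} \<or> S = topspace Z"
    using Z by (metis closedin_def connected_space_clopen_in openin_subset)
  then show False using x0 x \<open>g x \<noteq> g' x\<close> by (auto simp: S_def)
qed

text \<open>The value may be prescribed at every point of \<open>Q\<close>, which allows a lift to
  be continued from any common point of two pieces.\<close>

definition liftable :: "((nat \<Rightarrow> real) \<Rightarrow> 'p) \<Rightarrow> (nat \<Rightarrow> real) set \<Rightarrow> bool" where
  "liftable f Q \<longleftrightarrow> (\<forall>x0\<in>Q. \<forall>y0\<in>topspace Y. p y0 = f x0 \<longrightarrow>
     (\<exists>g. continuous_map (top_of_set Q) Y g \<and> (\<forall>x\<in>Q. p (g x) = f x) \<and> g x0 = y0))"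

text \<open>The second lift is started at a common point with the value of the first. Uniqueness on
  the connected set \<open>A \<inter> B\<close> makes the two agree there, and they paste.\<close>

lemma liftable_Un:
  assumes "closed A" "closed B" "connected (A \<inter> B)" "A \<inter> B \<noteq> {}" "liftable f A" "liftable f B"
  shows "liftable f (A \<union> B)"
  unfolding liftable_def
proof (intro ballI impI)
  have glue: "\<exists>k. continuous_map (top_of_set (A \<union> B)) Y k \<and> (\<forall>x\<in>A \<union> B. p (k x) = f x) \<and> k x0 = y0"
    if AB: "closed A" "closed B" "connected (A \<inter> B)" "A \<inter> B \<noteq> {}" "liftable f A" "liftable f B"
       and x0: "x0 \<in> A" "y0 \<in> topspace Y" "p y0 = f x0" for A B x0 y0
  proof -
    obtain g where g: "continuous_map (top_of_set A) Y g" "\<And>x. x \<in> A \<Longrightarrow> p (g x) = f x" "g x0 = y0"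
      using AB x0 unfolding liftable_def by metis
    obtain c where c: "c \<in> A" "c \<in> B" using AB by auto
    have "g c \<in> topspace Y" using g(1) c by (auto simp: continuous_map_def)
    then obtain g' where g': "continuous_map (top_of_set B) Y g'" "\<And>x. x \<in> B \<Longrightarrow> p (g' x) = f x" "g' c = g c"
      using AB c g unfolding liftable_def by metis
    have eq: "g x = g' x" if "x \<in> A" "x \<in> B" for x
    proof (rule lift_unique[of "top_of_set (A \<inter> B)"])
      show "connected_space (top_of_set (A \<inter> B))"
        using AB by (metis connectedin_def connectedin_iff_connected)
      show "continuous_map (top_of_set (A \<inter> B)) Y g" "continuous_map (top_of_set (A \<inter> B)) Y g'"
        using g(1) g'(1) continuous_map_from_subtopology_mono by (metis inf_le1, metis inf_le2)
      show "c \<in> topspace (top_of_set (A \<inter> B))" "g c = g' c" using c g' by auto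
    qed (use that g(2) g'(2) in auto)
    have "continuous_map (top_of_set (A \<union> B)) Y (\<lambda>x. if x \<in> A then g x else g' x)"
      by (rule paste_closed) (use AB g g' eq in auto)
    then show ?thesis using g g' x0 by (intro exI[of _ "\<lambda>x. if x \<in> A then g x else g' x"]) auto
  qed
  fix x0 y0 assume x0: "x0 \<in> A \<union> B" "y0 \<in> topspace Y" "p y0 = f x0"
  show "\<exists>g. continuous_map (top_of_set (A \<union> B)) Y g \<and> (\<forall>x\<in>A \<union> B. p (g x) = f x) \<and> g x0 = y0"
  proof (cases "x0 \<in> A")
    case True then show ?thesis using glue[of A B] assms x0 by blast
  next
    case False then show ?thesis using glue[of B A] assms x0 by (simp add: Un_commute Int_commute)
  qed
qed

text \<open>On \<open>U\<close> the map \<open>p\<close> is injective and open, which gives a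
  continuous section \<open>s\<close>; a translate of \<open>s\<close> takes the prescribed
  value.\<close>

lemma liftable_local:
  assumes f: "continuous_map (top_of_set Q) X f" and U: "openin Y U"
    and sep: "\<And>h u. h \<in> carrier H \<Longrightarrow> u \<in> U \<Longrightarrow> act h u \<in> U \<Longrightarrow> h = \<one>"
    and im: "f ` Q \<subseteq> p ` U"
  shows "liftable f Q"
  unfolding liftable_def
proof (intro ballI impI)
  fix x0 y0 assume x0: "x0 \<in> Q" and y0: "y0 \<in> topspace Y" "p y0 = f x0"
  have UY: "U \<subseteq> topspace Y" using U openin_subset by auto
  obtain u0 where u0: "u0 \<in> U" "p u0 = p y0" using im x0 y0 by fastforce
  then obtain k where k: "k \<in> carrier H" "y0 = act k u0" using fibres y0 UY by blast
  obtain s where s: "\<And>x. x \<in> Q \<Longrightarrow> s x \<in> U \<and> p (s x) = f x"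
  proof -
    have "\<forall>x\<in>Q. \<exists>u. u \<in> U \<and> p u = f x" using im by fastforce
    from bchoice[OF this] show thesis using that by blast
  qed
  have s_unique: "u = s x" if "x \<in> Q" "u \<in> U" "p u = f x" for x u
  proof -
    have "s x \<in> U" "p (s x) = p u" using s that by auto
    moreover have "s x \<in> topspace Y" "u \<in> topspace Y" using \<open>s x \<in> U\<close> that UY by auto
    ultimately obtain h where "h \<in> carrier H" "u = act h (s x)" using fibres[of "s x" u] by auto
    then show ?thesis using sep[of h "s x"] \<open>s x \<in> U\<close> that UY act_one by auto
  qed
  have conts: "continuous_map (top_of_set Q) Y s"
    unfolding continuous_map
  proof (intro conjI allI impI)
    show "s ` topspace (top_of_set Q) \<subseteq> topspace Y" using s UY by auto
    fix O' assume O': "openin Y O'"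
    then have "openin X (p ` (O' \<inter> U))" using U open_p by blast
    then have "openin (top_of_set Q) {x \<in> Q. f x \<in> p ` (O' \<inter> U)}"
      using f by (auto simp: continuous_map)
    moreover have "{x \<in> Q. f x \<in> p ` (O' \<inter> U)} = {x \<in> topspace (top_of_set Q). s x \<in> O'}"
    proof (intro equalityI subsetI)
      fix x assume "x \<in> {x \<in> Q. f x \<in> p ` (O' \<inter> U)}"
      then obtain u where "x \<in> Q" "u \<in> O'" "u \<in> U" "p u = f x" by fastforce
      then show "x \<in> {x \<in> topspace (top_of_set Q). s x \<in> O'}" using s_unique by auto
    next
      fix x assume "x \<in> {x \<in> topspace (top_of_set Q). s x \<in> O'}"
      then have "x \<in> Q" "s x \<in> O' \<inter> U" "p (s x) = f x" using s by auto
      then show "x \<in> {x \<in> Q. f x \<in> p ` (O' \<inter> U)}" by (metis (mono_tags, lifting) imageI mem_Collect_eq)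
    qed
    ultimately show "openin (top_of_set Q) {x \<in> topspace (top_of_set Q). s x \<in> O'}" by simp
  qed
  have "u0 = s x0" using s_unique x0 u0 y0 by auto
  then show "\<exists>g. continuous_map (top_of_set Q) Y g \<and> (\<forall>x\<in>Q. p (g x) = f x) \<and> g x0 = y0"
    using continuous_map_compose[OF conts act_cont[OF k(1)]] k s p_act[OF k(1)] UY
    by (intro exI[of _ "act k \<circ> s"]) (auto simp: subset_iff)
qed

text \<open>Boxes below the Lebesgue number of a cover by evenly covered sets are lifted by
  \<open>liftable_local\<close>. Larger boxes are cut by hyperplanes, one coordinate after another;
  the common wall is again a box, hence connected.\<close>

lemma liftable_cube:
  assumes f: "continuous_map (cube n) X f"
  shows "liftable f (topspace (cube n))"
proof -
  define C where "C = topspace (cube n)"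
  have fC: "continuous_map (top_of_set C) X f" using f by (simp add: C_def cube_eq topspace_cube)
  define \<U> where "\<U> = {W. open W \<and> (\<exists>U. openin Y U \<and> f ` (W \<inter> C) \<subseteq> p ` U \<and>
      (\<forall>h\<in>carrier H. \<forall>u\<in>U. act h u \<in> U \<longrightarrow> h = \<one>))}"
  have "\<exists>W\<in>\<U>. x \<in> W" if x: "x \<in> C" for x
  proof -
    have "f x \<in> topspace X" using fC x by (auto simp: continuous_map_def)
    then obtain y where y: "y \<in> topspace Y" "p y = f x" by (auto simp: topspace_X)
    obtain U where U: "openin Y U" "y \<in> U" "\<And>h u. h \<in> carrier H \<Longrightarrow> u \<in> U \<Longrightarrow> act h u \<in> U \<Longrightarrow> h = \<one>"
      using evenly_covered y by metis
    have "openin (top_of_set C) {x \<in> C. f x \<in> p ` U}"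
      using fC open_p[OF U(1)] by (auto simp: continuous_map)
    then obtain W where W: "open W" "{x \<in> C. f x \<in> p ` U} = C \<inter> W" by (auto simp: openin_open)
    moreover have "f ` (W \<inter> C) \<subseteq> p ` U" using W by blast
    ultimately have "W \<in> \<U>" using U unfolding \<U>_def mem_Collect_eq by (intro conjI exI[of _ U]) auto
    moreover have "x \<in> {x \<in> C. f x \<in> p ` U}" using y(2)[symmetric] U(2) x by simp
    ultimately show ?thesis using W by blast
  qed
  then have C\<U>: "C \<subseteq> \<Union>\<U>" by blast
  have "open W" if "W \<in> \<U>" for W using that by (simp add: \<U>_def)
  from Heine_Borel_lemma[OF compact_cube[of n, folded C_def] C\<U> this]
  obtain e where e: "0 < e" "\<And>x. x \<in> C \<Longrightarrow> \<exists>W\<in>\<U>. ball x e \<subseteq> W"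
    by blast
  \<comment> \<open>Two points of a box of side \<open>\<epsilon>\<close> are at distance at most
    \<open>2 * \<epsilon>\<close> by \<open>dist_fun_le\<close>, which is less than
    \<open>e\<close>.\<close>
  define \<epsilon> where "\<epsilon> = e / 4"
  have \<epsilon>: "\<epsilon> > 0" using e by (simp add: \<epsilon>_def)
  define box where "box a b = PiE {..<n} (\<lambda>i. {a i..b i :: real})" for a b
  have box_iff: "x \<in> box a b \<longleftrightarrow> (\<forall>i<n. a i \<le> x i \<and> x i \<le> b i) \<and> x \<in> extensional {..<n}" for x a b
    by (auto simp: box_def PiE_iff)
  have box_cl: "closed (box a b)" "connected (box a b)" for a b
    by (auto simp: box_def intro!: compact_imp_closed compact_PiE connected_PiE)
  have C_iff: "x \<in> C \<longleftrightarrow> (\<forall>i<n. 0 \<le> x i \<and> x i \<le> 1) \<and> x \<in> extensional {..<n}" for x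
    by (auto simp: C_def topspace_cube PiE_iff)
  have small: "liftable f (box a b)"
    if ab: "\<And>j. j < n \<Longrightarrow> 0 \<le> a j \<and> a j \<le> b j \<and> b j \<le> 1" and le: "\<And>j. j < n \<Longrightarrow> b j - a j \<le> \<epsilon>" for a b
  proof -
    have sub: "box a b \<subseteq> C"
      unfolding subset_iff box_iff C_iff using ab by (meson order_trans)
    define c where "c = restrict a {..<n}"
    have c: "c \<in> box a b" using ab by (auto simp: box_iff c_def)
    obtain W where W: "W \<in> \<U>" "ball c e \<subseteq> W" using e(2)[of c] c sub by blast
    have "dist c x < e" if x: "x \<in> box a b" for x
    proof -
      have "dist (c i) (x i) \<le> \<epsilon>" for i
      proof (cases "i < n")
        case True
        then have "a i \<le> x i" "x i \<le> b i" "c i = a i" using x by (auto simp: box_iff c_def)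
        then show ?thesis using le[OF True] by (simp add: dist_real_def)
      next
        case False
        then have "c i = x i" using x by (simp add: box_iff c_def extensional_def)
        then show ?thesis using \<epsilon> by simp
      qed
      then have "dist c x \<le> 2 * \<epsilon>" by (rule dist_fun_le)
      then show ?thesis using e(1) by (simp add: \<epsilon>_def)
    qed
    then have sub': "box a b \<subseteq> W \<inter> C" using W(2) sub by (auto simp: subset_iff)
    obtain U where U: "openin Y U" "f ` (W \<inter> C) \<subseteq> p ` U" "\<forall>h\<in>carrier H. \<forall>u\<in>U. act h u \<in> U \<longrightarrow> h = \<one>"
      using W(1) unfolding \<U>_def by blast
    show ?thesis
    proof (rule liftable_local)
      show "continuous_map (top_of_set (box a b)) X f"
        using sub fC continuous_map_from_subtopology_mono by blast
      show "openin Y U" by fact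
      show "h = \<one>" if "h \<in> carrier H" "u \<in> U" "act h u \<in> U" for h u using U(3) that by blast
      show "f ` box a b \<subseteq> p ` U" using U(2) sub' by blast
    qed
  qed
  \<comment> \<open>The sides are assumed short only from the index \<open>i\<close> on; for
    \<open>i = n\<close> the box is arbitrary within the cube.\<close>
  have "liftable f (box a b)"
    if "i \<le> n" "\<And>j. j < n \<Longrightarrow> 0 \<le> a j \<and> a j \<le> b j \<and> b j \<le> 1" "\<And>j. i \<le> j \<Longrightarrow> j < n \<Longrightarrow> b j - a j \<le> \<epsilon>"
    for i a b
    using that
  proof (induction i arbitrary: a b)
    case 0
    then show ?case using small by simp
  next
    case (Suc i)
    have i: "i < n" using Suc.prems(1) by simp
    note outer = Suc.IH
    have step: "liftable f (box a b)" if "b i - a i \<le> (real k + 1) * \<epsilon>" 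
      "\<And>j. j < n \<Longrightarrow> 0 \<le> a j \<and> a j \<le> b j \<and> b j \<le> 1" "\<And>j. Suc i \<le> j \<Longrightarrow> j < n \<Longrightarrow> b j - a j \<le> \<epsilon>" for k a b
      using that
    proof (induction k arbitrary: a b)
      case 0
      have "b j - a j \<le> \<epsilon>" if "i \<le> j" "j < n" for j
        using 0(1) 0(3)[of j] that by (cases "j = i") auto
      then show ?case using i 0(2) by (intro Suc.IH) auto
    next
      case (Suc k)
      note ab = Suc.prems(2) and le = Suc.prems(3)
      show ?case
      proof (cases "b i - a i \<le> \<epsilon>")
        case True
        have "b j - a j \<le> \<epsilon>" if "i \<le> j" "j < n" for j
          using True le[of j] that by (cases "j = i") auto
        then show ?thesis using i ab by (intro outer) auto
      next
        case False
        \<comment> \<open>A slice of width \<open>\<epsilon>\<close> is cut off at the top of side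
          \<open>i\<close>. The slice is short, and the side of the rest has shrunk by
          \<open>\<epsilon>\<close>, so the inner induction hypothesis covers both.\<close>
        define c where "c = b i - \<epsilon>"
        have ac: "a i < c" "c \<le> b i" using False \<epsilon> by (auto simp: c_def)
        have sb: "(b(i := c)) j \<le> b j" and sa: "a j \<le> (a(i := c)) j" for j
          using ac by auto
        have 1: "liftable f (box a (b(i := c)))"
        proof (rule Suc.IH)
          show "(b(i := c)) i - a i \<le> (real k + 1) * \<epsilon>"
            using Suc.prems(1) by (simp add: c_def algebra_simps)
          show "0 \<le> a j \<and> a j \<le> (b(i := c)) j \<and> (b(i := c)) j \<le> 1" if "j < n" for j
            using ab[OF that] ac sb[of j] by auto
          show "(b(i := c)) j - a j \<le> \<epsilon>" if "Suc i \<le> j" "j < n" for j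
            using le[OF that] that by auto
        qed
        have 2: "liftable f (box (a(i := c)) b)"
        proof (rule Suc.IH)
          have "\<epsilon> \<le> (real k + 1) * \<epsilon>" using \<epsilon> by (simp add: algebra_simps)
          then show "b i - (a(i := c)) i \<le> (real k + 1) * \<epsilon>"
            by (simp add: c_def)
          show "0 \<le> (a(i := c)) j \<and> (a(i := c)) j \<le> b j \<and> b j \<le> 1" if "j < n" for j
            using ab[OF that] ac sa[of j] by auto
          show "b j - (a(i := c)) j \<le> \<epsilon>" if "Suc i \<le> j" "j < n" for j
            using le[OF that] that by auto
        qed
        have m1: "x \<in> box a (b(i := c)) \<longleftrightarrow> x \<in> box a b \<and> x i \<le> c" for x a
          unfolding box_iff all_upd_le[where b = b, OF i ac(2)] by blast
        have m2: "x \<in> box (a(i := c)) b \<longleftrightarrow> x \<in> box a b \<and> c \<le> x i" for x b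
          unfolding box_iff all_upd_ge[where a = a, OF i less_imp_le[OF ac(1)]] by blast
        have un: "box a b = box a (b(i := c)) \<union> box (a(i := c)) b"
          using linear[of _ c] by (auto simp: m1 m2)
        have int: "box a (b(i := c)) \<inter> box (a(i := c)) b = box (a(i := c)) (b(i := c))"
          by (auto simp: m1 m2)
        have "restrict (a(i := c)) {..<n} \<in> box (a(i := c)) (b(i := c))"
          unfolding box_iff using ab ac by auto
        then have ne: "box (a(i := c)) (b(i := c)) \<noteq> {}" by blast
        show ?thesis
          unfolding un
          by (rule liftable_Un[OF box_cl(1) box_cl(1)]) (use 1 2 box_cl(2) ne in \<open>simp_all add: int\<close>)
      qed
    qed
    obtain k :: nat where "b i - a i < real k * \<epsilon>"
      using reals_Archimedean3[OF \<epsilon>] by blast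
    then have "b i - a i \<le> (real k + 1) * \<epsilon>" using \<epsilon> by (simp add: algebra_simps)
    then show ?case using Suc.prems by (intro step) auto
  qed
  from this[of n "\<lambda>_. 0" "\<lambda>_. 1"] show ?thesis
    by (simp add: box_def topspace_cube)
qed

lemma lift_cube:
  assumes "continuous_map (cube n) X f" "x0 \<in> topspace (cube n)" "y0 \<in> topspace Y" "p y0 = f x0"
  obtains g where "continuous_map (cube n) Y g" "\<And>x. x \<in> topspace (cube n) \<Longrightarrow> p (g x) = f x" "g x0 = y0"
  using liftable_cube[OF assms(1)] assms(2-) unfolding liftable_def
  by (metis cube_eq topspace_cube)

end

section \<open>The quotient of an absolute extensor is aspherical\<close>

lemma cube_boundary_subset: "cube_boundary n \<subseteq> topspace (cube n)"
  by (auto simp: cube_boundary_def)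

lemma cube_homotopyI:
  assumes "f \<in> cube_maps n X a" "g \<in> cube_maps n X a"
    and G: "continuous_map (cube (Suc n)) X G"
    "\<And>x. x \<in> topspace (cube n) \<Longrightarrow> G (x(n := 0)) = f x"
    "\<And>x. x \<in> topspace (cube n) \<Longrightarrow> G (x(n := 1)) = g x"
    "\<And>x t. x \<in> cube_boundary n \<Longrightarrow> 0 \<le> t \<Longrightarrow> t \<le> 1 \<Longrightarrow> G (x(n := t)) = a"
  shows "(f, g) \<in> cube_homotopy n X a"
proof -
  have "continuous_map (prod_topology (top_of_set {0..1}) (cube n)) X (G \<circ> (\<lambda>(t,x). x(n := t)))"
    using continuous_map_upd G(1) by (rule continuous_map_compose)
  moreover have "(\<forall>x\<in>cube_boundary n. h x = a) = (\<forall>x\<in>cube_boundary n. k x = a)"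
    if "\<And>x. x \<in> topspace (cube n) \<Longrightarrow> h x = k x" for h k
    using that cube_boundary_subset by (metis subsetD)
  moreover have "(G \<circ> (\<lambda>(t,x). x(n := t))) (t, x) = G (x(n := t))" for t x by simp
  ultimately have "homotopic_with (\<lambda>h. \<forall>x\<in>cube_boundary n. h x = a) (cube n) X f g"
    using G(2-4)
    by (subst homotopic_with, blast) (intro exI[of _ "G \<circ> (\<lambda>(t,x). x(n := t))"] conjI; simp del: fun_upd_apply comp_apply)
  then show ?thesis
    using assms by (simp add: cube_homotopy_def)
qed

lemma cube_homotopyD:
  assumes "(f, g) \<in> cube_homotopy n X a"
  obtains G where "continuous_map (cube (Suc n)) X G"
    "\<And>x. x \<in> topspace (cube n) \<Longrightarrow> G (x(n := 0)) = f x"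
    "\<And>x. x \<in> topspace (cube n) \<Longrightarrow> G (x(n := 1)) = g x"
    "\<And>x t. x \<in> cube_boundary n \<Longrightarrow> 0 \<le> t \<Longrightarrow> t \<le> 1 \<Longrightarrow> G (x(n := t)) = a"
proof -
  have "homotopic_with (\<lambda>h. \<forall>x\<in>cube_boundary n. h x = a) (cube n) X f g"
    using assms by (simp add: cube_homotopy_def)
  then obtain h
    where h: "continuous_map (prod_topology (top_of_set {0..1::real}) (cube n)) X h"
     "\<And>x. h (0, x) = f x" "\<And>x. h (1, x) = g x"
     "\<And>t x. t \<in> {0..1} \<Longrightarrow> x \<in> cube_boundary n \<Longrightarrow> h (t, x) = a"
    unfolding homotopic_with_def by blast
  have "continuous_on (topspace (cube (Suc n))) (\<lambda>z. z(n := undefined))"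
  proof (rule continuous_on_coordinatewise_then_product)
    show "continuous_on (topspace (cube (Suc n))) (\<lambda>z. (z(n := undefined)) i)" for i
      by (cases "i = n") (auto simp: continuous_on_coord)
  qed
  then have "continuous_map (cube (Suc n)) (cube n) (\<lambda>z. z(n := undefined))"
    unfolding cube_eq[of n] cube_eq[of "Suc n"] using cube_Suc_restrict[of _ n]
    by (auto simp: topspace_cube simp del: fun_upd_apply)
  moreover have "continuous_map (cube (Suc n)) (top_of_set {0..1}) (\<lambda>z. z n)"
    by (auto simp: cube_eq continuous_on_coord PiE_iff)
  ultimately have "continuous_map (cube (Suc n)) (prod_topology (top_of_set {0..1}) (cube n)) (\<lambda>z. (z n, z(n := undefined)))"
    by (intro continuous_map_pairedI)
  from continuous_map_compose[OF this h(1)]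
  have G: "continuous_map (cube (Suc n)) X (\<lambda>z. h (z n, z(n := undefined)))"
    by (simp add: o_def)
  have r: "(x(n := t))(n := undefined) = x" if "x \<in> topspace (cube n)" for x t
    using that by (auto simp: topspace_cube PiE_def extensional_def fun_eq_iff)
  show thesis
  proof (rule that[OF G])
    show "h ((x(n := t)) n, (x(n := t))(n := undefined)) = a" if "x \<in> cube_boundary n" "0 \<le> t" "t \<le> 1" for x t
      using h(4)[of t x] that r[OF subsetD[OF cube_boundary_subset that(1)], of t] by simp
  qed (use h(2,3) r in auto)
qed

lemma equiv_cube_homotopy: "equiv (cube_maps n X a) (cube_homotopy n X a)"
proof (rule equivI)
  show "cube_homotopy n X a \<subseteq> cube_maps n X a \<times> cube_maps n X a"
    by (auto simp: cube_homotopy_def)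
  show "refl_on (cube_maps n X a) (cube_homotopy n X a)"
    by (auto simp: refl_on_def cube_homotopy_def homotopic_with_refl cube_maps_def)
  show "sym (cube_homotopy n X a)"
    by (auto simp: sym_def cube_homotopy_def homotopic_with_sym)
  show "trans (cube_homotopy n X a)"
    unfolding trans_def cube_homotopy_def using homotopic_with_trans by blast
qed

lemma continuous_map_upd_const:
  assumes "0 \<le> t" "t \<le> 1"
  shows "continuous_map (cube n) (cube (Suc n)) (\<lambda>x. x(n := t))"
proof -
  have "continuous_map (cube n) (prod_topology (top_of_set {0..1}) (cube n)) (\<lambda>x. (t, x))"
    using assms by (intro continuous_map_pairedI) auto
  from continuous_map_compose[OF this continuous_map_upd] show ?thesis
    by (simp add: o_def)
qed

lemma continuous_map_upd_path:
  assumes "x \<in> topspace (cube n)"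
  shows "continuous_map (top_of_set {0..1}) (cube (Suc n)) (\<lambda>t. x(n := t))"
proof -
  have "continuous_map (top_of_set {0..1::real}) (prod_topology (top_of_set {0..1}) (cube n)) (\<lambda>t. (t, x))"
    using assms by (intro continuous_map_pairedI) auto
  from continuous_map_compose[OF this continuous_map_upd] show ?thesis
    by (simp add: o_def)
qed

lemma cube_concat_continuous:
  assumes f: "continuous_map (cube 1) Y f" and g: "continuous_map (cube 1) Y g"
    and fg: "f (pt 1) = g (pt 0)"
  shows "continuous_map (cube 1) Y (cube_concat f g)"
proof -
  define C where "C = topspace (cube 1)"
  have C: "x \<in> C \<longleftrightarrow> x = pt (x 0) \<and> 0 \<le> x 0 \<and> x 0 \<le> 1" for x
    using cube_1[of x] pt_in_cube[of "x 0"] by (metis C_def One_nat_def pt_0 topspace_cube)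
  have cl: "closed C" by (simp add: C_def compact_cube compact_imp_closed)
  have cont: "continuous_on S (\<lambda>x :: nat \<Rightarrow> real. x(0 := c * x 0 + d))" for S c d
  proof (rule continuous_on_coordinatewise_then_product)
    show "continuous_on S (\<lambda>x. (x(0 := c * x 0 + d)) i)" for i
      by (cases "i = 0") (auto intro!: continuous_on_add continuous_on_mult continuous_on_const continuous_on_coord)
  qed
  have up0: "(pt s)(0 := t) = pt t" for s t by (auto simp: pt_def restrict_def fun_eq_iff)
  have upd: "x(0 := s) = pt s" if "x \<in> C" for x s
    using that[unfolded C] by (metis up0)
  define A where "A = C \<inter> {x. x 0 \<le> 1/2}"
  define B where "B = C \<inter> {x. 1/2 \<le> x 0}"
  have clAB: "closed A" "closed B"
    unfolding A_def B_def
    by (rule closed_Int[OF cl closed_Collect_le[OF continuous_on_coord continuous_on_const]],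
        rule closed_Int[OF cl closed_Collect_le[OF continuous_on_const continuous_on_coord]])
  have "continuous_map (top_of_set A) (cube 1) (\<lambda>x. x(0 := 2 * x 0))"
  proof -
    have "(\<lambda>x. x(0 := 2 * x 0)) ` A \<subseteq> C"
      using upd by (auto simp: A_def C)
    then show ?thesis using cont[of A 2 0] by (auto simp: cube_eq[of "Suc 0"] C_def topspace_cube)
  qed
  from continuous_map_compose[OF this f]
  have 1: "continuous_map (top_of_set A) Y (\<lambda>x. f (x(0 := 2 * x 0)))" by (simp add: o_def)
  have "continuous_map (top_of_set B) (cube 1) (\<lambda>x. x(0 := 2 * x 0 - 1))"
  proof -
    have "(\<lambda>x. x(0 := 2 * x 0 - 1)) ` B \<subseteq> C"
      using upd by (auto simp: B_def C)
    then show ?thesis using cont[of B 2 "-1"] by (auto simp: cube_eq[of "Suc 0"] C_def topspace_cube)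
  qed
  from continuous_map_compose[OF this g]
  have 2: "continuous_map (top_of_set B) Y (\<lambda>x. g (x(0 := 2 * x 0 - 1)))" by (simp add: o_def)
  have "continuous_map (top_of_set (A \<union> B)) Y
     (\<lambda>x. if x \<in> A then f (x(0 := 2 * x 0)) else g (x(0 := 2 * x 0 - 1)))"
  proof (rule paste_closed[OF clAB 1 2])
    fix x assume "x \<in> A" "x \<in> B"
    then have "x \<in> C" "2 * x 0 = 1" by (auto simp: A_def B_def)
    then show "f (x(0 := 2 * x 0)) = g (x(0 := 2 * x 0 - 1))"
      using fg upd[of x 1] upd[of x 0] by simp
  qed
  moreover have "A \<union> B = C" by (auto simp: A_def B_def)
  ultimately have "continuous_map (cube 1) Y
     (\<lambda>x. if x \<in> A then f (x(0 := 2 * x 0)) else g (x(0 := 2 * x 0 - 1)))"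
    by (simp add: cube_eq C_def topspace_cube)
  then show ?thesis
    by (rule continuous_map_eq) (auto simp: A_def C_def cube_concat_def)
qed

context deck_action
begin

lemma lift_const:
  assumes "connected_space Z" "continuous_map Z Y g" "\<And>x. x \<in> topspace Z \<Longrightarrow> p (g x) = a"
    "x \<in> topspace Z" "y \<in> topspace Z"
  shows "g x = g y"
proof -
  have "g y \<in> topspace Y" using assms(2,5) continuous_map_image_subset_topspace by blast
  then show ?thesis
    using lift_unique[OF assms(1,2), of "\<lambda>_. g y" y x] assms by auto
qed

text \<open>Two lifts with equal boundary values are joined in \<open>Y\<close> by a homotopy that
  is constant on the boundary; this homotopy is projected.\<close>

lemma homotopy_projects:
  assumes Y: "abs_ext Y" and g: "continuous_map (cube n) Y g" "continuous_map (cube n) Y g'"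
    and eq: "\<And>x. x \<in> cube_boundary n \<Longrightarrow> g x = g' x" "\<And>x. x \<in> cube_boundary n \<Longrightarrow> p (g x) = a"
    and f: "f \<in> cube_maps n X a" "\<And>x. x \<in> topspace (cube n) \<Longrightarrow> p (g x) = f x"
    and f': "f' \<in> cube_maps n X a" "\<And>x. x \<in> topspace (cube n) \<Longrightarrow> p (g' x) = f' x"
  shows "(f, f') \<in> cube_homotopy n X a"
proof -
  obtain G where G: "continuous_map (cube (Suc n)) Y G"
    "\<And>x. x \<in> topspace (cube n) \<Longrightarrow> G (x(n := 0)) = g x"
    "\<And>x. x \<in> topspace (cube n) \<Longrightarrow> G (x(n := 1)) = g' x"
    "\<And>x t. x \<in> cube_boundary n \<Longrightarrow> 0 \<le> t \<Longrightarrow> t \<le> 1 \<Longrightarrow> G (x(n := t)) = g x"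
    using abs_ext_homotopy[OF Y g eq(1)] by blast
  show ?thesis
  proof (rule cube_homotopyI[OF f(1) f'(1) continuous_map_compose[OF G(1) continuous_p]])
  qed (simp_all add: G(2-4) f(2) f'(2) eq(2) del: fun_upd_apply)
qed

lemma path_connected_X:
  assumes Y: "abs_ext Y" shows "path_connected_space X"
  unfolding path_connected_space_def
proof (intro ballI)
  fix x y assume "x \<in> topspace X" "y \<in> topspace X"
  then obtain u v where uv: "u \<in> topspace Y" "v \<in> topspace Y" "x = p u" "y = p v"
    by (auto simp: topspace_X)
  obtain g where g: "continuous_map (cube 1) Y g" "g (pt 0) = u" "g (pt 1) = v"
    using abs_ext_path[OF Y uv(1,2)] by blast
  have "continuous_map (top_of_set {0..1}) X (p \<circ> (g \<circ> pt))"
    by (intro continuous_map_compose[OF _ continuous_p] continuous_map_compose[OF continuous_pt g(1)])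
  then show "\<exists>g. pathin X g \<and> g 0 = x \<and> g 1 = y"
    using g uv by (intro exI[of _ "p \<circ> (g \<circ> pt)"]) (simp add: pathin_def)
qed

lemma const_cube_maps: "a \<in> topspace X \<Longrightarrow> (\<lambda>_. a) \<in> cube_maps n X a"
  by (simp add: cube_maps_def)

text \<open>The boundary of a cube of dimension at least 2 is connected, so a lift of
  \<open>f\<close> is constant there and can be contracted in \<open>Y\<close> with its boundary
  fixed. Connectedness is used face by face: the lift is constant on each face, and faces are linked
  through their intersections.\<close>

lemma higher_homotopy_trivial:
  assumes Y: "abs_ext Y" and a: "a \<in> topspace X" and n: "n \<ge> 2"
  shows "carrier (homotopy_group n X a) = {\<one>\<^bsub>homotopy_group n X a\<^esub>}"
proof -
  have "(f, \<lambda>_. a) \<in> cube_homotopy n X a" if f: "f \<in> cube_maps n X a" for f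
  proof -
    have fc: "continuous_map (cube n) X f" "\<And>x. x \<in> cube_boundary n \<Longrightarrow> f x = a"
      using f by (auto simp: cube_maps_def)
    define x0 :: "nat \<Rightarrow> real" where "x0 = (\<lambda>i\<in>{..<n}. 0)"
    have x0: "x0 \<in> topspace (cube n)" "x0 \<in> cube_boundary n"
      using n by (auto simp: x0_def topspace_cube cube_boundary_def intro!: exI[of _ 0])
    obtain b where b: "b \<in> topspace Y" "p b = f x0" using a fc(2)[OF x0(2)] by (auto simp: topspace_X)
    obtain g where g: "continuous_map (cube n) Y g" "\<And>x. x \<in> topspace (cube n) \<Longrightarrow> p (g x) = f x" "g x0 = b"
      using lift_cube[OF fc(1) x0(1) b] by blast
    have face: "g x = g y"
      if i: "i < n" "x \<in> topspace (cube n)" "y \<in> topspace (cube n)" "x i = e" "y i = e" "e = 0 \<or> e = 1" for i e x y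
    proof -
      define Q where "Q = PiE {..<n} (\<lambda>j. if j = i then {e} else {0..1::real})"
      have Q: "z \<in> Q \<longleftrightarrow> z \<in> topspace (cube n) \<and> z i = e" for z
      proof
        assume z: "z \<in> Q"
        have "z j \<in> (if j = i then {e} else {0..1})" if "j < n" for j
          using z that unfolding Q_def by blast
        then have "z i = e" "\<And>j. j < n \<Longrightarrow> z j \<in> {0..1}"
          using \<open>i < n\<close> \<open>e = 0 \<or> e = 1\<close> by (fastforce split: if_splits)+
        then show "z \<in> topspace (cube n) \<and> z i = e"
          using z by (auto simp: Q_def topspace_cube PiE_iff)
      next
        assume "z \<in> topspace (cube n) \<and> z i = e" then show "z \<in> Q"
          by (auto simp: Q_def topspace_cube PiE_iff)
      qed
      have "connected Q" unfolding Q_def by (rule connected_PiE) auto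
      then have 1: "connected_space (subtopology (cube n) Q)"
        using Q by (metis connected_space_subtopology connectedin_def connectedin_iff_connected connectedin_subtopology cube_eq subsetI topspace_cube subtopology_subtopology Int_absorb1)
      show ?thesis
      proof (rule lift_const[OF 1, of g a])
        show "continuous_map (subtopology (cube n) Q) Y g"
          using g(1) continuous_map_from_subtopology by blast
        show "p (g z) = a" if "z \<in> topspace (subtopology (cube n) Q)" for z
        proof -
          have z: "z \<in> topspace (cube n)" "z i = e" using that Q by auto
          then have "z \<in> cube_boundary n" using i by (auto simp: cube_boundary_def)
          then show ?thesis using g(2) fc(2) z by simp
        qed
      qed (use that Q in auto)
    qed
    have gb: "g x = b" if x: "x \<in> cube_boundary n" for x
    proof -
      obtain i where i: "i < n" "x i = 0 \<or> x i = 1" and xc: "x \<in> topspace (cube n)"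
        using x by (auto simp: cube_boundary_def)
      \<comment> \<open>A second direction exists because \<open>n \<ge> 2\<close>. The face with
        vanishing coordinate \<open>j\<close> contains \<open>x0\<close> and meets the face of
        \<open>x\<close>.\<close>
      obtain j where j: "j < n" "j \<noteq> i" using n by (cases "i = 0") (auto intro: that[of 1] that[of 0])
      have xj: "x(j := 0) \<in> topspace (cube n)"
        using xc j by (auto simp: topspace_cube PiE_iff extensional_def)
      have "g x = g (x(j := 0))" using face[OF i(1) xc xj refl] i j by auto
      also have "\<dots> = g x0" using face[OF j(1) xj x0(1) refl] j by (auto simp: x0_def)
      finally show ?thesis using g by simp
    qed
    show ?thesis
    proof (rule homotopy_projects[OF Y g(1) _ _ _ f g(2)])
      show "continuous_map (cube n) Y (\<lambda>_. b)" using b by simp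
      show "p b = a" using b fc(2)[OF x0(2)] by simp
      show "(\<lambda>_. a) \<in> cube_maps n X a" using a by (rule const_cube_maps)
    qed (use gb g(2) fc(2) b x0(2) in auto)
  qed
  then have "cube_homotopy n X a `` {f} = cube_homotopy n X a `` {\<lambda>_. a}" if "f \<in> cube_maps n X a" for f
    using that by (intro equiv_class_eq[OF equiv_cube_homotopy]) auto
  then have "cube_maps n X a // cube_homotopy n X a = {cube_homotopy n X a `` {\<lambda>_. a}}"
    using const_cube_maps[OF a, of n] unfolding quotient_def by blast
  then show ?thesis
    by (simp add: homotopy_group_def)
qed

text \<open>The loops are sorted into the sets \<open>L h\<close> by the end point
  \<open>act h b\<close> of their lift at \<open>b\<close>. These sets turn out to be the homotopy
  classes, and they multiply like \<open>H\<close>.\<close>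

lemma fundamental_group:
  assumes Y: "abs_ext Y" and a: "a \<in> topspace X"
  shows "homotopy_group 1 X a \<cong> H"
proof -
  obtain b where b: "b \<in> topspace Y" "p b = a" using a by (auto simp: topspace_X)
  define lifts where "lifts f h g \<longleftrightarrow> continuous_map (cube 1) Y g \<and> (\<forall>x\<in>topspace (cube 1). p (g x) = f x) \<and>
     g (pt 0) = b \<and> g (pt 1) = act h b" for f h g
  define L where "L h = {f \<in> cube_maps 1 X a. \<exists>g. lifts f h g}" for h
  define R where "R = cube_homotopy 1 X a"
  have pts: "pt 0 \<in> topspace (cube 1)" "pt 1 \<in> topspace (cube 1)" by auto
  have bd: "cube_boundary 1 = {pt 0, pt 1}" "cube_boundary (Suc 0) = {pt 0, pt 1}"
    using cube_boundary_1 by simp_all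
  have conn: "connected_space (cube 1)"
    by (simp add: cube_def connected_space_product_topology connected_space_subtopology)
  have L_cover: "\<exists>h\<in>carrier H. f \<in> L h" if f: "f \<in> cube_maps 1 X a" for f
  proof -
    have fc: "continuous_map (cube 1) X f" "f (pt 0) = a" "f (pt 1) = a"
      using f unfolding cube_maps_def bd by auto
    obtain g where g: "continuous_map (cube 1) Y g" "\<And>x. x \<in> topspace (cube 1) \<Longrightarrow> p (g x) = f x" "g (pt 0) = b"
      using lift_cube[OF fc(1) pts(1) b(1)] b fc by metis
    have "g (pt 1) \<in> topspace Y" using g(1) pts continuous_map_image_subset_topspace by blast
    moreover have "p b = p (g (pt 1))" using g(2)[OF pts(2)] fc b by simp
    ultimately obtain h where "h \<in> carrier H" "g (pt 1) = act h b" using fibres b(1) by metis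
    then show ?thesis using f g unfolding L_def lifts_def by blast
  qed
  have L_ne: "L h \<noteq> {}" if h: "h \<in> carrier H" for h
  proof -
    obtain g where g: "continuous_map (cube 1) Y g" "g (pt 0) = b" "g (pt 1) = act h b"
      using abs_ext_path[OF Y b(1) act_closed[OF h b(1)]] by blast
    have "p \<circ> g \<in> cube_maps 1 X a"
      using continuous_map_compose[OF g(1) continuous_p] g b p_act[OF h b(1)] by (simp add: cube_maps_def bd)
    moreover have "lifts (p \<circ> g) h g" using g by (simp add: lifts_def)
    ultimately show ?thesis unfolding L_def by blast
  qed
  have L_R: "(f, f') \<in> R" if fL: "f \<in> L h" and f'L: "f' \<in> L h" and h: "h \<in> carrier H" for f f' h
  proof -
    obtain g g' where g: "lifts f h g" and g': "lifts f' h g'" using fL f'L by (auto simp: L_def)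
    show ?thesis
      unfolding R_def
    proof (rule homotopy_projects[OF Y, of 1 g g'])
    qed (use g g' fL f'L bd b p_act[OF h b(1)] in \<open>auto simp: lifts_def L_def\<close>)
  qed
  \<comment> \<open>The homotopy is lifted as a map of the square. The bottom side is the given lift
    and the two vertical sides are constant, so the top side is a lift of \<open>f'\<close> with the
    same end points.\<close>
  have R_L: "f' \<in> L h" if fL: "f \<in> L h" and ff': "(f, f') \<in> R" and h: "h \<in> carrier H" for f f' h
  proof -
    obtain g where g: "lifts f h g" using fL by (auto simp: L_def)
    obtain G where G: "continuous_map (cube (Suc 1)) X G"
      "\<And>x. x \<in> topspace (cube 1) \<Longrightarrow> G (x(1 := 0)) = f x"
      "\<And>x. x \<in> topspace (cube 1) \<Longrightarrow> G (x(1 := 1)) = f' x"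
      "\<And>x t. x \<in> cube_boundary 1 \<Longrightarrow> 0 \<le> t \<Longrightarrow> t \<le> 1 \<Longrightarrow> G (x(1 := t)) = a"
      using cube_homotopyD[of f f' 1 X a thesis] ff' unfolding R_def by blast
    have z: "(pt 0)(1 := 0) \<in> topspace (cube (Suc 1))" by (rule cube_Suc_upd[OF pts(1)]) auto
    have Ga: "G ((pt 0)(1 := 0)) = a" by (rule G(4)) (auto simp: bd)
    obtain K where K: "continuous_map (cube (Suc 1)) Y K" "\<And>x. x \<in> topspace (cube (Suc 1)) \<Longrightarrow> p (K x) = G x"
       "K ((pt 0)(1 := 0)) = b"
      using lift_cube[OF G(1) z b(1)] b(2) Ga by metis
    have bottom: "K (x(1 := 0)) = g x" if "x \<in> topspace (cube 1)" for x
    proof (rule lift_unique[OF conn, of "\<lambda>x. K (x(1 := 0))" g "pt 0"])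
      show "continuous_map (cube 1) Y (\<lambda>x. K (x(1 := 0)))"
        using continuous_map_compose[OF continuous_map_upd_const[of 0 1] K(1)] by (simp add: o_def)
      show "p (K (x(1 := 0))) = p (g x)" if "x \<in> topspace (cube 1)" for x
        using K(2)[OF cube_Suc_upd[OF that, of 0]] G(2)[OF that] g that by (simp add: lifts_def)
    qed (use g K pts that in \<open>auto simp: lifts_def\<close>)
    have side: "K ((pt s)(1 := 1)) = K ((pt s)(1 := 0))" if s: "s = 0 \<or> s = 1" for s
    proof -
      have ps: "pt s \<in> topspace (cube 1)" "pt s \<in> cube_boundary 1" using s by (auto simp: bd)
      show ?thesis
      proof (rule lift_const[of "top_of_set {0..1::real}" "\<lambda>t. K ((pt s)(1 := t))" a])
        show "connected_space (top_of_set {0..1::real})"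
          by (simp add: connected_space_subtopology)
        show "continuous_map (top_of_set {0..1}) Y (\<lambda>t. K ((pt s)(1 := t)))"
          using continuous_map_compose[OF continuous_map_upd_path[OF ps(1)] K(1)] by (simp add: o_def)
        show "p (K ((pt s)(1 := t))) = a" if "t \<in> topspace (top_of_set {0..1})" for t
          using K(2)[OF cube_Suc_upd[OF ps(1), of t]] G(4)[OF ps(2), of t] that by simp
      qed auto
    qed
    have "lifts f' h (\<lambda>x. K (x(1 := 1)))"
      unfolding lifts_def
    proof (intro conjI ballI)
      show "continuous_map (cube 1) Y (\<lambda>x. K (x(1 := 1)))"
        using continuous_map_compose[OF continuous_map_upd_const[of 1 1] K(1)] by (simp add: o_def)
      show "p (K (x(1 := 1))) = f' x" if "x \<in> topspace (cube 1)" for x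
        using K(2)[OF cube_Suc_upd[OF that, of 1]] G(3)[OF that] by simp
      show "K ((pt 0)(1 := 1)) = b" using side[of 0] K(3) by simp
      show "K ((pt 1)(1 := 1)) = act h b"
        using side[of 1] bottom[OF pts(2)] g by (simp add: lifts_def)
    qed
    moreover have "f' \<in> cube_maps 1 X a" using ff' by (simp add: R_def cube_homotopy_def)
    ultimately show ?thesis unfolding L_def by blast
  qed
  have class_L: "R `` {f} = L h" if "f \<in> L h" "h \<in> carrier H" for f h
    using that L_R R_L by blast
  have L_inj: "h = h'" if f: "f \<in> L h" "f \<in> L h'" and h: "h \<in> carrier H" "h' \<in> carrier H" for f h h'
  proof -
    obtain g g' where g: "lifts f h g" and g': "lifts f h' g'" using f by (auto simp: L_def)
    have "g (pt 1) = g' (pt 1)"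
      by (rule lift_unique[OF conn, of g g' "pt 0"]) (use g g' pts in \<open>auto simp: lifts_def\<close>)
    then have "act h b = act h' b" using g g' by (simp add: lifts_def)
    then have "act (inv h' \<otimes> h) b = b" using h b act_mult[of "inv h'" h b] act_inv[of h' b] by simp
    then have "inv h' \<otimes> h = \<one>" using free h b by simp
    then show ?thesis using h by (metis inv_equality inv_inv m_closed inv_closed)
  qed
  have L_mult: "cube_concat f f' \<in> L (h \<otimes> h')"
    if f: "f \<in> L h" "f' \<in> L h'" and h: "h \<in> carrier H" "h' \<in> carrier H" for f f' h h'
  proof -
    obtain g g' where g: "lifts f h g" and g': "lifts f' h' g'" using f by (auto simp: L_def)
    \<comment> \<open>The second lift starts at \<open>b\<close>; it is moved by \<open>h\<close> to
      start where the first one ends.\<close>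
    define k where "k = cube_concat g (act h \<circ> g')"
    have k: "continuous_map (cube 1) Y k"
      unfolding k_def using g g' act_cont[OF h(1)]
      by (intro cube_concat_continuous continuous_map_compose) (auto simp: lifts_def)
    have pk: "p (k x) = cube_concat f f' x" if x: "x \<in> topspace (cube 1)" for x
    proof -
      have "x(0 := 2 * x 0) \<in> topspace (cube 1)" if "x 0 \<le> 1/2"
        using x that by (auto simp: topspace_cube PiE_iff extensional_def)
      moreover have "x(0 := 2 * x 0 - 1) \<in> topspace (cube 1)" if "\<not> x 0 \<le> 1/2"
        using x that by (auto simp: topspace_cube PiE_iff extensional_def)
      moreover have "g' z \<in> topspace Y" if "z \<in> topspace (cube 1)" for z
        using g' that continuous_map_image_subset_topspace unfolding lifts_def by blast
      ultimately show ?thesis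
        using g g' p_act[OF h(1)] by (auto simp: k_def cube_concat_def lifts_def simp del: fun_upd_apply)
    qed
    have up0: "(pt s)(0 := t) = pt t" for s t by (auto simp: pt_def restrict_def fun_eq_iff)
    have k01: "k (pt 0) = b" "k (pt 1) = act (h \<otimes> h') b"
      using g g' act_mult[OF h b(1)] by (auto simp: k_def cube_concat_def up0 lifts_def)
    have "continuous_map (cube 1) X (cube_concat f f')"
      using continuous_map_compose[OF k continuous_p] by (rule continuous_map_eq) (simp add: pk)
    then have "cube_concat f f' \<in> cube_maps 1 X a"
      using f by (auto simp: cube_maps_def bd L_def cube_concat_def up0)
    then show ?thesis
      unfolding L_def lifts_def using k pk k01 by blast
  qed
  have carr: "carrier (homotopy_group 1 X a) = L ` carrier H"
  proof -
    have "carrier (homotopy_group 1 X a) = (\<lambda>f. R `` {f}) ` cube_maps 1 X a"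
      by (auto simp: homotopy_group_def quotient_def R_def)
    also have "\<dots> = L ` carrier H"
    proof (intro equalityI subsetI)
      fix S assume "S \<in> (\<lambda>f. R `` {f}) ` cube_maps 1 X a"
      then show "S \<in> L ` carrier H" using L_cover class_L by blast
    next
      fix S assume "S \<in> L ` carrier H"
      then obtain h f where "h \<in> carrier H" "S = L h" "f \<in> L h" using L_ne by blast
      then show "S \<in> (\<lambda>f. R `` {f}) ` cube_maps 1 X a"
        using class_L by (intro image_eqI[of _ _ f]) (auto simp: L_def)
    qed
    finally show ?thesis .
  qed
  have mult: "L h \<otimes>\<^bsub>homotopy_group 1 X a\<^esub> L h' = L (h \<otimes> h')" if h: "h \<in> carrier H" "h' \<in> carrier H" for h h'
  proof -
    have "(\<Union>f\<in>L h. \<Union>g\<in>L h'. R `` {cube_concat f g}) = (\<Union>f\<in>L h. \<Union>g\<in>L h'. L (h \<otimes> h'))"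
      using L_mult class_L h by (intro SUP_cong refl) (metis m_closed)
    also have "\<dots> = L (h \<otimes> h')" using L_ne h by auto
    finally show ?thesis by (simp add: homotopy_group_def R_def)
  qed
  have "L \<in> iso H (homotopy_group 1 X a)"
  proof (rule isoI)
    show "L \<in> hom H (homotopy_group 1 X a)"
      using carr mult by (auto intro!: homI)
    show "bij_betw L (carrier H) (carrier (homotopy_group 1 X a))"
      unfolding bij_betw_def carr
    proof (intro conjI inj_onI refl)
      fix h h' assume h: "h \<in> carrier H" "h' \<in> carrier H" "L h = L h'"
      obtain f where "f \<in> L h" using L_ne h by blast
      then show "h = h'" using L_inj h by metis
    qed
  qed
  then have "H \<cong> homotopy_group 1 X a" by (auto simp: is_iso_def)
  then show ?thesis by (rule iso_sym)
qed

theorem Eilenberg_MacLane_quotient: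
  assumes "abs_ext Y" "topspace Y \<noteq> {}"
  shows "Eilenberg_MacLane_1 H X"
  unfolding Eilenberg_MacLane_1_def
  using assms path_connected_X fundamental_group higher_homotopy_trivial by (simp add: topspace_X)

end

section \<open>CW complexes presented by characteristic maps, and their quotients\<close>

section \<open>Cell families in a Hausdorff space\<close>

lemma topspace_disc: "topspace (disc n) = {x. (\<forall>i\<ge>n. x i = 0) \<and> (\<Sum>i<n. (x i)\<^sup>2) \<le> 1}"
  by (auto simp: disc_def topspace_Euclidean_space)

lemma disc_eq: "disc n = top_of_set (topspace (disc n))"
proof -
  have "powertop_real (UNIV :: nat set) = euclidean" by (rule euclidean_product_topology)
  then show ?thesis
    unfolding topspace_disc by (simp add: disc_def Euclidean_space_def subtopology_subtopology Collect_conj_eq)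
qed

lemma disc_split: "topspace (disc n) = disc_interior n \<union> disc_boundary n"
  by (auto simp: disc_interior_def disc_boundary_def topspace_disc)

lemma compact_disc: "compact (topspace (disc n))"
proof -
  have "topspace (disc n) = PiE UNIV (\<lambda>_. {-1..1}) \<inter>
      ((\<Inter>i\<in>{n..}. {x. x i = 0}) \<inter> {x. (\<Sum>i<n. (x i)\<^sup>2) \<le> 1})"
  proof (intro equalityI subsetI)
    fix x :: "nat \<Rightarrow> real" assume x: "x \<in> topspace (disc n)"
    have "\<bar>x i\<bar> \<le> 1" for i
    proof (cases "i < n")
      case True
      then have "(x i)\<^sup>2 \<le> (\<Sum>i<n. (x i)\<^sup>2)" by (intro member_le_sum) auto
      then have "(x i)\<^sup>2 \<le> 1" using x by (auto simp: topspace_disc)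
      then show ?thesis by (simp add: abs_square_le_1)
    next
      case False
      then show ?thesis using x by (auto simp: topspace_disc)
    qed
    then have "x \<in> PiE UNIV (\<lambda>_. {-1..1})" by (auto simp: abs_le_iff minus_le_iff)
    then show "x \<in> PiE UNIV (\<lambda>_. {-1..1}) \<inter> ((\<Inter>i\<in>{n..}. {x. x i = 0}) \<inter> {x. (\<Sum>i<n. (x i)\<^sup>2) \<le> 1})"
      using x by (auto simp: topspace_disc)
  qed (auto simp: topspace_disc)
  moreover have "closed {x :: nat \<Rightarrow> real. (\<Sum>i<n. (x i)\<^sup>2) \<le> 1}"
    by (intro closed_Collect_le continuous_on_sum continuous_on_power continuous_on_coord continuous_on_const)
  ultimately show ?thesis
    by (auto intro!: compact_Int_closed compact_PiE closed_Int closed_INT closed_coord)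
qed

lemma compact_space_disc: "compact_space (disc n)"
  by (metis compact_disc compactin_euclidean_iff compactin_subspace disc_eq compact_space_subtopology)

text \<open>The cells lie in a Hausdorff type whose own topology serves for separation and for the
  continuity of the characteristic maps. The topology of the complex is \<open>weak\<close>, which
  may be finer.\<close>

locale cell_family =
  fixes I :: "'i set" and dim :: "'i \<Rightarrow> nat" and \<phi> :: "'i \<Rightarrow> (nat \<Rightarrow> real) \<Rightarrow> 'b::t2_space"
  assumes cell_cont: "i \<in> I \<Longrightarrow> continuous_on (topspace (disc (dim i))) (\<phi> i)"
    and cell_inj: "i \<in> I \<Longrightarrow> inj_on (\<phi> i) (disc_interior (dim i))"
    and cell_disj: "i \<in> I \<Longrightarrow> j \<in> I \<Longrightarrow> i \<noteq> j \<Longrightarrow>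
       \<phi> i ` disc_interior (dim i) \<inter> \<phi> j ` disc_interior (dim j) = {}"
    and cell_boundary: "i \<in> I \<Longrightarrow> \<exists>F. finite F \<and> F \<subseteq> I \<and> (\<forall>j\<in>F. dim j < dim i) \<and>
       \<phi> i ` disc_boundary (dim i) \<subseteq> (\<Union>j\<in>F. \<phi> j ` disc_interior (dim j))"
begin

definition open_cell :: "'i \<Rightarrow> 'b set" where "open_cell i = \<phi> i ` disc_interior (dim i)"
definition closed_cell :: "'i \<Rightarrow> 'b set" where "closed_cell i = \<phi> i ` topspace (disc (dim i))"
definition points :: "'b set" where "points = (\<Union>i\<in>I. closed_cell i)"

lemma points_eq: "points = (\<Union>i\<in>I. open_cell i)"
proof
  show "points \<subseteq> (\<Union>i\<in>I. open_cell i)"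
  proof
    fix y assume "y \<in> points"
    then obtain i x where i: "i \<in> I" "x \<in> topspace (disc (dim i))" "y = \<phi> i x"
      by (auto simp: points_def closed_cell_def)
    then consider "x \<in> disc_interior (dim i)" | "x \<in> disc_boundary (dim i)" by (auto simp: disc_split)
    then show "y \<in> (\<Union>i\<in>I. open_cell i)"
    proof cases
      case 1 then show ?thesis using i by (auto simp: open_cell_def)
    next
      case 2 then show ?thesis using i cell_boundary[OF i(1)] unfolding open_cell_def by blast
    qed
  qed
  show "(\<Union>i\<in>I. open_cell i) \<subseteq> points"
    unfolding points_def open_cell_def closed_cell_def disc_split by blast
qed

definition weak :: "'b topology" where
  "weak = topology (\<lambda>U. U \<subseteq> points \<and>
     (\<forall>i\<in>I. openin (disc (dim i)) {x \<in> topspace (disc (dim i)). \<phi> i x \<in> U}))"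

lemma openin_weak: "openin weak U \<longleftrightarrow> U \<subseteq> points \<and>
     (\<forall>i\<in>I. openin (disc (dim i)) {x \<in> topspace (disc (dim i)). \<phi> i x \<in> U})"
proof -
  have "istopology (\<lambda>U. U \<subseteq> points \<and>
     (\<forall>i\<in>I. openin (disc (dim i)) {x \<in> topspace (disc (dim i)). \<phi> i x \<in> U}))"
    unfolding istopology_def
  proof (intro conjI allI impI ballI; (elim conjE)?)
    fix S T i assume i: "i \<in> I" and "\<forall>i\<in>I. openin (disc (dim i)) {x \<in> topspace (disc (dim i)). \<phi> i x \<in> S}"
       "\<forall>i\<in>I. openin (disc (dim i)) {x \<in> topspace (disc (dim i)). \<phi> i x \<in> T}"
    then have "openin (disc (dim i)) ({x \<in> topspace (disc (dim i)). \<phi> i x \<in> S} \<inter> {x \<in> topspace (disc (dim i)). \<phi> i x \<in> T})"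
      by (intro openin_Int) auto
    then show "openin (disc (dim i)) {x \<in> topspace (disc (dim i)). \<phi> i x \<in> S \<inter> T}"
      by (rule back_subst[of "openin (disc (dim i))"]) auto
  next
    fix K i assume i: "i \<in> I" and K: "\<forall>S\<in>K. S \<subseteq> points \<and> (\<forall>i\<in>I. openin (disc (dim i)) {x \<in> topspace (disc (dim i)). \<phi> i x \<in> S})"
    then have "openin (disc (dim i)) (\<Union>S\<in>K. {x \<in> topspace (disc (dim i)). \<phi> i x \<in> S})"
      by (intro openin_Union) auto
    then show "openin (disc (dim i)) {x \<in> topspace (disc (dim i)). \<phi> i x \<in> \<Union> K}"
      by (rule back_subst[of "openin (disc (dim i))"]) auto
  qed blast+
  then show ?thesis
    by (simp add: weak_def topology_inverse')
qed

lemma cell_in_points: "i \<in> I \<Longrightarrow> x \<in> topspace (disc (dim i)) \<Longrightarrow> \<phi> i x \<in> points"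
  by (auto simp: points_def closed_cell_def)

lemma topspace_weak: "topspace weak = points"
proof
  show "topspace weak \<subseteq> points" using openin_weak openin_topspace by blast
  have "{x \<in> topspace (disc (dim i)). \<phi> i x \<in> points} = topspace (disc (dim i))" if "i \<in> I" for i
    using cell_in_points that by auto
  then have "openin weak points" by (simp add: openin_weak)
  then show "points \<subseteq> topspace weak" by (rule openin_subset)
qed

lemma continuous_cell: "i \<in> I \<Longrightarrow> continuous_map (disc (dim i)) weak (\<phi> i)"
  by (auto simp: continuous_map topspace_weak openin_weak cell_in_points)

lemma closedin_weak: "closedin weak A \<longleftrightarrow> A \<subseteq> points \<and>
     (\<forall>i\<in>I. closedin (disc (dim i)) {x \<in> topspace (disc (dim i)). \<phi> i x \<in> A})"
proof -
  have "topspace (disc (dim i)) - {x \<in> topspace (disc (dim i)). \<phi> i x \<in> A}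
     = {x \<in> topspace (disc (dim i)). \<phi> i x \<in> points - A}" if "i \<in> I" for i
    using cell_in_points that by auto
  then show ?thesis
    unfolding closedin_def topspace_weak openin_weak by auto
qed

lemma closedin_disc_preimage:
  assumes "i \<in> I" "closed T"
  shows "closedin (disc (dim i)) {x \<in> topspace (disc (dim i)). \<phi> i x \<in> T}"
proof -
  have "closedin (top_of_set (topspace (disc (dim i)))) (topspace (disc (dim i)) \<inter> \<phi> i -` T)"
    using cell_cont[OF assms(1)] assms(2) by (rule continuous_closedin_preimage)
  then show ?thesis
    by (simp add: vimage_def Int_def flip: disc_eq)
qed

text \<open>The topology \<open>weak\<close> is finer than the subspace topology; its Hausdorff
  property is inherited in this way.\<close>

lemma open_Int_points: "open U \<Longrightarrow> openin weak (U \<inter> points)"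
proof -
  assume U: "open U"
  have "closedin weak (points - U)"
    unfolding closedin_weak
  proof (intro conjI ballI)
    fix i assume i: "i \<in> I"
    have "{x \<in> topspace (disc (dim i)). \<phi> i x \<in> points - U} = {x \<in> topspace (disc (dim i)). \<phi> i x \<in> - U}"
      using cell_in_points[OF i] by auto
    then show "closedin (disc (dim i)) {x \<in> topspace (disc (dim i)). \<phi> i x \<in> points - U}"
      using closedin_disc_preimage[OF i closed_Compl[OF U]] by simp
  qed auto
  then have "openin weak (points - (points - U))"
    using topspace_weak by (metis openin_closedin_eq Diff_subset double_diff order_refl)
  moreover have "points - (points - U) = U \<inter> points" by auto
  ultimately show ?thesis by simp
qed

lemma continuous_weak_euclidean: "continuous_map weak euclidean (\<lambda>x. x)"
proof -
  have "{x \<in> points. x \<in> U} = U \<inter> points" for U by auto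
  then show ?thesis by (simp add: continuous_map topspace_weak open_Int_points)
qed

lemma Hausdorff_weak: "Hausdorff_space weak"
  unfolding Hausdorff_space_def
proof (intro allI impI, elim conjE)
  fix x y assume xy: "x \<in> topspace weak" "y \<in> topspace weak" "x \<noteq> y"
  obtain U V where "open U" "open V" "x \<in> U" "y \<in> V" "U \<inter> V = {}"
    using hausdorff[OF xy(3)] by blast
  then have "openin weak (U \<inter> points) \<and> openin weak (V \<inter> points) \<and> x \<in> U \<inter> points \<and> y \<in> V \<inter> points
      \<and> disjnt (U \<inter> points) (V \<inter> points)"
    using xy open_Int_points[of U] open_Int_points[of V] by (auto simp: topspace_weak disjnt_def)
  then show "\<exists>U V. openin weak U \<and> openin weak V \<and> x \<in> U \<and> y \<in> V \<and> disjnt U V"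
    by blast
qed

text \<open>Choose a point of \<open>K\<close> in every open cell that \<open>K\<close> meets. A
  closed cell is covered by finitely many open cells, so it contains finitely many chosen points and
  every set of chosen points is closed. They form a compact discrete space.\<close>

lemma compactin_finite_cells:
  assumes K: "compactin weak K"
  shows "finite {i \<in> I. K \<inter> open_cell i \<noteq> {}}"
proof -
  define J where "J = {i \<in> I. K \<inter> open_cell i \<noteq> {}}"
  define c where "c i = (SOME y. y \<in> K \<inter> open_cell i)" for i
  have c: "c i \<in> K" "c i \<in> open_cell i" "i \<in> I" if "i \<in> J" for i
  proof -
    have "\<exists>y. y \<in> K \<inter> open_cell i" using that by (auto simp: J_def)
    then have "c i \<in> K \<inter> open_cell i" unfolding c_def by (rule someI_ex)
    then show "c i \<in> K" "c i \<in> open_cell i" "i \<in> I" using that by (auto simp: J_def)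
  qed
  have same: "i = j" if "i \<in> J" "j \<in> I" "c i \<in> open_cell j" for i j
    using cell_disj[of i j] c[OF that(1)] that unfolding open_cell_def by blast
  have inj: "inj_on c J" using same c by (intro inj_onI) metis
  have KP: "K \<subseteq> points" using K compactin_subset_topspace topspace_weak by blast
  have closed_sub: "closedin weak S" if S: "S \<subseteq> c ` J" for S
    unfolding closedin_weak
  proof (intro conjI ballI)
    show "S \<subseteq> points" using S c(1) KP by blast
    fix j assume j: "j \<in> I"
    obtain F where F: "finite F" "F \<subseteq> I" "\<phi> j ` disc_boundary (dim j) \<subseteq> (\<Union>k\<in>F. open_cell k)"
      using cell_boundary[OF j] unfolding open_cell_def by blast
    have "S \<inter> closed_cell j \<subseteq> c ` insert j F"
    proof
      fix y assume y: "y \<in> S \<inter> closed_cell j"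
      then obtain i where i: "i \<in> J" "y = c i" using S by auto
      have "y \<in> open_cell j \<or> y \<in> (\<Union>k\<in>F. open_cell k)"
        using y F(3) unfolding closed_cell_def open_cell_def disc_split by blast
      then have "i \<in> insert j F" using same[OF i(1)] i(2) j F(2) by blast
      then show "y \<in> c ` insert j F" using i by blast
    qed
    then have "finite (S \<inter> closed_cell j)" using F(1) by (meson finite_imageI finite_insert finite_subset)
    then have "closedin (disc (dim j)) {x \<in> topspace (disc (dim j)). \<phi> j x \<in> S \<inter> closed_cell j}"
      using closedin_disc_preimage[OF j] finite_imp_closed by blast
    moreover have "{x \<in> topspace (disc (dim j)). \<phi> j x \<in> S \<inter> closed_cell j} = {x \<in> topspace (disc (dim j)). \<phi> j x \<in> S}"
      by (auto simp: closed_cell_def)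
    ultimately show "closedin (disc (dim j)) {x \<in> topspace (disc (dim j)). \<phi> j x \<in> S}" by simp
  qed
  define S where "S = c ` J"
  have SP: "S \<subseteq> topspace weak" using c KP by (auto simp: S_def topspace_weak)
  have "compactin weak S"
    using closed_compactin[OF K _ closed_sub[of S]] c by (auto simp: S_def)
  then have "compact_space (subtopology weak S)" by (simp add: compact_space_subtopology)
  moreover have "discrete_topology S = subtopology weak S"
    unfolding discrete_topology_unique
  proof (intro conjI ballI)
    show "topspace (subtopology weak S) = S" using SP by auto
    fix y assume "y \<in> S"
    have "closedin weak (S - {y})" by (rule closed_sub) (auto simp: S_def)
    then have "openin weak (topspace weak - (S - {y}))" by blast
    moreover have "{y} = (topspace weak - (S - {y})) \<inter> S" using SP \<open>y \<in> S\<close> by auto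
    ultimately show "openin (subtopology weak S) {y}" unfolding openin_subtopology by blast
  qed
  ultimately have "finite S" by (metis compact_space_discrete_topology)
  then show ?thesis using inj by (simp add: S_def J_def finite_image_iff)
qed

text \<open>Closed cells are compact, so on a finite union of them every closed set of
  \<open>weak\<close> is also closed in the ambient topology.\<close>

lemma continuous_into_weak:
  assumes g: "continuous_on D g" and F: "finite F" "F \<subseteq> I" "g ` D \<subseteq> (\<Union>i\<in>F. closed_cell i)"
  shows "continuous_map (top_of_set D) weak g"
  unfolding continuous_map_closedin
proof (intro conjI allI impI)
  have "g ` D \<subseteq> points" using F unfolding points_def by blast
  then show "g \<in> topspace (top_of_set D) \<rightarrow> topspace weak" by (auto simp: topspace_weak)
  fix A assume A: "closedin weak A"
  have "compact (A \<inter> closed_cell i)" if i: "i \<in> F" for i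
  proof -
    have iI: "i \<in> I" using i F by auto
    have "closedin (top_of_set (topspace (disc (dim i)))) {x \<in> topspace (disc (dim i)). \<phi> i x \<in> A}"
      using A iI unfolding closedin_weak by (metis disc_eq)
    then have "compact {x \<in> topspace (disc (dim i)). \<phi> i x \<in> A}"
      using compact_disc closedin_compact by blast
    then have "compact (\<phi> i ` {x \<in> topspace (disc (dim i)). \<phi> i x \<in> A})"
      using cell_cont[OF iI] by (intro compact_continuous_image) (auto intro: continuous_on_subset)
    moreover have "\<phi> i ` {x \<in> topspace (disc (dim i)). \<phi> i x \<in> A} = A \<inter> closed_cell i"
      by (auto simp: closed_cell_def)
    ultimately show ?thesis by simp
  qed
  then have "closed (\<Union>i\<in>F. A \<inter> closed_cell i)"
    using F by (intro closed_UN) (auto intro: compact_imp_closed)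
  then have "closedin (top_of_set D) (D \<inter> g -` (\<Union>i\<in>F. A \<inter> closed_cell i))"
    using g by (intro continuous_closedin_preimage)
  moreover have "D \<inter> g -` (\<Union>i\<in>F. A \<inter> closed_cell i) = {x \<in> topspace (top_of_set D). g x \<in> A}"
    using F(3) by (auto simp: image_subset_iff)
  ultimately show "closedin (top_of_set D) {x \<in> topspace (top_of_set D). g x \<in> A}" by simp
qed

end

text \<open>Assumption \<open>perm\<close> asks that a group element carry characteristic maps to
  characteristic maps without a change of parameters; then an orbit of cells gives a single map to
  the quotient. Assumption \<open>extends\<close> speaks of the ambient topology and of finite sets
  of cells, where extensions can be built by hand.\<close>

locale free_cell_action = cell_family I dim \<phi> + group H
  for I :: "'i set" and dim :: "'i \<Rightarrow> nat" and \<phi> :: "'i \<Rightarrow> (nat \<Rightarrow> real) \<Rightarrow> 'b::t2_space"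
    and H :: "('a, 'c) monoid_scheme" (structure) +
  fixes act :: "'a \<Rightarrow> 'b \<Rightarrow> 'b" and p :: "'b \<Rightarrow> 'p"
  assumes perm: "h \<in> carrier H \<Longrightarrow> i \<in> I \<Longrightarrow>
       \<exists>j\<in>I. dim j = dim i \<and> (\<forall>x\<in>topspace (disc (dim i)). \<phi> j x = act h (\<phi> i x))"
    and c_act_one: "y \<in> points \<Longrightarrow> act \<one> y = y"
    and c_act_mult: "g \<in> carrier H \<Longrightarrow> h \<in> carrier H \<Longrightarrow> y \<in> points \<Longrightarrow> act (g \<otimes> h) y = act g (act h y)"
    and c_free: "h \<in> carrier H \<Longrightarrow> y \<in> points \<Longrightarrow> act h y = y \<Longrightarrow> h = \<one>"
    and c_proper: "y \<in> points \<Longrightarrow> z \<in> points \<Longrightarrow>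
       \<exists>U V. open U \<and> open V \<and> y \<in> U \<and> z \<in> V \<and> finite {h \<in> carrier H. act h ` (U \<inter> points) \<inter> V \<noteq> {}}"
    and c_fibres: "y \<in> points \<Longrightarrow> z \<in> points \<Longrightarrow> p y = p z \<longleftrightarrow> (\<exists>h\<in>carrier H. z = act h y)"
    and extends: "\<And>(C :: (nat \<Rightarrow> real) set) D f F. compact C \<Longrightarrow> compact D \<Longrightarrow> C \<subseteq> D \<Longrightarrow>
       continuous_on C f \<Longrightarrow> finite F \<Longrightarrow> F \<subseteq> I \<Longrightarrow> f ` C \<subseteq> (\<Union>i\<in>F. closed_cell i) \<Longrightarrow>
       \<exists>g F'. continuous_on D g \<and> finite F' \<and> F' \<subseteq> I \<and> g ` D \<subseteq> (\<Union>i\<in>F'. closed_cell i) \<and> (\<forall>x\<in>C. g x = f x)"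
    and I_nonempty: "I \<noteq> {}"
begin

lemma act_points: "h \<in> carrier H \<Longrightarrow> y \<in> points \<Longrightarrow> act h y \<in> points"
proof -
  assume h: "h \<in> carrier H" and "y \<in> points"
  then obtain i x where i: "i \<in> I" "x \<in> topspace (disc (dim i))" "y = \<phi> i x"
    by (auto simp: points_def closed_cell_def)
  then obtain j where "j \<in> I" "dim j = dim i" "\<phi> j x = act h y"
    using perm[OF h i(1)] by blast
  then show ?thesis using cell_in_points[of j x] i(2) by simp
qed

lemma act_continuous:
  assumes h: "h \<in> carrier H" shows "continuous_map weak weak (act h)"
  unfolding continuous_map topspace_weak
proof (intro conjI allI impI)
  show "act h ` points \<subseteq> points" using act_points h by auto
  fix U assume U: "openin weak U"
  show "openin weak {y \<in> points. act h y \<in> U}"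
    unfolding openin_weak
  proof (intro conjI ballI)
    fix i assume i: "i \<in> I"
    obtain j where j: "j \<in> I" "dim j = dim i" "\<forall>x\<in>topspace (disc (dim i)). \<phi> j x = act h (\<phi> i x)"
      using perm[OF h i] by blast
    have "openin (disc (dim i)) {x \<in> topspace (disc (dim i)). \<phi> j x \<in> U}"
      using U j(1,2) unfolding openin_weak by metis
    moreover have "{x \<in> topspace (disc (dim i)). \<phi> j x \<in> U} = {x \<in> topspace (disc (dim i)). \<phi> i x \<in> {y \<in> points. act h y \<in> U}}"
      using j(3) cell_in_points[OF i] by auto
    ultimately show "openin (disc (dim i)) {x \<in> topspace (disc (dim i)). \<phi> i x \<in> {y \<in> points. act h y \<in> U}}"
      by simp
  qed auto
qed

sublocale deck_action H weak act p
proof unfold_locales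
  fix y z assume "y \<in> topspace weak" "z \<in> topspace weak"
  then obtain U V where UV: "open U" "open V" "y \<in> U" "z \<in> V"
     and fin: "finite {h \<in> carrier H. act h ` (U \<inter> points) \<inter> V \<noteq> {}}" and yz: "y \<in> points" "z \<in> points"
    using c_proper[of y z] unfolding topspace_weak by blast
  have "{h \<in> carrier H. act h ` (U \<inter> points) \<inter> (V \<inter> points) \<noteq> {}} \<subseteq> {h \<in> carrier H. act h ` (U \<inter> points) \<inter> V \<noteq> {}}"
    by blast
  then have "finite {h \<in> carrier H. act h ` (U \<inter> points) \<inter> (V \<inter> points) \<noteq> {}}"
    using fin finite_subset by blast
  moreover have "openin weak (U \<inter> points)" "openin weak (V \<inter> points)" "y \<in> U \<inter> points" "z \<in> V \<inter> points"
    using UV yz open_Int_points by auto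
  ultimately show "\<exists>U V. openin weak U \<and> openin weak V \<and> y \<in> U \<and> z \<in> V \<and> finite {h \<in> carrier H. act h ` U \<inter> V \<noteq> {}}"
    by blast
qed (use act_continuous c_act_one c_act_mult c_free c_fibres Hausdorff_weak in \<open>simp_all add: topspace_weak\<close>)

text \<open>A compact image lies in finitely many cells, so both the given map and its extension may
  be treated in the ambient topology.\<close>

lemma abs_ext_weak: "abs_ext weak"
  unfolding abs_ext_def
proof (intro allI impI, elim conjE)
  fix C D :: "(nat \<Rightarrow> real) set" and f
  assume C: "compact C" and D: "compact D" and CD: "C \<subseteq> D" and f: "continuous_map (top_of_set C) weak f"
  have fe: "continuous_on C f"
    using continuous_map_compose[OF f continuous_weak_euclidean] by (simp add: o_def)
  have "compactin (top_of_set C) C" using C by (simp add: compactin_subtopology)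
  then have "compactin weak (f ` C)" using f image_compactin by blast
  then have fin: "finite {i \<in> I. f ` C \<inter> open_cell i \<noteq> {}}" (is "finite ?F")
    by (rule compactin_finite_cells)
  have "f ` C \<subseteq> points" using f by (auto simp: continuous_map_def topspace_weak)
  then have "f ` C \<subseteq> (\<Union>i\<in>?F. open_cell i)" unfolding points_eq by blast
  moreover have "(\<Union>i\<in>?F. open_cell i) \<subseteq> (\<Union>i\<in>?F. closed_cell i)"
    by (rule UN_mono) (auto simp: open_cell_def closed_cell_def disc_split)
  ultimately have "f ` C \<subseteq> (\<Union>i\<in>?F. closed_cell i)" by (rule subset_trans)
  then obtain g F' where g: "continuous_on D g" "finite F'" "F' \<subseteq> I" "g ` D \<subseteq> (\<Union>i\<in>F'. closed_cell i)" "\<forall>x\<in>C. g x = f x"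
    using extends[OF C D CD fe fin] by blast
  then show "\<exists>g. continuous_map (top_of_set D) weak g \<and> (\<forall>x\<in>C. g x = f x)"
    using continuous_into_weak[OF g(1-4)] by blast
qed

text \<open>The restriction makes the maps of all cells in one orbit equal. So the elements of this
  set correspond to the orbits of \<open>n\<close>-cells, and finitely many orbits give a finite
  set.\<close>

definition quotient_cells :: "nat \<Rightarrow> ((nat \<Rightarrow> real) \<Rightarrow> 'p) set" where
  "quotient_cells n = (\<lambda>i. restrict (p \<circ> \<phi> i) (topspace (disc n))) ` {i \<in> I. dim i = n}"

lemma closedin_X: "closedin X A \<longleftrightarrow> A \<subseteq> topspace X \<and> closedin weak {y \<in> points. p y \<in> A}"
proof -
  have "points - {y \<in> points. p y \<in> A} = {y \<in> points. p y \<in> topspace X - A}"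
    by (auto simp: topspace_X topspace_weak)
  then show ?thesis
    unfolding closedin_def openin_X topspace_weak by (auto simp: topspace_X topspace_weak)
qed

lemma same_orbit_cell:
  assumes i: "i \<in> I" "x \<in> topspace (disc (dim i))" and j: "j \<in> I" "y \<in> disc_interior (dim j)"
    and eq: "p (\<phi> i x) = p (\<phi> j y)"
  obtains k h where "h \<in> carrier H" "k \<in> I" "dim k = dim i" "\<And>z. z \<in> topspace (disc (dim i)) \<Longrightarrow> \<phi> k z = act h (\<phi> i z)"
    "\<phi> k x = \<phi> j y"
proof -
  have "\<phi> i x \<in> points" "\<phi> j y \<in> points" using cell_in_points i j by (auto simp: disc_split)
  then obtain h where h: "h \<in> carrier H" "\<phi> j y = act h (\<phi> i x)" using c_fibres eq by blast
  then show thesis using perm[OF h(1) i(1)] i(2) that by metis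
qed

lemma same_orbit_interior:
  assumes i: "i \<in> I" "x \<in> disc_interior (dim i)" and j: "j \<in> I" "y \<in> disc_interior (dim j)"
    and eq: "p (\<phi> i x) = p (\<phi> j y)"
  shows "dim i = dim j" "x = y" "\<And>z. z \<in> topspace (disc (dim i)) \<Longrightarrow> p (\<phi> i z) = p (\<phi> j z)"
proof -
  have xd: "x \<in> topspace (disc (dim i))" using i by (auto simp: disc_split)
  obtain h k where k: "h \<in> carrier H" "k \<in> I" "dim k = dim i" "\<And>z. z \<in> topspace (disc (dim i)) \<Longrightarrow> \<phi> k z = act h (\<phi> i z)"
    "\<phi> k x = \<phi> j y"
    by (rule same_orbit_cell[OF i(1) xd j eq]) blast
  have "k = j" using cell_disj[OF k(2) j(1)] k i j by (metis disjoint_iff imageI)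
  then show "dim i = dim j" "x = y" using k i j cell_inj[OF j(1)] by (auto dest: inj_onD)
  fix z assume z: "z \<in> topspace (disc (dim i))"
  then show "p (\<phi> i z) = p (\<phi> j z)"
    using k(4)[OF z] \<open>k = j\<close> p_act[OF k(1)] cell_in_points[OF i(1) z] by (simp add: topspace_weak)
qed

text \<open>A boundary point lies in an open cell of smaller dimension, and translations preserve
  dimensions.\<close>

lemma boundary_not_interior:
  assumes i: "i \<in> I" "x \<in> disc_boundary (dim i)" "y \<in> disc_interior (dim i)"
  shows "p (\<phi> i x) \<noteq> p (\<phi> i y)"
proof
  assume eq: "p (\<phi> i x) = p (\<phi> i y)"
  have xd: "x \<in> topspace (disc (dim i))" using i by (auto simp: disc_split)
  obtain k h where k: "k \<in> I" "dim k = dim i" "\<phi> k x = \<phi> i y"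
    using same_orbit_cell[OF i(1) xd i(1,3) eq] by blast
  obtain F where F: "F \<subseteq> I" "\<forall>j\<in>F. dim j < dim k" "\<phi> k ` disc_boundary (dim k) \<subseteq> (\<Union>j\<in>F. \<phi> j ` disc_interior (dim j))"
    using cell_boundary[OF k(1)] by blast
  moreover have "\<phi> i y \<in> \<phi> k ` disc_boundary (dim k)" using i(2) k by (metis imageI)
  ultimately obtain j where j: "j \<in> F" "\<phi> i y \<in> \<phi> j ` disc_interior (dim j)" by blast
  then have "j = i" using cell_disj[of j i] F(1) i by blast
  then show False using j F(2) k(2) by auto
qed

theorem cw_quotient: "cw_complex X quotient_cells"
proof
  have cp: "continuous_map (disc (dim i)) X (p \<circ> \<phi> i)" if "i \<in> I" for i
    using continuous_map_compose[OF continuous_cell[OF that] continuous_p] .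
  have cr: "continuous_map (disc n) X \<psi>" if "\<psi> \<in> quotient_cells n" for n \<psi>
    using that by (auto simp: quotient_cells_def intro!: continuous_map_eq[OF cp])
  show "Hausdorff_space X" by (rule Hausdorff_X)
  show "continuous_map (disc n) X \<psi>" if "\<psi> \<in> quotient_cells n" for n \<psi>
    using cr that .
  have img: "\<psi> ` disc_interior n = p ` open_cell i" if "i \<in> I" "dim i = n" "\<psi> = restrict (p \<circ> \<phi> i) (topspace (disc n))" for i n \<psi>
    using that by (auto simp: open_cell_def disc_split image_iff)
  show "embedding_map (subtopology (disc n) (disc_interior n)) X \<psi>" if psi: "\<psi> \<in> quotient_cells n" for n \<psi>
  proof -
    obtain i where i: "i \<in> I" "dim i = n" "\<psi> = restrict (p \<circ> \<phi> i) (topspace (disc n))"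
      using psi by (auto simp: quotient_cells_def)
    have ti: "topspace (subtopology (disc n) (disc_interior n)) = disc_interior n"
      by (auto simp: disc_interior_def)
    have \<psi>: "\<psi> x = p (\<phi> i x)" if "x \<in> topspace (disc n)" for x using i that by simp
    have cl: "closedin X (\<psi> ` K)" if "closedin (disc n) K" for K
    proof (rule compactin_imp_closedin[OF Hausdorff_X])
      have "compactin (disc n) K" using that compact_space_disc closedin_compact_space by blast
      then show "compactin X (\<psi> ` K)" using cr[OF \<open>\<psi> \<in> quotient_cells n\<close>] image_compactin by blast
    qed
    show ?thesis
      unfolding embedding_map_def ti
    proof (rule bijective_closed_imp_homeomorphic_map)
      show "continuous_map (subtopology (disc n) (disc_interior n)) (subtopology X (\<psi> ` disc_interior n)) \<psi>"
        using cr[OF \<open>\<psi> \<in> quotient_cells n\<close>]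
        by (intro continuous_map_into_subtopology continuous_map_from_subtopology) (auto simp: ti)
      show "\<psi> ` topspace (subtopology (disc n) (disc_interior n)) = topspace (subtopology X (\<psi> ` disc_interior n))"
        using continuous_map_image_subset_topspace[OF cr[OF \<open>\<psi> \<in> quotient_cells n\<close>]]
        unfolding ti topspace_subtopology disc_split by blast
      show "inj_on \<psi> (topspace (subtopology (disc n) (disc_interior n)))"
        unfolding ti
        using same_orbit_interior(2)[OF i(1) _ i(1)] \<psi> i(2) by (auto intro!: inj_onI simp: disc_split)
      show "closed_map (subtopology (disc n) (disc_interior n)) (subtopology X (\<psi> ` disc_interior n)) \<psi>"
        unfolding closed_map_def
      proof (intro allI impI)
        fix U assume "closedin (subtopology (disc n) (disc_interior n)) U"
        then obtain K where K: "closedin (disc n) K" "U = K \<inter> disc_interior n"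
          by (auto simp: closedin_subtopology)
        \<comment> \<open>No boundary point has the same image as an interior point. So the image of
          a closed subset of the open cell is cut out by the compact image of a closed subset of the
          disc.\<close>
        have "\<psi> ` U = \<psi> ` K \<inter> \<psi> ` disc_interior n"
        proof (intro equalityI subsetI)
          fix z assume "z \<in> \<psi> ` K \<inter> \<psi> ` disc_interior n"
          then obtain x y where xy: "x \<in> K" "y \<in> disc_interior n" "z = \<psi> x" "z = \<psi> y" by blast
          have xd: "x \<in> topspace (disc n)" using xy K closedin_subset by blast
          have yd: "y \<in> topspace (disc n)" using xy disc_split by blast
          have eq: "p (\<phi> i x) = p (\<phi> i y)" using xy \<psi>[OF xd] \<psi>[OF yd] by simp
          have "x \<notin> disc_boundary n" using boundary_not_interior[of i x y] i xy eq by blast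
          then have "x \<in> disc_interior n" using xd disc_split by blast
          then show "z \<in> \<psi> ` U" using xy K by blast
        qed (use K in auto)
        then show "closedin (subtopology X (\<psi> ` disc_interior n)) (\<psi> ` U)"
          using cl[OF K(1)] by (auto simp: closedin_subtopology)
      qed
    qed
  qed
  show "disjnt (\<psi> ` disc_interior n) (\<psi>' ` disc_interior m)"
    if psi: "\<psi> \<in> quotient_cells n" "\<psi>' \<in> quotient_cells m" "(n, \<psi>) \<noteq> (m, \<psi>')" for n m \<psi> \<psi>'
  proof (rule ccontr)
    obtain i where i: "i \<in> I" "dim i = n" "\<psi> = restrict (p \<circ> \<phi> i) (topspace (disc n))"
      using psi by (auto simp: quotient_cells_def)
    obtain j where j: "j \<in> I" "dim j = m" "\<psi>' = restrict (p \<circ> \<phi> j) (topspace (disc m))"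
      using psi by (auto simp: quotient_cells_def)
    assume "\<not> disjnt (\<psi> ` disc_interior n) (\<psi>' ` disc_interior m)"
    then obtain x y where xy: "x \<in> disc_interior n" "y \<in> disc_interior m" "\<psi> x = \<psi>' y"
      by (auto simp: disjnt_iff)
    have d: "x \<in> topspace (disc n)" "y \<in> topspace (disc m)" using xy by (auto simp: disc_split)
    have eq: "p (\<phi> i x) = p (\<phi> j y)" using xy d i j by simp
    have "n = m" using same_orbit_interior(1)[OF i(1) _ j(1) _ eq] xy i j by simp
    moreover have "\<psi> = \<psi>'"
      using same_orbit_interior(3)[OF i(1) _ j(1) _ eq] xy i j \<open>n = m\<close> by (auto simp: restrict_def fun_eq_iff)
    ultimately show False using psi by simp
  qed
  show "topspace X = (\<Union>n. \<Union>\<psi>\<in>quotient_cells n. \<psi> ` disc_interior n)"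
  proof -
    have "topspace X = p ` (\<Union>i\<in>I. open_cell i)" by (simp add: topspace_X topspace_weak points_eq)
    also have "\<dots> = (\<Union>n. \<Union>\<psi>\<in>quotient_cells n. \<psi> ` disc_interior n)"
    proof (intro equalityI subsetI)
      fix z assume "z \<in> p ` (\<Union>i\<in>I. open_cell i)"
      then obtain i where i: "i \<in> I" "z \<in> p ` open_cell i" by blast
      then have "z \<in> restrict (p \<circ> \<phi> i) (topspace (disc (dim i))) ` disc_interior (dim i)"
        using img[OF i(1) refl refl] by simp
      then show "z \<in> (\<Union>n. \<Union>\<psi>\<in>quotient_cells n. \<psi> ` disc_interior n)"
        using i unfolding quotient_cells_def by blast
    next
      fix z assume "z \<in> (\<Union>n. \<Union>\<psi>\<in>quotient_cells n. \<psi> ` disc_interior n)"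
      then obtain i where i: "i \<in> I" "z \<in> restrict (p \<circ> \<phi> i) (topspace (disc (dim i))) ` disc_interior (dim i)"
        unfolding quotient_cells_def by blast
      then show "z \<in> p ` (\<Union>i\<in>I. open_cell i)" using img[OF i(1) refl refl] by blast
    qed
    finally show ?thesis .
  qed
  show "\<exists>F. finite F \<and> F \<subseteq> (SIGMA m:{..<n}. quotient_cells m) \<and>
             \<psi> ` disc_boundary n \<subseteq> (\<Union>(m, \<psi>)\<in>F. \<psi> ` disc_interior m)" if psi: "\<psi> \<in> quotient_cells n" for n \<psi>
  proof -
    obtain i where i: "i \<in> I" "dim i = n" "\<psi> = restrict (p \<circ> \<phi> i) (topspace (disc n))"
      using psi by (auto simp: quotient_cells_def)
    obtain F where F: "finite F" "F \<subseteq> I" "\<forall>j\<in>F. dim j < dim i" "\<phi> i ` disc_boundary (dim i) \<subseteq> (\<Union>j\<in>F. open_cell j)"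
      using cell_boundary[OF i(1)] unfolding open_cell_def by blast
    define q where "q j = (dim j, restrict (p \<circ> \<phi> j) (topspace (disc (dim j))))" for j
    have "\<psi> ` disc_boundary n \<subseteq> (\<Union>(m, \<psi>)\<in>q ` F. \<psi> ` disc_interior m)"
    proof
      fix z assume "z \<in> \<psi> ` disc_boundary n"
      then obtain x where x: "x \<in> disc_boundary n" "z = p (\<phi> i x)" using i by (auto simp: disc_split)
      then obtain j where j: "j \<in> F" "\<phi> i x \<in> open_cell j" using F i by blast
      then have "z \<in> restrict (p \<circ> \<phi> j) (topspace (disc (dim j))) ` disc_interior (dim j)"
        using img[of j "dim j", OF _ refl refl] x F by blast
      then show "z \<in> (\<Union>(m, \<psi>)\<in>q ` F. \<psi> ` disc_interior m)" using j by (force simp: q_def)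
    qed
    moreover have "q ` F \<subseteq> (SIGMA m:{..<n}. quotient_cells m)"
      using F i by (auto simp: q_def quotient_cells_def)
    ultimately show ?thesis using F by (intro exI[of _ "q ` F"]) auto
  qed
  show "closedin X A \<longleftrightarrow> (\<forall>n. \<forall>\<psi>\<in>quotient_cells n. closedin X (A \<inter> \<psi> ` topspace (disc n)))"
    if A: "A \<subseteq> topspace X" for A
  proof (intro iffI allI ballI)
    fix n \<psi> assume cl: "closedin X A" and \<psi>: "\<psi> \<in> quotient_cells n"
    have "compactin X (\<psi> ` topspace (disc n))"
      using image_compactin[OF _ cr[OF \<psi>]] compact_space_disc by (simp add: compact_space_def)
    then show "closedin X (A \<inter> \<psi> ` topspace (disc n))"
      using cl compactin_imp_closedin[OF Hausdorff_X] by blast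
  next
    assume *: "\<forall>n. \<forall>\<psi>\<in>quotient_cells n. closedin X (A \<inter> \<psi> ` topspace (disc n))"
    have "closedin (disc (dim i)) {x \<in> topspace (disc (dim i)). \<phi> i x \<in> {y \<in> points. p y \<in> A}}" if i: "i \<in> I" for i
    proof -
      define \<psi> where "\<psi> = restrict (p \<circ> \<phi> i) (topspace (disc (dim i)))"
      have \<psi>: "\<psi> \<in> quotient_cells (dim i)" using i by (auto simp: \<psi>_def quotient_cells_def)
      have "closedin X (A \<inter> \<psi> ` topspace (disc (dim i)))" using * \<psi> by blast
      then have "closedin (disc (dim i)) {x \<in> topspace (disc (dim i)). \<psi> x \<in> A \<inter> \<psi> ` topspace (disc (dim i))}"
        using cr[OF \<psi>] unfolding continuous_map_closedin by blast
      moreover have "{x \<in> topspace (disc (dim i)). \<psi> x \<in> A \<inter> \<psi> ` topspace (disc (dim i))}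
         = {x \<in> topspace (disc (dim i)). \<phi> i x \<in> {y \<in> points. p y \<in> A}}"
        using cell_in_points[OF i] by (auto simp: \<psi>_def)
      ultimately show ?thesis by simp
    qed
    then show "closedin X A"
      using A unfolding closedin_X closedin_weak by auto
  qed
qed

theorem type_F_quotient: "cw_complex X quotient_cells" "Eilenberg_MacLane_1 H X"
proof -
  show "cw_complex X quotient_cells" by (rule cw_quotient)
  have "points \<noteq> {}"
  proof -
    obtain i where i: "i \<in> I" using I_nonempty by blast
    have "(\<lambda>_. 0) \<in> topspace (disc (dim i))" by (simp add: topspace_disc)
    then show ?thesis using cell_in_points[OF i] by blast
  qed
  then show "Eilenberg_MacLane_1 H X"
    by (intro Eilenberg_MacLane_quotient abs_ext_weak) (simp add: topspace_weak)
qed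

end

section \<open>Compact sets into which maps extend\<close>

section \<open>Gauges\<close>

definition coord_space :: "nat set \<Rightarrow> (nat \<Rightarrow> real) set" where
  "coord_space J = {x. \<forall>i. i \<notin> J \<longrightarrow> x i = 0}"

text \<open>The constant \<open>B\<close> bounds the coordinates by the gauge, so a gauge vanishes only at the origin.\<close>

definition gauge :: "nat set \<Rightarrow> ((nat \<Rightarrow> real) \<Rightarrow> real) \<Rightarrow> bool" where
  "gauge J N \<longleftrightarrow> finite J \<and> continuous_on UNIV N \<and> (\<forall>c x. 0 \<le> c \<longrightarrow> N (\<lambda>i. c * x i) = c * N x) \<and>
     (\<exists>B\<ge>0. \<forall>x. \<forall>i\<in>J. \<bar>x i\<bar> \<le> B * N x) \<and> (\<forall>x. 0 \<le> N x)"

lemma gauge_scale: "gauge J N \<Longrightarrow> 0 \<le> c \<Longrightarrow> N (\<lambda>i. c * x i) = c * N x"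
  by (simp add: gauge_def)

lemma gauge_nonneg: "gauge J N \<Longrightarrow> 0 \<le> N x"
  by (simp add: gauge_def)

lemma gauge_zero: "gauge J N \<Longrightarrow> N (\<lambda>i. 0) = 0"
  using gauge_scale[of J N 0 "\<lambda>i. 0"] by simp

lemma gauge_pos:
  assumes "gauge J N" "x \<in> coord_space J" "x \<noteq> (\<lambda>i. 0)" shows "0 < N x"
proof -
  obtain i where i: "x i \<noteq> 0" "i \<in> J" using assms(2,3) by (auto simp: coord_space_def fun_eq_iff)
  obtain B where "\<forall>x. \<forall>i\<in>J. \<bar>x i\<bar> \<le> B * N x" using assms by (auto simp: gauge_def)
  then have "0 < B * N x" using i by (metis abs_le_zero_iff linorder_not_le order_trans)
  then show ?thesis using gauge_nonneg[OF assms(1), of x] by (metis mult_zero_right order_le_less less_irrefl)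
qed

lemma gauge_zero_iff: "gauge J N \<Longrightarrow> x \<in> coord_space J \<Longrightarrow> N x = 0 \<longleftrightarrow> x = (\<lambda>i. 0)"
  using gauge_pos gauge_zero by fastforce

definition euclid :: "nat set \<Rightarrow> (nat \<Rightarrow> real) \<Rightarrow> real" where
  "euclid J x = sqrt (\<Sum>i\<in>J. (x i)\<^sup>2)"

lemma gauge_euclid: "finite J \<Longrightarrow> gauge J (euclid J)"
  unfolding gauge_def
proof (intro conjI allI impI exI[of _ 1] ballI)
  show "continuous_on UNIV (euclid J)"
    unfolding euclid_def
    by (intro continuous_on_real_sqrt continuous_on_sum continuous_on_power continuous_on_coord)
  show "euclid J (\<lambda>i. c * x i) = c * euclid J x" if "0 \<le> c" for c x
    using that by (simp add: euclid_def power_mult_distrib real_sqrt_mult flip: sum_distrib_left)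
  show "\<bar>x i\<bar> \<le> 1 * euclid J x" if "finite J" "i \<in> J" for x i
  proof -
    have "(x i)\<^sup>2 \<le> (\<Sum>i\<in>J. (x i)\<^sup>2)" using that by (intro member_le_sum) auto
    then have "sqrt ((x i)\<^sup>2) \<le> euclid J x" unfolding euclid_def by (rule real_sqrt_le_mono)
    then show ?thesis by simp
  qed
  show "0 \<le> euclid J x" for x by (simp add: euclid_def sum_nonneg)
qed auto

lemma disc_euclid:
  "topspace (disc n) = {x \<in> coord_space {..<n}. euclid {..<n} x \<le> 1}"
  "disc_interior n = {x \<in> coord_space {..<n}. euclid {..<n} x < 1}"
  "disc_boundary n = {x \<in> coord_space {..<n}. euclid {..<n} x = 1}"
proof -
  have *: "0 \<le> (\<Sum>i<n. (x i)\<^sup>2)" for x :: "nat \<Rightarrow> real" by (simp add: sum_nonneg)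
  show 1: "topspace (disc n) = {x \<in> coord_space {..<n}. euclid {..<n} x \<le> 1}"
    by (auto simp: topspace_disc coord_space_def euclid_def)
  show "disc_interior n = {x \<in> coord_space {..<n}. euclid {..<n} x < 1}"
    unfolding disc_interior_def 1 by (auto simp: euclid_def)
  show "disc_boundary n = {x \<in> coord_space {..<n}. euclid {..<n} x = 1}"
    unfolding disc_boundary_def 1 by (auto simp: euclid_def)
qed

text \<open>The radial map that carries the balls of \<open>M\<close> onto those of
  \<open>N\<close>. At the origin the quotient is \<open>0 / 0 = 0\<close> and the value is the
  origin.\<close>

definition rescale :: "((nat \<Rightarrow> real) \<Rightarrow> real) \<Rightarrow> ((nat \<Rightarrow> real) \<Rightarrow> real) \<Rightarrow> (nat \<Rightarrow> real) \<Rightarrow> nat \<Rightarrow> real" where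
  "rescale M N x = (\<lambda>i. M x / N x * x i)"

lemma rescale_gauge:
  assumes M: "gauge J M" and N: "gauge J N" and x: "x \<in> coord_space J"
  shows "N (rescale M N x) = M x" "rescale N M (rescale M N x) = x" "rescale M N x \<in> coord_space J"
proof -
  have nn: "0 \<le> M x / N x" using gauge_nonneg[OF M] gauge_nonneg[OF N] by simp
  show coord: "rescale M N x \<in> coord_space J" using x by (auto simp: coord_space_def rescale_def)
  show 1: "N (rescale M N x) = M x"
  proof (cases "x = (\<lambda>i. 0)")
    case True then show ?thesis using gauge_zero[OF M] gauge_zero[OF N] by (simp add: rescale_def)
  next
    case False
    then show ?thesis
      unfolding rescale_def gauge_scale[OF N nn] using gauge_pos[OF N x False] by simp
  qed
  show "rescale N M (rescale M N x) = x"
  proof (cases "x = (\<lambda>i. 0)")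
    case True then show ?thesis by (simp add: rescale_def)
  next
    case False
    have p: "0 < M x" "0 < N x" using gauge_pos[OF M x False] gauge_pos[OF N x False] .
    have "M (rescale M N x) = M x / N x * M x"
      unfolding rescale_def by (rule gauge_scale[OF M nn])
    then have "rescale N M (rescale M N x) = (\<lambda>i. M x / (M x / N x * M x) * (M x / N x * x i))"
      unfolding rescale_def[of N M] 1 by (simp add: rescale_def)
    also have "\<dots> = x" using p by (auto simp: field_simps)
    finally show ?thesis .
  qed
qed

lemma continuous_on_gauge_compose: "gauge J N \<Longrightarrow> continuous_on S f \<Longrightarrow> continuous_on S (\<lambda>x. N (f x))"
  by (metis continuous_on_compose2 gauge_def subset_UNIV)

text \<open>The origin is the critical point: there every coordinate is bounded by
  \<open>B * M x\<close>, which tends to 0.\<close>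

lemma continuous_on_rescale:
  assumes M: "gauge J M" and N: "gauge J N"
  shows "continuous_on (coord_space J) (rescale M N)"
proof (rule continuous_on_coordinatewise_then_product)
  fix i
  obtain B where B: "B \<ge> 0" "\<And>x i. i \<in> J \<Longrightarrow> \<bar>x i\<bar> \<le> B * N x" using N by (auto simp: gauge_def)
  have bound: "\<bar>rescale M N x i\<bar> \<le> B * M x" if x: "x \<in> coord_space J" for x
  proof (cases "i \<in> J")
    case True
    then show ?thesis using B(2)[OF True, of "rescale M N x"] rescale_gauge(1)[OF M N x] by simp
  next
    case False
    then show ?thesis using x B gauge_nonneg[OF M] by (simp add: rescale_def coord_space_def)
  qed
  have M': "continuous_on UNIV M" and N': "continuous_on UNIV N" using M N by (auto simp: gauge_def)
  show "continuous_on (coord_space J) (\<lambda>x. rescale M N x i)"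
    unfolding continuous_on_eq_continuous_within
  proof
    fix x assume x: "x \<in> coord_space J"
    show "continuous (at x within coord_space J) (\<lambda>x. rescale M N x i)"
    proof (cases "x = (\<lambda>i. 0)")
      case True
      have "continuous (at x within coord_space J) (\<lambda>x. B * M x)"
        using M' by (intro continuous_intros) (meson UNIV_I continuous_on_eq_continuous_within continuous_within_subset subset_UNIV)
      then have "((\<lambda>x. B * M x) \<longlongrightarrow> 0) (at x within coord_space J)"
        using gauge_zero[OF M] True by (simp add: continuous_within)
      moreover have "\<forall>\<^sub>F y in at x within coord_space J. norm (rescale M N y i) \<le> B * M y"
        using bound by (simp add: eventually_at_filter)
      ultimately have "((\<lambda>y. rescale M N y i) \<longlongrightarrow> 0) (at x within coord_space J)"
        by (rule Lim_null_comparison[rotated])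
      moreover have "rescale M N x i = 0" using True by (simp add: rescale_def)
      ultimately show ?thesis by (simp add: continuous_within)
    next
      case False
      then have "N x \<noteq> 0" using gauge_pos[OF N x] by simp
      moreover have "continuous (at x within coord_space J) M" "continuous (at x within coord_space J) N"
        using M' N' by (meson UNIV_I continuous_on_eq_continuous_within continuous_within_subset subset_UNIV)+
      moreover have "continuous (at x within coord_space J) (\<lambda>x. x i)"
        using continuous_on_coord[of "coord_space J" i] x unfolding continuous_on_eq_continuous_within by blast
      ultimately show ?thesis
        unfolding rescale_def by (intro continuous_intros)
    qed
  qed
qed

definition index_bij :: "nat set \<Rightarrow> nat \<Rightarrow> nat" where
  "index_bij J = (SOME f. bij_betw f J {..<card J})"

lemma index_bij: "finite J \<Longrightarrow> bij_betw (index_bij J) J {..<card J}"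
  unfolding index_bij_def using ex_bij_betw_finite_nat[of J] by (metis atLeast0LessThan someI_ex)

definition reindex :: "nat set \<Rightarrow> (nat \<Rightarrow> real) \<Rightarrow> nat \<Rightarrow> real" where
  "reindex J x = (\<lambda>i. if i \<in> J then x (index_bij J i) else 0)"

text \<open>Identifies the round disc with the unit ball of a gauge, so that cubes, stair-shaped
  balls and their products with discs all serve as cells. The coordinates are renumbered because the
  disc uses the first \<open>card J\<close> of them.\<close>

definition ball_param :: "nat set \<Rightarrow> ((nat \<Rightarrow> real) \<Rightarrow> real) \<Rightarrow> (nat \<Rightarrow> real) \<Rightarrow> nat \<Rightarrow> real" where
  "ball_param J N x = rescale (euclid J) N (reindex J x)"

lemma reindex_bij: "finite J \<Longrightarrow> bij_betw (reindex J) (coord_space {..<card J}) (coord_space J)"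
proof -
  assume fin: "finite J"
  define b where "b = index_bij J"
  define c where "c = the_inv_into J b"
  have b: "bij_betw b J {..<card J}" using index_bij[OF fin] by (simp add: b_def)
  have c: "c k \<in> J" "b (c k) = k" if "k < card J" for k
    using b that by (auto simp: c_def bij_betw_def f_the_inv_into_f the_inv_into_into)
  have cb: "c (b i) = i" "b i < card J" if "i \<in> J" for i
    using b that by (auto simp: c_def bij_betw_def the_inv_into_f_f)
  show ?thesis
  proof (rule bij_betw_byWitness[where f' = "\<lambda>x k. if k < card J then x (c k) else 0"])
    show "\<forall>x\<in>coord_space {..<card J}. (\<lambda>k. if k < card J then reindex J x (c k) else 0) = x"
      using c by (auto simp: reindex_def coord_space_def fun_eq_iff simp flip: b_def)
    show "\<forall>x\<in>coord_space J. reindex J (\<lambda>k. if k < card J then x (c k) else 0) = x"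
      using cb by (auto simp: reindex_def coord_space_def fun_eq_iff simp flip: b_def)
  qed (auto simp: reindex_def coord_space_def)
qed

lemma euclid_reindex: "finite J \<Longrightarrow> euclid J (reindex J x) = euclid {..<card J} x"
proof -
  assume fin: "finite J"
  have "(\<Sum>i\<in>J. (reindex J x i)\<^sup>2) = (\<Sum>i\<in>J. (x (index_bij J i))\<^sup>2)"
    by (intro sum.cong) (auto simp: reindex_def)
  also have "\<dots> = (\<Sum>k<card J. (x k)\<^sup>2)"
    by (rule sum.reindex_bij_betw[OF index_bij[OF fin]])
  finally show ?thesis by (simp add: euclid_def)
qed

lemma ball_param:
  assumes N: "gauge J N"
  shows "continuous_on (topspace (disc (card J))) (ball_param J N)"
    "inj_on (ball_param J N) (topspace (disc (card J)))"
    "ball_param J N ` topspace (disc (card J)) = {x \<in> coord_space J. N x \<le> 1}"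
    "ball_param J N ` disc_interior (card J) = {x \<in> coord_space J. N x < 1}"
    "ball_param J N ` disc_boundary (card J) = {x \<in> coord_space J. N x = 1}"
proof -
  have fin: "finite J" using N by (simp add: gauge_def)
  note E = gauge_euclid[OF fin]
  have rc: "reindex J x \<in> coord_space J" for x by (simp add: reindex_def coord_space_def)
  have "continuous_on S (reindex J)" for S
  proof (rule continuous_on_coordinatewise_then_product)
    show "continuous_on S (\<lambda>x. reindex J x i)" for i
      by (cases "i \<in> J") (auto simp: reindex_def continuous_on_coord)
  qed
  then show "continuous_on (topspace (disc (card J))) (ball_param J N)"
    unfolding ball_param_def using rc
    by (intro continuous_on_compose2[OF continuous_on_rescale[OF E N]]) auto
  have inj: "inj_on (ball_param J N) (coord_space {..<card J})"
  proof (rule inj_onI)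
    fix x y assume xy: "x \<in> coord_space {..<card J}" "y \<in> coord_space {..<card J}" "ball_param J N x = ball_param J N y"
    then have "reindex J x = reindex J y" using rescale_gauge(2)[OF E N rc] by (metis ball_param_def)
    then show "x = y" using reindex_bij[OF fin] xy by (auto simp: bij_betw_def dest: inj_onD)
  qed
  then show "inj_on (ball_param J N) (topspace (disc (card J)))"
    by (rule inj_on_subset) (auto simp: disc_euclid)
  have val: "N (ball_param J N x) = euclid {..<card J} x" "ball_param J N x \<in> coord_space J" for x
    using rescale_gauge[OF E N rc] euclid_reindex[OF fin] by (simp_all add: ball_param_def)
  have img: "ball_param J N ` {x \<in> coord_space {..<card J}. P (euclid {..<card J} x)} = {x \<in> coord_space J. P (N x)}" for P
  proof (intro equalityI subsetI)
    fix y assume y: "y \<in> {x \<in> coord_space J. P (N x)}"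
    then have "rescale N (euclid J) y \<in> coord_space J" using rescale_gauge(3)[OF N E] by simp
    then obtain x where x: "x \<in> coord_space {..<card J}" "reindex J x = rescale N (euclid J) y"
      using reindex_bij[OF fin] by (metis (no_types, lifting) bij_betw_def imageE)
    then have yx: "ball_param J N x = y" using rescale_gauge(2)[OF N E] y by (simp add: ball_param_def)
    then have "P (euclid {..<card J} x)" using val(1)[of x] y by simp
    then show "y \<in> ball_param J N ` {x \<in> coord_space {..<card J}. P (euclid {..<card J} x)}" using x yx by blast
  qed (use val in auto)
  show "ball_param J N ` topspace (disc (card J)) = {x \<in> coord_space J. N x \<le> 1}"
    unfolding disc_euclid by (rule img)
  show "ball_param J N ` disc_interior (card J) = {x \<in> coord_space J. N x < 1}"
    unfolding disc_euclid by (rule img)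
  show "ball_param J N ` disc_boundary (card J) = {x \<in> coord_space J. N x = 1}"
    unfolding disc_euclid by (rule img)
qed

lemma compact_gauge_ball: "gauge J N \<Longrightarrow> compact {x \<in> coord_space J. N x \<le> 1}"
  using ball_param(3)[of J N] compact_continuous_image[OF ball_param(1) compact_disc] by metis

section \<open>Extending maps into compact sets\<close>

text \<open>The form of \<open>abs_ext\<close> for a subset of a Hausdorff type with its ambient
  topology; it is applied to the finite pieces of the complex.\<close>

definition ext_set :: "'c::t2_space set \<Rightarrow> bool" where
  "ext_set K \<longleftrightarrow> (\<forall>(C :: (nat \<Rightarrow> real) set) D f. compact C \<and> compact D \<and> C \<subseteq> D \<and> continuous_on C f \<and> f ` C \<subseteq> K \<longrightarrow>
     (\<exists>g. continuous_on D g \<and> g ` D \<subseteq> K \<and> (\<forall>x\<in>C. g x = f x)))"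

lemma ext_setE:
  fixes C D :: "(nat \<Rightarrow> real) set"
  assumes "ext_set K" "compact C" "compact D" "C \<subseteq> D" "continuous_on C f" "f ` C \<subseteq> K"
  obtains g where "continuous_on D g" "g ` D \<subseteq> K" "\<And>x. x \<in> C \<Longrightarrow> g x = f x"
  using assms(1)[unfolded ext_set_def, rule_format, of C D f] assms(2-) that by blast

lemma continuous_on_paste:
  assumes "closed S" "closed T" "continuous_on S f" "continuous_on T g" "\<And>x. x \<in> S \<Longrightarrow> x \<in> T \<Longrightarrow> f x = g x"
  shows "continuous_on (S \<union> T) (\<lambda>x. if x \<in> S then f x else g x)"
  using assms by (intro continuous_on_cases) auto

text \<open>The domain is divided like the target: \<open>D\<close> is cut into the points nearer to
  the preimage of \<open>A\<close> and those nearer to the preimage of \<open>B\<close>. The map is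
  extended over the common wall into \<open>A \<inter> B\<close>, and from there over both
  halves.\<close>

lemma ext_set_Un:
  fixes A B :: "'c::t2_space set"
  assumes cl: "closed A" "closed B" and A: "ext_set A" and B: "ext_set B" and AB: "ext_set (A \<inter> B)"
  shows "ext_set (A \<union> B)"
  unfolding ext_set_def
proof (intro allI impI, elim conjE)
  fix C D :: "(nat \<Rightarrow> real) set" and f :: "(nat \<Rightarrow> real) \<Rightarrow> 'c"
  assume C: "compact C" and D: "compact D" and CD: "C \<subseteq> D" and f: "continuous_on C f" "f ` C \<subseteq> A \<union> B"
  define CA where "CA = C \<inter> f -` A"
  define CB where "CB = C \<inter> f -` B"
  have cC: "closed C" "closed D" using C D by (auto intro: compact_imp_closed)
  have clC: "closed CA" "closed CB" using f cl cC by (auto simp: CA_def CB_def intro!: continuous_closed_preimage)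
  have cCA: "compact CA" "compact CB"
    using clC C by (metis CA_def CB_def compact_Int_closed inf.left_idem)+
  have un: "C = CA \<union> CB" using f by (auto simp: CA_def CB_def)
  show "\<exists>g. continuous_on D g \<and> g ` D \<subseteq> A \<union> B \<and> (\<forall>x\<in>C. g x = f x)"
  \<comment> \<open>The value of \<open>infdist\<close> to the empty set is 0 and separates nothing,
    so the case of an empty preimage is treated apart.\<close>
  proof (cases "CA = {} \<or> CB = {}")
    case True
    have "f ` CA \<subseteq> A" "f ` CB \<subseteq> B" by (auto simp: CA_def CB_def)
    then have "f ` C \<subseteq> A \<or> f ` C \<subseteq> B" using True un by auto
    then consider "f ` C \<subseteq> A" | "f ` C \<subseteq> B" by blast
    then show ?thesis
    proof cases
      case 1 then show ?thesis using ext_setE[OF A C D CD f(1)] by (metis le_supI1)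
    next
      case 2 then show ?thesis using ext_setE[OF B C D CD f(1)] by (metis le_supI2)
    qed
  next
    case False
    define ZA where "ZA = D \<inter> {x. infdist x CA \<le> infdist x CB}"
    define ZB where "ZB = D \<inter> {x. infdist x CB \<le> infdist x CA}"
    have cZ: "compact ZA" "compact ZB"
      unfolding ZA_def ZB_def using D
      by (auto intro!: compact_Int_closed closed_Collect_le continuous_on_infdist continuous_on_id)
    have z0: "infdist x CA = 0 \<longleftrightarrow> x \<in> CA" "infdist x CB = 0 \<longleftrightarrow> x \<in> CB" for x
      using in_closed_iff_infdist_zero clC False by metis+
    have le0: "infdist x CA \<le> infdist x CB \<longleftrightarrow> x \<in> CA" if "x \<in> CB" for x
      using z0 that infdist_nonneg[of x CA] by auto
    have le0': "infdist x CB \<le> infdist x CA \<longleftrightarrow> x \<in> CB" if "x \<in> CA" for x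
      using z0 that infdist_nonneg[of x CB] by auto
    have le1: "x \<in> CA \<Longrightarrow> infdist x CA \<le> infdist x CB" "x \<in> CB \<Longrightarrow> infdist x CB \<le> infdist x CA" for x
      using z0 infdist_nonneg[of x CA] infdist_nonneg[of x CB] by auto
    \<comment> \<open>The halves add no points of \<open>C\<close>: a point of \<open>CB\<close> has
      distance 0 from \<open>CB\<close>, hence lies in \<open>ZA\<close> only if it also belongs to
      \<open>CA\<close>.\<close>
    have cap: "C \<inter> ZA = CA" "C \<inter> ZB = CB"
      using CD le0 le0' le1 unfolding un ZA_def ZB_def by blast+
    have sub: "CA \<subseteq> ZA" "CB \<subseteq> ZB" using cap by auto
    have f': "continuous_on (CA \<inter> CB) f" "f ` (CA \<inter> CB) \<subseteq> A \<inter> B"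
      using f(1) by (auto simp: CA_def CB_def intro: continuous_on_subset)
    obtain g0 where g0: "continuous_on (ZA \<inter> ZB) g0" "g0 ` (ZA \<inter> ZB) \<subseteq> A \<inter> B" "\<And>x. x \<in> CA \<inter> CB \<Longrightarrow> g0 x = f x"
      using ext_setE[OF AB _ _ _ f', of "ZA \<inter> ZB"] cCA cZ clC sub
      by (metis compact_Int Int_mono)
    have step: "\<exists>g. continuous_on Z g \<and> g ` Z \<subseteq> E \<and> (\<forall>x\<in>CE. g x = f x) \<and> (\<forall>x\<in>ZA \<inter> ZB. g x = g0 x)"
      if E: "ext_set E" "A \<inter> B \<subseteq> E" and Z: "compact Z" "ZA \<inter> ZB \<subseteq> Z" and CE: "compact CE" "CE \<subseteq> Z" "CE \<subseteq> C" "f ` CE \<subseteq> E" 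
        "CE \<inter> (ZA \<inter> ZB) \<subseteq> CA \<inter> CB" for E Z CE
    proof -
      let ?k = "\<lambda>x. if x \<in> CE then f x else g0 x"
      have ov: "f x = g0 x" if "x \<in> CE" "x \<in> ZA \<inter> ZB" for x
        using g0(3)[of x] subsetD[OF CE(5), of x] that by auto
      have "continuous_on (CE \<union> ZA \<inter> ZB) ?k"
      proof (rule continuous_on_paste)
        show "closed CE" "closed (ZA \<inter> ZB)" using CE cZ by (auto intro: compact_imp_closed)
        show "continuous_on CE f" using f CE by (auto intro: continuous_on_subset)
      qed (use ov g0(1) in auto)
      moreover have "?k ` (CE \<union> ZA \<inter> ZB) \<subseteq> E"
      proof (rule image_subsetI)
        fix x assume "x \<in> CE \<union> ZA \<inter> ZB"
        then show "?k x \<in> E" using subsetD[OF CE(4), of "f x"] subsetD[OF g0(2), of "g0 x"] E(2) by auto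
      qed
      moreover have "compact (CE \<union> ZA \<inter> ZB)" using CE cZ by (simp add: compact_Int compact_Un)
      moreover have "CE \<union> ZA \<inter> ZB \<subseteq> Z" using CE Z by auto
      ultimately obtain g where "continuous_on Z g" "g ` Z \<subseteq> E" "\<And>x. x \<in> CE \<union> ZA \<inter> ZB \<Longrightarrow> g x = ?k x"
        using ext_setE[OF E(1) _ Z(1), of "CE \<union> ZA \<inter> ZB" ?k] by blast
      moreover have "?k x = g0 x" if "x \<in> ZA \<inter> ZB" for x using that ov by auto
      ultimately show ?thesis by (intro exI[of _ g]) auto
    qed
    have "f ` CA \<subseteq> A" "f ` CB \<subseteq> B" "CA \<subseteq> C" "CB \<subseteq> C" by (auto simp: CA_def CB_def)
    moreover have "CA \<inter> (ZA \<inter> ZB) \<subseteq> CA \<inter> CB" "CB \<inter> (ZA \<inter> ZB) \<subseteq> CA \<inter> CB" using cap un by auto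
    ultimately obtain gA gB
      where gA: "continuous_on ZA gA" "gA ` ZA \<subseteq> A" "\<And>x. x \<in> CA \<Longrightarrow> gA x = f x" "\<And>x. x \<in> ZA \<inter> ZB \<Longrightarrow> gA x = g0 x"
        and gB: "continuous_on ZB gB" "gB ` ZB \<subseteq> B" "\<And>x. x \<in> CB \<Longrightarrow> gB x = f x" "\<And>x. x \<in> ZA \<inter> ZB \<Longrightarrow> gB x = g0 x"
      using step[OF A _ cZ(1) _ cCA(1) sub(1)] step[OF B _ cZ(2) _ cCA(2) sub(2)] by (metis inf_le1 inf_le2)
    have "D = ZA \<union> ZB" by (auto simp: ZA_def ZB_def)
    then have "continuous_on D (\<lambda>x. if x \<in> ZA then gA x else gB x)"
      using gA gB cZ by (auto intro!: continuous_on_paste simp: compact_imp_closed)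
    moreover have "(if x \<in> ZA then gA x else gB x) = f x" if x: "x \<in> C" for x
    proof (cases "x \<in> ZA")
      case True
      then have "x \<in> CA" using cap x by auto
      then show ?thesis using gA(3) True by simp
    next
      case False
      then have "x \<in> CB" using x un sub by auto
      then show ?thesis using gB(3) False by simp
    qed
    moreover have "(\<lambda>x. if x \<in> ZA then gA x else gB x) ` D \<subseteq> A \<union> B"
      using \<open>D = ZA \<union> ZB\<close> gA(2) gB(2) by auto
    ultimately show ?thesis by blast
  qed
qed

lemma ext_set_homeo:
  fixes \<psi> :: "'c::t2_space \<Rightarrow> 'd::t2_space"
  assumes K: "compact K" "ext_set K" and \<psi>: "continuous_on K \<psi>" "inj_on \<psi> K"
  shows "ext_set (\<psi> ` K)"
  unfolding ext_set_def
proof (intro allI impI, elim conjE)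
  fix C D :: "(nat \<Rightarrow> real) set" and f
  assume C: "compact C" and D: "compact D" and CD: "C \<subseteq> D" and f: "continuous_on C f" "f ` C \<subseteq> \<psi> ` K"
  obtain i where i: "homeomorphism K (\<psi> ` K) \<psi> i"
    using homeomorphism_compact[OF K(1) \<psi>(1) refl \<psi>(2)] by blast
  have "continuous_on C (\<lambda>x. i (f x))"
    using i f by (intro continuous_on_compose2[OF _ f(1)]) (auto simp: homeomorphism_def)
  moreover have "(\<lambda>x. i (f x)) ` C \<subseteq> K" using i f by (fastforce simp: homeomorphism_def)
  ultimately obtain g where g: "continuous_on D g" "g ` D \<subseteq> K" "\<And>x. x \<in> C \<Longrightarrow> g x = i (f x)"
    using ext_setE[OF K(2) C D CD] by blast
  have "continuous_on D (\<lambda>x. \<psi> (g x))"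
    using g \<psi> by (intro continuous_on_compose2[OF \<psi>(1) g(1)]) auto
  moreover have "\<psi> (g x) = f x" if "x \<in> C" for x
    using g(3)[OF that] i f that by (auto simp: homeomorphism_def)
  ultimately show "\<exists>g. continuous_on D g \<and> g ` D \<subseteq> \<psi> ` K \<and> (\<forall>x\<in>C. g x = f x)"
    using g by (intro exI[of _ "\<lambda>x. \<psi> (g x)"]) auto
qed

lemma real_extension:
  fixes f :: "(nat \<Rightarrow> real) \<Rightarrow> real"
  assumes "compact C" "C \<subseteq> D" "continuous_on C f"
  obtains g where "continuous_on D g" "\<And>x. x \<in> C \<Longrightarrow> g x = f x"
proof -
  have "closedin (top_of_set D) C"
    using assms by (simp add: closed_subset compact_imp_closed)
  from Tietze_unbounded[OF assms(3) this] show thesis using that by blast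
qed

text \<open>The coordinates are extended one by one with Tietze's theorem; dividing by
  \<open>max 1 (N (k x))\<close> pushes the result radially into the ball.\<close>

lemma ext_set_gauge_ball:
  assumes N: "gauge J N" shows "ext_set {x \<in> coord_space J. N x \<le> 1}"
  unfolding ext_set_def
proof (intro allI impI, elim conjE)
  fix C D :: "(nat \<Rightarrow> real) set" and f
  assume C: "compact C" and D: "compact D" and CD: "C \<subseteq> D" and f: "continuous_on C f" "f ` C \<subseteq> {x \<in> coord_space J. N x \<le> 1}"
  have "\<exists>g. continuous_on D g \<and> (\<forall>x\<in>C. g x = f x i)" for i
    using real_extension[OF C CD continuous_on_product_then_coordinatewise[OF f(1), of i]] by metis
  then obtain g where g: "\<And>i. continuous_on D (g i)" "\<And>i x. x \<in> C \<Longrightarrow> g i x = f x i" by metis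
  define k where "k x = (\<lambda>i. if i \<in> J then g i x else 0)" for x
  have k: "continuous_on D k"
  proof (rule continuous_on_coordinatewise_then_product)
    show "continuous_on D (\<lambda>x. k x i)" for i by (cases "i \<in> J") (auto simp: k_def g)
  qed
  have kC: "k x \<in> coord_space J" for x by (simp add: k_def coord_space_def)
  define r where "r x = (\<lambda>i. 1 / max 1 (N (k x)) * k x i)" for x
  have "continuous_on D r"
  proof (rule continuous_on_coordinatewise_then_product)
    have "continuous_on D (\<lambda>x. max 1 (N (k x)))"
      by (intro continuous_on_max continuous_on_const continuous_on_gauge_compose[OF N k])
    then show "continuous_on D (\<lambda>x. r x i)" for i
      unfolding r_def using continuous_on_product_then_coordinatewise[OF k, of i]
      by (intro continuous_on_mult continuous_on_divide continuous_on_const) auto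
  qed
  moreover have "N (r x) \<le> 1" for x
    unfolding r_def by (subst gauge_scale[OF N]) auto
  moreover have "r x \<in> coord_space J" for x using kC by (auto simp: r_def coord_space_def)
  moreover have "r x = f x" if "x \<in> C" for x
  proof -
    have fx: "f x \<in> coord_space J" "N (f x) \<le> 1" using f that by auto
    then have "k x = f x" using g(2)[OF that] by (auto simp: k_def coord_space_def fun_eq_iff)
    then show ?thesis using fx by (simp add: r_def)
  qed
  ultimately show "\<exists>g. continuous_on D g \<and> g ` D \<subseteq> {x \<in> coord_space J. N x \<le> 1} \<and> (\<forall>x\<in>C. g x = f x)"
    by (intro exI[of _ r]) auto
qed

lemma ext_set_interval: "a \<le> b \<Longrightarrow> ext_set {a..b::real}"
  unfolding ext_set_def
proof (intro allI impI, elim conjE)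
  fix C D :: "(nat \<Rightarrow> real) set" and f :: "(nat \<Rightarrow> real) \<Rightarrow> real"
  assume ab: "a \<le> b" and C: "compact C" and D: "compact D" and CD: "C \<subseteq> D" and f: "continuous_on C f" "f ` C \<subseteq> {a..b}"
  obtain g where g: "continuous_on D g" "\<And>x. x \<in> C \<Longrightarrow> g x = f x"
    using real_extension[OF C CD f(1)] by blast
  show "\<exists>g. continuous_on D g \<and> g ` D \<subseteq> {a..b} \<and> (\<forall>x\<in>C. g x = f x)"
  proof (intro exI conjI ballI)
    show "continuous_on D (\<lambda>x. max a (min b (g x)))" by (intro continuous_intros g)
    show "(\<lambda>x. max a (min b (g x))) ` D \<subseteq> {a..b}" using ab by auto
    show "max a (min b (g x)) = f x" if "x \<in> C" for x using g(2)[OF that] f that by auto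
  qed
qed

lemma ext_set_singleton: "ext_set {y}"
  unfolding ext_set_def
proof (intro allI impI, elim conjE)
  fix C D :: "(nat \<Rightarrow> real) set" and f assume "f ` C \<subseteq> {y}"
  then show "\<exists>g. continuous_on D g \<and> g ` D \<subseteq> {y} \<and> (\<forall>x\<in>C. g x = f x)"
    by (intro exI[of _ "\<lambda>_. y"]) auto
qed

section \<open>The Cayley tree of the free group on two letters\<close>

section \<open>Reduced words in two letters\<close>

type_synonym w2 = "bool word"

abbreviation wmul :: "'s word \<Rightarrow> 's word \<Rightarrow> 's word" (infixl "\<cdot>" 70) where "u \<cdot> v \<equiv> foldr cons_reduce u v"

definition winv :: "'s word \<Rightarrow> 's word" where "winv u = rev (map inv_letter u)"

lemma reduced_mul [simp]: "freely_reduced v \<Longrightarrow> freely_reduced (u \<cdot> v)"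
  by (rule reduced_foldr)

lemma reduced_append_iff: "freely_reduced (u @ v) \<longleftrightarrow> freely_reduced u \<and> freely_reduced v \<and>
    (u \<noteq> [] \<longrightarrow> v \<noteq> [] \<longrightarrow> hd v \<noteq> inv_letter (last u))"
  by (auto simp: freely_reduced_def successively_append_iff)

lemma reduced_winv [simp]: "freely_reduced (winv u) \<longleftrightarrow> freely_reduced u"
proof -
  have "freely_reduced (winv u)" if "freely_reduced u" for u
    using that
  proof (induction u)
    case (Cons l u)
    then have "freely_reduced (winv u)" using reduced_ConsD[of l u] by auto
    moreover have "u \<noteq> [] \<longrightarrow> hd u \<noteq> inv_letter l" using Cons.prems
      by (cases u) (auto simp: freely_reduced_def)
    then have "u \<noteq> [] \<longrightarrow> l \<noteq> inv_letter (hd u)" by (metis inv_letter_inv_letter)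
    ultimately show ?case
      by (auto simp: winv_def reduced_append_iff last_rev hd_map last_map freely_reduced_def[of "[_]"])
         (metis inv_letter_inv_letter)
  qed (simp add: winv_def)
  moreover have "winv (winv u) = u" by (simp add: winv_def rev_map comp_def)
  ultimately show ?thesis by metis
qed

lemma mul_Nil [simp]: "freely_reduced u \<Longrightarrow> u \<cdot> [] = u"
  by (rule foldr_cons_reduce_Nil)

lemma mul_assoc: "freely_reduced w \<Longrightarrow> (u \<cdot> v) \<cdot> w = u \<cdot> (v \<cdot> w)"
  by (rule foldr_cons_reduce_assoc)

lemma winv_mul [simp]: "freely_reduced v \<Longrightarrow> winv u \<cdot> (u \<cdot> v) = v"
  unfolding winv_def by (rule foldr_cons_reduce_rev_inv)

lemma winv_winv [simp]: "winv (winv u) = u"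
  by (simp add: winv_def rev_map comp_def)

lemma mul_winv [simp]: "freely_reduced v \<Longrightarrow> u \<cdot> (winv u \<cdot> v) = v"
  using winv_mul[of v "winv u"] by simp

lemma winv_mul_self [simp]: "freely_reduced u \<Longrightarrow> winv u \<cdot> u = []"
  using winv_mul[of "[]" u] by simp

lemma mul_winv_self [simp]: "freely_reduced u \<Longrightarrow> u \<cdot> winv u = []"
  using mul_winv[of "[]" u] by simp

lemma mul_left_cancel: "freely_reduced v \<Longrightarrow> freely_reduced w \<Longrightarrow> u \<cdot> v = u \<cdot> w \<longleftrightarrow> v = w"
  by (metis winv_mul)

lemma reduced_single [simp]: "freely_reduced [l]"
  by (simp add: freely_reduced_def)

lemma mul_append: "freely_reduced (u @ v) \<Longrightarrow> u \<cdot> v = u @ v"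
proof (induction u)
  case (Cons l u)
  then have "u \<cdot> v = u @ v" using reduced_ConsD[of l "u @ v"] by auto
  then show ?case using Cons.prems cons_reduce_reduced[of l "u @ v"] by simp
qed simp

lemma mul_snoc: "freely_reduced u \<Longrightarrow> u \<cdot> [l] = (if u \<noteq> [] \<and> last u = inv_letter l then butlast u else u @ [l])"
proof (cases "u \<noteq> [] \<and> last u = inv_letter l")
  case True
  assume u: "freely_reduced u"
  have "u = butlast u @ [inv_letter l]" using True by (metis append_butlast_last_id)
  then have r: "freely_reduced (butlast u)" "freely_reduced (butlast u @ [inv_letter l])" using u by (metis reduced_append_iff)+
  have "u \<cdot> [l] = (butlast u \<cdot> [inv_letter l]) \<cdot> [l]"
    using mul_append[OF r(2)] True by (metis append_butlast_last_id)
  also have "\<dots> = butlast u" using r by (subst mul_assoc) auto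
  finally show ?thesis using True by simp
next
  case False
  assume u: "freely_reduced u"
  then have "freely_reduced (u @ [l])" using False
    by (auto simp: reduced_append_iff)
  then show ?thesis using False mul_append by auto
qed

subsection \<open>Height and the swap of the two letters\<close>

definition height :: "w2 \<Rightarrow> int" where
  "height w = (\<Sum>l\<leftarrow>w. if snd l then 1 else -1)"

lemma height_Nil [simp]: "height [] = 0" by (simp add: height_def)
lemma height_Cons: "height (l # w) = (if snd l then 1 else -1) + height w" by (simp add: height_def)
lemma height_append [simp]: "height (u @ v) = height u + height v" by (simp add: height_def)
lemma height_single [simp]: "height [(s, e)] = (if e then 1 else -1)" by (simp add: height_def)

lemma height_cons_reduce: "height (cons_reduce l w) = (if snd l then 1 else -1) + height w"
  by (cases w) (auto simp: height_def inv_letter_def)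

lemma height_mul [simp]: "height (u \<cdot> v) = height u + height v"
  by (induction u) (auto simp: height_cons_reduce height_Cons)

lemma height_winv [simp]: "height (winv u) = - height u"
  by (induction u) (auto simp: height_def winv_def inv_letter_def)

definition swap :: "w2 \<Rightarrow> w2" where "swap = map (\<lambda>l. (\<not> fst l, snd l))"

lemma swap_Nil [simp]: "swap [] = []" by (simp add: swap_def)
lemma swap_swap [simp]: "swap (swap w) = w" by (simp add: swap_def comp_def)
lemma swap_eq_iff [simp]: "swap u = swap v \<longleftrightarrow> u = v" by (metis swap_swap)
lemma swap_single [simp]: "swap [(s, e)] = [(\<not> s, e)]" by (simp add: swap_def)

lemma swap_cons_reduce: "swap (cons_reduce l w) = cons_reduce (\<not> fst l, snd l) (swap w)"
  by (cases w) (auto simp: swap_def inv_letter_def prod_eq_iff)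

lemma swap_Cons: "swap (l # w) = (\<not> fst l, snd l) # swap w"
  by (simp add: swap_def)

lemma swap_mul [simp]: "swap (u \<cdot> v) = swap u \<cdot> swap v"
  by (induction u) (simp_all add: swap_cons_reduce swap_Cons)

lemma height_swap [simp]: "height (swap w) = height w"
  by (simp add: height_def swap_def comp_def)

lemma reduced_swap [simp]: "freely_reduced (swap w) \<longleftrightarrow> freely_reduced w"
proof -
  have "freely_reduced (swap w)" if "freely_reduced w" for w
    using that by (induction w rule: induct_list012) (auto simp: freely_reduced_def swap_def inv_letter_def prod_eq_iff)
  then show ?thesis by (metis swap_swap)
qed

lemma swap_fixed: "swap w = w \<Longrightarrow> w = []"
  by (cases w) (auto simp: swap_def prod_eq_iff)

section \<open>The tree and its two-ended lines\<close>

text \<open>A point of the tree is the function of its barycentric coordinates at the vertices.\<close>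

definition vert :: "w2 \<Rightarrow> w2 \<Rightarrow> real" where
  "vert w = (\<lambda>u. if u = w then 1 else 0)"

definition edge_point :: "w2 \<Rightarrow> w2 \<Rightarrow> real \<Rightarrow> w2 \<Rightarrow> real" where
  "edge_point u v t = (\<lambda>x. (1 - t) * vert u x + t * vert v x)"

text \<open>An edge is always written from its lower end \<open>w\<close>, since appending a letter
  with sign \<open>True\<close> raises the height by 1.\<close>

definition tree :: "(w2 \<Rightarrow> real) set" where
  "tree = {edge_point w (w \<cdot> [(s, True)]) t | w s t. freely_reduced w \<and> 0 \<le> t \<and> t \<le> 1}"

text \<open>The vertices of a line through \<open>w\<close>. Negative \<open>j\<close> uses the
  letter \<open>True\<close> and positive \<open>j\<close> the letter \<open>False\<close>, both
  with sign \<open>e\<close>; as the letters differ, the line does not backtrack at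
  \<open>w\<close>.\<close>

definition step :: "w2 \<Rightarrow> bool \<Rightarrow> int \<Rightarrow> w2" where
  "step w e j = w \<cdot> replicate (nat \<bar>j\<bar>) (j < 0, e)"

text \<open>The line through \<open>w\<close> that leaves \<open>w\<close> along the powers of the two letters with the same
  exponent sign \<open>e\<close>; its height is monotone on both rays.\<close>

definition line :: "w2 \<Rightarrow> bool \<Rightarrow> real \<Rightarrow> w2 \<Rightarrow> real" where
  "line w e t = (\<lambda>u. if \<exists>j. u = step w e j then max 0 (1 - \<bar>t - real_of_int (THE j. u = step w e j)\<bar>) else 0)"

lemma reduced_replicate [simp]: "freely_reduced (replicate n (s, e))"
  by (induction n) (auto simp: freely_reduced_def successively_Cons inv_letter_def hd_replicate)

lemma reduced_step [simp]: "freely_reduced (step w e j)"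
  by (simp add: step_def)

lemma step_0 [simp]: "freely_reduced w \<Longrightarrow> step w e 0 = w"
  by (simp add: step_def)

lemma step_inject [simp]: "step w e i = step w e j \<longleftrightarrow> i = j"
proof
  assume "step w e i = step w e j"
  then have eq: "replicate (nat \<bar>i\<bar>) (i < 0, e) = replicate (nat \<bar>j\<bar>) (j < 0, e)"
    unfolding step_def by (simp only: mul_left_cancel reduced_replicate)
  then have "nat \<bar>i\<bar> = nat \<bar>j\<bar>" by (metis length_replicate)
  moreover have "i = 0 \<or> (i < 0) = (j < 0)" using eq by (cases "nat \<bar>i\<bar>"; cases "nat \<bar>j\<bar>") auto
  ultimately show "i = j" by auto
qed simp

lemma line_step: "line w e t (step w e j) = max 0 (1 - \<bar>t - real_of_int j\<bar>)"
  by (simp add: line_def)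

lemma line_off: "(\<And>j. u \<noteq> step w e j) \<Longrightarrow> line w e t u = 0"
  by (simp add: line_def)

lemma line_pos: "0 < line w e t u \<longleftrightarrow> (\<exists>j. u = step w e j \<and> \<bar>t - real_of_int j\<bar> < 1)"
  by (cases "\<exists>j. u = step w e j") (auto simp: line_step line_off)

lemma continuous_line: "continuous_on S (line w e)"
proof (rule continuous_on_coordinatewise_then_product)
  show "continuous_on S (\<lambda>t. line w e t u)" for u
    by (cases "\<exists>j. u = step w e j") (auto simp: line_step line_off intro!: continuous_intros)
qed

lemma line_inject: "line w e s = line w e t \<Longrightarrow> s = t"
proof -
  assume eq: "line w e s = line w e t"
  have *: "max 0 (1 - \<bar>s - real_of_int j\<bar>) = max 0 (1 - \<bar>t - real_of_int j\<bar>)" for j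
    using eq by (metis line_step)
  define k where "k = \<lfloor>s\<rfloor>"
  have k: "real_of_int k \<le> s" "s < real_of_int k + 1" by (auto simp: k_def)
  have 1: "1 - \<bar>s - k\<bar> = 1 - \<bar>t - k\<bar>" using *[of k] k by (auto simp: max_def split: if_splits)
  show "s = t"
  proof (cases "s = k")
    case True then show ?thesis using 1 by simp
  next
    case False
    then have "1 - \<bar>s - (k + 1)\<bar> = 1 - \<bar>t - (k + 1)\<bar>"
      using *[of "k + 1"] k by (auto simp: max_def split: if_splits)
    then show ?thesis using 1 k by (auto simp: abs_if split: if_splits)
  qed
qed

lemma line_edge:
  "line w e t = edge_point (step w e \<lfloor>t\<rfloor>) (step w e (\<lfloor>t\<rfloor> + 1)) (t - \<lfloor>t\<rfloor>)"
proof
  fix u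
  show "line w e t u = edge_point (step w e \<lfloor>t\<rfloor>) (step w e (\<lfloor>t\<rfloor> + 1)) (t - \<lfloor>t\<rfloor>) u"
  proof (cases "\<exists>j. u = step w e j")
    case True
    then obtain j where j: "u = step w e j" by blast
    have t: "real_of_int \<lfloor>t\<rfloor> \<le> t" "t < real_of_int \<lfloor>t\<rfloor> + 1" "t - real_of_int \<lfloor>t\<rfloor> \<le> 1" by linarith+
    consider "j < \<lfloor>t\<rfloor>" | "j = \<lfloor>t\<rfloor>" | "j = \<lfloor>t\<rfloor> + 1" | "j > \<lfloor>t\<rfloor> + 1" by linarith
    then show ?thesis
    proof cases
      case 1
      then have "real_of_int j + 1 \<le> real_of_int \<lfloor>t\<rfloor>" by linarith
      then have "1 - \<bar>t - real_of_int j\<bar> \<le> 0" using t by linarith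
      then show ?thesis using 1 by (simp add: j line_step edge_point_def vert_def)
    next
      case 4
      then have "real_of_int j \<ge> real_of_int \<lfloor>t\<rfloor> + 2" by linarith
      then have "1 - \<bar>t - real_of_int j\<bar> \<le> 0" using t by linarith
      then show ?thesis using 4 by (simp add: j line_step edge_point_def vert_def)
    qed (use t in \<open>auto simp: j line_step edge_point_def vert_def max_def\<close>)
  next
    case False
    then show ?thesis by (auto simp: line_off edge_point_def vert_def)
  qed
qed

lemma edge_point_commute: "edge_point u v t = edge_point v u (1 - t)"
  by (auto simp: edge_point_def)

lemma edge_in_tree:
  assumes "freely_reduced w" "0 \<le> t" "t \<le> 1"
  shows "edge_point w (w \<cdot> [(s, e)]) t \<in> tree"
proof (cases e)
  case True then show ?thesis using assms by (auto simp: tree_def)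
next
  case False
  define v where "v = w \<cdot> [(s, e)]"
  have v: "freely_reduced v" by (simp add: v_def)
  have "w = v \<cdot> [(s, True)]"
    unfolding v_def using assms False mul_assoc[of "[(s, True)]" w "[(s, e)]"] by (simp add: inv_letter_def)
  then have "edge_point w v t = edge_point v (v \<cdot> [(s, True)]) (1 - t)" by (metis edge_point_commute)
  then show ?thesis using v assms unfolding tree_def v_def by fastforce
qed

lemma step_succ: "0 \<le> j \<Longrightarrow> step w e (j + 1) = step w e j \<cdot> [(False, e)]"
proof -
  assume j: "0 \<le> j"
  have "replicate (nat (j + 1)) (False, e) = replicate (nat j) (False, e) @ [(False, e)]"
    using j by (metis Suc_nat_eq_nat_zadd1 add.commute replicate_append_same replicate_Suc)
  also have "\<dots> = replicate (nat j) (False, e) \<cdot> [(False, e)]"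
    by (rule mul_append[symmetric]) (metis reduced_replicate replicate_Suc replicate_append_same)
  finally show ?thesis using j by (simp add: step_def mul_assoc)
qed

lemma step_pred: "j \<le> 0 \<Longrightarrow> step w e (j - 1) = step w e j \<cdot> [(True, e)]"
proof -
  assume j: "j \<le> 0"
  have "replicate (nat (- (j - 1))) (True, e) = replicate (nat (- j)) (True, e) @ [(True, e)]"
    using j by (metis Suc_nat_eq_nat_zadd1 add.commute diff_add_cancel minus_diff_eq neg_0_le_iff_le replicate_append_same replicate_Suc uminus_add_conv_diff diff_minus_eq_add)
  also have "\<dots> = replicate (nat (- j)) (True, e) \<cdot> [(True, e)]"
    by (rule mul_append[symmetric]) (metis reduced_replicate replicate_Suc replicate_append_same)
  finally show ?thesis using j by (cases "j = 0") (simp_all add: step_def mul_assoc)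
qed

lemma line_in_tree: "line w e t \<in> tree"
proof (cases "0 \<le> \<lfloor>t\<rfloor>")
  case True
  have "0 \<le> t - \<lfloor>t\<rfloor>" "t - \<lfloor>t\<rfloor> \<le> 1" by linarith+
  then show ?thesis unfolding line_edge step_succ[OF True] by (intro edge_in_tree) auto
next
  case False
  then have "\<lfloor>t\<rfloor> + 1 \<le> 0" by linarith
  from step_pred[OF this, of w e] have "step w e \<lfloor>t\<rfloor> = step w e (\<lfloor>t\<rfloor> + 1) \<cdot> [(True, e)]" by simp
  moreover have "0 \<le> 1 - (t - \<lfloor>t\<rfloor>)" "1 - (t - \<lfloor>t\<rfloor>) \<le> 1" by linarith+
  ultimately show ?thesis
    unfolding line_edge edge_point_commute[of "step w e \<lfloor>t\<rfloor>"] by (metis edge_in_tree reduced_step)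
qed

lemma height_replicate [simp]: "height (replicate n (s, e)) = (if e then int n else - int n)"
  by (induction n) (auto simp: height_Cons)

lemma height_step: "height (step w e j) = height w + (if e then \<bar>j\<bar> else - \<bar>j\<bar>)"
  by (simp add: step_def)

subsection \<open>Carriers\<close>

definition verts :: "(w2 \<Rightarrow> real) \<Rightarrow> w2 set" where
  "verts x = {u. 0 < x u}"

lemma verts_edge: "u \<noteq> v \<Longrightarrow> 0 \<le> t \<Longrightarrow> t \<le> 1 \<Longrightarrow>
   verts (edge_point u v t) = (if t = 0 then {u} else if t = 1 then {v} else {u, v})"
  by (auto simp: verts_def edge_point_def vert_def)

lemma mul_single_neq: "freely_reduced (w :: w2) \<Longrightarrow> w \<cdot> [l] \<noteq> w"
proof
  assume "w \<cdot> [l] = w"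
  then have "height (w \<cdot> [l]) = height w" by simp
  then show False by (cases l) (simp split: if_splits)
qed

lemma mul_single_inject: "w \<cdot> [l] = w \<cdot> [m] \<longleftrightarrow> l = m"
  using mul_left_cancel[of "[l]" "[m]" w] by simp

lemma edge_point_0 [simp]: "edge_point u v 0 = vert u" and edge_point_1 [simp]: "edge_point u v 1 = vert v"
  by (auto simp: edge_point_def)

lemma tree_cases:
  assumes "x \<in> tree"
  obtains (vertex) w where "freely_reduced w" "x = vert w"
    | (edge) w s t where "freely_reduced w" "0 < t" "t < 1" "x = edge_point w (w \<cdot> [(s, True)]) t"
proof -
  obtain w s t where w: "freely_reduced w" "0 \<le> t" "t \<le> 1" "x = edge_point w (w \<cdot> [(s, True)]) t"
    using assms by (auto simp: tree_def)
  consider "t = 0" | "t = 1" | "0 < t" "t < 1" using w by linarith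
  then show thesis using w vertex[of w] vertex[of "w \<cdot> [(s, True)]"] edge by cases auto
qed

lemma verts_vert [simp]: "verts (vert w) = {w}"
  by (auto simp: verts_def vert_def)

lemma vert_inject [simp]: "vert u = vert v \<longleftrightarrow> u = v"
  by (metis verts_vert the_elem_eq)

lemma vert_in_tree: "freely_reduced w \<Longrightarrow> vert w \<in> tree"
  using edge_in_tree[of w 0 True True] by simp

lemma verts_edge': "freely_reduced w \<Longrightarrow> 0 < t \<Longrightarrow> t < 1 \<Longrightarrow> verts (edge_point w (w \<cdot> [l]) t) = {w, w \<cdot> [l]}"
  using verts_edge[of w "w \<cdot> [l]" t] mul_single_neq[of w l] by auto

lemma edge_unique:
  assumes "freely_reduced w" "freely_reduced v" "0 < t" "t < 1" "0 < r" "r < 1"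
    and eq: "edge_point w (w \<cdot> [(s, True)]) t = edge_point v (v \<cdot> [(s', True)]) r"
  shows "w = v" "s = s'" "t = r"
proof -
  have V: "{w, w \<cdot> [(s, True)]} = {v, v \<cdot> [(s', True)]}"
    using verts_edge' assms by metis
  have h: "height (w \<cdot> [(s, True)]) = height w + 1" "height (v \<cdot> [(s', True)]) = height v + 1" by simp_all
  show wv: "w = v"
  proof (rule ccontr)
    assume "w \<noteq> v"
    then have "w = v \<cdot> [(s', True)]" "v = w \<cdot> [(s, True)]" using V by (auto simp: doubleton_eq_iff)
    then show False using h by (metis add_cancel_left_right add.assoc one_add_one zero_neq_numeral)
  qed
  then show "s = s'" using V mul_single_neq[OF assms(1)] by (auto simp: doubleton_eq_iff mul_single_inject)
  have "edge_point w (w \<cdot> [(s, True)]) t w = edge_point v (v \<cdot> [(s', True)]) r w" using eq by simp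
  then show "t = r" using wv mul_single_neq[OF assms(1), of "(s, True)"] mul_single_neq[OF assms(1), of "(s', True)"]
    by (auto simp: edge_point_def vert_def split: if_splits)
qed

lemma verts_tree:
  assumes "x \<in> tree"
  shows "finite (verts x)" "verts x \<noteq> {}" "u \<in> verts x \<Longrightarrow> freely_reduced u"
  using assms by (cases rule: tree_cases; auto simp: verts_edge')+

lemma tree_neighbours:
  assumes "x \<in> tree" "u \<in> verts x" "v \<in> verts x"
  shows "u = v \<or> (\<exists>l. v = u \<cdot> [l])"
  using assms(1)
proof (cases rule: tree_cases)
  case (edge w s t)
  have "w = (w \<cdot> [(s, True)]) \<cdot> [(s, False)]"
    using edge(1) mul_assoc[of "[(s, False)]" w "[(s, True)]"] by (simp add: inv_letter_def)
  then show ?thesis using assms edge verts_edge' by auto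
qed (use assms in auto)

text \<open>The neighbours of \<open>w\<close> on the side \<open>e\<close> of its height are
  obtained by appending one of the two letters with sign \<open>e\<close>, and these are exactly the
  neighbours of \<open>w\<close> on \<open>line w e\<close>. So the part of the star of
  \<open>w\<close> on that side is contained in one line.\<close>

lemma tree_on_line:
  assumes x: "x \<in> tree" and w: "w \<in> verts x" and side: "\<And>u. u \<in> verts x \<Longrightarrow> u \<noteq> w \<Longrightarrow> height u = height w + (if e then 1 else -1)"
  obtains t where "\<bar>t\<bar> < 1" "x = line w e t"
  using x
proof (cases rule: tree_cases)
  case (vertex v)
  then have "v = w" using w by simp
  have "line w e 0 = vert w" using line_edge[of w e 0] vertex \<open>v = w\<close> by simp
  then show ?thesis using that[of 0] vertex \<open>v = w\<close> by simp
next
  case (edge v s t)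
  have V: "verts x = {v, v \<cdot> [(s, True)]}" using edge verts_edge' by simp
  have wr: "freely_reduced w" using verts_tree(3)[OF x w] .
  note found = that
  have key: thesis if u: "x = edge_point w (w \<cdot> [(s, e)]) r" "0 < r" "r < 1" for r
  proof (cases s)
    case False
    have "line w e r = edge_point (step w e 0) (step w e (0 + 1)) r"
      using line_edge[of w e r] u floor_unique[of 0 r] by simp
    also have "\<dots> = x" using step_succ[of 0 w e] u wr False by simp
    finally show ?thesis using found[of r] u by auto
  next
    case True
    have f: "\<lfloor>-r\<rfloor> = -1" using u by linarith
    have "line w e (-r) = edge_point (step w e (-1)) (step w e 0) (1 - r)"
      using line_edge[of w e "-r"] f by simp
    also have "\<dots> = x" using step_pred[of 0 w e] u wr True edge_point_commute[of w _ r] by simp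
    finally show ?thesis using found[of "-r"] u by auto
  qed
  show ?thesis
  proof (cases "w = v")
    case True
    have "height (v \<cdot> [(s, True)]) = height w + (if e then 1 else -1)"
      using side[of "v \<cdot> [(s, True)]"] V True mul_single_neq[OF wr] by auto
    then have e using True by (auto split: if_splits)
    then show ?thesis using key[of t] edge True by simp
  next
    case False
    then have wv: "w = v \<cdot> [(s, True)]" using w V by auto
    have "height v = height w + (if e then 1 else -1)" using side[of v] V False by auto
    then have "\<not> e" using wv by (auto split: if_splits)
    moreover have "v = w \<cdot> [(s, False)]"
      unfolding wv using edge(1) mul_assoc[of "[(s, False)]" v "[(s, True)]"] by (simp add: inv_letter_def)
    ultimately show ?thesis using key[of "1 - t"] edge wv edge_point_commute[of v w t] by simp
  qed
qed

lemma continuous_on_Max_image: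
  fixes f :: "'i \<Rightarrow> 'a::topological_space \<Rightarrow> real"
  assumes "finite A" "A \<noteq> {}" "\<And>a. a \<in> A \<Longrightarrow> continuous_on S (f a)"
  shows "continuous_on S (\<lambda>x. Max ((\<lambda>a. f a x) ` A))"
  using assms
proof (induction A rule: finite_ne_induct)
  case (insert a A)
  have "(\<lambda>x. Max ((\<lambda>a. f a x) ` insert a A)) = (\<lambda>x. max (f a x) (Max ((\<lambda>a. f a x) ` A)))"
    using insert by simp
  then show ?case using insert by (simp add: continuous_on_max)
qed simp

lemma continuous_on_Min_image:
  fixes f :: "'i \<Rightarrow> 'a::topological_space \<Rightarrow> real"
  assumes "finite A" "A \<noteq> {}" "\<And>a. a \<in> A \<Longrightarrow> continuous_on S (f a)"
  shows "continuous_on S (\<lambda>x. Min ((\<lambda>a. f a x) ` A))"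
  using assms
proof (induction A rule: finite_ne_induct)
  case (insert a A)
  have "(\<lambda>x. Min ((\<lambda>a. f a x) ` insert a A)) = (\<lambda>x. min (f a x) (Min ((\<lambda>a. f a x) ` A)))"
    using insert by simp
  then show ?case using insert by (simp add: continuous_on_min)
qed simp

definition sup_norm :: "nat set \<Rightarrow> (nat \<Rightarrow> real) \<Rightarrow> real" where
  "sup_norm J x = Max (insert 0 ((\<lambda>i. \<bar>x i\<bar>) ` J))"

lemma sup_norm_le: "finite J \<Longrightarrow> sup_norm J x \<le> c \<longleftrightarrow> 0 \<le> c \<and> (\<forall>i\<in>J. \<bar>x i\<bar> \<le> c)"
  unfolding sup_norm_def by (subst Max_le_iff) auto

lemma sup_norm_less: "finite J \<Longrightarrow> sup_norm J x < c \<longleftrightarrow> 0 < c \<and> (\<forall>i\<in>J. \<bar>x i\<bar> < c)"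
  unfolding sup_norm_def by (subst Max_less_iff) auto

lemma sup_norm_coord: "finite J \<Longrightarrow> i \<in> J \<Longrightarrow> \<bar>x i\<bar> \<le> sup_norm J x"
  using sup_norm_le[of J x "sup_norm J x"] by simp

lemma sup_norm_nonneg: "finite J \<Longrightarrow> 0 \<le> sup_norm J x"
  using sup_norm_le[of J x "sup_norm J x"] by simp

lemma gauge_sup_norm: "finite J \<Longrightarrow> gauge J (sup_norm J)"
  unfolding gauge_def
proof (intro conjI allI impI exI[of _ 1] ballI)
  assume J: "finite J"
  show "continuous_on UNIV (sup_norm J)"
  proof (cases "J = {}")
    case False
    have "sup_norm J = (\<lambda>x. max 0 (Max ((\<lambda>i. \<bar>x i\<bar>) ` J)))"
      using J False by (auto simp: sup_norm_def fun_eq_iff)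
    then show ?thesis
      using J False by (auto intro!: continuous_on_max continuous_on_Max_image continuous_on_rabs continuous_on_coord)
  qed (simp add: sup_norm_def)
  show "sup_norm J (\<lambda>i. c * x i) = c * sup_norm J x" if "0 \<le> c" for c x
  proof (cases "c = 0")
    case True
    then show ?thesis by (simp add: sup_norm_def image_constant_conv)
  next
    case False
    then have c: "c > 0" using that by simp
    show ?thesis
    proof (rule antisym)
      show "sup_norm J (\<lambda>i. c * x i) \<le> c * sup_norm J x"
        using J c sup_norm_nonneg[OF J] sup_norm_coord[OF J] by (auto simp: sup_norm_le abs_mult)
      have "\<bar>x i\<bar> \<le> sup_norm J (\<lambda>i. c * x i) / c" if "i \<in> J" for i
        using sup_norm_coord[OF J that, of "\<lambda>i. c * x i"] c by (simp add: abs_mult field_simps)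
      then have "sup_norm J x \<le> sup_norm J (\<lambda>i. c * x i) / c"
        using J c sup_norm_nonneg[OF J] by (auto simp: sup_norm_le)
      then show "c * sup_norm J x \<le> sup_norm J (\<lambda>i. c * x i)" using c by (simp add: field_simps)
    qed
  qed
qed (auto simp: sup_norm_nonneg sup_norm_coord)

text \<open>The argument for \<open>rescale\<close> with an arbitrary new radius \<open>h\<close>:
  where \<open>z\<close> vanishes, the coordinates are controlled by \<open>B * h s\<close>, which
  tends to 0.\<close>

lemma continuous_on_radial:
  fixes z :: "'s::t2_space \<Rightarrow> nat \<Rightarrow> real"
  assumes N: "gauge J N" and z: "continuous_on S z" "z ` S \<subseteq> coord_space J"
    and h: "continuous_on S h" "\<And>s. s \<in> S \<Longrightarrow> 0 \<le> h s" "\<And>s. s \<in> S \<Longrightarrow> z s = (\<lambda>i. 0) \<Longrightarrow> h s = 0"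
  shows "continuous_on S (\<lambda>s i. h s / N (z s) * z s i)"
proof (rule continuous_on_coordinatewise_then_product)
  fix i
  obtain B where B: "B \<ge> 0" "\<And>x i. i \<in> J \<Longrightarrow> \<bar>x i\<bar> \<le> B * N x" using N by (auto simp: gauge_def)
  have zJ: "z s \<in> coord_space J" if "s \<in> S" for s using z that by auto
  have bound: "\<bar>h s / N (z s) * z s i\<bar> \<le> B * h s" if s: "s \<in> S" for s
  proof (cases "z s = (\<lambda>i. 0)")
    case True then show ?thesis using h B s by simp
  next
    case False
    then have N0: "0 < N (z s)" using gauge_pos[OF N zJ[OF s]] by simp
    have "\<bar>z s i\<bar> \<le> B * N (z s)"
      using B zJ[OF s] N0 by (cases "i \<in> J") (auto simp: coord_space_def)
    then have "h s / N (z s) * \<bar>z s i\<bar> \<le> h s / N (z s) * (B * N (z s))"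
      using N0 h(2)[OF s] by (intro mult_left_mono) auto
    then show ?thesis using N0 h(2)[OF s] by (simp add: abs_mult mult.commute)
  qed
  have Nz: "continuous_on S (\<lambda>s. N (z s))" by (rule continuous_on_gauge_compose[OF N z(1)])
  have zi: "continuous_on S (\<lambda>s. z s i)" by (rule continuous_on_product_then_coordinatewise[OF z(1)])
  show "continuous_on S (\<lambda>s. h s / N (z s) * z s i)"
    unfolding continuous_on_eq_continuous_within
  proof
    fix s assume s: "s \<in> S"
    have cN: "continuous (at s within S) (\<lambda>s. N (z s))" and cz: "continuous (at s within S) (\<lambda>s. z s i)"
      and ch: "continuous (at s within S) h"
      using Nz zi h(1) s unfolding continuous_on_eq_continuous_within by auto
    show "continuous (at s within S) (\<lambda>s. h s / N (z s) * z s i)"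
    proof (cases "z s = (\<lambda>i. 0)")
      case True
      have "continuous (at s within S) (\<lambda>s. B * h s)" using ch by (intro continuous_intros)
      then have "((\<lambda>s. B * h s) \<longlongrightarrow> 0) (at s within S)"
        using h(3)[OF s True] by (simp add: continuous_within)
      moreover have "\<forall>\<^sub>F s in at s within S. norm (h s / N (z s) * z s i) \<le> B * h s"
        using bound by (simp add: eventually_at_filter)
      ultimately have "((\<lambda>s. h s / N (z s) * z s i) \<longlongrightarrow> 0) (at s within S)"
        by (rule Lim_null_comparison[rotated])
      then show ?thesis using True by (simp add: continuous_within)
    next
      case False
      then have "N (z s) \<noteq> 0" using gauge_pos[OF N zJ[OF s]] by simp
      then show ?thesis using cN cz ch by (intro continuous_intros)
    qed
  qed
qed

section \<open>Contractibility of the slab with its domes\<close>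

section \<open>Levels in the product of trees\<close>

locale tree_power =
  fixes m :: nat
  assumes m_pos: "0 < m"
begin

definition tuples :: "(nat \<Rightarrow> w2) set" where
  "tuples = {v. (\<forall>i<m. freely_reduced (v i)) \<and> (\<forall>i\<ge>m. v i = [])}"

definition ht :: "(nat \<Rightarrow> w2) \<Rightarrow> int" where "ht v = (\<Sum>i<m. height (v i))"

text \<open>The distance of a height from the slab \<open>{0..m - 1}\<close>.\<close>

definition level_of :: "int \<Rightarrow> nat" where "level_of h = nat (max (h - (int m - 1)) (- h))"
definition level :: "(nat \<Rightarrow> w2) \<Rightarrow> nat" where "level v = level_of (ht v)"
definition below :: "(nat \<Rightarrow> w2) \<Rightarrow> bool" where "below v \<longleftrightarrow> ht v < 0"

definition partitions :: "nat \<Rightarrow> (nat \<Rightarrow> nat) set" where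
  "partitions n = {u. (\<Sum>i<m. u i) = n - 1 \<and> (\<forall>i\<ge>m. u i = 0)}"

text \<open>The unit ball of \<open>stair n\<close> is the union of the boxes with half-side lengths \<open>u i + 1\<close>; it is a
  union of unit cubes whose boundary cubes lie in the slab when placed on a flat of level \<open>n\<close>.\<close>

definition stair :: "nat \<Rightarrow> (nat \<Rightarrow> real) \<Rightarrow> real" where
  "stair n z = Min ((\<lambda>u. Max ((\<lambda>i. \<bar>z i\<bar> / (real (u i) + 1)) ` {..<m})) ` partitions n)"

abbreviation K :: "(nat \<Rightarrow> real) \<Rightarrow> real" where "K \<equiv> sup_norm {..<m}"

lemma m_ne: "{..<m} \<noteq> {}" using m_pos by auto

lemma finite_partitions: "finite (partitions n)"
proof -
  have "partitions n \<subseteq> (\<lambda>f i. if i < m then f i else 0) ` PiE {..<m} (\<lambda>_. {..n})"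
  proof
    fix u assume u: "u \<in> partitions n"
    have "u i \<le> n" if "i < m" for i
    proof -
      have "u i \<le> (\<Sum>i<m. u i)" using that by (intro member_le_sum) auto
      then show ?thesis using u by (simp add: partitions_def)
    qed
    then have "restrict u {..<m} \<in> PiE {..<m} (\<lambda>_. {..n})" by auto
    moreover have "u = (\<lambda>i. if i < m then restrict u {..<m} i else 0)" using u by (auto simp: partitions_def fun_eq_iff)
    ultimately show "u \<in> (\<lambda>f i. if i < m then f i else 0) ` PiE {..<m} (\<lambda>_. {..n})" by blast
  qed
  then show ?thesis by (rule finite_subset) (auto intro!: finite_PiE)
qed

lemma partitions_nonempty: "partitions n \<noteq> {}"
proof -
  have "(\<lambda>i. if i = 0 then n - 1 else 0) \<in> partitions n"
    using m_pos by (auto simp: partitions_def)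
  then show ?thesis by blast
qed

lemma stair_le: "stair n z \<le> c \<longleftrightarrow> (\<exists>u\<in>partitions n. \<forall>i<m. \<bar>z i\<bar> \<le> c * (real (u i) + 1))"
proof -
  have "stair n z \<le> c \<longleftrightarrow> (\<exists>u\<in>partitions n. Max ((\<lambda>i. \<bar>z i\<bar> / (real (u i) + 1)) ` {..<m}) \<le> c)"
    unfolding stair_def using finite_partitions partitions_nonempty by (subst Min_le_iff) auto
  also have "\<dots> \<longleftrightarrow> (\<exists>u\<in>partitions n. \<forall>i<m. \<bar>z i\<bar> / (real (u i) + 1) \<le> c)"
    using m_ne by (subst Max_le_iff) auto
  finally show ?thesis by (simp add: divide_le_eq)
qed

lemma stair_less: "stair n z < c \<longleftrightarrow> (\<exists>u\<in>partitions n. \<forall>i<m. \<bar>z i\<bar> < c * (real (u i) + 1))"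
proof -
  have "stair n z < c \<longleftrightarrow> (\<exists>u\<in>partitions n. Max ((\<lambda>i. \<bar>z i\<bar> / (real (u i) + 1)) ` {..<m}) < c)"
    unfolding stair_def using finite_partitions partitions_nonempty by (subst Min_less_iff) auto
  also have "\<dots> \<longleftrightarrow> (\<exists>u\<in>partitions n. \<forall>i<m. \<bar>z i\<bar> / (real (u i) + 1) < c)"
    using m_ne by (subst Max_less_iff) auto
  finally show ?thesis by (simp add: divide_less_eq)
qed

lemma partition_le: "u \<in> partitions n \<Longrightarrow> u i \<le> n - 1"
proof (cases "i < m")
  case True
  assume "u \<in> partitions n"
  moreover have "u i \<le> (\<Sum>i<m. u i)" using True by (intro member_le_sum) auto
  ultimately show ?thesis by (simp add: partitions_def)
qed (simp add: partitions_def)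

lemma stair_nonneg: "0 \<le> stair n z"
proof (rule ccontr)
  assume "\<not> 0 \<le> stair n z"
  then obtain u where "\<forall>i<m. \<bar>z i\<bar> < 0 * (real (u i) + 1)" using stair_less[of n z 0] by auto
  then show False using m_pos by (metis abs_not_less_zero mult_zero_left)
qed

lemma stair_coord:
  assumes "i < m" shows "\<bar>z i\<bar> \<le> (real n + 1) * stair n z"
proof -
  obtain u where u: "u \<in> partitions n" "\<bar>z i\<bar> \<le> stair n z * (real (u i) + 1)"
    using stair_le[of n z "stair n z"] assms by auto
  moreover have "stair n z * (real (u i) + 1) \<le> stair n z * (real n + 1)"
    using partition_le[OF u(1), of i] stair_nonneg by (intro mult_left_mono) auto
  ultimately show ?thesis by (simp add: mult.commute)
qed

text \<open>Every box has half-sides at least 1, so the unit cube around the centre is contained in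
  the unit ball. The interior of this cube will be the free face.\<close>

lemma stair_le_K: "stair n z \<le> K z"
proof -
  obtain u where "u \<in> partitions n" using partitions_nonempty by blast
  moreover have "\<bar>z i\<bar> \<le> K z * (real (u i) + 1)" if "i < m" for i
  proof -
    have "\<bar>z i\<bar> \<le> K z" using sup_norm_coord[of "{..<m}" i z] that by simp
    also have "\<dots> \<le> K z * (real (u i) + 1)" using sup_norm_nonneg[of "{..<m}" z] by (simp add: mult_le_cancel_left1)
    finally show ?thesis .
  qed
  ultimately show ?thesis using stair_le by blast
qed

lemma gauge_stair: "gauge {..<m} (stair n)"
  unfolding gauge_def
proof (intro conjI allI impI exI[of _ "real n + 1"] ballI)
  show "continuous_on UNIV (stair n)"
    unfolding stair_def
    by (intro continuous_on_Min_image continuous_on_Max_image finite_partitions partitions_nonempty m_ne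
        continuous_on_divide continuous_on_rabs continuous_on_coord continuous_on_const) auto
  show "stair n (\<lambda>i. c * z i) = c * stair n z" if c: "0 \<le> c" for c z
  proof (cases "c = 0")
    case True
    have "stair n (\<lambda>i. 0) \<le> 0" using partitions_nonempty by (auto simp: stair_le)
    then show ?thesis using True stair_nonneg[of n "\<lambda>i. 0"] by simp
  next
    case False
    then have c: "c > 0" using that by simp
    have "stair n (\<lambda>i. c * z i) \<le> d \<longleftrightarrow> stair n z \<le> d / c" for d
      using c by (auto simp: stair_le abs_mult field_simps)
    then have "stair n (\<lambda>i. c * z i) \<le> d \<longleftrightarrow> c * stair n z \<le> d" for d
      using c by (simp add: field_simps)
    then show ?thesis by (metis order_antisym order_refl)
  qed
qed (auto simp: stair_nonneg stair_coord)

text \<open>In the box of \<open>u\<close> each coordinate rounded up is at most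
  \<open>u i + 1\<close>, and the \<open>u i\<close> add up to \<open>n - 1\<close>. The bound is
  the number of steps from level \<open>n\<close> to the far side of the slab.\<close>

lemma stair_le_1: "1 \<le> n \<Longrightarrow> stair n z \<le> 1 \<Longrightarrow> (\<Sum>i<m. \<lceil>\<bar>z i\<bar>\<rceil>) \<le> int n - 1 + int m"
proof -
  assume n: "1 \<le> n" and "stair n z \<le> 1"
  then obtain u where u: "u \<in> partitions n" "\<And>i. i < m \<Longrightarrow> \<bar>z i\<bar> \<le> real (u i) + 1" using stair_le[of n z 1] by auto
  have "(\<Sum>i<m. \<lceil>\<bar>z i\<bar>\<rceil>) \<le> (\<Sum>i<m. int (u i) + 1)"
    using u(2) by (intro sum_mono) (simp add: ceiling_le_iff)
  also have "\<dots> = int (\<Sum>i<m. u i) + int m" by (simp add: sum.distrib)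
  also have "\<dots> = int n - 1 + int m" using u(1) n by (simp add: partitions_def of_nat_diff)
  finally show ?thesis .
qed

text \<open>If the integer parts had a sum below \<open>n\<close>, they could be completed to a
  member \<open>u\<close> of \<open>partitions n\<close>, and \<open>z\<close> would lie in the
  interior of the box of \<open>u\<close>.\<close>

lemma stair_ge_1:
  assumes n: "1 \<le> n" and z: "1 \<le> stair n z" shows "int n \<le> (\<Sum>i<m. \<lfloor>\<bar>z i\<bar>\<rfloor>)"
proof (rule ccontr)
  assume neg: "\<not> int n \<le> (\<Sum>i<m. \<lfloor>\<bar>z i\<bar>\<rfloor>)"
  define f where "f i = nat \<lfloor>\<bar>z i\<bar>\<rfloor>" for i
  have f: "int (f i) = \<lfloor>\<bar>z i\<bar>\<rfloor>" for i by (simp add: f_def)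
  have "int (\<Sum>i<m. f i) = (\<Sum>i<m. \<lfloor>\<bar>z i\<bar>\<rfloor>)" by (simp add: f)
  then have le: "(\<Sum>i<m. f i) \<le> n - 1" using neg by linarith
  \<comment> \<open>The amount missing from the sum \<open>n - 1\<close> is put into the coordinate
    0.\<close>
  define u where "u i = (if i < m then f i + (if i = 0 then n - 1 - (\<Sum>i<m. f i) else 0) else 0)" for i
  have "(\<Sum>i<m. u i) = (\<Sum>i<m. f i) + (\<Sum>i<m. if i = 0 then n - 1 - (\<Sum>i<m. f i) else 0)"
    unfolding sum.distrib[symmetric] by (intro sum.cong) (auto simp: u_def)
  also have "(\<Sum>i<m. if i = 0 then n - 1 - (\<Sum>i<m. f i) else 0) = n - 1 - (\<Sum>i<m. f i)"
    using m_pos by (simp add: sum.delta)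
  finally have "u \<in> partitions n" using le by (simp add: partitions_def u_def)
  moreover have "\<bar>z i\<bar> < 1 * (real (u i) + 1)" if "i < m" for i
  proof -
    have "\<bar>z i\<bar> < real_of_int \<lfloor>\<bar>z i\<bar>\<rfloor> + 1" by linarith
    also have "real_of_int \<lfloor>\<bar>z i\<bar>\<rfloor> = real (f i)" using f[of i] by (metis of_int_of_nat_eq)
    also have "real (f i) \<le> real (u i)" using that by (simp add: u_def)
    finally show ?thesis by simp
  qed
  ultimately have "stair n z < 1" unfolding stair_less by blast
  then show False using z by simp
qed

subsection \<open>Flats\<close>

text \<open>The sign \<open>below v\<close> makes the lines rise from a vertex under the slab and
  descend from one above it, so the height runs towards the slab on the flat of an outer
  vertex.\<close>

definition flat :: "(nat \<Rightarrow> w2) \<Rightarrow> (nat \<Rightarrow> real) \<Rightarrow> nat \<Rightarrow> w2 \<Rightarrow> real" where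
  "flat v z = (\<lambda>i. if i < m then line (v i) (below v) (z i) else (\<lambda>_. 0))"

definition flat_vertex :: "(nat \<Rightarrow> w2) \<Rightarrow> (nat \<Rightarrow> int) \<Rightarrow> nat \<Rightarrow> w2" where
  "flat_vertex v j = (\<lambda>i. if i < m then step (v i) (below v) (j i) else [])"

definition tree_pow :: "(nat \<Rightarrow> w2 \<Rightarrow> real) set" where
  "tree_pow = {x. (\<forall>i<m. x i \<in> tree) \<and> (\<forall>i\<ge>m. x i = (\<lambda>_. 0))}"

text \<open>For a point of \<open>tree_pow\<close> these are the vertices of the smallest cube that
  contains it, because \<open>verts\<close> collects the vertices with positive barycentric
  coordinate.\<close>

definition carrier_verts :: "(nat \<Rightarrow> w2 \<Rightarrow> real) \<Rightarrow> (nat \<Rightarrow> w2) set" where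
  "carrier_verts x = {u \<in> tuples. \<forall>i<m. u i \<in> verts (x i)}"

definition level_le :: "nat \<Rightarrow> (nat \<Rightarrow> w2 \<Rightarrow> real) \<Rightarrow> bool" where
  "level_le j x \<longleftrightarrow> (\<forall>u\<in>carrier_verts x. level u \<le> j)"

lemma flat_in: "flat v z \<in> tree_pow"
  by (simp add: flat_def tree_pow_def line_in_tree)

lemma continuous_flat: "continuous_on S (flat v)"
proof (rule continuous_on_coordinatewise_then_product)
  show "continuous_on S (\<lambda>z. flat v z i)" for i
  proof (cases "i < m")
    case True
    have "continuous_on S (\<lambda>z. line (v i) (below v) (z i))"
      by (rule continuous_on_compose2[OF continuous_line continuous_on_coord]) auto
    then show ?thesis using True by (simp add: flat_def)
  qed (simp add: flat_def)
qed

lemma flat_inject: "z \<in> coord_space {..<m} \<Longrightarrow> z' \<in> coord_space {..<m} \<Longrightarrow> flat v z = flat v z' \<Longrightarrow> z = z'"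
proof
  fix i assume z: "z \<in> coord_space {..<m}" "z' \<in> coord_space {..<m}" and eq: "flat v z = flat v z'"
  show "z i = z' i"
  proof (cases "i < m")
    case True
    have "line (v i) (below v) (z i) = line (v i) (below v) (z' i)"
      using fun_cong[OF eq, of i] True by (simp add: flat_def)
    then show ?thesis by (rule line_inject)
  qed (use z in \<open>auto simp: coord_space_def\<close>)
qed

lemma flat_vertex_in: "flat_vertex v j \<in> tuples"
  by (simp add: flat_vertex_def tuples_def)

lemma carrier_flat: "u \<in> carrier_verts (flat v z) \<longleftrightarrow> (\<exists>j. u = flat_vertex v j \<and> (\<forall>i<m. \<bar>z i - real_of_int (j i)\<bar> < 1))"
proof
  assume u: "u \<in> carrier_verts (flat v z)"
  then have "\<forall>i. \<exists>k. i < m \<longrightarrow> u i = step (v i) (below v) k \<and> \<bar>z i - real_of_int k\<bar> < 1"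
    by (auto simp: carrier_verts_def flat_def verts_def line_pos)
  then obtain j where "\<forall>i. i < m \<longrightarrow> u i = step (v i) (below v) (j i) \<and> \<bar>z i - real_of_int (j i)\<bar> < 1"
    using choice by metis
  moreover have "u i = []" if "\<not> i < m" for i using u that by (simp add: carrier_verts_def tuples_def)
  ultimately show "\<exists>j. u = flat_vertex v j \<and> (\<forall>i<m. \<bar>z i - real_of_int (j i)\<bar> < 1)"
    by (intro exI[of _ j]) (auto simp: flat_vertex_def fun_eq_iff)
next
  assume "\<exists>j. u = flat_vertex v j \<and> (\<forall>i<m. \<bar>z i - real_of_int (j i)\<bar> < 1)"
  then show "u \<in> carrier_verts (flat v z)"
    using flat_vertex_in by (auto simp: carrier_verts_def flat_def flat_vertex_def verts_def line_pos)
qed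

lemma ht_flat_vertex: "ht (flat_vertex v j) = ht v + (if below v then (\<Sum>i<m. \<bar>j i\<bar>) else - (\<Sum>i<m. \<bar>j i\<bar>))"
proof -
  have "ht (flat_vertex v j) = (\<Sum>i<m. height (v i) + (if below v then \<bar>j i\<bar> else - \<bar>j i\<bar>))"
    unfolding ht_def by (intro sum.cong) (auto simp: flat_vertex_def height_step)
  then show ?thesis by (simp add: ht_def sum.distrib sum_negf)
qed

text \<open>Away from \<open>v\<close> the level falls by one with each step until it is 0. The
  bound on the number of steps says that the far side of the slab is not passed; beyond it the level
  would rise again.\<close>

lemma level_flat_vertex:
  assumes "1 \<le> level v" "(\<Sum>i<m. \<bar>j i\<bar>) \<le> int (level v) - 1 + int m"
  shows "level (flat_vertex v j) = nat (int (level v) - (\<Sum>i<m. \<bar>j i\<bar>))"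
  using assms m_pos unfolding level_def ht_flat_vertex below_def level_of_def by (auto split: if_splits)

lemma abs_int_bounds:
  assumes "\<bar>z - real_of_int j\<bar> < 1" shows "\<bar>j\<bar> \<le> \<lceil>\<bar>z\<bar>\<rceil>" "\<lfloor>\<bar>z\<bar>\<rfloor> \<le> \<bar>j\<bar>"
proof -
  have a: "\<bar>real_of_int j\<bar> = real_of_int \<bar>j\<bar>" by simp
  have "\<bar>z\<bar> < real_of_int \<bar>j\<bar> + 1" "real_of_int \<bar>j\<bar> < \<bar>z\<bar> + 1" using assms a by linarith+
  then show "\<bar>j\<bar> \<le> \<lceil>\<bar>z\<bar>\<rceil>" "\<lfloor>\<bar>z\<bar>\<rfloor> \<le> \<bar>j\<bar>" by linarith+
qed

lemma flat_ball_carrier: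
  assumes v: "1 \<le> level v" and z: "stair (level v) z \<le> 1" and u: "u \<in> carrier_verts (flat v z)"
  obtains j where "u = flat_vertex v j" "\<And>i. i < m \<Longrightarrow> \<bar>z i - real_of_int (j i)\<bar> < 1"
    "(\<Sum>i<m. \<lfloor>\<bar>z i\<bar>\<rfloor>) \<le> (\<Sum>i<m. \<bar>j i\<bar>)" "(\<Sum>i<m. \<bar>j i\<bar>) \<le> int (level v) - 1 + int m"
    "level u = nat (int (level v) - (\<Sum>i<m. \<bar>j i\<bar>))"
proof -
  obtain j where j: "u = flat_vertex v j" "\<And>i. i < m \<Longrightarrow> \<bar>z i - real_of_int (j i)\<bar> < 1"
    using u carrier_flat by blast
  have 1: "(\<Sum>i<m. \<lfloor>\<bar>z i\<bar>\<rfloor>) \<le> (\<Sum>i<m. \<bar>j i\<bar>)" using j abs_int_bounds by (intro sum_mono) auto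
  have "(\<Sum>i<m. \<bar>j i\<bar>) \<le> (\<Sum>i<m. \<lceil>\<bar>z i\<bar>\<rceil>)" using j abs_int_bounds by (intro sum_mono) auto
  then have 2: "(\<Sum>i<m. \<bar>j i\<bar>) \<le> int (level v) - 1 + int m" using stair_le_1[OF v z] by linarith
  show thesis using that[OF j 1 2] level_flat_vertex[OF v 2] j(1) by simp
qed

lemma flat_vertex_0: "v \<in> tuples \<Longrightarrow> (\<And>i. i < m \<Longrightarrow> j i = 0) \<Longrightarrow> flat_vertex v j = v"
  by (auto simp: flat_vertex_def tuples_def fun_eq_iff)

text \<open>The facts behind the removal of lenses: \<open>v\<close> is the only vertex of top level
  in its ball, the boundary of the ball lies in the slab, and \<open>v\<close> disappears outside
  the open unit cube. All follow from the level being \<open>level v\<close> minus the number of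
  steps from \<open>v\<close>, cut off at 0.\<close>

lemma flat_ball_level:
  assumes v: "v \<in> tuples" "1 \<le> level v" and z: "stair (level v) z \<le> 1" and u: "u \<in> carrier_verts (flat v z)"
  shows "level u \<le> level v" "level u = level v \<Longrightarrow> u = v" "1 \<le> stair (level v) z \<Longrightarrow> level u = 0"
    "1 \<le> K z \<Longrightarrow> level u < level v"
proof -
  obtain j where j: "u = flat_vertex v j" "(\<Sum>i<m. \<lfloor>\<bar>z i\<bar>\<rfloor>) \<le> (\<Sum>i<m. \<bar>j i\<bar>)"
    and lev: "level u = nat (int (level v) - (\<Sum>i<m. \<bar>j i\<bar>))"
    using flat_ball_carrier[OF v(2) z u] by metis
  have nn: "0 \<le> (\<Sum>i<m. \<bar>j i\<bar>)" by (simp add: sum_nonneg)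
  then show "level u \<le> level v" using lev by linarith
  show "u = v" if "level u = level v"
  proof -
    have "(\<Sum>i<m. \<bar>j i\<bar>) = 0" using lev that v nn by linarith
    then have "j i = 0" if "i < m" for i using that by (subst (asm) sum_nonneg_eq_0_iff) auto
    then show ?thesis using flat_vertex_0[OF v(1)] j by simp
  qed
  show "level u = 0" if "1 \<le> stair (level v) z" using stair_ge_1[OF v(2) that] j lev by linarith
  show "level u < level v" if "1 \<le> K z"
  proof -
    have "\<exists>i<m. 1 \<le> \<bar>z i\<bar>" using that sup_norm_less[of "{..<m}" z 1] by force
    then obtain i where i: "i < m" "1 \<le> \<lfloor>\<bar>z i\<bar>\<rfloor>" by (metis le_floor_iff of_int_1)
    have "\<lfloor>\<bar>z i\<bar>\<rfloor> \<le> (\<Sum>i<m. \<lfloor>\<bar>z i\<bar>\<rfloor>)" using i by (intro member_le_sum) auto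
    then show ?thesis using i j(2) lev v(2) by linarith
  qed
qed

lemma centre_in_carrier:
  assumes v: "v \<in> tuples" and z: "K z < 1" shows "v \<in> carrier_verts (flat v z)"
  unfolding carrier_flat using z v flat_vertex_0[OF v, of "\<lambda>_. 0"]
  by (intro exI[of _ "\<lambda>_. 0"]) (simp add: sup_norm_less)

text \<open>Seen from a vertex of maximal level the whole carrier lies in the direction of the slab,
  for a neighbour on the other side would have a larger level. In each coordinate
  \<open>tree_on_line\<close> then puts \<open>x\<close> on the line of \<open>v\<close>.\<close>

lemma top_vertex_flat:
  assumes x: "x \<in> tree_pow" and v: "v \<in> carrier_verts x" and lev: "1 \<le> level v" "level_le (level v) x"
  obtains z where "z \<in> coord_space {..<m}" "K z < 1" "x = flat v z"
proof -
  have vt: "v \<in> tuples" using v by (simp add: carrier_verts_def)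
  have "\<exists>t. \<bar>t\<bar> < 1 \<and> x i = line (v i) (below v) t" if i: "i < m" for i
  proof -
    have xi: "x i \<in> tree" and vi: "v i \<in> verts (x i)" using x v i by (auto simp: tree_pow_def carrier_verts_def)
    have "height u = height (v i) + (if below v then 1 else -1)" if u: "u \<in> verts (x i)" "u \<noteq> v i" for u
    proof -
      obtain l where l: "u = v i \<cdot> [l]" using tree_neighbours[OF xi vi u(1)] u(2) by auto
      \<comment> \<open>Carriers are products, so a single coordinate of \<open>v\<close> may be
        changed.\<close>
      have "v(i := u) \<in> carrier_verts x"
        using v u verts_tree(3)[OF xi u(1)] i by (auto simp: carrier_verts_def tuples_def)
      then have le: "level (v(i := u)) \<le> level v" using lev(2) by (simp add: level_le_def)
      have "ht (v(i := u)) = ht v - height (v i) + height u"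
      proof -
        have "ht (v(i := u)) = height u + (\<Sum>k\<in>{..<m} - {i}. height (v k))"
          unfolding ht_def using i by (subst sum.remove[of _ i]) auto
        moreover have "ht v = height (v i) + (\<Sum>k\<in>{..<m} - {i}. height (v k))"
          unfolding ht_def using i by (subst sum.remove[of _ i]) auto
        ultimately show ?thesis by simp
      qed
      then have ht: "ht (v(i := u)) = ht v + (if snd l then 1 else -1)"
        using l by (cases l) simp
      then have "snd l = below v"
        using le lev(1) m_pos unfolding level_def below_def level_of_def by (auto split: if_splits)
      then show ?thesis using l by (cases l) auto
    qed
    then show ?thesis using tree_on_line[OF xi vi, of "below v"] by metis
  qed
  then obtain t where t: "\<And>i. i < m \<Longrightarrow> \<bar>t i\<bar> < 1 \<and> x i = line (v i) (below v) (t i)" by metis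
  define z where "z i = (if i < m then t i else 0)" for i
  show thesis
  proof (rule that)
    show "z \<in> coord_space {..<m}" by (auto simp: z_def coord_space_def)
    show "K z < 1" using t by (simp add: sup_norm_less z_def)
    show "x = flat v z" using t x by (auto simp: flat_def z_def tree_pow_def fun_eq_iff)
  qed
qed

end

section \<open>Finite subtrees and their powers\<close>

definition subtree :: "w2 set \<Rightarrow> (w2 \<Rightarrow> real) set" where
  "subtree P = {x \<in> tree. verts x \<subseteq> P}"

lemma continuous_edge_point: "continuous_on S (edge_point u v)"
proof (rule continuous_on_coordinatewise_then_product)
  show "continuous_on S (\<lambda>t. edge_point u v t x)" for x
    unfolding edge_point_def by (intro continuous_intros)
qed

lemma verts_edge_subset: "0 \<le> t \<Longrightarrow> t \<le> 1 \<Longrightarrow> verts (edge_point u v t) \<subseteq> {u, v}"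
  by (auto simp: verts_def edge_point_def vert_def split: if_splits)

lemma compact_subtree:
  assumes "finite P" shows "compact (subtree P)"
proof -
  let ?E = "\<Union>w\<in>{w\<in>P. freely_reduced w}. \<Union>s\<in>{s. w \<cdot> [(s, True)] \<in> P}. edge_point w (w \<cdot> [(s, True)]) ` {0..1}"
  have "subtree P = vert ` {w\<in>P. freely_reduced w} \<union> ?E"
  proof (intro equalityI subsetI)
    fix x assume "x \<in> subtree P"
    then have x: "x \<in> tree" "verts x \<subseteq> P" by (auto simp: subtree_def)
    from x(1) show "x \<in> vert ` {w\<in>P. freely_reduced w} \<union> ?E"
    proof (cases rule: tree_cases)
      case (vertex w) then show ?thesis using x by auto
    next
      case (edge w s t)
      then have "w \<in> P" "w \<cdot> [(s, True)] \<in> P" using x verts_edge'[of w t "(s, True)"] by auto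
      then show ?thesis using edge by fastforce
    qed
  next
    fix x assume "x \<in> vert ` {w\<in>P. freely_reduced w} \<union> ?E"
    then consider w where "w \<in> P" "freely_reduced w" "x = vert w"
      | w s t where "w \<in> P" "freely_reduced w" "w \<cdot> [(s, True)] \<in> P" "0 \<le> t" "t \<le> 1" "x = edge_point w (w \<cdot> [(s, True)]) t"
      by auto
    then show "x \<in> subtree P"
    proof cases
      case 1 then show ?thesis by (simp add: subtree_def vert_in_tree)
    next
      case 2
      then show ?thesis
        using edge_in_tree[of w t s True] verts_edge_subset[of t w "w \<cdot> [(s, True)]"] by (auto simp: subtree_def)
    qed
  qed
  moreover have "compact ?E"
    using assms by (intro compact_UN compact_continuous_image continuous_edge_point) auto
  ultimately show ?thesis using assms by (simp add: compact_Un finite_imp_compact)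
qed

text \<open>Such a set is the vertex set of a finite subtree that contains the root.\<close>

definition prefix_closed :: "w2 set \<Rightarrow> bool" where
  "prefix_closed P \<longleftrightarrow> finite P \<and> [] \<in> P \<and> (\<forall>u\<in>P. freely_reduced u \<and> butlast u \<in> P)"

lemma prefix_closed_superset:
  assumes "finite Q" "\<And>u. u \<in> Q \<Longrightarrow> freely_reduced u"
  obtains P where "prefix_closed P" "Q \<subseteq> P"
proof
  let ?P = "insert [] (\<Union>u\<in>Q. (\<lambda>k. take k u) ` {..length u})"
  have "freely_reduced (take k u)" if "u \<in> Q" for k u
    using assms(2)[OF that] by (metis append_take_drop_id reduced_append_iff)
  moreover have "butlast (take k u) \<in> ?P" if "u \<in> Q" "k \<le> length u" for k u
    using that by (auto simp: butlast_take intro!: bexI[of _ u])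
  ultimately show "prefix_closed ?P" using assms(1) by (auto simp: prefix_closed_def)
  show "Q \<subseteq> ?P"
  proof
    fix u assume u: "u \<in> Q"
    have "u \<in> (\<lambda>k. take k u) ` {..length u}" by (rule image_eqI[of _ _ "length u"]) auto
    then show "u \<in> ?P" using u by blast
  qed
qed

text \<open>A longest word is a leaf. Removing it leaves a smaller subtree to which an edge is
  attached at one point, and \<open>ext_set_Un\<close> applies.\<close>

lemma ext_set_subtree:
  assumes "prefix_closed P" shows "ext_set (subtree P)"
  using assms
proof (induction "card P" arbitrary: P rule: less_induct)
  case less
  have P: "finite P" "[] \<in> P" "\<And>u. u \<in> P \<Longrightarrow> freely_reduced u" "\<And>u. u \<in> P \<Longrightarrow> butlast u \<in> P"
    using less.prems by (auto simp: prefix_closed_def)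
  show ?case
  proof (cases "P = {[]}")
    case True
    have "x = vert []" if x: "x \<in> tree" "verts x \<subseteq> {[]}" for x
      using x(1)
    proof (cases rule: tree_cases)
      case (edge w s t)
      then have "{w, w \<cdot> [(s, True)]} \<subseteq> {[]}" using x(2) verts_edge'[of w t "(s, True)"] by metis
      then show ?thesis using mul_single_neq[OF edge(1), of "(s, True)"] by blast
    qed (use x(2) in auto)
    then have "subtree P = {vert []}" using True by (auto simp: subtree_def vert_in_tree)
    then show ?thesis by (simp add: ext_set_singleton)
  next
    case False
    define k where "k = Max (length ` P)"
    have "k \<in> length ` P" unfolding k_def using P by (intro Max_in) auto
    then obtain u where u: "u \<in> P" "length u = k" by auto
    have long: "length v \<le> length u" if "v \<in> P" for v using that P(1) u by (simp add: k_def)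
    have ne: "u \<noteq> []"
    proof
      assume "u = []"
      then have "v = []" if "v \<in> P" for v using long[OF that] by simp
      then show False using False P(2) by auto
    qed
    define b where "b = butlast u"
    have ub: "u = b \<cdot> [last u]" "b \<noteq> u" "freely_reduced b" "b \<in> P"
    proof -
      have "u = b @ [last u]" using ne by (simp add: b_def)
      then show "u = b \<cdot> [last u]" using mul_append[of b "[last u]"] P(3)[OF u(1)] by simp
      show "b \<noteq> u" using ne by (metis b_def append_butlast_last_id not_Cons_self2 self_append_conv)
      show "b \<in> P" using P(4)[OF u(1)] by (simp add: b_def)
      then show "freely_reduced b" by (rule P(3))
    qed
    define E where "E = edge_point b u ` {0..1}"
    have pc: "prefix_closed (P - {u})"
      unfolding prefix_closed_def
    proof (intro conjI ballI)
      fix v assume v: "v \<in> P - {u}"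
      then show "freely_reduced v" using P by auto
      have "butlast v \<noteq> u"
      proof
        assume bv: "butlast v = u"
        then have "length v = Suc (length u)" using ne by (cases v rule: rev_cases) auto
        then show False using long[of v] v by simp
      qed
      then show "butlast v \<in> P - {u}" using P v by auto
    qed (use P ne in auto)
    have "card (P - {u}) < card P" using P(1) u(1) by (rule card_Diff1_less)
    then have IH: "ext_set (subtree (P - {u}))" using less.hyps pc by blast
    have Ein: "E \<subseteq> subtree P"
    proof
      fix x assume "x \<in> E"
      then obtain t where t: "0 \<le> t" "t \<le> 1" "x = edge_point b u t" by (auto simp: E_def)
      have "x \<in> tree" using edge_in_tree[OF ub(3) t(1,2), of "fst (last u)" "snd (last u)"] t(3) ub(1) by simp
      then show "x \<in> subtree P" using verts_edge_subset[OF t(1,2), of b u] t(3) ub u by (auto simp: subtree_def)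
    qed
    have un: "subtree P = subtree (P - {u}) \<union> E"
    proof (intro equalityI subsetI)
      fix x assume "x \<in> subtree P"
      then have x: "x \<in> tree" "verts x \<subseteq> P" by (auto simp: subtree_def)
      show "x \<in> subtree (P - {u}) \<union> E"
      proof (cases "u \<in> verts x")
        case False then show ?thesis using x by (auto simp: subtree_def)
      next
        case True
        have other: "v = b" if v: "v \<in> verts x" "v \<noteq> u" for v
        proof -
          obtain l where "v = u \<cdot> [l]" using tree_neighbours[OF x(1) True v(1)] v(2) by blast
          then have "v = butlast u \<or> v = u @ [l]" using mul_snoc[OF P(3)[OF u(1)], of l] by (simp split: if_splits)
          then show ?thesis using long[of v] v x(2) by (auto simp: b_def)
        qed
        from x(1) have "x \<in> E"
        proof (cases rule: tree_cases)
          case (vertex w)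
          then have "x = edge_point b u 1" using True by auto
          then show ?thesis unfolding E_def by (rule image_eqI) auto
        next
          case (edge w s t)
          have V: "verts x = {w, w \<cdot> [(s, True)]}" "w \<cdot> [(s, True)] \<noteq> w"
            using edge verts_edge' mul_single_neq by auto
          have "w = u \<and> w \<cdot> [(s, True)] = b \<or> w = b \<and> w \<cdot> [(s, True)] = u"
          proof (cases "w = u")
            case True
            then show ?thesis using other[of "w \<cdot> [(s, True)]"] V by auto
          next
            case False
            then have "w \<cdot> [(s, True)] = u" using V(1) \<open>u \<in> verts x\<close> by auto
            then show ?thesis using other[of w] V(1) False by auto
          qed
          then consider "w = u" "w \<cdot> [(s, True)] = b" | "w = b" "w \<cdot> [(s, True)] = u" by blast
          then show ?thesis
          proof cases
            case 1
            then have "x = edge_point b u (1 - t)" using edge edge_point_commute[of u b t] by simp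
            then show ?thesis using edge by (simp add: E_def)
          next
            case 2 then show ?thesis using edge by (simp add: E_def)
          qed
        qed
        then show ?thesis by blast
      qed
    next
      fix x assume "x \<in> subtree (P - {u}) \<union> E"
      then show "x \<in> subtree P" using Ein by (auto simp: subtree_def)
    qed
    have int: "subtree (P - {u}) \<inter> E = {vert b}"
    proof (intro equalityI subsetI)
      fix x assume x: "x \<in> subtree (P - {u}) \<inter> E"
      then obtain t where t: "0 \<le> t" "t \<le> 1" "x = edge_point b u t" by (auto simp: E_def)
      have "u \<notin> verts x" using x by (auto simp: subtree_def)
      then have "t = 0" using verts_edge[OF ub(2) t(1,2)] t(3) by (auto split: if_splits)
      then show "x \<in> {vert b}" using t by simp
    next
      fix x assume "x \<in> {vert b}"
      moreover have "vert b \<in> E" unfolding E_def by (rule image_eqI[of _ _ 0]) auto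
      ultimately show "x \<in> subtree (P - {u}) \<inter> E" using ub by (auto simp: subtree_def vert_in_tree)
    qed
    have "inj_on (edge_point b u) {0..1}"
    proof (rule inj_onI)
      fix s t assume "edge_point b u s = edge_point b u t"
      then have "edge_point b u s u = edge_point b u t u" by simp
      then show "s = t" using ub(2) by (simp add: edge_point_def vert_def)
    qed
    then have "ext_set E"
      unfolding E_def by (intro ext_set_homeo ext_set_interval continuous_edge_point) auto
    moreover have "closed E" unfolding E_def by (intro compact_imp_closed compact_continuous_image continuous_edge_point) auto
    moreover have "closed (subtree (P - {u}))" using P by (intro compact_imp_closed compact_subtree) auto
    ultimately show ?thesis
      unfolding un using IH int by (intro ext_set_Un) (auto simp: ext_set_singleton)
  qed
qed

text \<open>Pushes a map out of \<open>L\<close> by a map \<open>r\<close> that is the identity on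
  \<open>A \<inter> L\<close>. It is used with a lens for \<open>L\<close>, its rim for
  \<open>F\<close> and the rest of the finite complex for \<open>A\<close>.\<close>

lemma retract_push:
  assumes D: "closed D" and g: "continuous_on D g" "g ` D \<subseteq> A \<union> L"
    and A: "closed A" and L: "closed L" and r: "continuous_on L r" "r ` L \<subseteq> F" "\<And>y. y \<in> L \<Longrightarrow> y \<in> A \<Longrightarrow> r y = y"
  obtains g' where "continuous_on D g'" "g' ` D \<subseteq> A \<union> F" "\<And>x. x \<in> D \<Longrightarrow> g x \<in> A \<Longrightarrow> g' x = g x"
proof
  let ?S = "D \<inter> g -` L" and ?T = "D \<inter> g -` A"
  let ?g = "\<lambda>x. if x \<in> ?S then r (g x) else g x"
  have "continuous_on (?S \<union> ?T) ?g"
  proof (rule continuous_on_paste)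
    show "closed ?S" "closed ?T" using continuous_closed_preimage[OF g(1) D] A L by auto
    show "continuous_on ?S (\<lambda>x. r (g x))"
      by (rule continuous_on_compose2[OF r(1)]) (auto intro: continuous_on_subset[OF g(1)])
    show "continuous_on ?T g" by (rule continuous_on_subset[OF g(1)]) auto
  qed (use r(3) in auto)
  moreover have "?S \<union> ?T = D" using g(2) by auto
  ultimately show "continuous_on D ?g" by simp
  show "?g ` D \<subseteq> A \<union> F"
  proof (rule image_subsetI)
    fix x assume "x \<in> D"
    then show "?g x \<in> A \<union> F" using subsetD[OF g(2), of "g x"] subsetD[OF r(2), of "r (g x)"] by auto
  qed
  show "?g x = g x" if "x \<in> D" "g x \<in> A" for x using that r(3) by auto
qed

type_synonym cpoint = "(nat \<Rightarrow> w2 \<Rightarrow> real) \<times> (w2 list \<Rightarrow> real)"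

context tree_power
begin

definition subpow :: "w2 set \<Rightarrow> (nat \<Rightarrow> w2 \<Rightarrow> real) set" where
  "subpow P = {x \<in> tree_pow. \<forall>i<m. verts (x i) \<subseteq> P}"

lemma subpow_iff: "x \<in> subpow P \<longleftrightarrow> (\<forall>i<m. x i \<in> subtree P) \<and> (\<forall>i\<ge>m. x i = (\<lambda>_. 0))"
  unfolding subpow_def tree_pow_def subtree_def by blast

lemma subpow_eq: "subpow P = PiE UNIV (\<lambda>i. if i < m then subtree P else {\<lambda>_. 0})"
proof (rule Set.set_eqI)
  fix x :: "nat \<Rightarrow> w2 \<Rightarrow> real"
  have "(x i \<in> (if i < m then subtree P else {\<lambda>_. 0})) \<longleftrightarrow> (i < m \<longrightarrow> x i \<in> subtree P) \<and> (i \<ge> m \<longrightarrow> x i = (\<lambda>_. 0))" for i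
    by (cases "i < m") auto
  then show "x \<in> subpow P \<longleftrightarrow> x \<in> PiE UNIV (\<lambda>i. if i < m then subtree P else {\<lambda>_. 0})"
    unfolding subpow_iff PiE_iff by auto
qed

lemma compact_subpow: "finite P \<Longrightarrow> compact (subpow P)"
  unfolding subpow_eq by (rule compact_PiE) (simp add: compact_subtree)

lemma ext_set_subpow:
  assumes "prefix_closed P" shows "ext_set (subpow P)"
  unfolding ext_set_def
proof (intro allI impI, elim conjE)
  fix C D :: "(nat \<Rightarrow> real) set" and f
  assume C: "compact C" and D: "compact D" and CD: "C \<subseteq> D" and f: "continuous_on C f" "f ` C \<subseteq> subpow P"
  have "\<exists>g. continuous_on D g \<and> g ` D \<subseteq> subtree P \<and> (\<forall>x\<in>C. g x = f x i)" if i: "i < m" for i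
  proof -
    have "(\<lambda>x. f x i) ` C \<subseteq> subtree P" using f(2) i by (auto simp: image_subset_iff subpow_iff)
    with ext_setE[OF ext_set_subtree[OF assms] C D CD continuous_on_product_then_coordinatewise[OF f(1)]]
    show ?thesis by metis
  qed
  then obtain g where g: "\<And>i. i < m \<Longrightarrow> continuous_on D (g i) \<and> g i ` D \<subseteq> subtree P \<and> (\<forall>x\<in>C. g i x = f x i)" by metis
  define h where "h x = (\<lambda>i. if i < m then g i x else (\<lambda>_. 0))" for x
  have "continuous_on D h"
  proof (rule continuous_on_coordinatewise_then_product)
    show "continuous_on D (\<lambda>x. h x i)" for i by (cases "i < m") (auto simp: h_def g)
  qed
  moreover have "h ` D \<subseteq> subpow P" using g by (simp add: image_subset_iff h_def subpow_iff)
  moreover have "h x = f x" if "x \<in> C" for x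
  proof
    fix i show "h x i = f x i" using g f(2) that by (cases "i < m") (auto simp: h_def subpow_def tree_pow_def)
  qed
  ultimately show "\<exists>g. continuous_on D g \<and> g ` D \<subseteq> subpow P \<and> (\<forall>x\<in>C. g x = f x)" by blast
qed

text \<open>For each vertex \<open>u\<close> of larger level some coordinate
  \<open>x i (u i)\<close> must fail to be positive; these are closed conditions.\<close>

lemma closed_level_le: "closed {x. level_le j x}"
proof -
  have "{x. level_le j x} = (\<Inter>u\<in>{u\<in>tuples. j < level u}. \<Union>i\<in>{..<m}. {x. x i (u i) \<le> 0})"
  proof (rule Set.set_eqI)
    fix x
    have "level_le j x \<longleftrightarrow> (\<forall>u. u \<in> tuples \<longrightarrow> j < level u \<longrightarrow> (\<exists>i<m. \<not> 0 < x i (u i)))"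
    proof -
      have "level_le j x \<longleftrightarrow> (\<forall>u. u \<in> tuples \<longrightarrow> (\<forall>i<m. 0 < x i (u i)) \<longrightarrow> \<not> j < level u)"
        by (auto simp: level_le_def carrier_verts_def verts_def not_less)
      then show ?thesis by blast
    qed
    then show "x \<in> {x. level_le j x} \<longleftrightarrow> x \<in> (\<Inter>u\<in>{u\<in>tuples. j < level u}. \<Union>i\<in>{..<m}. {x. x i (u i) \<le> 0})"
      by (auto simp: not_less)
  qed
  moreover have "closed {x :: nat \<Rightarrow> w2 \<Rightarrow> real. x i w \<le> 0}" for i w
  proof (rule closed_Collect_le)
    show "continuous_on UNIV (\<lambda>x :: nat \<Rightarrow> w2 \<Rightarrow> real. x i w)"
      using continuous_on_product_then_coordinatewise[OF continuous_on_product_coordinates, of i w] by simp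
  qed (rule continuous_on_const)
  ultimately show ?thesis by (auto intro!: closed_INT closed_UN)
qed

section \<open>Domes and lenses\<close>

text \<open>A tuple is recorded as a list because functions on the naturals do not form a countable
  type, and the index types of a point of the complex have to be countable for its final
  coding.\<close>

definition lab :: "(nat \<Rightarrow> w2) \<Rightarrow> w2 list" where "lab v = map v [0..<m]"

lemma lab_inject: "v \<in> tuples \<Longrightarrow> w \<in> tuples \<Longrightarrow> lab v = lab w \<Longrightarrow> v = w"
proof
  fix i assume "v \<in> tuples" "w \<in> tuples" "lab v = lab w"
  then show "v i = w i" by (cases "i < m") (auto simp: lab_def tuples_def)
qed

definition spike :: "(nat \<Rightarrow> w2) \<Rightarrow> real \<Rightarrow> w2 list \<Rightarrow> real" where
  "spike v h = (\<lambda>l. if l = lab v then h else 0)"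

lemma spike_0 [simp]: "spike v 0 = (\<lambda>_. 0)" by (auto simp: spike_def)

lemma spike_inject: "spike v h = spike v h' \<Longrightarrow> h = h'"
  by (metis spike_def)

lemma spike_zero_iff: "spike v h = (\<lambda>_. 0) \<longleftrightarrow> h = 0"
  using spike_inject[of v h 0] by auto

lemma spike_distinct: "v \<in> tuples \<Longrightarrow> w \<in> tuples \<Longrightarrow> v \<noteq> w \<Longrightarrow> spike v h = spike w h' \<Longrightarrow> h = 0 \<and> h' = 0"
  by (metis spike_def lab_inject)

definition lift :: "(nat \<Rightarrow> w2) \<Rightarrow> (nat \<Rightarrow> real) \<times> real \<Rightarrow> cpoint" where
  "lift v p = (flat v (fst p), spike v (snd p))"

text \<open>The second component of a point of the complex is supported on the label of a single vertex \<open>v\<close> and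
  is its height in the lens of \<open>v\<close>; it vanishes on the product of trees.\<close>

definition lens_base :: "nat \<Rightarrow> ((nat \<Rightarrow> real) \<times> real) set" where
  "lens_base n = {p. fst p \<in> coord_space {..<m} \<and> 0 \<le> snd p \<and> stair n (fst p) + snd p \<le> 1}"

text \<open>The dome together with the floor outside the open unit cube. What is missing from the
  boundary of the lens is the open unit cube of the floor, the free face through which the lens is
  collapsed.\<close>

definition rim_base :: "nat \<Rightarrow> ((nat \<Rightarrow> real) \<times> real) set" where
  "rim_base n = {p \<in> lens_base n. snd p = 1 - stair n (fst p) \<or> snd p = 0 \<and> 1 \<le> K (fst p)}"

definition outer :: "(nat \<Rightarrow> w2) set" where "outer = {v \<in> tuples. 1 \<le> level v}"
definition lens :: "(nat \<Rightarrow> w2) \<Rightarrow> cpoint set" where "lens v = lift v ` lens_base (level v)"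
definition rim :: "(nat \<Rightarrow> w2) \<Rightarrow> cpoint set" where "rim v = lift v ` rim_base (level v)"
definition dome :: "(nat \<Rightarrow> w2) \<Rightarrow> cpoint set" where
  "dome v = (\<lambda>z. lift v (z, 1 - stair (level v) z)) ` {z \<in> coord_space {..<m}. stair (level v) z \<le> 1}"
definition slab :: "w2 set \<Rightarrow> nat \<Rightarrow> cpoint set" where
  "slab P j = (\<lambda>x. (x, \<lambda>_. 0)) ` {x \<in> subpow P. level_le j x}"
text \<open>The finite part of the complex given by the words \<open>P\<close> and the outer
  vertices \<open>V\<close>, filtered by level. All domes of \<open>V\<close> are present at every
  level; at level 0 no lens is left, since outer vertices have positive level.\<close>

definition stage :: "w2 set \<Rightarrow> (nat \<Rightarrow> w2) set \<Rightarrow> nat \<Rightarrow> cpoint set" where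
  "stage P V j = slab P j \<union> (\<Union>v\<in>{v\<in>V. level v \<le> j}. lens v) \<union> (\<Union>v\<in>V. dome v)"

lemma continuous_lift: "continuous_on S (lift v)"
proof -
  have "continuous_on S (\<lambda>p. flat v (fst p))"
    by (rule continuous_on_compose2[OF continuous_flat continuous_on_fst[OF continuous_on_id]]) auto
  moreover have "continuous_on S (\<lambda>p. spike v (snd p))"
  proof (rule continuous_on_coordinatewise_then_product)
    show "continuous_on S (\<lambda>p. spike v (snd p) l)" for l
      by (cases "l = lab v") (auto simp: spike_def intro!: continuous_on_snd continuous_on_id)
  qed
  ultimately show ?thesis unfolding lift_def by (intro continuous_on_Pair)
qed

lemma inj_lift: "inj_on (lift v) (lens_base n)"
proof (rule inj_onI)
  fix p q assume pq: "p \<in> lens_base n" "q \<in> lens_base n" and eq: "lift v p = lift v q"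
  have "fst p = fst q" using flat_inject[of "fst p" "fst q" v] pq eq by (auto simp: lens_base_def lift_def)
  moreover have "snd p = snd q" using eq spike_inject[of v] by (auto simp: lift_def)
  ultimately show "p = q" by (simp add: prod_eq_iff)
qed

lemma continuous_stair_fst: "continuous_on S (\<lambda>p :: (nat \<Rightarrow> real) \<times> real. stair n (fst p))"
  by (rule continuous_on_gauge_compose[OF gauge_stair continuous_on_fst[OF continuous_on_id]])

lemma compact_lens_base: "compact (lens_base n)"
proof -
  have "lens_base n = ({z \<in> coord_space {..<m}. stair n z \<le> 1} \<times> {0..1}) \<inter> {p. stair n (fst p) + snd p \<le> 1}"
    using stair_nonneg[of n] by (auto simp: lens_base_def intro: order_trans[of _ "_ + _"])
      (smt (verit) stair_nonneg)+
  moreover have "closed {p :: (nat \<Rightarrow> real) \<times> real. stair n (fst p) + snd p \<le> 1}"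
    by (intro closed_Collect_le continuous_on_add continuous_stair_fst continuous_on_snd continuous_on_id continuous_on_const)
  ultimately show ?thesis
    by (simp add: compact_Int_closed compact_Times compact_gauge_ball[OF gauge_stair])
qed

text \<open>The position in the ball and the height are extended separately; the height is then
  clamped between 0 and the dome.\<close>

lemma ext_set_lens_base: "ext_set (lens_base n)"
  unfolding ext_set_def
proof (intro allI impI, elim conjE)
  fix C D :: "(nat \<Rightarrow> real) set" and f :: "(nat \<Rightarrow> real) \<Rightarrow> (nat \<Rightarrow> real) \<times> real"
  assume C: "compact C" and D: "compact D" and CD: "C \<subseteq> D" and f: "continuous_on C f" "f ` C \<subseteq> lens_base n"
  have f1: "(\<lambda>x. fst (f x)) ` C \<subseteq> {z \<in> coord_space {..<m}. stair n z \<le> 1}"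
    using f(2) by (force simp: lens_base_def)
  obtain g where g: "continuous_on D g" "g ` D \<subseteq> {z \<in> coord_space {..<m}. stair n z \<le> 1}" "\<And>x. x \<in> C \<Longrightarrow> g x = fst (f x)"
    using ext_setE[OF ext_set_gauge_ball[OF gauge_stair] C D CD continuous_on_fst[OF f(1)] f1] by blast
  obtain h where h: "continuous_on D h" "\<And>x. x \<in> C \<Longrightarrow> h x = snd (f x)"
    using real_extension[OF C CD continuous_on_snd[OF f(1)]] by blast
  define k where "k x = (g x, max 0 (min (h x) (1 - stair n (g x))))" for x
  have "continuous_on D k"
    unfolding k_def
    by (intro continuous_on_Pair continuous_on_max continuous_on_min continuous_on_diff continuous_on_const g(1) h(1)
        continuous_on_gauge_compose[OF gauge_stair])
  moreover have "k ` D \<subseteq> lens_base n" using g(2) by (auto simp: k_def lens_base_def)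
  moreover have "k x = f x" if "x \<in> C" for x
    using g(3)[OF that] h(2)[OF that] f(2) that by (auto simp: k_def lens_base_def prod_eq_iff)
  ultimately show "\<exists>g. continuous_on D g \<and> g ` D \<subseteq> lens_base n \<and> (\<forall>x\<in>C. g x = f x)" by blast
qed

lemma compact_lens: "compact (lens v)"
  unfolding lens_def by (intro compact_continuous_image continuous_lift compact_lens_base)

lemma ext_set_lens: "ext_set (lens v)"
  unfolding lens_def by (intro ext_set_homeo compact_lens_base ext_set_lens_base continuous_lift inj_lift)

lemma dome_base: "z \<in> coord_space {..<m} \<Longrightarrow> stair n z \<le> 1 \<Longrightarrow> (z, 1 - stair n z) \<in> rim_base n"
  by (auto simp: rim_base_def lens_base_def)

lemma dome_subset_rim: "dome v \<subseteq> rim v"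
  unfolding dome_def rim_def using dome_base by blast

lemma rim_subset_lens: "rim v \<subseteq> lens v"
  by (auto simp: rim_def lens_def rim_base_def)

lemma compact_dome: "compact (dome v)"
  unfolding dome_def
proof (intro compact_continuous_image compact_gauge_ball gauge_stair)
  show "continuous_on {z \<in> coord_space {..<m}. stair (level v) z \<le> 1} (\<lambda>z. lift v (z, 1 - stair (level v) z))"
    by (intro continuous_on_compose2[OF continuous_lift] continuous_on_Pair continuous_on_diff continuous_on_const
        continuous_on_id continuous_on_gauge_compose[OF gauge_stair]) auto
qed

lemma compact_slab: "finite P \<Longrightarrow> compact (slab P j)"
proof -
  assume "finite P"
  then have "compact (subpow P \<inter> {x. level_le j x})" by (intro compact_Int_closed compact_subpow closed_level_le)
  moreover have "continuous_on S (\<lambda>x. (x, \<lambda>_. 0) :: cpoint)" for S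
    by (intro continuous_on_Pair continuous_on_id continuous_on_const)
  ultimately show ?thesis unfolding slab_def Int_def[of "subpow P", symmetric] by (auto intro!: compact_continuous_image simp: Int_def)
qed

lemma compact_stage: "finite P \<Longrightarrow> finite V \<Longrightarrow> compact (stage P V j)"
  unfolding stage_def by (intro compact_Un compact_slab compact_UN) (auto simp: compact_lens compact_dome)

subsection \<open>Collapsing a lens through its free face\<close>

definition depth :: "nat \<Rightarrow> (nat \<Rightarrow> real) \<times> real \<Rightarrow> real" where
  "depth n p = max (stair n (fst p)) (2 * min 1 (K (fst p)) - stair n (fst p) - 2 * snd p)"

text \<open>On a ray of the flat the rim is a broken line from the apex of the dome down to its boundary and
  back to the unit cube; \<open>depth\<close> is the arc parameter of the image point on it.\<close>

definition collapse :: "nat \<Rightarrow> (nat \<Rightarrow> real) \<times> real \<Rightarrow> (nat \<Rightarrow> real) \<times> real" where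
  "collapse n p = ((\<lambda>i. min (depth n p) (2 - depth n p) / stair n (fst p) * fst p i), max 0 (1 - depth n p))"

lemma depth_bounds:
  assumes "p \<in> lens_base n" shows "0 \<le> depth n p" "depth n p \<le> 2"
proof -
  have "0 \<le> stair n (fst p)" "stair n (fst p) \<le> 1" "0 \<le> snd p" using assms stair_nonneg[of n "fst p"] by (auto simp: lens_base_def)
  then show "0 \<le> depth n p" "depth n p \<le> 2" by (auto simp: depth_def)
qed

lemma continuous_collapse: "continuous_on (lens_base n) (collapse n)"
proof -
  have K: "continuous_on S (\<lambda>p :: (nat \<Rightarrow> real) \<times> real. K (fst p))" for S
    by (rule continuous_on_gauge_compose[OF gauge_sup_norm continuous_on_fst[OF continuous_on_id]]) auto
  have d: "continuous_on (lens_base n) (depth n)"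
    unfolding depth_def
    by (intro continuous_on_max continuous_on_min continuous_on_diff continuous_on_mult continuous_on_const
        continuous_stair_fst K continuous_on_snd continuous_on_id)
  have "continuous_on (lens_base n) (\<lambda>p i. min (depth n p) (2 - depth n p) / stair n (fst p) * fst p i)"
  proof (rule continuous_on_radial[OF gauge_stair])
    show "continuous_on (lens_base n) fst" by (intro continuous_on_fst continuous_on_id)
    show "fst ` lens_base n \<subseteq> coord_space {..<m}" by (auto simp: lens_base_def)
    show "continuous_on (lens_base n) (\<lambda>p. min (depth n p) (2 - depth n p))"
      by (intro continuous_on_min d continuous_on_diff continuous_on_const)
    show "0 \<le> min (depth n p) (2 - depth n p)" if "p \<in> lens_base n" for p using depth_bounds[OF that] by auto
    \<comment> \<open>The axis over the centre goes to the apex: there \<open>depth\<close> is 0 and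
      the new radius vanishes, as \<open>continuous_on_radial\<close> requires.\<close>
    show "min (depth n p) (2 - depth n p) = 0" if p: "p \<in> lens_base n" "fst p = (\<lambda>i. 0)" for p
    proof -
      have "stair n (fst p) = 0" "K (fst p) = 0" unfolding p(2)
        using gauge_zero[OF gauge_stair] gauge_zero[OF gauge_sup_norm] by auto
      then show ?thesis using p(1) by (auto simp: depth_def lens_base_def)
    qed
  qed
  then show ?thesis
    unfolding collapse_def by (intro continuous_on_Pair continuous_on_max continuous_on_diff continuous_on_const d)
qed

text \<open>For \<open>depth\<close> at most 1 the image lies on the dome by the choice of its two
  components. Beyond 1 it lies on the floor and must be kept out of the open unit cube. This comes
  down to \<open>stair n z \<le> (2 - u) * K z\<close>, which for \<open>K z < 1\<close> follows
  from \<open>0 \<le> (1 - K z) * (2 * K z - stair n z)\<close>.\<close>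

lemma collapse_rim:
  assumes p: "p \<in> lens_base n" shows "collapse n p \<in> rim_base n"
proof -
  define z where "z = fst p"
  define u where "u = depth n p"
  define w where "w = fst (collapse n p)"
  have z: "z \<in> coord_space {..<m}" using p by (simp add: z_def lens_base_def)
  have u: "0 \<le> u" "u \<le> 2" using depth_bounds[OF p] by (auto simp: u_def)
  have w: "w = (\<lambda>i. min u (2 - u) / stair n z * z i)" by (simp add: w_def collapse_def u_def z_def)
  have sn: "stair n z = 0 \<longleftrightarrow> z = (\<lambda>i. 0)" using gauge_zero_iff[OF gauge_stair z] .
  have c: "0 \<le> min u (2 - u) / stair n z" using u stair_nonneg[of n z] by auto
  have wJ: "w \<in> coord_space {..<m}" using z by (auto simp: w coord_space_def)
  have N: "stair n w = min u (2 - u)"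
  proof (cases "stair n z = 0")
    case True
    then have "K z = 0" using sn gauge_zero[OF gauge_sup_norm[of "{..<m}"]] by simp
    then have "u = 0" using p True by (auto simp: u_def depth_def z_def lens_base_def)
    then show ?thesis using True sn w gauge_zero[OF gauge_stair] by simp
  next
    case False
    then show ?thesis unfolding w by (subst gauge_scale[OF gauge_stair c]) simp
  qed
  have sz: "stair n z \<le> 1" "0 \<le> stair n z" "0 \<le> snd p" using p stair_nonneg[of n z] by (auto simp: lens_base_def z_def)
  have snd: "snd (collapse n p) = max 0 (1 - u)" by (simp add: collapse_def u_def)
  show ?thesis
  proof (cases "u \<le> 1")
    case True
    then have "snd (collapse n p) = 1 - stair n w" using N snd by simp
    then show ?thesis using wJ N True u by (auto simp: rim_base_def lens_base_def w_def[symmetric] snd)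
  next
    case False
    then have N': "stair n w = 2 - u" using N by simp
    have zn: "0 < stair n z"
    proof (rule ccontr)
      assume "\<not> 0 < stair n z"
      then have "z = (\<lambda>i. 0)" using sz sn by simp
      then have "K z = 0" using gauge_zero[OF gauge_sup_norm[of "{..<m}"]] by simp
      then show False using False sz \<open>\<not> 0 < stair n z\<close> by (auto simp: u_def depth_def z_def)
    qed
    have "K w = (2 - u) / stair n z * K z"
      unfolding w using False u sz by (subst gauge_scale[OF gauge_sup_norm]) auto
    moreover have "stair n z \<le> (2 - u) * K z"
    proof -
      have eq: "u = 2 * min 1 (K z) - stair n z - 2 * snd p" using False sz by (auto simp: u_def depth_def z_def)
      have NK: "stair n z \<le> K z" by (rule stair_le_K)
      show ?thesis
      proof (cases "1 \<le> K z")
        case True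
        have "2 - u \<ge> stair n z" using eq True sz by simp
        then have "stair n z * 1 \<le> (2 - u) * K z" using True sz by (intro mult_mono) auto
        then show ?thesis by simp
      next
        case False
        then have "2 - u \<ge> 2 - 2 * K z + stair n z" using eq sz by simp
        then have "(2 - 2 * K z + stair n z) * K z \<le> (2 - u) * K z"
          using NK sz by (intro mult_right_mono) auto
        moreover have "stair n z \<le> (2 - 2 * K z + stair n z) * K z"
        proof -
          have "0 \<le> (1 - K z) * (2 * K z - stair n z)" using False NK sz by (intro mult_nonneg_nonneg) auto
          then show ?thesis by (simp add: algebra_simps)
        qed
        ultimately show ?thesis by simp
      qed
    qed
    ultimately have "1 \<le> K w" using zn by (simp add: le_divide_eq)
    then show ?thesis using wJ N' False u snd by (auto simp: rim_base_def lens_base_def w_def[symmetric])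
  qed
qed

text \<open>On the dome the second term of \<open>depth\<close> does not exceed
  \<open>stair\<close>, and on the floor with \<open>1 \<le> K\<close> it is
  \<open>2 - stair\<close>. In both cases the new radius is the old one.\<close>

lemma collapse_fixes:
  assumes p: "p \<in> rim_base n" shows "collapse n p = p"
proof -
  have sz: "stair n (fst p) \<le> 1" "0 \<le> stair n (fst p)" and z: "fst p \<in> coord_space {..<m}"
    using p stair_nonneg[of n "fst p"] by (auto simp: rim_base_def lens_base_def)
  have eqz: "(\<lambda>i. stair n (fst p) / stair n (fst p) * fst p i) = fst p"
    using gauge_zero_iff[OF gauge_stair z, of n] by (cases "stair n (fst p) = 0") auto
  have NK: "stair n (fst p) \<le> K (fst p)" by (rule stair_le_K)
  have "min (depth n p) (2 - depth n p) = stair n (fst p) \<and> max 0 (1 - depth n p) = snd p"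
    using p sz NK by (auto simp: rim_base_def lens_base_def depth_def min_def max_def)
  then show ?thesis using eqz by (simp add: collapse_def)
qed

lemma lens_retraction:
  obtains r where "continuous_on (lens v) r" "r ` lens v \<subseteq> rim v" "\<And>y. y \<in> rim v \<Longrightarrow> r y = y"
proof -
  obtain i where i: "homeomorphism (lens_base (level v)) (lens v) (lift v) i"
    unfolding lens_def using homeomorphism_compact[OF compact_lens_base continuous_lift refl inj_lift] by blast
  define r where "r y = lift v (collapse (level v) (i y))" for y
  have i': "i ` lens v = lens_base (level v)" "continuous_on (lens v) i" "\<And>p. p \<in> lens_base (level v) \<Longrightarrow> i (lift v p) = p"
    using i by (auto simp: homeomorphism_def)
  show thesis
  proof
    show "continuous_on (lens v) r"
      unfolding r_def
      by (intro continuous_on_compose2[OF continuous_lift] continuous_on_compose2[OF continuous_collapse] i'(2)) (use i'(1) in auto)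
    show "r ` lens v \<subseteq> rim v" using i'(1) collapse_rim unfolding r_def rim_def by blast
    fix y assume "y \<in> rim v"
    then obtain p where p: "p \<in> rim_base (level v)" "y = lift v p" by (auto simp: rim_def)
    then have "i y = p" using i'(3) by (auto simp: rim_base_def)
    then show "r y = y" using p collapse_fixes by (simp add: r_def)
  qed
qed

end

context tree_power
begin

lemma carrier_in:
  assumes "x \<in> tree_pow" "u \<in> carrier_verts x" "i < m"
  shows "u i \<in> verts (x i)" "x i \<in> tree"
  using assms by (auto simp: carrier_verts_def tree_pow_def)

lemma lens_cases:
  assumes "y \<in> lens v"
  obtains z h where "z \<in> coord_space {..<m}" "0 \<le> h" "stair (level v) z + h \<le> 1" "y = (flat v z, spike v h)"
  using assms by (auto simp: lens_def lens_base_def lift_def)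

lemma rim_lower:
  assumes "z \<in> coord_space {..<m}" "stair (level v) z \<le> 1" "1 \<le> K z"
  shows "(flat v z, \<lambda>_. 0) \<in> rim v"
  unfolding rim_def
  by (rule image_eqI[of _ _ "(z, 0)"]) (use assms in \<open>auto simp: lift_def rim_base_def lens_base_def\<close>)

lemma rim_cases:
  assumes "y \<in> rim v"
  obtains "y \<in> dome v" | z where "z \<in> coord_space {..<m}" "stair (level v) z \<le> 1" "1 \<le> K z" "y = (flat v z, \<lambda>_. 0)"
proof -
  obtain p where p: "p \<in> rim_base (level v)" "y = lift v p" using assms by (auto simp: rim_def)
  then consider "snd p = 1 - stair (level v) (fst p)" | "snd p = 0" "1 \<le> K (fst p)" by (auto simp: rim_base_def)
  then show thesis
  proof cases
    case 1
    have "y \<in> dome v"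
      unfolding dome_def
      by (rule image_eqI[of _ _ "fst p"]) (use 1 p in \<open>auto simp: rim_base_def lens_base_def lift_def\<close>)
    then show thesis by (rule that(1))
  next
    case 2
    then show thesis using p that(2)[of "fst p"] by (auto simp: rim_base_def lens_base_def lift_def)
  qed
qed

lemma dome_cases:
  assumes "y \<in> dome v"
  obtains z where "z \<in> coord_space {..<m}" "stair (level v) z \<le> 1" "y = (flat v z, spike v (1 - stair (level v) z))"
  using assms by (auto simp: dome_def lift_def)

lemma slab_iff: "y \<in> slab P j \<longleftrightarrow> fst y \<in> subpow P \<and> level_le j (fst y) \<and> snd y = (\<lambda>_. 0)"
  by (cases y) (auto simp: slab_def)

lemma subpow_mono: "P \<subseteq> Q \<Longrightarrow> subpow P \<subseteq> subpow Q"
  by (auto simp: subpow_def)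

text \<open>Contains all words in the carriers of points of the ball: the coordinates are at most
  \<open>level v + 1\<close> in absolute value, and carrier vertices are less than one step away
  from them.\<close>

definition flat_words :: "(nat \<Rightarrow> w2) \<Rightarrow> w2 set" where
  "flat_words v = (\<lambda>(i, j). step (v i) (below v) j) ` ({..<m} \<times> {- int (level v) - 2..int (level v) + 2})"

lemma finite_flat_words: "finite (flat_words v)"
  by (simp add: flat_words_def)

lemma flat_words_reduced: "u \<in> flat_words v \<Longrightarrow> freely_reduced u"
  by (auto simp: flat_words_def)

lemma flat_ball_subpow:
  assumes z: "stair (level v) z \<le> 1" and P: "flat_words v \<subseteq> P"
  shows "flat v z \<in> subpow P"
proof -
  have "u \<in> P" if i: "i < m" and u: "u \<in> verts (flat v z i)" for i u
  proof -
    obtain j where j: "u = step (v i) (below v) j" "\<bar>z i - real_of_int j\<bar> < 1"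
      using u i by (auto simp: flat_def verts_def line_pos)
    have "\<bar>z i\<bar> \<le> (real (level v) + 1) * stair (level v) z" using stair_coord[OF i] .
    also have "\<dots> \<le> (real (level v) + 1) * 1" using z by (intro mult_left_mono) auto
    finally have "\<bar>z i\<bar> \<le> real (level v) + 1" by simp
    moreover have "\<bar>real_of_int j\<bar> \<le> \<bar>z i\<bar> + \<bar>z i - real_of_int j\<bar>" by linarith
    ultimately have "\<bar>real_of_int j\<bar> < real (level v) + 2" using j(2) by linarith
    then have "j \<in> {- int (level v) - 2..int (level v) + 2}" by (simp add: abs_less_iff)
    then have "u \<in> flat_words v" using j(1) i unfolding flat_words_def by (auto intro!: image_eqI[of _ _ "(i, j)"])
    then show ?thesis using P by blast
  qed
  then show ?thesis using flat_in by (auto simp: subpow_def)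
qed

lemma outer_tuples: "v \<in> outer \<Longrightarrow> v \<in> tuples" and outer_level: "v \<in> outer \<Longrightarrow> 1 \<le> level v"
  by (auto simp: outer_def)

lemma finite_tuples_in: "finite P \<Longrightarrow> finite {v \<in> tuples. \<forall>i<m. v i \<in> P}"
proof -
  assume "finite P"
  have "{v \<in> tuples. \<forall>i<m. v i \<in> P} \<subseteq> (\<lambda>f i. if i < m then f i else []) ` PiE {..<m} (\<lambda>_. P)"
  proof
    fix v assume v: "v \<in> {v \<in> tuples. \<forall>i<m. v i \<in> P}"
    then have "v = (\<lambda>i. if i < m then restrict v {..<m} i else [])" by (auto simp: tuples_def fun_eq_iff)
    moreover have "restrict v {..<m} \<in> PiE {..<m} (\<lambda>_. P)" using v by auto
    ultimately show "v \<in> (\<lambda>f i. if i < m then f i else []) ` PiE {..<m} (\<lambda>_. P)" by blast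
  qed
  then show ?thesis by (rule finite_subset) (use \<open>finite P\<close> in \<open>auto intro!: finite_PiE\<close>)
qed

text \<open>A point of positive height belongs to no lens or dome of another vertex, and of its own
  lens the stage has only the dome. At height 0 inside the open unit cube the carrier contains
  \<open>v\<close>; but carriers in the other pieces contain only vertices of smaller level, apart
  from centres different from \<open>v\<close>.\<close>

lemma lens_meets_stage:
  assumes v: "v \<in> outer" "level v = Suc j" and V: "V \<subseteq> outer" and A: "A \<subseteq> outer" "v \<notin> A" "\<forall>w\<in>A. level w = Suc j"
    and y: "y \<in> lens v" "y \<in> stage P V j \<union> (\<Union>w\<in>A. lens w)"
  shows "y \<in> rim v"
proof -
  obtain z h where z: "z \<in> coord_space {..<m}" "0 \<le> h" "stair (level v) z + h \<le> 1" "y = (flat v z, spike v h)"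
    using lens_cases[OF y(1)] by blast
  have sz: "stair (level v) z \<le> 1" using z by simp
  have vt: "v \<in> tuples" using v(1) by (rule outer_tuples)
  have low: ?thesis if "h = 0" "1 \<le> K z" using rim_lower[OF z(1) sz that(2)] z(4) that by simp
  have lens_case: ?thesis if w: "w \<in> outer" "w \<noteq> v" "level w \<le> Suc j" "y \<in> lens w" for w
  proof -
    obtain z' h' where z': "stair (level w) z' + h' \<le> 1" "0 \<le> h'" "y = (flat w z', spike w h')"
      using lens_cases[OF w(4)] by metis
    have "h = 0" using spike_distinct[OF vt outer_tuples[OF w(1)]] w(2) z(4) z'(3) by (metis prod.inject)
    moreover have "1 \<le> K z"
    proof (rule ccontr)
      assume "\<not> 1 \<le> K z"
      then have "v \<in> carrier_verts (flat v z)" using centre_in_carrier[OF vt] by simp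
      then have vc: "v \<in> carrier_verts (flat w z')" using z(4) z'(3) by simp
      have le: "stair (level w) z' \<le> 1" using z' by simp
      have "level v \<le> level w" "level v = level w \<Longrightarrow> v = w"
        using flat_ball_level[OF outer_tuples[OF w(1)] outer_level[OF w(1)] le vc] by auto
      then show False using w v by simp
    qed
    ultimately show ?thesis by (rule low)
  qed
  from y(2) consider "y \<in> slab P j" | w where "w \<in> V" "level w \<le> j" "y \<in> lens w" | w where "w \<in> V" "y \<in> dome w"
    | w where "w \<in> A" "y \<in> lens w"
    by (auto simp: stage_def)
  then show ?thesis
  proof cases
    case 1
    then have "h = 0" "level_le j (flat v z)" using z(4) spike_zero_iff by (auto simp: slab_iff)
    moreover have "1 \<le> K z"
    proof (rule ccontr)
      assume "\<not> 1 \<le> K z"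
      then have "v \<in> carrier_verts (flat v z)" using centre_in_carrier[OF vt] by simp
      then show False using \<open>level_le j (flat v z)\<close> v by (auto simp: level_le_def)
    qed
    ultimately show ?thesis using low by blast
  next
    case 2
    then have "w \<in> outer" "w \<noteq> v" "level w \<le> Suc j" using V v by auto
    then show ?thesis using lens_case 2(3) by blast
  next
    case 3
    show ?thesis
    proof (cases "w = v")
      case True then show ?thesis using 3 dome_subset_rim by blast
    next
      case False
      have w: "w \<in> tuples" "1 \<le> level w" using 3 V outer_tuples outer_level by auto
      obtain z' where z': "stair (level w) z' \<le> 1" "y = (flat w z', spike w (1 - stair (level w) z'))"
        using dome_cases[OF 3(2)] by metis
      have 0: "h = 0" "1 - stair (level w) z' = 0" using spike_distinct[OF vt w(1)] False z(4) z'(2) by (metis prod.inject)+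
      moreover have "1 \<le> K z"
      proof (rule ccontr)
        assume "\<not> 1 \<le> K z"
        then have "v \<in> carrier_verts (flat v z)" using centre_in_carrier[OF vt] by simp
        then have "v \<in> carrier_verts (flat w z')" using z(4) z'(2) by simp
        then have "level v = 0" using flat_ball_level(3)[OF w z'(1)] 0 by simp
        then show False using v by simp
      qed
      ultimately show ?thesis using low by blast
    qed
  next
    case 4
    then show ?thesis using lens_case[of w] A v by auto
  qed
qed

text \<open>The floor part of the rim avoids the open unit cube and has thereby lost the vertex
  \<open>v\<close>, so its level is smaller than that of \<open>v\<close>.\<close>

lemma rim_in_stage:
  assumes v: "v \<in> outer" "level v = Suc j" and V: "v \<in> V" and P: "flat_words v \<subseteq> P"
  shows "rim v \<subseteq> stage P V j"
proof
  fix y assume "y \<in> rim v"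
  then show "y \<in> stage P V j"
  proof (cases rule: rim_cases)
    case 1 then show ?thesis using V by (auto simp: stage_def)
  next
    case (2 z)
    have "level_le j (flat v z)"
      unfolding level_le_def
      using flat_ball_level(4)[OF outer_tuples[OF v(1)] outer_level[OF v(1)] 2(2) _ 2(3)] v(2) by fastforce
    then have "y \<in> slab P j" using flat_ball_subpow[OF 2(2) P] 2(4) by (simp add: slab_iff)
    then show ?thesis by (simp add: stage_def)
  qed
qed

text \<open>The lenses of level \<open>j + 1\<close> are collapsed one at a time. By
  \<open>lens_meets_stage\<close> each retraction fixes the points that the lens shares with the
  rest, which includes the lenses not yet collapsed.\<close>

lemma remove_lenses:
  assumes A: "finite A" "A \<subseteq> {v \<in> outer. level v = Suc j}" and V: "V \<subseteq> outer" "A \<subseteq> V" "finite V"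
    and P: "finite P" "\<And>v. v \<in> A \<Longrightarrow> flat_words v \<subseteq> P"
    and D: "closed D" and g: "continuous_on D g" "g ` D \<subseteq> stage P V j \<union> (\<Union>v\<in>A. lens v)"
  shows "\<exists>g'. continuous_on D g' \<and> g' ` D \<subseteq> stage P V j \<and> (\<forall>x\<in>D. g x \<in> stage P V j \<longrightarrow> g' x = g x)"
  using A V(2) P(2) g
proof (induction A arbitrary: g rule: finite_induct)
  case empty
  then show ?case by auto
next
  case (insert v A)
  have v: "v \<in> outer" "level v = Suc j" "v \<in> V" "flat_words v \<subseteq> P" using insert.prems by auto
  have Ao: "A \<subseteq> outer" "\<forall>w\<in>A. level w = Suc j" using insert.prems by auto
  define B where "B = stage P V j \<union> (\<Union>w\<in>A. lens w)"
  obtain r where r: "continuous_on (lens v) r" "r ` lens v \<subseteq> rim v" "\<And>y. y \<in> rim v \<Longrightarrow> r y = y"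
    using lens_retraction by blast
  have clB: "closed B"
    unfolding B_def using insert.hyps(1) compact_stage[OF P(1) V(3)] compact_lens
    by (intro compact_imp_closed compact_Un compact_UN) auto
  have fixB: "r y = y" if "y \<in> lens v" "y \<in> B" for y
    using r(3) lens_meets_stage[OF v(1,2) V(1) Ao(1) insert.hyps(2) Ao(2) that(1)] that(2) unfolding B_def by blast
  have gB: "g ` D \<subseteq> B \<union> lens v" using insert.prems(5) by (auto simp: B_def)
  obtain g1 where g1: "continuous_on D g1" "g1 ` D \<subseteq> B \<union> rim v" "\<And>x. x \<in> D \<Longrightarrow> g x \<in> B \<Longrightarrow> g1 x = g x"
    using retract_push[OF D insert.prems(4) gB clB compact_imp_closed[OF compact_lens] r(1,2) fixB] by blast
  have "rim v \<subseteq> B" using rim_in_stage[OF v] by (auto simp: B_def)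
  then have "g1 ` D \<subseteq> stage P V j \<union> (\<Union>w\<in>A. lens w)" using g1(2) by (auto simp: B_def)
  then obtain g' where g': "continuous_on D g'" "g' ` D \<subseteq> stage P V j" "\<forall>x\<in>D. g1 x \<in> stage P V j \<longrightarrow> g' x = g1 x"
    using insert.IH[OF _ _ _ g1(1)] insert.prems by auto
  have "g' x = g x" if "x \<in> D" "g x \<in> stage P V j" for x
    using g1(3)[of x] g'(3) that by (auto simp: B_def)
  then show ?case using g' by blast
qed

text \<open>A point of the slab of level \<open>j + 1\<close> but not of level \<open>j\<close> has
  a carrier vertex \<open>v\<close> of level \<open>j + 1\<close>. By \<open>top_vertex_flat\<close>
  it lies in the unit cube around \<open>v\<close>, hence on the floor of the lens of
  \<open>v\<close>.\<close>

lemma stage_subset_step: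
  assumes PQ: "P \<subseteq> Q" "V \<subseteq> V'" and V': "{v \<in> outer. level v = Suc j \<and> (\<forall>i<m. v i \<in> P)} \<subseteq> V'"
  shows "stage P V (Suc j) \<subseteq> stage Q V' j \<union> (\<Union>v\<in>{v\<in>V'. level v = Suc j}. lens v)"
proof
  fix y assume "y \<in> stage P V (Suc j)"
  then consider "y \<in> slab P (Suc j)" | v where "v \<in> V" "level v \<le> Suc j" "y \<in> lens v" | v where "v \<in> V" "y \<in> dome v"
    by (auto simp: stage_def)
  then show "y \<in> stage Q V' j \<union> (\<Union>v\<in>{v\<in>V'. level v = Suc j}. lens v)"
  proof cases
    case 1
    then have y: "fst y \<in> subpow P" "level_le (Suc j) (fst y)" "snd y = (\<lambda>_. 0)" by (auto simp: slab_iff)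
    show ?thesis
    proof (cases "level_le j (fst y)")
      case True
      then have "y \<in> slab Q j" using y subpow_mono[OF PQ(1)] by (auto simp: slab_iff)
      then show ?thesis by (simp add: stage_def)
    next
      case False
      then obtain v where v: "v \<in> carrier_verts (fst y)" "j < level v" by (auto simp: level_le_def not_le)
      then have lv: "level v = Suc j" using y(2) by (auto simp: level_le_def le_antisym Suc_leI)
      have xt: "fst y \<in> tree_pow" using y(1) by (simp add: subpow_def)
      have "v i \<in> P" if "i < m" for i using y(1) carrier_in(1)[OF xt v(1) that] that by (auto simp: subpow_def)
      then have vV: "v \<in> V'" using V' lv v(1) by (auto simp: outer_def carrier_verts_def)
      have "1 \<le> level v" "level_le (level v) (fst y)" using lv y(2) by auto
      then obtain z where z: "z \<in> coord_space {..<m}" "K z < 1" "fst y = flat v z"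
        using top_vertex_flat[OF xt v(1)] by blast
      have "stair (level v) z \<le> 1" using stair_le_K[of "level v" z] z(2) by simp
      then have "(z, 0) \<in> lens_base (level v)" using z by (simp add: lens_base_def)
      moreover have "y = lift v (z, 0)" using z(3) y(3) by (simp add: lift_def prod_eq_iff)
      ultimately have "y \<in> lens v" by (auto simp: lens_def)
      then show ?thesis using vV lv by blast
    qed
  next
    case 2
    then show ?thesis using PQ(2) by (cases "level v = Suc j") (auto simp: stage_def)
  next
    case 3
    then show ?thesis using PQ(2) by (auto simp: stage_def)
  qed
qed

lemma stage_mono: "P \<subseteq> Q \<Longrightarrow> V \<subseteq> V' \<Longrightarrow> stage P V j \<subseteq> stage Q V' j"
  using subpow_mono[of P Q] unfolding stage_def slab_def by blast

text \<open>Before the lenses of level \<open>j + 1\<close> are removed, all vertices of this level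
  over \<open>P\<close> join \<open>V\<close>, and the words of their flats join \<open>P\<close>.
  This brings in new domes, which is why \<open>P'\<close> and \<open>V'\<close> cannot be fixed in
  advance.\<close>

lemma descend:
  assumes "finite P" "finite V" "V \<subseteq> outer" "closed D" "continuous_on D g" "g ` D \<subseteq> stage P V j"
  shows "\<exists>P' V' g'. finite P' \<and> finite V' \<and> V' \<subseteq> outer \<and> continuous_on D g' \<and> g' ` D \<subseteq> stage P' V' 0 \<and>
     (\<forall>x\<in>D. g x \<in> stage P V 0 \<longrightarrow> g' x = g x)"
  using assms
proof (induction j arbitrary: P V g)
  case 0
  then show ?case by blast
next
  case (Suc j)
  define T where "T = {v \<in> outer. level v = Suc j \<and> (\<forall>i<m. v i \<in> P)}"
  define V' where "V' = V \<union> T"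
  define Q where "Q = P \<union> (\<Union>v\<in>V'. flat_words v)"
  have "T \<subseteq> {v \<in> tuples. \<forall>i<m. v i \<in> P}" using outer_tuples by (auto simp: T_def)
  then have fin: "finite V'" using Suc.prems finite_tuples_in[of P] unfolding V'_def by (meson finite_Un finite_subset)
  then have finQ: "finite Q" using Suc.prems by (simp add: Q_def finite_flat_words)
  have V'o: "V' \<subseteq> outer" using Suc.prems by (auto simp: V'_def T_def)
  define A where "A = {v\<in>V'. level v = Suc j}"
  have "g ` D \<subseteq> stage Q V' j \<union> (\<Union>v\<in>A. lens v)"
    using Suc.prems(6) stage_subset_step[of P Q V V' j] unfolding A_def
    by (rule order_trans) (auto simp: Q_def V'_def T_def)
  then obtain g1 where g1: "continuous_on D g1" "g1 ` D \<subseteq> stage Q V' j" "\<forall>x\<in>D. g x \<in> stage Q V' j \<longrightarrow> g1 x = g x"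
    using remove_lenses[of A j V' Q D g] fin finQ V'o Suc.prems(4,5) by (auto simp: A_def Q_def)
  obtain P' V'' g' where g': "finite P'" "finite V''" "V'' \<subseteq> outer" "continuous_on D g'" "g' ` D \<subseteq> stage P' V'' 0"
      "\<forall>x\<in>D. g1 x \<in> stage Q V' 0 \<longrightarrow> g' x = g1 x"
    using Suc.IH[OF finQ fin V'o Suc.prems(4) g1(1,2)] by blast
  have "g' x = g x" if x: "x \<in> D" "g x \<in> stage P V 0" for x
  proof -
    have 0: "g x \<in> stage Q V' 0" using x(2) stage_mono[of P Q V V' 0] by (auto simp: Q_def V'_def)
    have "stage Q V' 0 \<subseteq> stage Q V' j"
      unfolding stage_def slab_def level_le_def by (auto intro!: image_mono) 
    then have "g1 x = g x" using g1(3) x(1) 0 by blast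
    then show ?thesis using g'(6) x(1) 0 by simp
  qed
  then show ?case using g' by blast
qed

text \<open>Here the lenses are complete. The power of the subtree has the extension property by
  coordinates, and each lens meets the union of the previous pieces exactly in its floor, a gauge
  ball.\<close>

lemma ext_set_tower:
  assumes P: "prefix_closed P" and V: "finite V" "V \<subseteq> outer" "\<And>v. v \<in> V \<Longrightarrow> flat_words v \<subseteq> P"
  shows "ext_set ((\<lambda>x. (x, \<lambda>_. 0)) ` subpow P \<union> (\<Union>v\<in>V. lens v))"
  using V
proof (induction V rule: finite_induct)
  case empty
  have "inj_on (\<lambda>x. (x, \<lambda>_. 0) :: cpoint) (subpow P)" by (rule inj_onI) simp
  moreover have "continuous_on (subpow P) (\<lambda>x. (x, \<lambda>_. 0) :: cpoint)" 
    by (intro continuous_on_Pair continuous_on_id continuous_on_const)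
  ultimately show ?case
    using P ext_set_subpow[OF P] compact_subpow[of P] by (simp add: ext_set_homeo prefix_closed_def)
next
  case (insert v V)
  define M where "M = (\<lambda>x. (x, \<lambda>_. 0) :: cpoint) ` subpow P \<union> (\<Union>w\<in>V. lens w)"
  have vt: "v \<in> tuples" using insert.prems outer_tuples by auto
  have fP: "finite P" using P by (simp add: prefix_closed_def)
  have "compact M"
    unfolding M_def using insert.hyps(1) compact_subpow[OF fP] compact_lens
    by (intro compact_Un compact_UN compact_continuous_image continuous_on_Pair continuous_on_id continuous_on_const) auto
  then have clM: "closed M" by (rule compact_imp_closed)
  have eq: "M \<inter> lens v = (\<lambda>z. (flat v z, \<lambda>_. 0) :: cpoint) ` {z \<in> coord_space {..<m}. stair (level v) z \<le> 1}"
  proof (intro equalityI subsetI)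
    fix y assume y: "y \<in> M \<inter> lens v"
    then obtain z h where z: "z \<in> coord_space {..<m}" "0 \<le> h" "stair (level v) z + h \<le> 1" "y = (flat v z, spike v h)"
      using lens_cases[of y v] by blast
    have "h = 0"
    proof (cases "y \<in> (\<lambda>x. (x, \<lambda>_. 0)) ` subpow P")
      case True then show ?thesis using z(4) spike_zero_iff by auto
    next
      case False
      then obtain w where w: "w \<in> V" "y \<in> lens w" using y by (auto simp: M_def)
      then obtain z' h' where "y = (flat w z', spike w h')" using lens_cases[of y w] by metis
      then show ?thesis using spike_distinct[OF vt, of w h h'] w insert z(4) outer_tuples by auto
    qed
    then show "y \<in> (\<lambda>z. (flat v z, \<lambda>_. 0) :: cpoint) ` {z \<in> coord_space {..<m}. stair (level v) z \<le> 1}" using z by auto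
  next
    fix y assume "y \<in> (\<lambda>z. (flat v z, \<lambda>_. 0) :: cpoint) ` {z \<in> coord_space {..<m}. stair (level v) z \<le> 1}"
    then obtain z where z: "z \<in> coord_space {..<m}" "stair (level v) z \<le> 1" "y = (flat v z, \<lambda>_. 0)" by auto
    have "flat v z \<in> subpow P" using flat_ball_subpow[OF z(2)] insert.prems(2)[of v] by simp
    moreover have "y \<in> lens v"
      unfolding lens_def by (rule image_eqI[of _ _ "(z, 0)"]) (use z in \<open>auto simp: lift_def lens_base_def\<close>)
    ultimately show "y \<in> M \<inter> lens v" using z(3) by (auto simp: M_def)
  qed
  have "ext_set (M \<inter> lens v)"
    unfolding eq
  proof (intro ext_set_homeo compact_gauge_ball gauge_stair ext_set_gauge_ball)
    show "continuous_on {z \<in> coord_space {..<m}. stair (level v) z \<le> 1} (\<lambda>z. (flat v z, \<lambda>_. 0) :: cpoint)"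
      by (intro continuous_on_Pair continuous_flat continuous_on_const)
    show "inj_on (\<lambda>z. (flat v z, \<lambda>_. 0) :: cpoint) {z \<in> coord_space {..<m}. stair (level v) z \<le> 1}"
      using flat_inject by (auto intro!: inj_onI)
  qed
  moreover have "ext_set M" unfolding M_def using insert by auto
  ultimately have "ext_set (M \<union> lens v)"
    using clM compact_lens compact_imp_closed ext_set_lens by (intro ext_set_Un) auto
  moreover have "M \<union> lens v = (\<lambda>x. (x, \<lambda>_. 0)) ` subpow P \<union> (\<Union>w\<in>insert v V. lens w)" by (auto simp: M_def)
  ultimately show ?case by simp
qed

text \<open>The map is extended into a finite tower of full lenses over the product of subtrees. The
  result is then pushed down to level 0 by \<open>descend\<close>, which does not move the points
  that are there already.\<close>

theorem extension_stage:
  fixes C D :: "(nat \<Rightarrow> real) set"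
  assumes C: "compact C" "compact D" "C \<subseteq> D" and f: "continuous_on C f" "f ` C \<subseteq> stage P V 0"
    and P: "finite P" "\<And>u. u \<in> P \<Longrightarrow> freely_reduced u" and V: "finite V" "V \<subseteq> outer"
  shows "\<exists>g P' V'. continuous_on D g \<and> finite P' \<and> finite V' \<and> V' \<subseteq> outer \<and> g ` D \<subseteq> stage P' V' 0 \<and> (\<forall>x\<in>C. g x = f x)"
proof -
  have "finite (P \<union> (\<Union>v\<in>V. flat_words v))" using P V finite_flat_words by auto
  moreover have "freely_reduced u" if "u \<in> P \<union> (\<Union>v\<in>V. flat_words v)" for u
    using that P(2) flat_words_reduced by auto
  ultimately obtain Q where Q: "prefix_closed Q" "P \<union> (\<Union>v\<in>V. flat_words v) \<subseteq> Q"
    using prefix_closed_superset by metis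
  have fQ: "finite Q" using Q by (simp add: prefix_closed_def)
  define M where "M = (\<lambda>x. (x, \<lambda>_. 0) :: cpoint) ` subpow Q \<union> (\<Union>v\<in>V. lens v)"
  have extM: "ext_set M" unfolding M_def using Q V by (intro ext_set_tower) auto
  have s0: "stage P V 0 \<subseteq> M"
  proof
    fix y assume "y \<in> stage P V 0"
    then consider "y \<in> slab P 0" | v where "v \<in> V" "y \<in> lens v \<or> y \<in> dome v" by (auto simp: stage_def)
    then show "y \<in> M"
    proof cases
      case 1
      then show ?thesis using Q subpow_mono[of P Q] by (auto simp: slab_def M_def)
    next
      case 2
      then have "y \<in> lens v" using dome_subset_rim rim_subset_lens by blast
      then show ?thesis using 2 by (auto simp: M_def)
    qed
  qed
  obtain g where g: "continuous_on D g" "g ` D \<subseteq> M" "\<And>x. x \<in> C \<Longrightarrow> g x = f x"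
    using ext_setE[OF extM C f(1)] f(2) s0 by blast
  \<comment> \<open>Only finitely many levels occur over \<open>Q\<close> and in \<open>V\<close>,
    so the tower is contained in a stage.\<close>
  define S where "S = level ` (V \<union> {v \<in> tuples. \<forall>i<m. v i \<in> Q})"
  have finS: "finite S" unfolding S_def using V finite_tuples_in[OF fQ] by simp
  define J where "J = Max (insert 0 S)"
  have J: "k \<le> J" if "k \<in> S" for k using finS that by (simp add: J_def)
  have "M \<subseteq> stage Q V J"
  proof
    fix y assume "y \<in> M"
    then consider x where "x \<in> subpow Q" "y = (x, \<lambda>_. 0)" | v where "v \<in> V" "y \<in> lens v" by (auto simp: M_def)
    then show "y \<in> stage Q V J"
    proof cases
      case 1
      have "level u \<le> J" if u: "u \<in> carrier_verts x" for u
      proof (rule J)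
        have "x \<in> tree_pow" using 1 by (simp add: subpow_def)
        then have "u i \<in> Q" if "i < m" for i using carrier_in(1)[OF _ u that] 1(1) that by (auto simp: subpow_def)
        then show "level u \<in> S" using u by (auto simp: S_def carrier_verts_def)
      qed
      then have "y \<in> slab Q J" using 1 by (simp add: slab_iff level_le_def)
      then show ?thesis by (simp add: stage_def)
    next
      case 2
      then show ?thesis using J[of "level v"] by (auto simp: stage_def S_def)
    qed
  qed
  then have gJ: "g ` D \<subseteq> stage Q V J" using g(2) by blast
  then obtain P' V' g' where g': "finite P'" "finite V'" "V' \<subseteq> outer" "continuous_on D g'" "g' ` D \<subseteq> stage P' V' 0"
      "\<forall>x\<in>D. g x \<in> stage Q V 0 \<longrightarrow> g' x = g x"
    using descend[OF fQ V compact_imp_closed[OF C(2)] g(1) gJ] by (elim exE conjE) (rule that)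
  have "g' x = f x" if "x \<in> C" for x
  proof -
    have "f x \<in> stage Q V 0" using f(2) that stage_mono[of P Q V V 0] Q(2) by auto
    then show ?thesis using g'(6) g(3)[OF that] that C(3) by auto
  qed
  then show ?thesis using g' by blast
qed

end

section \<open>The cells of the complex and the free action on its product with the sphere\<close>

section \<open>The cells of the level complex\<close>

datatype ycell = Cube "nat \<Rightarrow> w2" "nat \<Rightarrow> bool option" | Dome "nat \<Rightarrow> w2"

context tree_power
begin

definition dirs :: "(nat \<Rightarrow> bool option) \<Rightarrow> nat set" where
  "dirs d = {i. i < m \<and> d i \<noteq> None}"

text \<open>The parameter runs over \<open>[-1,1]\<close>, because cubes are handled as unit balls
  of the supremum norm.\<close>

definition cube_coord :: "w2 \<Rightarrow> bool option \<Rightarrow> real \<Rightarrow> w2 \<Rightarrow> real" where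
  "cube_coord w d t = (case d of None \<Rightarrow> vert w | Some s \<Rightarrow> edge_point w (w \<cdot> [(s, True)]) ((1 + t) / 2))"

definition cube_point :: "(nat \<Rightarrow> w2) \<Rightarrow> (nat \<Rightarrow> bool option) \<Rightarrow> (nat \<Rightarrow> real) \<Rightarrow> nat \<Rightarrow> w2 \<Rightarrow> real" where
  "cube_point w d z = (\<lambda>i. if i < m then cube_coord (w i) (d i) (z i) else (\<lambda>_. 0))"

text \<open>The vertex \<open>w\<close> is the lowest of the cube, whose heights run up to
  \<open>ht w + card (dirs d)\<close>. So the condition says that all vertices lie in the slab, and
  it bounds the dimension by \<open>m - 1\<close>.\<close>

definition cube_ok :: "(nat \<Rightarrow> w2) \<Rightarrow> (nat \<Rightarrow> bool option) \<Rightarrow> bool" where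
  "cube_ok w d \<longleftrightarrow> w \<in> tuples \<and> (\<forall>i\<ge>m. d i = None) \<and> 0 \<le> ht w \<and> ht w + int (card (dirs d)) \<le> int m - 1"

definition ycells :: "ycell set" where
  "ycells = {Cube w d | w d. cube_ok w d} \<union> Dome ` outer"

text \<open>A cell \<open>c\<close> is the image under \<open>ymap c\<close> of the unit ball of the gauge \<open>yN c\<close> on the coordinates \<open>yJ c\<close>.\<close>

fun yJ :: "ycell \<Rightarrow> nat set" where
  "yJ (Cube w d) = dirs d"
| "yJ (Dome v) = {..<m}"

fun yN :: "ycell \<Rightarrow> (nat \<Rightarrow> real) \<Rightarrow> real" where
  "yN (Cube w d) = sup_norm (dirs d)"
| "yN (Dome v) = stair (level v)"

fun ymap :: "ycell \<Rightarrow> (nat \<Rightarrow> real) \<Rightarrow> cpoint" where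
  "ymap (Cube w d) z = (cube_point w d z, \<lambda>_. 0)"
| "ymap (Dome v) z = lift v (z, 1 - stair (level v) z)"

definition yopen :: "ycell \<Rightarrow> cpoint set" where "yopen c = ymap c ` {z \<in> coord_space (yJ c). yN c z < 1}"
definition yclosed :: "ycell \<Rightarrow> cpoint set" where "yclosed c = ymap c ` {z \<in> coord_space (yJ c). yN c z \<le> 1}"

lemma finite_dirs [simp]: "finite (dirs d)"
  by (simp add: dirs_def)

lemma dirs_subset: "dirs d \<subseteq> {..<m}"
  by (auto simp: dirs_def)

lemma yJ_subset: "yJ c \<subseteq> {..<m}"
  using dirs_subset by (cases c) auto

lemma gauge_yN: "gauge (yJ c) (yN c)"
  by (cases c) (auto simp: gauge_sup_norm gauge_stair)

lemma continuous_ymap: "continuous_on S (ymap c)"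
proof (cases c)
  case (Cube w d)
  have "continuous_on S (cube_point w d)"
  proof (rule continuous_on_coordinatewise_then_product)
    fix i
    show "continuous_on S (\<lambda>z. cube_point w d z i)"
    proof (cases "i < m \<and> d i \<noteq> None")
      case True
      then obtain s where s: "d i = Some s" by auto
      have "continuous_on S (\<lambda>z :: nat \<Rightarrow> real. (1 + z i) / 2)"
        by (intro continuous_on_divide continuous_on_add continuous_on_const continuous_on_coord) auto
      then have "continuous_on S (\<lambda>z. edge_point (w i) (w i \<cdot> [(s, True)]) ((1 + z i) / 2))"
        by (intro continuous_on_compose2[OF continuous_edge_point]) auto
      then show ?thesis using True s by (simp add: cube_point_def cube_coord_def)
    next
      case False
      then show ?thesis by (cases "i < m"; cases "d i") (simp_all add: cube_point_def cube_coord_def continuous_on_const)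
    qed
  qed
  then show ?thesis using Cube by (simp add: continuous_on_Pair)
next
  case (Dome v)
  have "continuous_on S (\<lambda>z. lift v (z, 1 - stair (level v) z))"
    by (intro continuous_on_compose2[OF continuous_lift] continuous_on_Pair continuous_on_diff continuous_on_const
        continuous_on_id continuous_on_gauge_compose[OF gauge_stair]) auto
  then show ?thesis using Dome by simp
qed

lemma cube_coord_tree: "freely_reduced w \<Longrightarrow> \<bar>t\<bar> \<le> 1 \<Longrightarrow> cube_coord w d t \<in> tree"
  by (cases d) (auto simp: cube_coord_def vert_in_tree intro!: edge_in_tree)

lemma cube_coord_verts: "\<bar>t\<bar> \<le> 1 \<Longrightarrow> verts (cube_coord w d t) \<subseteq> {w} \<union> {w \<cdot> [(s, True)] | s. d = Some s}"
proof (cases d)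
  case (Some s)
  assume "\<bar>t\<bar> \<le> 1"
  then have "verts (edge_point w (w \<cdot> [(s, True)]) ((1 + t) / 2)) \<subseteq> {w, w \<cdot> [(s, True)]}" by (intro verts_edge_subset) auto
  then show ?thesis using Some by (auto simp: cube_coord_def)
qed (simp add: cube_coord_def)

lemma cube_coord_inject:
  assumes "freely_reduced w" "freely_reduced w'" "d \<noteq> None \<longrightarrow> \<bar>t\<bar> < 1" "d' \<noteq> None \<longrightarrow> \<bar>t'\<bar> < 1"
    "cube_coord w d t = cube_coord w' d' t'"
  shows "w = w'" "d = d'" "d \<noteq> None \<longrightarrow> t = t'"
proof -
  have V: "verts (cube_coord w d t) = (case d of None \<Rightarrow> {w} | Some s \<Rightarrow> {w, w \<cdot> [(s, True)]})"
    if "freely_reduced w" "d \<noteq> None \<longrightarrow> \<bar>t\<bar> < 1" for w d t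
    using that by (cases d) (auto simp: cube_coord_def verts_edge')
  have ne: "w \<noteq> w \<cdot> [(s, True)]" if "freely_reduced w" for w :: w2 and s using mul_single_neq[OF that] by metis
  have eq: "(case d of None \<Rightarrow> {w} | Some s \<Rightarrow> {w, w \<cdot> [(s, True)]}) = (case d' of None \<Rightarrow> {w'} | Some s \<Rightarrow> {w', w' \<cdot> [(s, True)]})"
    using V[OF assms(1,3)] V[OF assms(2,4)] assms(5) by simp
  have "w = w' \<and> d = d' \<and> (d \<noteq> None \<longrightarrow> t = t')"
  proof (cases d)
    case None
    then show ?thesis using eq ne[OF assms(2)] by (cases d') (auto, metis insertI1 insert_iff singletonD)
  next
    case (Some s)
    then obtain s' where s': "d' = Some s'" using eq ne[OF assms(1)] by (cases d') (auto, metis insertI1 insert_iff singletonD)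
    have "0 < (1 + t) / 2" "(1 + t) / 2 < 1" "0 < (1 + t') / 2" "(1 + t') / 2 < 1" using assms(3,4) Some s' by auto
    moreover have "edge_point w (w \<cdot> [(s, True)]) ((1 + t) / 2) = edge_point w' (w' \<cdot> [(s', True)]) ((1 + t') / 2)"
      using assms(5) Some s' by (simp add: cube_coord_def)
    ultimately have "w = w'" "s = s'" "(1 + t) / 2 = (1 + t') / 2" using edge_unique[OF assms(1,2)] by metis+
    then show ?thesis using Some s' by simp
  qed
  then show "w = w'" "d = d'" "d \<noteq> None \<longrightarrow> t = t'" by auto
qed

lemma ymap_inj: "c \<in> ycells \<Longrightarrow> inj_on (ymap c) {z \<in> coord_space (yJ c). yN c z < 1}"
proof (rule inj_onI)
  fix z z' assume c: "c \<in> ycells" and z: "z \<in> {z \<in> coord_space (yJ c). yN c z < 1}" "z' \<in> {z \<in> coord_space (yJ c). yN c z < 1}"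
    and eq: "ymap c z = ymap c z'"
  show "z = z'"
  proof (cases c)
    case (Cube w d)
    have w: "freely_reduced (w i)" if "i < m" for i using c Cube that by (auto simp: ycells_def cube_ok_def tuples_def)
    show ?thesis
    proof
      fix i
      show "z i = z' i"
      proof (cases "i \<in> dirs d")
        case True
        then have i: "i < m" "d i \<noteq> None" by (auto simp: dirs_def)
        have "cube_point w d z i = cube_point w d z' i" using eq Cube by simp
        then have "cube_coord (w i) (d i) (z i) = cube_coord (w i) (d i) (z' i)" using i by (simp add: cube_point_def)
        moreover have "\<bar>z i\<bar> < 1" "\<bar>z' i\<bar> < 1" using z Cube True by (auto simp: sup_norm_less)
        ultimately show ?thesis using cube_coord_inject(3)[OF w[OF i(1)] w[OF i(1)]] i by metis
      qed (use z Cube in \<open>auto simp: coord_space_def\<close>)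
    qed
  next
    case (Dome v)
    then show ?thesis using eq z flat_inject by (auto simp: lift_def)
  qed
qed

text \<open>Inside a dome the height is positive and the support of the second component names the
  vertex. On the slab the base vertex and the directions are recovered in each coordinate from the
  carrier.\<close>

lemma yopen_disjoint:
  assumes c: "c \<in> ycells" "c' \<in> ycells" and y: "y \<in> yopen c" "y \<in> yopen c'"
  shows "c = c'"
proof -
  obtain z z' where z: "z \<in> coord_space (yJ c)" "yN c z < 1" "y = ymap c z" and z': "z' \<in> coord_space (yJ c')" "yN c' z' < 1" "y = ymap c' z'"
    using y by (auto simp: yopen_def)
  show ?thesis
  proof (cases c)
    case C: (Cube w d)
    show ?thesis
    proof (cases c')
      case C': (Cube w' d')
      have ok: "w \<in> tuples" "w' \<in> tuples" "\<forall>i\<ge>m. d i = None" "\<forall>i\<ge>m. d' i = None"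
        using c C C' by (auto simp: ycells_def cube_ok_def)
      have eq: "cube_point w d z = cube_point w' d' z'" using z z' C C' by simp
      have "w i = w' i \<and> d i = d' i" for i
      proof (cases "i < m")
        case True
        have "cube_coord (w i) (d i) (z i) = cube_coord (w' i) (d' i) (z' i)"
          using fun_cong[OF eq, of i] True by (simp add: cube_point_def)
        moreover have "d i \<noteq> None \<longrightarrow> \<bar>z i\<bar> < 1" "d' i \<noteq> None \<longrightarrow> \<bar>z' i\<bar> < 1"
          using z(2) z'(2) C C' True by (auto simp: sup_norm_less dirs_def)
        moreover have "freely_reduced (w i)" "freely_reduced (w' i)" using ok True by (auto simp: tuples_def)
        ultimately show ?thesis
          using cube_coord_inject(1,2)[of "w i" "w' i" "d i" "z i" "d' i" "z' i"] by blast
      qed (use ok in \<open>auto simp: tuples_def\<close>)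
      then show ?thesis using C C' by (simp add: fun_eq_iff)
    next
      case (Dome v')
      then show ?thesis using z z' C spike_zero_iff[of v'] by (auto simp: lift_def)
    qed
  next
    case C: (Dome v)
    show ?thesis
    proof (cases c')
      case (Cube w' d')
      then have "spike v (1 - stair (level v) z) = (\<lambda>_. 0)" using z z' C by (auto simp: lift_def)
      then have "1 - stair (level v) z = 0" by (simp only: spike_zero_iff)
      then show ?thesis using z(2) C by simp
    next
      case C': (Dome v')
      have "v \<in> tuples" "v' \<in> tuples" using c C C' outer_tuples by (auto simp: ycells_def)
      moreover have "spike v (1 - stair (level v) z) = spike v' (1 - stair (level v') z')"
        using z(3) z'(3) C C' by (simp add: lift_def)
      moreover have "1 - stair (level v) z \<noteq> 0" using z(2) C by simp
      ultimately show ?thesis using spike_distinct[of v v'] C C' by blast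
    qed
  qed
qed

definition cubes_in :: "w2 set \<Rightarrow> ycell set" where
  "cubes_in P = {Cube w d | w d. cube_ok w d \<and> (\<forall>i<m. w i \<in> P)}"

lemma finite_cubes_in: "finite P \<Longrightarrow> finite (cubes_in P)"
proof -
  assume P: "finite P"
  let ?O = "(\<lambda>f i. if i < m then f i else None) ` PiE {..<m} (\<lambda>_. UNIV :: bool option set)"
  have "cubes_in P \<subseteq> (\<lambda>(w, d). Cube w d) ` ({v \<in> tuples. \<forall>i<m. v i \<in> P} \<times> ?O)"
  proof
    fix c assume "c \<in> cubes_in P"
    then obtain w d where c: "c = Cube w d" "cube_ok w d" "\<forall>i<m. w i \<in> P" by (auto simp: cubes_in_def)
    have "d = (\<lambda>i. if i < m then restrict d {..<m} i else None)" using c(2) by (auto simp: cube_ok_def fun_eq_iff)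
    then have "d \<in> ?O" by (rule image_eqI[of _ _ "restrict d {..<m}"]) auto
    then show "c \<in> (\<lambda>(w, d). Cube w d) ` ({v \<in> tuples. \<forall>i<m. v i \<in> P} \<times> ?O)"
      using c by (auto simp: cube_ok_def intro!: image_eqI[of _ _ "(w, d)"])
  qed
  moreover have "finite ?O" by (intro finite_imageI finite_PiE) auto
  ultimately show ?thesis using finite_tuples_in[OF P] by (meson finite_SigmaI finite_imageI finite_subset)
qed

lemma cubes_in_ycells: "cubes_in P \<subseteq> ycells"
  by (auto simp: cubes_in_def ycells_def)

text \<open>For a point of the slab the cardinality of this set is the dimension of the open cube
  that contains it; it shows the drop of dimension at the boundary.\<close>

definition nonvertex :: "(nat \<Rightarrow> w2 \<Rightarrow> real) \<Rightarrow> nat set" where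
  "nonvertex x = {i. i < m \<and> (\<forall>w. x i \<noteq> vert w)}"

lemma ht_add_dirs:
  assumes "\<And>i. i < m \<Longrightarrow> height (u i) = height (w i) + (if i \<in> S then 1 else 0)" "S \<subseteq> {..<m}"
  shows "ht u = ht w + int (card S)"
proof -
  have "ht u = (\<Sum>i<m. height (w i) + (if i \<in> S then 1 else 0))" unfolding ht_def using assms(1) by (intro sum.cong) auto
  also have "\<dots> = ht w + (\<Sum>i<m. if i \<in> S then 1 else 0)" by (simp add: sum.distrib ht_def)
  also have "(\<Sum>i<m. if i \<in> S then 1 else 0 :: int) = int (card S)"
    using assms(2) by (simp add: sum.If_cases Int_absorb1)
  finally show ?thesis .
qed

text \<open>The lowest and the highest vertex of the carrier have level 0, which gives the two
  bounds in \<open>cube_ok\<close>.\<close>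

lemma slab_point_cube:
  assumes x: "x \<in> tree_pow" "level_le 0 x"
  obtains w d where "cube_ok w d" "(x, \<lambda>_. 0) \<in> yopen (Cube w d)" "\<And>i. i < m \<Longrightarrow> w i \<in> verts (x i)"
    "dirs d = nonvertex x"
proof -
  have "\<exists>w s t. freely_reduced w \<and> x i = cube_coord w s t \<and> \<bar>t\<bar> < 1 \<and> w \<in> verts (x i) \<and>
      (s = None \<longleftrightarrow> (\<exists>v. x i = vert v)) \<and> (\<forall>r. s = Some r \<longrightarrow> w \<cdot> [(r, True)] \<in> verts (x i))" if i: "i < m" for i
  proof -
    have "x i \<in> tree" using x i by (simp add: tree_pow_def)
    then show ?thesis
    proof (cases rule: tree_cases)
      case (vertex w)
      then show ?thesis by (intro exI[of _ w] exI[of _ None] exI[of _ 0]) (auto simp: cube_coord_def)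
    next
      case (edge w s t)
      have V: "verts (x i) = {w, w \<cdot> [(s, True)]}" using edge verts_edge' by simp
      have "x i \<noteq> vert v" for v
      proof
        assume "x i = vert v"
        then show False using V mul_single_neq[OF edge(1), of "(s, True)"] by auto
      qed
      then show ?thesis using edge V
        by (intro exI[of _ w] exI[of _ "Some s"] exI[of _ "2 * t - 1"]) (auto simp: cube_coord_def)
    qed
  qed
  then obtain w s t where wst: "\<And>i. i < m \<Longrightarrow> freely_reduced (w i) \<and> x i = cube_coord (w i) (s i) (t i) \<and> \<bar>t i\<bar> < 1 \<and> w i \<in> verts (x i) \<and>
      (s i = None \<longleftrightarrow> (\<exists>v. x i = vert v)) \<and> (\<forall>r. s i = Some r \<longrightarrow> w i \<cdot> [(r, True)] \<in> verts (x i))"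
    by metis
  have xi: "x i = cube_coord (w i) (s i) (t i)" if "i < m" for i using wst[OF that] by blast
  have wv: "freely_reduced (w i)" "w i \<in> verts (x i)" "\<bar>t i\<bar> < 1" "s i = None \<longleftrightarrow> (\<exists>v. x i = vert v)" if "i < m" for i
    using wst[OF that] by blast+
  have wr: "w i \<cdot> [(r, True)] \<in> verts (x i)" if "i < m" "s i = Some r" for i r using wst[OF that(1)] that(2) by blast
  define w' where "w' i = (if i < m then w i else [])" for i
  define d where "d i = (if i < m then s i else None)" for i
  define z where "z i = (if i \<in> dirs d then t i else 0)" for i
  define u where "u i = (if i < m then case s i of None \<Rightarrow> w i | Some r \<Rightarrow> w i \<cdot> [(r, True)] else [])" for i
  have w': "w' \<in> carrier_verts x" using wv(1,2) by (auto simp: w'_def carrier_verts_def tuples_def)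
  have u: "u \<in> carrier_verts x" using wv(1,2) wr by (auto simp: u_def carrier_verts_def tuples_def split: option.splits)
  have dn: "dirs d = nonvertex x" unfolding dirs_def nonvertex_def d_def using wv(4) by (intro Collect_cong) (metis (no_types))
  have "ht u = ht w' + int (card (dirs d))"
    by (rule ht_add_dirs) (auto simp: u_def w'_def dirs_def d_def split: option.splits)
  moreover have "level w' = 0" "level u = 0" using x(2) w' u by (auto simp: level_le_def)
  ultimately have ok: "cube_ok w' d"
    using w' by (auto simp: cube_ok_def carrier_verts_def d_def level_def level_of_def)
  have "x = cube_point w' d z"
  proof
    fix i show "x i = cube_point w' d z i"
      using xi[of i] x(1) by (cases "i < m"; cases "s i")
        (auto simp: cube_point_def w'_def d_def z_def dirs_def tree_pow_def cube_coord_def)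
  qed
  moreover have "z \<in> coord_space (dirs d)" "sup_norm (dirs d) z < 1"
    using wv(3) by (auto simp: z_def coord_space_def sup_norm_less dirs_def)
  ultimately have "(x, \<lambda>_. 0) \<in> yopen (Cube w' d)" by (auto simp: yopen_def)
  then show thesis using that ok dn wv(2) by (simp add: w'_def)
qed

lemma cube_closed_slab:
  assumes ok: "cube_ok w d" and z: "sup_norm (dirs d) z \<le> 1" "z \<in> coord_space (dirs d)"
  shows "cube_point w d z \<in> tree_pow" "level_le 0 (cube_point w d z)"
    "i < m \<Longrightarrow> verts (cube_point w d z i) \<subseteq> {w i} \<union> {w i \<cdot> [(s, True)] | s. d i = Some s}"
    "nonvertex (cube_point w d z) \<subseteq> {i \<in> dirs d. \<bar>z i\<bar> < 1}"
proof -
  have zi: "\<bar>z i\<bar> \<le> 1" if "i < m" for i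
    using z that by (cases "i \<in> dirs d") (auto simp: sup_norm_le coord_space_def)
  have w: "freely_reduced (w i)" if "i < m" for i using ok that by (auto simp: cube_ok_def tuples_def)
  show 1: "cube_point w d z \<in> tree_pow"
    using zi w cube_coord_tree by (auto simp: tree_pow_def cube_point_def)
  show V: "verts (cube_point w d z i) \<subseteq> {w i} \<union> {w i \<cdot> [(s, True)] | s. d i = Some s}" if "i < m" for i
    using cube_coord_verts[OF zi[OF that], of "w i" "d i"] that by (simp add: cube_point_def)
  show "level_le 0 (cube_point w d z)"
    unfolding level_le_def
  proof
    fix u assume u: "u \<in> carrier_verts (cube_point w d z)"
    define S where "S = {i\<in>dirs d. u i \<noteq> w i}"
    have "u i = w i \<or> (\<exists>s. d i = Some s \<and> u i = w i \<cdot> [(s, True)])" if "i < m" for i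
      using V[OF that] u that by (auto simp: carrier_verts_def)
    then have "height (u i) = height (w i) + (if i \<in> S then 1 else 0)" if "i < m" for i
      using that mul_single_neq[OF w[OF that]] by (fastforce simp: S_def dirs_def)
    then have h: "ht u = ht w + int (card S)"
      by (rule ht_add_dirs) (auto simp: S_def dirs_def)
    have "card S \<le> card (dirs d)" by (rule card_mono) (auto simp: S_def)
    then show "level u \<le> 0" using h ok by (auto simp: level_def level_of_def cube_ok_def)
  qed
  show "nonvertex (cube_point w d z) \<subseteq> {i \<in> dirs d. \<bar>z i\<bar> < 1}"
  proof
    fix i assume i: "i \<in> nonvertex (cube_point w d z)"
    then have im: "i < m" and nv: "\<And>v. cube_coord (w i) (d i) (z i) \<noteq> vert v" by (auto simp: nonvertex_def cube_point_def)
    have "d i \<noteq> None" using nv[of "w i"] by (auto simp: cube_coord_def)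
    then obtain s where s: "d i = Some s" by auto
    have "z i \<noteq> 1" "z i \<noteq> -1" using nv[of "w i \<cdot> [(s, True)]"] nv[of "w i"] s by (auto simp: cube_coord_def)
    then show "i \<in> {i \<in> dirs d. \<bar>z i\<bar> < 1}" using zi[OF im] im s by (auto simp: dirs_def)
  qed
qed

text \<open>On the boundary of a cube some coordinate has become a vertex. The boundary of a dome
  lies in the slab, all of whose cubes have dimension less than \<open>m\<close>.\<close>

lemma yboundary:
  assumes c: "c \<in> ycells"
  shows "\<exists>F. finite F \<and> F \<subseteq> ycells \<and> (\<forall>c'\<in>F. card (yJ c') < card (yJ c)) \<and>
     ymap c ` {z \<in> coord_space (yJ c). yN c z = 1} \<subseteq> (\<Union>c'\<in>F. yopen c')"
proof -
  have slab: "\<exists>c'\<in>cubes_in P. card (yJ c') = card (nonvertex x) \<and> (x, \<lambda>_. 0) \<in> yopen c' \<and> card (yJ c') < m"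
    if x: "x \<in> subpow P" "level_le 0 x" for x P
  proof -
    have xt: "x \<in> tree_pow" using x by (simp add: subpow_def)
    obtain w d where wd: "cube_ok w d" "(x, \<lambda>_. 0) \<in> yopen (Cube w d)" "\<And>i. i < m \<Longrightarrow> w i \<in> verts (x i)" "dirs d = nonvertex x"
      using slab_point_cube[OF xt x(2)] by metis
    have "Cube w d \<in> cubes_in P" using wd x by (auto simp: cubes_in_def subpow_def)
    moreover have "card (dirs d) < m" using wd(1) by (auto simp: cube_ok_def)
    ultimately show ?thesis using wd by (intro bexI[of _ "Cube w d"]) auto
  qed
  show ?thesis
  proof (cases c)
    case (Cube w d)
    have ok: "cube_ok w d" using c Cube by (auto simp: ycells_def)
    define P where "P = (\<Union>i<m. {w i} \<union> (\<lambda>s. w i \<cdot> [(s, True)]) ` UNIV)"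
    define F where "F = {c'\<in>cubes_in P. card (yJ c') < card (dirs d)}"
    have "finite P" by (auto simp: P_def)
    then have "finite F" using finite_cubes_in by (simp add: F_def)
    moreover have "ymap c z \<in> (\<Union>c'\<in>F. yopen c')" if z: "z \<in> coord_space (dirs d)" "sup_norm (dirs d) z = 1" for z
    proof -
      note cl = cube_closed_slab[OF ok _ z(1)]
      have z1: "sup_norm (dirs d) z \<le> 1" using z by simp
      have "cube_point w d z \<in> subpow P"
        using cl(1)[OF z1] cl(3)[OF z1] by (fastforce simp: subpow_def P_def)
      then obtain c' where c': "c' \<in> cubes_in P" "card (yJ c') = card (nonvertex (cube_point w d z))" "ymap c z \<in> yopen c'"
        using slab[OF _ cl(2)[OF z1]] Cube by auto
      have "\<exists>i\<in>dirs d. \<not> \<bar>z i\<bar> < 1" using z(2) sup_norm_less[of "dirs d" z 1] by auto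
      then have "{i \<in> dirs d. \<bar>z i\<bar> < 1} \<subset> dirs d" by auto
      then have "nonvertex (cube_point w d z) \<subset> dirs d" using cl(4)[OF z1] by blast
      then have "card (yJ c') < card (dirs d)" using c'(2) by (simp add: psubset_card_mono)
      then show ?thesis using c' by (auto simp: F_def)
    qed
    ultimately show ?thesis
      using Cube cubes_in_ycells by (intro exI[of _ F]) (auto simp: F_def)
  next
    case (Dome v)
    have v: "v \<in> outer" using c Dome by (auto simp: ycells_def)
    define F where "F = {c'\<in>cubes_in (flat_words v). card (yJ c') < m}"
    have "finite F" using finite_cubes_in[OF finite_flat_words] by (simp add: F_def)
    moreover have "ymap c z \<in> (\<Union>c'\<in>F. yopen c')" if z: "stair (level v) z = 1" for z
    proof -
      have z1: "stair (level v) z \<le> 1" "1 \<le> stair (level v) z" using z by auto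
      have "flat v z \<in> subpow (flat_words v)" using flat_ball_subpow[OF z1(1)] by simp
      moreover have "level_le 0 (flat v z)"
        unfolding level_le_def using flat_ball_level(3)[OF outer_tuples[OF v] outer_level[OF v] z1(1) _ z1(2)] by simp
      ultimately show ?thesis using slab[of "flat v z"] z Dome by (auto simp: F_def lift_def)
    qed
    ultimately show ?thesis
      using Dome cubes_in_ycells by (intro exI[of _ F]) (auto simp: F_def)
  qed
qed

lemma yopen_subset: "yopen c \<subseteq> yclosed c"
  by (auto simp: yopen_def yclosed_def)

lemma stage_in_cells:
  assumes P: "finite P" and V: "finite V" "V \<subseteq> outer"
  obtains F where "finite F" "F \<subseteq> ycells" "stage P V 0 \<subseteq> (\<Union>c\<in>F. yclosed c)"
proof
  let ?F = "cubes_in P \<union> Dome ` V"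
  show "finite ?F" "?F \<subseteq> ycells" using finite_cubes_in[OF P] V cubes_in_ycells by (auto simp: ycells_def)
  show "stage P V 0 \<subseteq> (\<Union>c\<in>?F. yclosed c)"
  proof
    fix y assume "y \<in> stage P V 0"
    then consider "y \<in> slab P 0" | v where "v \<in> V" "level v = 0" | v where "v \<in> V" "y \<in> dome v" by (auto simp: stage_def)
    then show "y \<in> (\<Union>c\<in>?F. yclosed c)"
    proof cases
      case 1
      then have x: "fst y \<in> subpow P" "fst y \<in> tree_pow" "level_le 0 (fst y)" "y = (fst y, \<lambda>_. 0)"
        by (auto simp: slab_iff subpow_def prod_eq_iff)
      obtain w d where wd: "cube_ok w d" "(fst y, \<lambda>_. 0) \<in> yopen (Cube w d)" "\<And>i. i < m \<Longrightarrow> w i \<in> verts (fst y i)"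
        using slab_point_cube[OF x(2,3)] by metis
      have "Cube w d \<in> cubes_in P" using wd x by (auto simp: cubes_in_def subpow_def)
      then show ?thesis using wd(2) x(4) yopen_subset by fastforce
    next
      case 2 then show ?thesis using V outer_level by fastforce
    next
      case 3 then show ?thesis by (auto simp: dome_def yclosed_def intro!: bexI[of _ "Dome v"])
    qed
  qed
qed

lemma cells_in_stage:
  assumes F: "finite F" "F \<subseteq> ycells"
  obtains P V where "finite P" "\<And>u. u \<in> P \<Longrightarrow> freely_reduced u" "finite V" "V \<subseteq> outer" "(\<Union>c\<in>F. yclosed c) \<subseteq> stage P V 0"
proof
  define V where "V = {v. Dome v \<in> F}"
  define W where "W = {w. \<exists>d. Cube w d \<in> F}"
  define P where "P = (\<Union>w\<in>W. \<Union>i<m. {w i} \<union> (\<lambda>s. w i \<cdot> [(s, True)]) ` UNIV)"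
  have "V = Dome -` F" by (auto simp: V_def)
  then show "finite V" using F by (simp add: finite_vimageI inj_def)
  have "W \<subseteq> (\<lambda>c. case c of Cube w d \<Rightarrow> w | Dome v \<Rightarrow> v) ` F" by (force simp: W_def)
  then have "finite W" using F finite_subset by blast
  then show "finite P" by (auto simp: P_def)
  show "V \<subseteq> outer" using F by (auto simp: V_def ycells_def)
  show "freely_reduced u" if "u \<in> P" for u
    using that F by (fastforce simp: P_def W_def ycells_def cube_ok_def tuples_def)
  show "(\<Union>c\<in>F. yclosed c) \<subseteq> stage P V 0"
  proof
    fix y assume "y \<in> (\<Union>c\<in>F. yclosed c)"
    then obtain c z where c: "c \<in> F" "z \<in> coord_space (yJ c)" "yN c z \<le> 1" "y = ymap c z" by (auto simp: yclosed_def)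
    show "y \<in> stage P V 0"
    proof (cases c)
      case (Cube w d)
      have ok: "cube_ok w d" using c(1) Cube F by (auto simp: ycells_def)
      have z: "z \<in> coord_space (dirs d)" "sup_norm (dirs d) z \<le> 1" using c Cube by auto
      have "w \<in> W" using c Cube by (auto simp: W_def)
      then have "cube_point w d z \<in> subpow P"
        using cube_closed_slab(1)[OF ok z(2,1)] cube_closed_slab(3)[OF ok z(2,1)] by (auto simp: subpow_def P_def) blast
      then have "y \<in> slab P 0" using cube_closed_slab(2)[OF ok z(2,1)] c Cube by (simp add: slab_iff)
      then show ?thesis by (simp add: stage_def)
    next
      case (Dome v)
      then have "y \<in> dome v" "v \<in> V" using c by (auto simp: dome_def V_def)
      then show ?thesis by (auto simp: stage_def)
    qed
  qed
qed

theorem yextension: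
  fixes C D :: "(nat \<Rightarrow> real) set"
  assumes C: "compact C" "compact D" "C \<subseteq> D" and f: "continuous_on C f" and F: "finite F" "F \<subseteq> ycells" "f ` C \<subseteq> (\<Union>c\<in>F. yclosed c)"
  shows "\<exists>g F'. continuous_on D g \<and> finite F' \<and> F' \<subseteq> ycells \<and> g ` D \<subseteq> (\<Union>c\<in>F'. yclosed c) \<and> (\<forall>x\<in>C. g x = f x)"
proof -
  obtain P V where PV: "finite P" "\<And>u. u \<in> P \<Longrightarrow> freely_reduced u" "finite V" "V \<subseteq> outer" "(\<Union>c\<in>F. yclosed c) \<subseteq> stage P V 0"
    using cells_in_stage[OF F(1,2)] by metis
  have fs: "f ` C \<subseteq> stage P V 0" using F(3) PV(5) by blast
  have "\<exists>g P' V'. continuous_on D g \<and> finite P' \<and> finite V' \<and> V' \<subseteq> outer \<and> g ` D \<subseteq> stage P' V' 0 \<and> (\<forall>x\<in>C. g x = f x)"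
    by (rule extension_stage[OF C f fs PV(1) _ PV(3,4)]) (rule PV(2))
  then obtain g P' V' where g: "continuous_on D g" "finite P'" "finite V'" "V' \<subseteq> outer" "g ` D \<subseteq> stage P' V' 0" "\<forall>x\<in>C. g x = f x"
    by (elim exE conjE) (rule that)
  obtain F' where "finite F'" "F' \<subseteq> ycells" "stage P' V' 0 \<subseteq> (\<Union>c\<in>F'. yclosed c)"
    using stage_in_cells[OF g(2,3,4)] by blast
  then show ?thesis using g by (intro exI[of _ g] exI[of _ F']) auto
qed

end

section \<open>The infinite sphere with its antipodal cell structure\<close>

abbreviation sg :: "bool \<Rightarrow> real" where "sg \<sigma> \<equiv> (if \<sigma> then -1 else 1)"

text \<open>The sign multiplies the whole vector and not only the last coordinate. So the antipodal
  map carries one cell of a dimension to the other without a change of parameters, as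
  \<open>perm\<close> demands.\<close>

definition hemi :: "nat \<Rightarrow> bool \<Rightarrow> (nat \<Rightarrow> real) \<Rightarrow> nat \<Rightarrow> real" where
  "hemi n \<sigma> y = (\<lambda>k. if k < n then sg \<sigma> * y k else if k = n then sg \<sigma> * sqrt (1 - (\<Sum>i<n. (y i)\<^sup>2)) else 0)"

definition sphere_upto :: "nat \<Rightarrow> (nat \<Rightarrow> real) set" where
  "sphere_upto n = {e \<in> coord_space {..<Suc n}. (\<Sum>k<Suc n. (e k)\<^sup>2) = 1}"

lemma continuous_hemi: "continuous_on S (hemi n \<sigma>)"
proof (rule continuous_on_coordinatewise_then_product)
  fix k
  have "continuous_on S (\<lambda>y. sg \<sigma> * y k)" "continuous_on S (\<lambda>y. sg \<sigma> * sqrt (1 - (\<Sum>i<n. (y i)\<^sup>2)))"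
    by (intro continuous_on_mult continuous_on_const continuous_on_coord continuous_on_real_sqrt continuous_on_diff
        continuous_on_sum continuous_on_power)+
  then show "continuous_on S (\<lambda>y. hemi n \<sigma> y k)"
    by (cases "k < n"; cases "k = n") (simp_all add: hemi_def continuous_on_const)
qed

lemma hemi_antipode: "(\<lambda>k. sg \<epsilon> * hemi n \<sigma> y k) = hemi n (\<sigma> \<noteq> \<epsilon>) y"
  by (auto simp: hemi_def fun_eq_iff)

lemma disc_sum: "y \<in> topspace (disc n) \<longleftrightarrow> y \<in> coord_space {..<n} \<and> (\<Sum>i<n. (y i)\<^sup>2) \<le> 1"
  "y \<in> disc_interior n \<longleftrightarrow> y \<in> coord_space {..<n} \<and> (\<Sum>i<n. (y i)\<^sup>2) < 1"
  by (auto simp: disc_euclid euclid_def)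

lemma hemi_sphere: "y \<in> topspace (disc n) \<Longrightarrow> hemi n \<sigma> y \<in> sphere_upto n"
proof -
  assume y: "y \<in> topspace (disc n)"
  have "(\<Sum>k<n. (hemi n \<sigma> y k)\<^sup>2) = (\<Sum>k<n. (y k)\<^sup>2)" by (intro sum.cong) (auto simp: hemi_def)
  moreover have "(hemi n \<sigma> y n)\<^sup>2 = 1 - (\<Sum>k<n. (y k)\<^sup>2)" using y by (simp add: hemi_def disc_sum)
  ultimately have "(\<Sum>k<Suc n. (hemi n \<sigma> y k)\<^sup>2) = 1" by simp
  then show ?thesis by (auto simp: sphere_upto_def coord_space_def hemi_def)
qed

lemma hemi_inject:
  assumes y: "y \<in> disc_interior n" "y' \<in> disc_interior n'" and eq: "hemi n \<sigma> y = hemi n' \<sigma>' y'"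
  shows "n = n'" "\<sigma> = \<sigma>'" "y = y'"
proof -
  have pos: "0 < sqrt (1 - (\<Sum>i<n. (y i)\<^sup>2))" "0 < sqrt (1 - (\<Sum>i<n'. (y' i)\<^sup>2))" using y by (auto simp: disc_sum)
  show n: "n = n'"
  proof (rule ccontr)
    assume "n \<noteq> n'"
    then consider "n < n'" | "n' < n" by linarith
    then show False
    proof cases
      case 1
      then have "hemi n \<sigma> y n' = 0" "hemi n' \<sigma>' y' n' \<noteq> 0" using pos by (auto simp: hemi_def)
      then show False using eq by simp
    next
      case 2
      then have "hemi n \<sigma> y n \<noteq> 0" "hemi n' \<sigma>' y' n = 0" using pos by (auto simp: hemi_def)
      then show False using eq by simp
    qed
  qed
  have "sg \<sigma> * sqrt (1 - (\<Sum>i<n. (y i)\<^sup>2)) = sg \<sigma>' * sqrt (1 - (\<Sum>i<n. (y' i)\<^sup>2))"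
    using fun_cong[OF eq, of n] n by (simp add: hemi_def)
  then show s: "\<sigma> = \<sigma>'" 
    using pos[unfolded n] unfolding n by (cases \<sigma>; cases \<sigma>'; simp only: if_True if_False; linarith)
  show "y = y'"
  proof
    fix i
    show "y i = y' i"
      using fun_cong[OF eq, of i] y n s by (cases "i < n"; cases \<sigma>) (auto simp: hemi_def disc_sum coord_space_def)
  qed
qed

text \<open>The dimension of the cell is the index of the last nonzero coordinate, whose sign
  selects the hemisphere.\<close>

lemma sphere_cells:
  assumes e: "e \<in> sphere_upto N"
  obtains n \<sigma> y where "n \<le> N" "y \<in> disc_interior n" "e = hemi n \<sigma> y"
proof -
  define S where "S = {k. e k \<noteq> 0}"
  have sub: "S \<subseteq> {..<Suc N}" using e by (auto simp: S_def sphere_upto_def coord_space_def)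
  have fin: "finite S" using sub finite_subset by blast
  have "S \<noteq> {}"
  proof
    assume "S = {}"
    then have "(\<Sum>k<Suc N. (e k)\<^sup>2) = 0" by (auto simp: S_def)
    then show False using e by (simp add: sphere_upto_def)
  qed
  define n where "n = Max S"
  have n: "e n \<noteq> 0" using Max_in[OF fin \<open>S \<noteq> {}\<close>] by (simp add: n_def S_def)
  have above: "e k = 0" if "n < k" for k using Max_ge[OF fin, of k] that by (auto simp: n_def S_def not_le[symmetric])
  have nN: "n \<le> N" using n sub by (auto simp: S_def)
  define \<sigma> where "\<sigma> = (e n < 0)"
  define y where "y k = (if k < n then sg \<sigma> * e k else 0)" for k
  have "(\<Sum>k<Suc N. (e k)\<^sup>2) = (\<Sum>k<Suc n. (e k)\<^sup>2)"
    using nN above by (intro sum.mono_neutral_right) auto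
  then have 1: "(\<Sum>k<n. (e k)\<^sup>2) + (e n)\<^sup>2 = 1" using e by (simp add: sphere_upto_def)
  have ye: "(\<Sum>k<n. (y k)\<^sup>2) = (\<Sum>k<n. (e k)\<^sup>2)" by (intro sum.cong) (auto simp: y_def)
  have en: "0 < (e n)\<^sup>2" using n by simp
  have "(\<Sum>k<n. (y k)\<^sup>2) < 1" using ye 1 en by linarith
  then have "y \<in> disc_interior n" unfolding disc_sum by (simp add: coord_space_def y_def)
  moreover have "e = hemi n \<sigma> y"
  proof
    fix k
    have "sqrt (1 - (\<Sum>k<n. (y k)\<^sup>2)) = \<bar>e n\<bar>" using ye 1 by (metis add_diff_cancel_left' real_sqrt_abs)
    then show "e k = hemi n \<sigma> y k"
      using above[of k] by (cases "k < n"; cases "k = n") (auto simp: hemi_def y_def \<sigma>_def)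
  qed
  ultimately show thesis using that nN by blast
qed

lemma hemi_boundary:
  assumes "y \<in> disc_boundary n"
  obtains n' \<sigma>' y' where "n' < n" "y' \<in> disc_interior n'" "hemi n \<sigma> y = hemi n' \<sigma>' y'"
proof -
  have y: "y \<in> coord_space {..<n}" "(\<Sum>i<n. (y i)\<^sup>2) = 1" using assms by (auto simp: disc_euclid euclid_def)
  then obtain l where l: "n = Suc l" by (cases n) auto
  have "(\<Sum>k<n. (hemi n \<sigma> y k)\<^sup>2) = (\<Sum>k<n. (y k)\<^sup>2)" by (intro sum.cong) (auto simp: hemi_def)
  then have "hemi n \<sigma> y \<in> sphere_upto l" using y l by (auto simp: sphere_upto_def coord_space_def hemi_def)
  then show thesis using sphere_cells[of "hemi n \<sigma> y" l] that l by (metis less_Suc_eq_le)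
qed

lemma sphere_nonzero: "e \<in> sphere_upto n \<Longrightarrow> \<exists>k. e k \<noteq> 0"
  by (rule ccontr) (auto simp: sphere_upto_def)

lemma sphere_upto_mono: "n \<le> N \<Longrightarrow> sphere_upto n \<subseteq> sphere_upto N"
proof
  fix e assume n: "n \<le> N" and e: "e \<in> sphere_upto n"
  have "(\<Sum>k<Suc N. (e k)\<^sup>2) = (\<Sum>k<Suc n. (e k)\<^sup>2)"
    using n e by (intro sum.mono_neutral_right) (auto simp: sphere_upto_def coord_space_def)
  then show "e \<in> sphere_upto N" using n e by (auto simp: sphere_upto_def coord_space_def)
qed

text \<open>A sphere is contractible in the next one: the map is extended into the ball, which
  parametrizes the upper hemisphere of the next sphere. On the smaller sphere the new coordinate is
  \<open>sqrt (1 - 1) = 0\<close>.\<close>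

lemma sphere_extension:
  fixes C D :: "(nat \<Rightarrow> real) set"
  assumes C: "compact C" "compact D" "C \<subseteq> D" and f: "continuous_on C f" "f ` C \<subseteq> sphere_upto N"
  obtains g where "continuous_on D g" "g ` D \<subseteq> sphere_upto (Suc N)" "\<And>x. x \<in> C \<Longrightarrow> g x = f x"
proof -
  have "f ` C \<subseteq> {x \<in> coord_space {..<Suc N}. euclid {..<Suc N} x \<le> 1}"
    using f(2) by (auto simp: sphere_upto_def euclid_def)
  then obtain h where h: "continuous_on D h" "h ` D \<subseteq> {x \<in> coord_space {..<Suc N}. euclid {..<Suc N} x \<le> 1}" "\<And>x. x \<in> C \<Longrightarrow> h x = f x"
    using ext_setE[OF ext_set_gauge_ball[OF gauge_euclid[OF finite_lessThan[of "Suc N"]]] C f(1)] by blast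
  show thesis
  proof (rule that)
    show "continuous_on D (\<lambda>x. hemi (Suc N) False (h x))"
      by (rule continuous_on_compose2[OF continuous_hemi h(1)]) auto
    show "(\<lambda>x. hemi (Suc N) False (h x)) ` D \<subseteq> sphere_upto (Suc N)"
      using h(2) hemi_sphere by (auto simp: disc_euclid)
    fix x assume "x \<in> C"
    then have "f x \<in> sphere_upto N" "h x = f x" using f(2) h(3) by auto
    then show "hemi (Suc N) False (h x) = f x"
      by (auto simp: hemi_def sphere_upto_def coord_space_def fun_eq_iff)
  qed
qed

section \<open>The action on the level complex\<close>

definition twist :: "bool \<Rightarrow> w2 \<Rightarrow> w2" where "twist \<epsilon> w = (if \<epsilon> then swap w else w)"

lemma twist_simps [simp]:
  "twist False w = w" "twist \<epsilon> [] = []" "twist \<epsilon> (twist \<epsilon> w) = w" "height (twist \<epsilon> w) = height w"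
  "freely_reduced (twist \<epsilon> w) \<longleftrightarrow> freely_reduced w" "twist \<epsilon> (u \<cdot> v) = twist \<epsilon> u \<cdot> twist \<epsilon> v"
  "twist \<epsilon> [(s, e)] = [(s \<noteq> \<epsilon>, e)]" "twist \<epsilon> u = twist \<epsilon> v \<longleftrightarrow> u = v"
  by (auto simp: twist_def)

lemma twist_twist: "twist \<epsilon> (twist \<delta> w) = twist (\<epsilon> \<noteq> \<delta>) w"
  by (auto simp: twist_def)

text \<open>Push-forward of barycentric coordinates along
  \<open>u \<mapsto> w \<cdot> twist \<epsilon> u\<close>, hence the inverse in the argument. Words
  that are not reduced are no vertices and receive 0.\<close>

definition tree_move :: "w2 \<Rightarrow> bool \<Rightarrow> (w2 \<Rightarrow> real) \<Rightarrow> w2 \<Rightarrow> real" where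
  "tree_move w \<epsilon> x = (\<lambda>u. if freely_reduced u then x (twist \<epsilon> (winv w \<cdot> u)) else 0)"

lemma move_eq_iff: "freely_reduced u \<Longrightarrow> freely_reduced v \<Longrightarrow> twist \<epsilon> (winv w \<cdot> u) = v \<longleftrightarrow> u = w \<cdot> twist \<epsilon> v"
  by (metis mul_winv reduced_mul twist_simps(3,5) winv_mul)

lemma tree_move_vert: "freely_reduced v \<Longrightarrow> tree_move w \<epsilon> (vert v) = vert (w \<cdot> twist \<epsilon> v)"
  by (auto simp: tree_move_def vert_def move_eq_iff fun_eq_iff)

lemma tree_move_edge: "freely_reduced u \<Longrightarrow> freely_reduced v \<Longrightarrow>
   tree_move w \<epsilon> (edge_point u v t) = edge_point (w \<cdot> twist \<epsilon> u) (w \<cdot> twist \<epsilon> v) t"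
proof -
  assume uv: "freely_reduced u" "freely_reduced v"
  have "tree_move w \<epsilon> (edge_point u v t) = (\<lambda>x. (1 - t) * tree_move w \<epsilon> (vert u) x + t * tree_move w \<epsilon> (vert v) x)"
    by (auto simp: tree_move_def edge_point_def fun_eq_iff)
  then show ?thesis unfolding tree_move_vert[OF uv(1)] tree_move_vert[OF uv(2)] edge_point_def .
qed

lemma step_move: "freely_reduced v \<Longrightarrow> w \<cdot> twist \<epsilon> (step v e j) = step (w \<cdot> twist \<epsilon> v) e (if \<epsilon> then - j else j)"
proof -
  have "twist \<epsilon> (replicate (nat \<bar>j\<bar>) (j < 0, e)) = replicate (nat \<bar>j\<bar>) ((if \<epsilon> then - j else j) < 0, e)"
    by (cases "j = 0") (auto simp: twist_def swap_def)
  then show ?thesis by (simp add: step_def mul_assoc)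
qed

lemma tree_move_line:
  assumes v: "freely_reduced v"
  shows "tree_move w \<epsilon> (line v e t) = line (w \<cdot> twist \<epsilon> v) e (if \<epsilon> then - t else t)"
proof
  fix u
  show "tree_move w \<epsilon> (line v e t) u = line (w \<cdot> twist \<epsilon> v) e (if \<epsilon> then - t else t) u"
  proof (cases "freely_reduced u \<and> (\<exists>j. twist \<epsilon> (winv w \<cdot> u) = step v e j)")
    case True
    then obtain j where j: "freely_reduced u" "twist \<epsilon> (winv w \<cdot> u) = step v e j" by blast
    then have "u = w \<cdot> twist \<epsilon> (step v e j)" using move_eq_iff by simp
    then have "u = step (w \<cdot> twist \<epsilon> v) e (if \<epsilon> then - j else j)" using step_move[OF v] by simp
    then have "line (w \<cdot> twist \<epsilon> v) e (if \<epsilon> then - t else t) u = max 0 (1 - \<bar>t - real_of_int j\<bar>)"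
      using abs_minus_commute[of t j] by (simp add: line_step)
    moreover have "tree_move w \<epsilon> (line v e t) u = max 0 (1 - \<bar>t - real_of_int j\<bar>)"
      unfolding tree_move_def using j by (simp only: if_True line_step)
    ultimately show ?thesis by simp
  next
    case False
    have "line (w \<cdot> twist \<epsilon> v) e (if \<epsilon> then - t else t) u = 0"
    proof (rule line_off)
      fix j show "u \<noteq> step (w \<cdot> twist \<epsilon> v) e j"
      proof
        assume "u = step (w \<cdot> twist \<epsilon> v) e j"
        then have "u = w \<cdot> twist \<epsilon> (step v e (if \<epsilon> then - j else j))" using step_move[OF v] by simp
        then have "freely_reduced u" "twist \<epsilon> (winv w \<cdot> u) = step v e (if \<epsilon> then - j else j)" by simp_all
        then show False using False by blast
      qed
    qed
    moreover have "tree_move w \<epsilon> (line v e t) u = 0" using False line_off by (auto simp: tree_move_def)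
    ultimately show ?thesis by simp
  qed
qed

lemma verts_tree_move: "x \<in> tree \<Longrightarrow> verts (tree_move w \<epsilon> x) = (\<lambda>u. w \<cdot> twist \<epsilon> u) ` verts x"
proof (intro equalityI subsetI)
  fix u assume x: "x \<in> tree" and "u \<in> verts (tree_move w \<epsilon> x)"
  then have u: "freely_reduced u" "twist \<epsilon> (winv w \<cdot> u) \<in> verts x" by (auto simp: verts_def tree_move_def split: if_splits)
  then show "u \<in> (\<lambda>u. w \<cdot> twist \<epsilon> u) ` verts x" by (intro image_eqI[of _ _ "twist \<epsilon> (winv w \<cdot> u)"]) auto
next
  fix u assume x: "x \<in> tree" and "u \<in> (\<lambda>u. w \<cdot> twist \<epsilon> u) ` verts x"
  then obtain v where v: "v \<in> verts x" "u = w \<cdot> twist \<epsilon> v" by blast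
  then have vr: "freely_reduced v" using verts_tree(3)[OF x] by blast
  then have "freely_reduced u" "twist \<epsilon> (winv w \<cdot> u) = v" using v move_eq_iff[of u v] by simp_all
  then show "u \<in> verts (tree_move w \<epsilon> x)" using v(1) by (simp add: verts_def tree_move_def)
qed

text \<open>A translation that fixes a point permutes its carrier, which consists of a vertex
  \<open>u\<close> and at most one vertex one step higher. Comparing the heights of
  \<open>w \<cdot> u\<close> and \<open>w \<cdot> (w \<cdot> u)\<close> with that of
  \<open>u\<close> leaves only \<open>w \<cdot> u = u\<close>.\<close>

lemma tree_translation_free:
  assumes x: "x \<in> tree" and w: "freely_reduced w" and eq: "tree_move w False x = x"
  shows "w = []"
proof -
  have V: "(\<lambda>u. w \<cdot> u) ` verts x = verts x" using verts_tree_move[OF x, of w False] eq by simp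
  obtain u where u: "u \<in> verts x" "\<And>v. v \<in> verts x \<Longrightarrow> v = u \<or> height v = height u + 1"
    using x
  proof (cases rule: tree_cases)
    case (edge v s t) 
    then have "verts x = {v, v \<cdot> [(s, True)]}" using verts_edge' by simp
    then show ?thesis by (intro that[of v]) auto
  qed (use that in auto)
  have ur: "freely_reduced u" using verts_tree(3)[OF x u(1)] .
  have "w \<cdot> u \<in> verts x" "w \<cdot> (w \<cdot> u) \<in> verts x" using V u(1) by blast+
  have "w \<cdot> u = u"
  proof (rule ccontr)
    assume "w \<cdot> u \<noteq> u"
    then have "height w = 1" using u(2)[of "w \<cdot> u"] \<open>w \<cdot> u \<in> verts x\<close> by simp
    moreover have "2 * height w = 0 \<or> 2 * height w = 1"
      using u(2)[OF \<open>w \<cdot> (w \<cdot> u) \<in> verts x\<close>] by (auto dest: arg_cong[of _ _ height])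
    ultimately show False by simp
  qed
  then have "(w \<cdot> u) \<cdot> winv u = u \<cdot> winv u" by simp
  then show "w = []" using ur w by (simp add: mul_assoc)
qed

context tree_power
begin

definition gact :: "(nat \<Rightarrow> w2) \<times> bool \<Rightarrow> (nat \<Rightarrow> w2) \<Rightarrow> nat \<Rightarrow> w2" where
  "gact g v = (\<lambda>i. fst g i \<cdot> twist (snd g) (v i))"

definition level_group :: "((nat \<Rightarrow> w2) \<times> bool) monoid" where
  "level_group = \<lparr>carrier = {w \<in> tuples. ht w = 0} \<times> UNIV,
     mult = (\<lambda>g h. (gact g (fst h), snd g \<noteq> snd h)), one = (\<lambda>_. [], False)\<rparr>"

lemma gact_tuples: "fst g \<in> tuples \<Longrightarrow> v \<in> tuples \<Longrightarrow> gact g v \<in> tuples"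
  by (auto simp: gact_def tuples_def)

lemma ht_gact: "ht (gact g v) = ht (fst g) + ht v"
  by (simp add: ht_def gact_def sum.distrib)

lemma tuples_reduced: "v \<in> tuples \<Longrightarrow> freely_reduced (v i)"
  by (cases "i < m") (auto simp: tuples_def)

lemma gact_mult: "g \<in> carrier level_group \<Longrightarrow> h \<in> carrier level_group \<Longrightarrow> v \<in> tuples \<Longrightarrow> gact (g \<otimes>\<^bsub>level_group\<^esub> h) v = gact g (gact h v)"
  by (auto simp: gact_def level_group_def mul_assoc tuples_reduced twist_twist fun_eq_iff)

lemma gact_one: "v \<in> tuples \<Longrightarrow> gact \<one>\<^bsub>level_group\<^esub> v = v"
  by (simp add: gact_def level_group_def tuples_reduced)

lemma level_group_mem: "g \<in> carrier level_group \<longleftrightarrow> fst g \<in> tuples \<and> ht (fst g) = 0"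
  by (cases g) (auto simp: level_group_def)

lemma group_level_group: "group level_group"
proof (rule groupI)
  fix x y z assume x: "x \<in> carrier level_group" and y: "y \<in> carrier level_group" and z: "z \<in> carrier level_group"
  show "x \<otimes>\<^bsub>level_group\<^esub> y \<in> carrier level_group"
    using x y gact_tuples[of x "fst y"] ht_gact[of x "fst y"] unfolding level_group_mem by (simp add: level_group_def)
  have "gact (x \<otimes>\<^bsub>level_group\<^esub> y) (fst z) = gact x (gact y (fst z))"
    using gact_mult[OF x y] z by (simp add: level_group_mem)
  then show "x \<otimes>\<^bsub>level_group\<^esub> y \<otimes>\<^bsub>level_group\<^esub> z = x \<otimes>\<^bsub>level_group\<^esub> (y \<otimes>\<^bsub>level_group\<^esub> z)"
    by (auto simp: level_group_def)
next
  show "\<one>\<^bsub>level_group\<^esub> \<in> carrier level_group" by (auto simp: level_group_def tuples_def ht_def)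
  fix x assume x: "x \<in> carrier level_group"
  show "\<one>\<^bsub>level_group\<^esub> \<otimes>\<^bsub>level_group\<^esub> x = x"
    using x gact_one[of "fst x"] by (cases x) (simp add: level_group_def)
  define y where "y = (\<lambda>i. twist (snd x) (winv (fst x i)), snd x)"
  have xr: "freely_reduced (fst x i)" for i using x tuples_reduced level_group_mem by blast
  have "ht (fst y) = - ht (fst x)" by (simp add: ht_def y_def sum_negf)
  then have "y \<in> carrier level_group"
    using x xr by (simp add: level_group_mem y_def tuples_def) (simp add: winv_def)
  moreover have "y \<otimes>\<^bsub>level_group\<^esub> x = \<one>\<^bsub>level_group\<^esub>"
    using xr by (simp add: level_group_def gact_def y_def twist_simps(6)[symmetric] del: twist_simps(6))
  ultimately show "\<exists>y\<in>carrier level_group. y \<otimes>\<^bsub>level_group\<^esub> x = \<one>\<^bsub>level_group\<^esub>" by blast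
qed

text \<open>The labels of spikes are moved by the same formula as vertices. Lists that are no labels
  of tuples receive 0, so that spikes go to spikes.\<close>

definition ymove :: "(nat \<Rightarrow> w2) \<times> bool \<Rightarrow> cpoint \<Rightarrow> cpoint" where
  "ymove g y = ((\<lambda>i. if i < m then tree_move (fst g i) (snd g) (fst y i) else (\<lambda>_. 0)),
     (\<lambda>l. if length l = m \<and> (\<forall>u\<in>set l. freely_reduced u)
        then snd y (map (\<lambda>i. twist (snd g) (winv (fst g i) \<cdot> l ! i)) [0..<m]) else 0))"

fun cell_move :: "(nat \<Rightarrow> w2) \<times> bool \<Rightarrow> ycell \<Rightarrow> ycell" where
  "cell_move g (Cube w d) = Cube (gact g w) (\<lambda>i. map_option (\<lambda>s. s \<noteq> snd g) (d i))"
| "cell_move g (Dome v) = Dome (gact g v)"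

text \<open>The swap reverses the lines through a vertex, whereas it preserves the orientation of the edges.\<close>

fun cell_flip :: "ycell \<Rightarrow> bool \<Rightarrow> (nat \<Rightarrow> real) \<Rightarrow> nat \<Rightarrow> real" where
  "cell_flip (Cube w d) \<epsilon> z = z"
| "cell_flip (Dome v) \<epsilon> z = (\<lambda>i. sg \<epsilon> * z i)"

lemma dirs_move [simp]: "dirs (\<lambda>i. map_option f (d i)) = dirs d"
  by (simp add: dirs_def)

lemma level_gact: "g \<in> carrier level_group \<Longrightarrow> level (gact g v) = level v" "g \<in> carrier level_group \<Longrightarrow> below (gact g v) = below v"
  by (simp_all add: level_def below_def ht_gact level_group_mem)

lemma cell_move_ycells: "g \<in> carrier level_group \<Longrightarrow> c \<in> ycells \<Longrightarrow> cell_move g c \<in> ycells"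
  by (cases c) (auto simp: ycells_def cube_ok_def outer_def gact_tuples ht_gact level_gact level_group_mem)

lemma yJ_move [simp]: "yJ (cell_move g c) = yJ c" by (cases c) auto
lemma yN_move: "g \<in> carrier level_group \<Longrightarrow> yN (cell_move g c) = yN c" by (cases c) (auto simp: level_gact)
lemma cell_flip_move [simp]: "cell_flip (cell_move g c) = cell_flip c" by (cases c) (auto simp: fun_eq_iff)
lemma cell_flip_flip: "cell_flip c \<epsilon> (cell_flip c \<delta> z) = cell_flip c (\<epsilon> \<noteq> \<delta>) z" by (cases c) (auto simp: fun_eq_iff)
lemma cell_flip_False [simp]: "cell_flip c False z = z" by (cases c) auto
lemma cell_flip_coord: "z \<in> coord_space J \<Longrightarrow> cell_flip c \<epsilon> z \<in> coord_space J" by (cases c) (auto simp: coord_space_def)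

lemma stair_flip: "stair n (\<lambda>i. sg \<epsilon> * z i) = stair n z"
proof -
  have "\<bar>sg \<epsilon> * z i\<bar> = \<bar>z i\<bar>" for i by auto
  then show ?thesis unfolding stair_def by presburger
qed

lemma yN_flip [simp]: "yN c (cell_flip c \<epsilon> z) = yN c z" by (cases c) (auto simp: stair_flip simp del: if_distrib)

lemma continuous_cell_flip: "continuous_on S (cell_flip c \<epsilon>)"
proof (cases c)
  case (Dome v)
  have "continuous_on S (\<lambda>z i. sg \<epsilon> * z i)"
    by (intro continuous_on_coordinatewise_then_product continuous_on_mult continuous_on_const continuous_on_coord)
  then show ?thesis using Dome by simp
qed (simp add: continuous_on_id)

lemma cell_move_one: "c \<in> ycells \<Longrightarrow> cell_move \<one>\<^bsub>level_group\<^esub> c = c"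
proof (cases c)
  case (Cube w d)
  assume "c \<in> ycells"
  then have "w \<in> tuples" using Cube by (auto simp: ycells_def cube_ok_def)
  moreover have "map_option (\<lambda>s. s \<noteq> snd \<one>\<^bsub>level_group\<^esub>) (d i) = d i" for i by (cases "d i") (auto simp: level_group_def)
  ultimately show ?thesis using Cube gact_one by simp
next
  case (Dome v)
  assume "c \<in> ycells"
  then have "v \<in> tuples" using Dome outer_tuples by (auto simp: ycells_def)
  then show ?thesis using Dome gact_one by simp
qed

lemma cell_move_mult:
  assumes gh: "g \<in> carrier level_group" "h \<in> carrier level_group" and c: "c \<in> ycells"
  shows "cell_move (g \<otimes>\<^bsub>level_group\<^esub> h) c = cell_move g (cell_move h c)"
proof (cases c)
  case (Cube w d)
  then have "w \<in> tuples" using c by (auto simp: ycells_def cube_ok_def)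
  moreover have "map_option (\<lambda>s. s \<noteq> snd (g \<otimes>\<^bsub>level_group\<^esub> h)) (d i) = map_option (\<lambda>s. s \<noteq> snd g) (map_option (\<lambda>s. s \<noteq> snd h) (d i))" for i
    by (cases "d i") (auto simp: level_group_def)
  ultimately show ?thesis using Cube gact_mult[OF gh] by simp
next
  case (Dome v)
  then have "v \<in> tuples" using c outer_tuples by (auto simp: ycells_def)
  then show ?thesis using Dome gact_mult[OF gh] by simp
qed

lemma spike_move:
  assumes v: "v \<in> tuples"
  shows "snd (ymove g (x, spike v h)) = spike (gact g v) h"
proof
  fix l
  have iff: "map (\<lambda>i. twist (snd g) (winv (fst g i) \<cdot> l ! i)) [0..<m] = lab v \<longleftrightarrow> l = lab (gact g v)"
    if l: "length l = m" "\<forall>u\<in>set l. freely_reduced u"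
  proof -
    have "map (\<lambda>i. twist (snd g) (winv (fst g i) \<cdot> l ! i)) [0..<m] = lab v \<longleftrightarrow> (\<forall>i<m. twist (snd g) (winv (fst g i) \<cdot> l ! i) = v i)"
      by (auto simp: lab_def)
    also have "\<dots> \<longleftrightarrow> (\<forall>i<m. l ! i = gact g v i)"
      using l v move_eq_iff by (auto simp: gact_def tuples_reduced)
    also have "\<dots> \<longleftrightarrow> l = lab (gact g v)" using l by (auto simp: lab_def list_eq_iff_nth_eq)
    finally show ?thesis .
  qed
  have "length (lab (gact g v)) = m" "\<forall>u\<in>set (lab (gact g v)). freely_reduced u"
    using v by (auto simp: lab_def gact_def tuples_reduced)
  then show "snd (ymove g (x, spike v h)) l = spike (gact g v) h l"
    using iff by (auto simp: ymove_def spike_def)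
qed

lemma ymove_ymap:
  assumes g: "g \<in> carrier level_group" and c: "c \<in> ycells"
  shows "ymove g (ymap c z) = ymap (cell_move g c) (cell_flip c (snd g) z)"
proof (cases c)
  case (Cube w d)
  then have w: "w \<in> tuples" using c by (auto simp: ycells_def cube_ok_def)
  have "tree_move (fst g i) (snd g) (cube_coord (w i) (d i) t) = cube_coord (gact g w i) (map_option (\<lambda>s. s \<noteq> snd g) (d i)) t" for i t
    using tuples_reduced[OF w, of i]
    by (cases "d i") (simp_all add: cube_coord_def tree_move_vert tree_move_edge gact_def mul_assoc)
  then show ?thesis using Cube by (auto simp: ymove_def cube_point_def fun_eq_iff)
next
  case (Dome v)
  then have v: "v \<in> tuples" using c outer_tuples by (auto simp: ycells_def)
  have "tree_move (fst g i) (snd g) (line (v i) (below v) t) = line (gact g v i) (below v) (sg (snd g) * t)" for i t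
    using tree_move_line[OF tuples_reduced[OF v, of i]] by (simp add: gact_def)
  then have "fst (ymove g (lift v (z, h))) = flat (gact g v) (\<lambda>i. sg (snd g) * z i)" for h
    using level_gact(2)[OF g, of v] by (auto simp: ymove_def lift_def flat_def fun_eq_iff)
  moreover have "snd (ymove g (lift v (z, h))) = spike (gact g v) h" for h
    using spike_move[OF v] by (simp add: lift_def)
  ultimately show ?thesis
    using Dome level_gact(1)[OF g, of v] stair_flip[of "level v" "snd g" z] by (simp add: lift_def prod_eq_iff)
qed

lemma ymap_tree_pow:
  assumes c: "c \<in> ycells" and z: "z \<in> coord_space (yJ c)" "yN c z \<le> 1"
  shows "fst (ymap c z) \<in> tree_pow"
proof (cases c)
  case (Cube w d)
  then show ?thesis using cube_closed_slab(1)[of w d z] c z by (auto simp: ycells_def)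
next
  case (Dome v)
  then show ?thesis using flat_in by (simp add: lift_def)
qed

end

context tree_power
begin

text \<open>A cell of the product uses the coordinates below \<open>m\<close> for the level complex
  and those from \<open>m\<close> on for the sphere; \<open>cut\<close> and \<open>shift\<close>
  separate them, \<open>join\<close> combines them.\<close>

definition cut :: "(nat \<Rightarrow> real) \<Rightarrow> nat \<Rightarrow> real" where "cut z = (\<lambda>k. if k < m then z k else 0)"
definition shift :: "(nat \<Rightarrow> real) \<Rightarrow> nat \<Rightarrow> real" where "shift z = (\<lambda>k. z (m + k))"
definition join :: "(nat \<Rightarrow> real) \<Rightarrow> (nat \<Rightarrow> real) \<Rightarrow> nat \<Rightarrow> real" where
  "join a b = (\<lambda>k. if k < m then a k else b (k - m))"

type_synonym pcell = "ycell \<times> bool \<times> nat"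

fun pJ :: "pcell \<Rightarrow> nat set" where "pJ (c, \<sigma>, n) = yJ c \<union> (+) m ` {..<n}"
fun pN :: "pcell \<Rightarrow> (nat \<Rightarrow> real) \<Rightarrow> real" where
  "pN (c, \<sigma>, n) z = max (yN c (cut z)) (euclid {..<n} (shift z))"
text \<open>The swap acts on the parameters of a dome by the reflection \<open>cell_flip\<close>,
  and on the sphere it exchanges the two cells of each dimension. Flipping the dome parameter by the
  sign \<open>\<sigma>\<close> of the sphere cell absorbs the reflection, so that the action
  permutes the characteristic maps exactly.\<close>

fun pmap :: "pcell \<Rightarrow> (nat \<Rightarrow> real) \<Rightarrow> cpoint \<times> (nat \<Rightarrow> real)" where
  "pmap (c, \<sigma>, n) z = (ymap c (cell_flip c \<sigma> (cut z)), hemi n \<sigma> (shift z))"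
definition pcells :: "pcell set" where "pcells = ycells \<times> UNIV"
definition pdim :: "pcell \<Rightarrow> nat" where "pdim i = card (pJ i)"
definition pchar :: "pcell \<Rightarrow> (nat \<Rightarrow> real) \<Rightarrow> cpoint \<times> (nat \<Rightarrow> real)" where
  "pchar i x = pmap i (ball_param (pJ i) (pN i) x)"

lemma finite_pJ: "finite (pJ i)"
proof -
  obtain c \<sigma> n where i: "i = (c, \<sigma>, n)" using prod_cases3 by blast
  have "finite (yJ c)" using yJ_subset finite_subset by blast
  then show ?thesis by (simp add: i)
qed

lemma pdim_eq: "pdim (c, \<sigma>, n) = card (yJ c) + n"
proof -
  have "finite (yJ c)" using yJ_subset finite_subset by blast
  moreover have "yJ c \<inter> (+) m ` {..<n} = {}" using yJ_subset by fastforce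
  ultimately show ?thesis by (simp add: pdim_def card_Un_disjoint card_image)
qed

lemma continuous_cut: "continuous_on S cut" and continuous_shift: "continuous_on S shift"
proof -
  have "continuous_on S (\<lambda>z. cut z k)" for k
    by (cases "k < m") (simp_all add: cut_def continuous_on_coord continuous_on_const)
  then show "continuous_on S cut" by (rule continuous_on_coordinatewise_then_product)
  show "continuous_on S shift"
    by (rule continuous_on_coordinatewise_then_product) (simp add: shift_def continuous_on_coord)
qed

lemma gauge_pN: "gauge (pJ i) (pN i)"
proof -
  obtain c \<sigma> n where i: "i = (c, \<sigma>, n)" using prod_cases3 by blast
  have gy: "gauge (yJ c) (yN c)" and ge: "gauge {..<n} (euclid {..<n})" by (simp_all add: gauge_yN gauge_euclid)
  obtain B1 where B1: "0 \<le> B1" "\<And>x i. i \<in> yJ c \<Longrightarrow> \<bar>x i\<bar> \<le> B1 * yN c x" using gy by (auto simp: gauge_def)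
  obtain B2 where B2: "0 \<le> B2" "\<And>x i. i < n \<Longrightarrow> \<bar>x i\<bar> \<le> B2 * euclid {..<n} x" using ge by (auto simp: gauge_def)
  show ?thesis
    unfolding gauge_def
  proof (intro conjI allI impI exI[of _ "B1 + B2"] ballI)
    have "continuous_on UNIV (\<lambda>z. yN c (cut z))" "continuous_on UNIV (\<lambda>z. euclid {..<n} (shift z))"
      by (intro continuous_on_gauge_compose[OF gy continuous_cut] continuous_on_gauge_compose[OF ge continuous_shift])+
    then show "continuous_on UNIV (pN i)" by (simp add: i continuous_on_max)
    show "pN i (\<lambda>k. r * z k) = r * pN i z" if r: "0 \<le> r" for r z
    proof -
      have "cut (\<lambda>k. r * z k) = (\<lambda>k. r * cut z k)" "shift (\<lambda>k. r * z k) = (\<lambda>k. r * shift z k)"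
        by (auto simp: cut_def shift_def)
      then show ?thesis
        using gauge_scale[OF gy r] gauge_scale[OF ge r] r by (simp add: i max_mult_distrib_left)
    qed
    show nn: "0 \<le> pN i z" for z using gauge_nonneg[OF gy] by (simp add: i le_max_iff_disj)
    fix z k assume k: "k \<in> pJ i"
    then consider "k \<in> yJ c" | l where "l < n" "k = m + l" by (auto simp: i)
    then show "\<bar>z k\<bar> \<le> (B1 + B2) * pN i z"
    proof cases
      case 1
      then have "k < m" using yJ_subset by blast
      then have "\<bar>z k\<bar> \<le> B1 * yN c (cut z)" using B1(2)[OF 1, of "cut z"] by (simp add: cut_def)
      also have "\<dots> \<le> B1 * pN i z" using B1(1) by (intro mult_left_mono) (auto simp: i)
      also have "\<dots> \<le> (B1 + B2) * pN i z" using B2(1) nn by (simp add: distrib_right)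
      finally show ?thesis .
    next
      case 2
      then have "\<bar>z k\<bar> \<le> B2 * euclid {..<n} (shift z)" using B2(2)[OF 2(1), of "shift z"] by (simp add: shift_def)
      also have "\<dots> \<le> B2 * pN i z" using B2(1) by (intro mult_left_mono) (auto simp: i)
      also have "\<dots> \<le> (B1 + B2) * pN i z" using B1(1) nn by (simp add: distrib_right)
      finally show ?thesis .
    qed
  next
    show "finite (pJ i)" by (rule finite_pJ)
    show "0 \<le> B1 + B2" using B1(1) B2(1) by simp
  qed
qed

lemma coord_pJ: "z \<in> coord_space (pJ (c, \<sigma>, n)) \<Longrightarrow> cut z \<in> coord_space (yJ c) \<and> shift z \<in> coord_space {..<n}"
proof -
  assume z: "z \<in> coord_space (pJ (c, \<sigma>, n))"
  have "cut z k = 0" if "k \<notin> yJ c" for k using z that by (auto simp: coord_space_def cut_def)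
  moreover have "shift z k = 0" if "\<not> k < n" for k
  proof -
    have "m + k \<notin> yJ c" using yJ_subset[of c] by auto
    then show ?thesis using z that by (auto simp: coord_space_def shift_def)
  qed
  ultimately show ?thesis by (simp add: coord_space_def)
qed

lemma join_pJ:
  assumes "a \<in> coord_space (yJ c)" "b \<in> coord_space {..<n}"
  shows "join a b \<in> coord_space (pJ (c, \<sigma>, n))" "cut (join a b) = a" "shift (join a b) = b"
proof -
  have "a k = 0" if "m \<le> k" for k using assms(1) yJ_subset[of c] that by (auto simp: coord_space_def)
  then show "cut (join a b) = a" by (auto simp: cut_def join_def fun_eq_iff)
  show "shift (join a b) = b" by (simp add: shift_def join_def)
  show "join a b \<in> coord_space (pJ (c, \<sigma>, n))"
    unfolding coord_space_def
  proof (intro CollectI allI impI)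
    fix k assume k: "k \<notin> pJ (c, \<sigma>, n)"
    show "join a b k = 0"
    proof (cases "k < m")
      case True
      then show ?thesis using k assms(1) by (simp add: join_def coord_space_def)
    next
      case False
      then have "k = m + (k - m)" by simp
      then have "\<not> k - m < n" using k by auto
      then show ?thesis using False assms(2) by (simp add: join_def coord_space_def)
    qed
  qed
qed

lemma cut_shift_inject: "cut z = cut z' \<Longrightarrow> shift z = shift z' \<Longrightarrow> z = z'"
proof
  fix k assume "cut z = cut z'" "shift z = shift z'"
  then have "cut z k = cut z' k" "shift z (k - m) = shift z' (k - m)" by simp_all
  then show "z k = z' k" by (cases "k < m") (auto simp: cut_def shift_def)
qed

lemma continuous_pmap: "continuous_on S (pmap i)"
proof -
  obtain c \<sigma> n where i: "i = (c, \<sigma>, n)" using prod_cases3 by blast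
  have "continuous_on S (\<lambda>z. ymap c (cell_flip c \<sigma> (cut z)))"
    by (intro continuous_on_compose2[OF continuous_ymap continuous_on_compose2[OF continuous_cell_flip continuous_cut]]) auto
  moreover have "continuous_on S (\<lambda>z. hemi n \<sigma> (shift z))"
    by (intro continuous_on_compose2[OF continuous_hemi continuous_shift]) auto
  ultimately show ?thesis by (simp add: i continuous_on_Pair)
qed

lemma pchar_images:
  "pchar i ` topspace (disc (pdim i)) = pmap i ` {z \<in> coord_space (pJ i). pN i z \<le> 1}"
  "pchar i ` disc_interior (pdim i) = pmap i ` {z \<in> coord_space (pJ i). pN i z < 1}"
  "pchar i ` disc_boundary (pdim i) = pmap i ` {z \<in> coord_space (pJ i). pN i z = 1}"
proof -
  have "pchar i ` A = pmap i ` (ball_param (pJ i) (pN i) ` A)" for A by (simp add: pchar_def[abs_def] image_image)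
  then show "pchar i ` topspace (disc (pdim i)) = pmap i ` {z \<in> coord_space (pJ i). pN i z \<le> 1}"
    "pchar i ` disc_interior (pdim i) = pmap i ` {z \<in> coord_space (pJ i). pN i z < 1}"
    "pchar i ` disc_boundary (pdim i) = pmap i ` {z \<in> coord_space (pJ i). pN i z = 1}"
    using ball_param(3,4,5)[OF gauge_pN[of i]] by (simp_all add: pdim_def)
qed

lemma pclosed_eq: "pmap (c, \<sigma>, n) ` {z \<in> coord_space (pJ (c, \<sigma>, n)). pN (c, \<sigma>, n) z \<le> 1} = yclosed c \<times> hemi n \<sigma> ` topspace (disc n)"
proof (intro equalityI subsetI)
  fix y assume "y \<in> pmap (c, \<sigma>, n) ` {z \<in> coord_space (pJ (c, \<sigma>, n)). pN (c, \<sigma>, n) z \<le> 1}"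
  then obtain z where z: "z \<in> coord_space (pJ (c, \<sigma>, n))" "yN c (cut z) \<le> 1" "euclid {..<n} (shift z) \<le> 1" "y = pmap (c, \<sigma>, n) z" by auto
  have "cell_flip c \<sigma> (cut z) \<in> {z \<in> coord_space (yJ c). yN c z \<le> 1}" "shift z \<in> topspace (disc n)"
    using z coord_pJ[OF z(1)] by (auto simp: cell_flip_coord disc_euclid)
  then show "y \<in> yclosed c \<times> hemi n \<sigma> ` topspace (disc n)" using z(4) unfolding yclosed_def by auto
next
  fix y assume "y \<in> yclosed c \<times> hemi n \<sigma> ` topspace (disc n)"
  then obtain a b where ab: "a \<in> coord_space (yJ c)" "yN c a \<le> 1" "b \<in> coord_space {..<n}" "euclid {..<n} b \<le> 1" "y = (ymap c a, hemi n \<sigma> b)"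
    by (auto simp: yclosed_def disc_euclid)
  note j = join_pJ[OF cell_flip_coord[OF ab(1), of c \<sigma>] ab(3)]
  have "y = pmap (c, \<sigma>, n) (join (cell_flip c \<sigma> a) b)" using ab(5) j(2,3) by (simp add: cell_flip_flip)
  moreover have "pN (c, \<sigma>, n) (join (cell_flip c \<sigma> a) b) \<le> 1" using ab j(2,3) by simp
  ultimately show "y \<in> pmap (c, \<sigma>, n) ` {z \<in> coord_space (pJ (c, \<sigma>, n)). pN (c, \<sigma>, n) z \<le> 1}"
    using j(1) by blast
qed

lemma popen_eq: "pmap (c, \<sigma>, n) ` {z \<in> coord_space (pJ (c, \<sigma>, n)). pN (c, \<sigma>, n) z < 1} = yopen c \<times> hemi n \<sigma> ` disc_interior n"
proof (intro equalityI subsetI)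
  fix y assume "y \<in> pmap (c, \<sigma>, n) ` {z \<in> coord_space (pJ (c, \<sigma>, n)). pN (c, \<sigma>, n) z < 1}"
  then obtain z where z: "z \<in> coord_space (pJ (c, \<sigma>, n))" "yN c (cut z) < 1" "euclid {..<n} (shift z) < 1" "y = pmap (c, \<sigma>, n) z" by auto
  have "cell_flip c \<sigma> (cut z) \<in> {z \<in> coord_space (yJ c). yN c z < 1}" "shift z \<in> disc_interior n"
    using z coord_pJ[OF z(1)] by (auto simp: cell_flip_coord disc_euclid)
  then show "y \<in> yopen c \<times> hemi n \<sigma> ` disc_interior n" using z(4) unfolding yopen_def by auto
next
  fix y assume "y \<in> yopen c \<times> hemi n \<sigma> ` disc_interior n"
  then obtain a b where ab: "a \<in> coord_space (yJ c)" "yN c a < 1" "b \<in> coord_space {..<n}" "euclid {..<n} b < 1" "y = (ymap c a, hemi n \<sigma> b)"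
    by (auto simp: yopen_def disc_euclid)
  note j = join_pJ[OF cell_flip_coord[OF ab(1), of c \<sigma>] ab(3)]
  have "y = pmap (c, \<sigma>, n) (join (cell_flip c \<sigma> a) b)" using ab(5) j(2,3) by (simp add: cell_flip_flip)
  moreover have "pN (c, \<sigma>, n) (join (cell_flip c \<sigma> a) b) < 1" using ab j(2,3) by simp
  ultimately show "y \<in> pmap (c, \<sigma>, n) ` {z \<in> coord_space (pJ (c, \<sigma>, n)). pN (c, \<sigma>, n) z < 1}"
    using j(1) by blast
qed

lemma pboundary:
  assumes i: "i \<in> pcells"
  shows "\<exists>F. finite F \<and> F \<subseteq> pcells \<and> (\<forall>j\<in>F. pdim j < pdim i) \<and>
     pchar i ` disc_boundary (pdim i) \<subseteq> (\<Union>j\<in>F. pchar j ` disc_interior (pdim j))"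
proof -
  obtain c \<sigma> n where ic: "i = (c, \<sigma>, n)" using prod_cases3 by blast
  have c: "c \<in> ycells" using i by (simp add: ic pcells_def)
  obtain F0 where F0: "finite F0" "F0 \<subseteq> ycells" "\<forall>c'\<in>F0. card (yJ c') < card (yJ c)"
      "ymap c ` {z \<in> coord_space (yJ c). yN c z = 1} \<subseteq> (\<Union>c'\<in>F0. yopen c')"
    using yboundary[OF c] by (elim exE conjE) (rule that)
  define F where "F = {j \<in> insert c F0 \<times> UNIV \<times> {..n}. pdim j < pdim i}"
  have "y \<in> (\<Union>j\<in>F. pchar j ` disc_interior (pdim j))" if y: "y \<in> pchar i ` disc_boundary (pdim i)" for y
  proof -
    obtain z where z: "z \<in> coord_space (pJ i)" "max (yN c (cut z)) (euclid {..<n} (shift z)) = 1" "y = pmap i z"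
      using y unfolding pchar_images by (auto simp: ic)
    note zc = coord_pJ[OF z(1)[unfolded ic]]
    define a where "a = cell_flip c \<sigma> (cut z)"
    have a: "a \<in> coord_space (yJ c)" "yN c a = yN c (cut z)" using zc by (simp_all add: a_def cell_flip_coord)
    have y': "y = (ymap c a, hemi n \<sigma> (shift z))" using z(3) by (simp add: ic a_def)
    obtain c' where c': "c' \<in> insert c F0" "ymap c a \<in> yopen c'" "yN c (cut z) = 1 \<Longrightarrow> c' \<in> F0"
    proof (cases "yN c (cut z) = 1")
      case True
      then have "ymap c a \<in> ymap c ` {z \<in> coord_space (yJ c). yN c z = 1}" using a by simp
      then obtain c' where "c' \<in> F0" "ymap c a \<in> yopen c'" using F0(4) by blast
      then show ?thesis by (intro that[of c']) auto
    next
      case False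
      then have "yN c a < 1" using z(2) a(2) by linarith
      then have "ymap c a \<in> yopen c" using a(1) by (auto simp: yopen_def)
      then show ?thesis using that False by blast
    qed
    obtain n' \<sigma>' b where b: "n' \<le> n" "b \<in> disc_interior n'" "hemi n \<sigma> (shift z) = hemi n' \<sigma>' b" "euclid {..<n} (shift z) = 1 \<Longrightarrow> n' < n"
    proof (cases "euclid {..<n} (shift z) = 1")
      case True
      then have "shift z \<in> disc_boundary n" using zc by (simp add: disc_euclid)
      then show ?thesis using hemi_boundary[of "shift z" n \<sigma>] that by (metis less_imp_le)
    next
      case False
      then have "shift z \<in> disc_interior n" using z(2) zc by (auto simp: disc_euclid)
      then show ?thesis using that False by blast
    qed
    have "card (yJ c') \<le> card (yJ c)" "yN c (cut z) = 1 \<Longrightarrow> card (yJ c') < card (yJ c)" using c' F0(3) by auto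
    moreover have "yN c (cut z) = 1 \<or> euclid {..<n} (shift z) = 1" using z(2) by linarith
    ultimately have "pdim (c', \<sigma>', n') < pdim i" using b(1,4) unfolding ic pdim_eq by linarith
    then have "(c', \<sigma>', n') \<in> F" using c'(1) b(1) by (simp add: F_def)
    moreover have "y \<in> pchar (c', \<sigma>', n') ` disc_interior (pdim (c', \<sigma>', n'))"
      unfolding pchar_images popen_eq y' using c'(2) b(2,3) by blast
    ultimately show ?thesis by blast
  qed
  then have "pchar i ` disc_boundary (pdim i) \<subseteq> (\<Union>j\<in>F. pchar j ` disc_interior (pdim j))" by (rule subsetI)
  moreover have "finite F" using F0(1) by (simp add: F_def)
  moreover have "F \<subseteq> pcells" using F0(2) c by (auto simp: F_def pcells_def)
  moreover have "\<forall>j\<in>F. pdim j < pdim i" by (simp add: F_def)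
  ultimately show ?thesis by (intro exI[of _ F] conjI)
qed

sublocale product: cell_family pcells pdim pchar
proof
  fix i assume i: "i \<in> pcells"
  obtain c \<sigma> n where ic: "i = (c, \<sigma>, n)" using prod_cases3 by blast
  have c: "c \<in> ycells" using i by (simp add: ic pcells_def)
  note bp = ball_param[OF gauge_pN[of i], folded pdim_def]
  show "continuous_on (topspace (disc (pdim i))) (pchar i)"
    unfolding pchar_def by (rule continuous_on_compose2[OF continuous_pmap bp(1)]) auto
  have "inj_on (pmap i) {z \<in> coord_space (pJ i). pN i z < 1}"
  proof (rule inj_onI)
    fix z z' assume z: "z \<in> {z \<in> coord_space (pJ i). pN i z < 1}" "z' \<in> {z \<in> coord_space (pJ i). pN i z < 1}" and eq: "pmap i z = pmap i z'"
    note zc = coord_pJ[of z c \<sigma> n] coord_pJ[of z' c \<sigma> n]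
    have "cell_flip c \<sigma> (cut z) = cell_flip c \<sigma> (cut z')"
      using inj_onD[OF ymap_inj[OF c], of "cell_flip c \<sigma> (cut z)" "cell_flip c \<sigma> (cut z')"] eq z zc by (simp add: ic cell_flip_coord)
    then have "cell_flip c \<sigma> (cell_flip c \<sigma> (cut z)) = cell_flip c \<sigma> (cell_flip c \<sigma> (cut z'))" by simp
    then have "cut z = cut z'" by (simp add: cell_flip_flip)
    moreover have "shift z = shift z'"
      using hemi_inject(3)[of "shift z" n "shift z'" n \<sigma> \<sigma>] eq z zc by (simp add: ic disc_euclid)
    ultimately show "z = z'" by (rule cut_shift_inject)
  qed
  moreover have "inj_on (ball_param (pJ i) (pN i)) (disc_interior (pdim i))"
    using bp(2) by (rule inj_on_subset) (simp add: disc_split)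
  ultimately have "inj_on (pmap i \<circ> ball_param (pJ i) (pN i)) (disc_interior (pdim i))"
    using bp(4) by (intro comp_inj_on) simp_all
  then show "inj_on (pchar i) (disc_interior (pdim i))" by (simp add: pchar_def[abs_def] comp_def)
  show "\<exists>F. finite F \<and> F \<subseteq> pcells \<and> (\<forall>j\<in>F. pdim j < pdim i) \<and>
     pchar i ` disc_boundary (pdim i) \<subseteq> (\<Union>j\<in>F. pchar j ` disc_interior (pdim j))" by (rule pboundary[OF i])
  fix j assume j: "j \<in> pcells" "i \<noteq> j"
  obtain c' \<sigma>' n' where jc: "j = (c', \<sigma>', n')" using prod_cases3 by blast
  show "pchar i ` disc_interior (pdim i) \<inter> pchar j ` disc_interior (pdim j) = {}"
  proof (rule ccontr)
    assume "\<not> ?thesis"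
    then obtain y e where y: "y \<in> yopen c" "y \<in> yopen c'" "e \<in> hemi n \<sigma> ` disc_interior n" "e \<in> hemi n' \<sigma>' ` disc_interior n'"
      unfolding pchar_images ic jc popen_eq by blast
    have "c = c'" using yopen_disjoint[OF c _ y(1,2)] j(1) by (simp add: jc pcells_def)
    moreover obtain b b' where "b \<in> disc_interior n" "b' \<in> disc_interior n'" "hemi n \<sigma> b = hemi n' \<sigma>' b'"
      using y(3,4) by auto
    then have "n = n'" "\<sigma> = \<sigma>'" using hemi_inject(1,2)[of b n b' n' \<sigma> \<sigma>'] by simp_all
    ultimately show False using j(2) ic jc by simp
  qed
qed

lemma product_closed_cell: "product.closed_cell (c, \<sigma>, n) = yclosed c \<times> hemi n \<sigma> ` topspace (disc n)"
  unfolding product.closed_cell_def pchar_images pclosed_eq ..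

lemma pextension:
  fixes C D :: "(nat \<Rightarrow> real) set"
  assumes C: "compact C" "compact D" "C \<subseteq> D" and f: "continuous_on C f" and F: "finite F" "F \<subseteq> pcells" "f ` C \<subseteq> (\<Union>i\<in>F. product.closed_cell i)"
  shows "\<exists>g F'. continuous_on D g \<and> finite F' \<and> F' \<subseteq> pcells \<and> g ` D \<subseteq> (\<Union>i\<in>F'. product.closed_cell i) \<and> (\<forall>x\<in>C. g x = f x)"
proof -
  define N where "N = Max (insert 0 ((snd \<circ> snd) ` F))"
  have N: "n \<le> N" if "(c, \<sigma>, n) \<in> F" for c \<sigma> n
  proof -
    have "n \<in> (snd \<circ> snd) ` F" using that by (force intro: image_eqI[of _ _ "(c, \<sigma>, n)"])
    then show ?thesis using F(1) by (simp add: N_def)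
  qed
  have cells: "fst (f x) \<in> (\<Union>c\<in>fst ` F. yclosed c) \<and> snd (f x) \<in> sphere_upto N" if x: "x \<in> C" for x
  proof -
    obtain c \<sigma> n where i: "(c, \<sigma>, n) \<in> F" "f x \<in> product.closed_cell (c, \<sigma>, n)" using F(3) x by fastforce
    then have fx: "fst (f x) \<in> yclosed c" "snd (f x) \<in> hemi n \<sigma> ` topspace (disc n)" unfolding product_closed_cell by auto
    have "snd (f x) \<in> sphere_upto n" using fx(2) hemi_sphere by auto
    then have "snd (f x) \<in> sphere_upto N" using sphere_upto_mono[OF N[OF i(1)]] by blast
    moreover have "c \<in> fst ` F" using i(1) by force
    ultimately show ?thesis using fx(1) by blast
  qed
  have f12: "continuous_on C (\<lambda>x. fst (f x))" "continuous_on C (\<lambda>x. snd (f x))"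
    using f by (intro continuous_on_fst continuous_on_snd; simp)+
  have sub: "finite (fst ` F)" "fst ` F \<subseteq> ycells" "(\<lambda>x. fst (f x)) ` C \<subseteq> (\<Union>c\<in>fst ` F. yclosed c)"
    using F cells by (auto simp: pcells_def)
  obtain g1 F1 where g1: "continuous_on D g1" "finite F1" "F1 \<subseteq> ycells" "g1 ` D \<subseteq> (\<Union>c\<in>F1. yclosed c)" "\<forall>x\<in>C. g1 x = fst (f x)"
    using yextension[OF C f12(1) sub] by (elim exE conjE) (rule that)
  have sub2: "(\<lambda>x. snd (f x)) ` C \<subseteq> sphere_upto N" using cells by blast
  obtain g2 where g2: "continuous_on D g2" "g2 ` D \<subseteq> sphere_upto (Suc N)" "\<And>x. x \<in> C \<Longrightarrow> g2 x = snd (f x)"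
    using sphere_extension[OF C f12(2) sub2] by blast
  let ?F = "F1 \<times> (UNIV :: bool set) \<times> {..Suc N}"
  have "(g1 x, g2 x) \<in> (\<Union>i\<in>?F. product.closed_cell i)" if x: "x \<in> D" for x
  proof -
    obtain c where c: "c \<in> F1" "g1 x \<in> yclosed c" using g1(4) x by blast
    have "g2 x \<in> sphere_upto (Suc N)" using g2(2) x by blast
    then obtain n \<sigma> y where n: "n \<le> Suc N" "y \<in> disc_interior n" "g2 x = hemi n \<sigma> y" using sphere_cells[of "g2 x" "Suc N"] by metis
    then have "(g1 x, g2 x) \<in> product.closed_cell (c, \<sigma>, n)"
      unfolding product_closed_cell using c by (auto simp: disc_split)
    then show ?thesis using c(1) n(1) by (intro UN_I[of "(c, \<sigma>, n)"]) auto
  qed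
  moreover have "continuous_on D (\<lambda>x. (g1 x, g2 x))" by (intro continuous_on_Pair g1(1) g2(1))
  moreover have "finite ?F" using g1(2) by (intro finite_cartesian_product) auto
  moreover have "?F \<subseteq> pcells" using g1(3) by (auto simp: pcells_def)
  moreover have "\<forall>x\<in>C. (g1 x, g2 x) = f x" using g1(5) g2(3) by simp
  ultimately show ?thesis by (intro exI[of _ "\<lambda>x. (g1 x, g2 x)"] exI[of _ ?F]) blast
qed

definition pact :: "(nat \<Rightarrow> w2) \<times> bool \<Rightarrow> cpoint \<times> (nat \<Rightarrow> real) \<Rightarrow> cpoint \<times> (nat \<Rightarrow> real)" where
  "pact g y = (ymove g (fst y), \<lambda>k. sg (snd g) * snd y k)"

fun pmove :: "(nat \<Rightarrow> w2) \<times> bool \<Rightarrow> pcell \<Rightarrow> pcell" where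
  "pmove g (c, \<sigma>, n) = (cell_move g c, \<sigma> \<noteq> snd g, n)"

lemma pmove:
  assumes g: "g \<in> carrier level_group" and i: "i \<in> pcells"
  shows "pmove g i \<in> pcells" "pdim (pmove g i) = pdim i" "pchar (pmove g i) x = pact g (pchar i x)"
proof -
  obtain c \<sigma> n where ic: "i = (c, \<sigma>, n)" using prod_cases3 by blast
  have c: "c \<in> ycells" using i by (simp add: ic pcells_def)
  show "pmove g i \<in> pcells" using cell_move_ycells[OF g c] by (simp add: ic pcells_def)
  show "pdim (pmove g i) = pdim i" by (simp add: ic pdim_eq)
  have "pJ (pmove g i) = pJ i" "pN (pmove g i) = pN i" using yN_move[OF g] by (auto simp: ic fun_eq_iff)
  moreover have "pmap (pmove g i) z = pact g (pmap i z)" for z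
    using ymove_ymap[OF g c] cell_flip_flip[of c "snd g" \<sigma> "cut z"] neq_commute[of \<sigma> "snd g"]
    by (simp only: ic pact_def hemi_antipode pmap.simps pmove.simps cell_flip_move fst_conv snd_conv)
  ultimately show "pchar (pmove g i) x = pact g (pchar i x)" by (simp add: pchar_def)
qed

lemma pmove_one: "i \<in> pcells \<Longrightarrow> pmove \<one>\<^bsub>level_group\<^esub> i = i"
proof -
  assume i: "i \<in> pcells"
  obtain c \<sigma> n where ic: "i = (c, \<sigma>, n)" using prod_cases3 by blast
  have "snd \<one>\<^bsub>level_group\<^esub> = False" by (simp add: level_group_def)
  then show ?thesis using i cell_move_one by (simp add: ic pcells_def)
qed

lemma pmove_mult: "g \<in> carrier level_group \<Longrightarrow> h \<in> carrier level_group \<Longrightarrow> i \<in> pcells \<Longrightarrow>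
   pmove (g \<otimes>\<^bsub>level_group\<^esub> h) i = pmove g (pmove h i)"
proof -
  assume g: "g \<in> carrier level_group" "h \<in> carrier level_group" and i: "i \<in> pcells"
  obtain c \<sigma> n where ic: "i = (c, \<sigma>, n)" using prod_cases3 by blast
  have "snd (g \<otimes>\<^bsub>level_group\<^esub> h) = (snd g \<noteq> snd h)" by (simp add: level_group_def)
  then show ?thesis using i cell_move_mult[OF g] by (auto simp: ic pcells_def)
qed

lemma points_char: "y \<in> product.points \<Longrightarrow> \<exists>i\<in>pcells. \<exists>x. y = pchar i x"
  by (auto simp: product.points_def product.closed_cell_def)

lemma points_parts:
  assumes "y \<in> product.points"
  shows "fst (fst y) \<in> tree_pow" "\<exists>k. snd y k \<noteq> 0"
proof -
  obtain c \<sigma> n where i: "(c, \<sigma>, n) \<in> pcells" "y \<in> product.closed_cell (c, \<sigma>, n)"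
    using assms by (auto simp: product.points_def)
  then have c: "c \<in> ycells" "fst y \<in> yclosed c" "snd y \<in> hemi n \<sigma> ` topspace (disc n)"
    unfolding product_closed_cell by (auto simp: pcells_def)
  then obtain z where "z \<in> coord_space (yJ c)" "yN c z \<le> 1" "fst y = ymap c z" unfolding yclosed_def by auto
  then show "fst (fst y) \<in> tree_pow" using ymap_tree_pow[OF c(1)] by simp
  have "snd y \<in> sphere_upto n" using c(3) hemi_sphere by auto
  then show "\<exists>k. snd y k \<noteq> 0" by (rule sphere_nonzero)
qed

lemma pact_mult: "g \<in> carrier level_group \<Longrightarrow> h \<in> carrier level_group \<Longrightarrow> y \<in> product.points \<Longrightarrow>
   pact (g \<otimes>\<^bsub>level_group\<^esub> h) y = pact g (pact h y)"
proof -
  assume g: "g \<in> carrier level_group" and h: "h \<in> carrier level_group" and "y \<in> product.points"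
  then obtain i x where i: "i \<in> pcells" "y = pchar i x" using points_char by blast
  interpret group level_group by (rule group_level_group)
  show ?thesis
    using pmove(3)[OF _ i(1), of "g \<otimes>\<^bsub>level_group\<^esub> h"] pmove(3)[OF h i(1)] pmove(3)[OF g pmove(1)[OF h i(1)]] g h i pmove_mult[OF g h i(1)]
    by simp
qed

text \<open>A nonzero coordinate on the sphere excludes the swap; what remains is a translation in
  each tree, which is free.\<close>

lemma pact_free:
  assumes g: "g \<in> carrier level_group" and y: "y \<in> product.points" and fix_y: "pact g y = y"
  shows "g = \<one>\<^bsub>level_group\<^esub>"
proof -
  obtain k where k: "snd y k \<noteq> 0" using points_parts(2)[OF y] by blast
  have "sg (snd g) * snd y k = snd y k" using fun_cong[OF arg_cong[OF fix_y, of snd], of k] by (simp add: pact_def)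
  then have e: "snd g = False" using k by (cases "snd g") auto
  have "fst g i = []" for i
  proof (cases "i < m")
    case True
    have "tree_move (fst g i) False (fst (fst y) i) = fst (fst y) i"
      using fun_cong[OF arg_cong[OF fix_y, of "fst \<circ> fst"], of i] True e by (simp add: pact_def ymove_def)
    moreover have "fst (fst y) i \<in> tree" using points_parts(1)[OF y] True by (simp add: tree_pow_def)
    moreover have "freely_reduced (fst g i)" using g tuples_reduced by (simp add: level_group_mem)
    ultimately show ?thesis using tree_translation_free by blast
  next
    case False
    then show ?thesis using g by (simp add: level_group_mem tuples_def)
  qed
  then show ?thesis using e by (auto simp: level_group_def prod_eq_iff)
qed

text \<open>Open stars of vertices serve as neighbourhoods. If \<open>g\<close> moves a point of the
  star of \<open>u\<close> into the star of \<open>v\<close>, then in every coordinate it moves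
  \<open>u\<close> to \<open>v\<close> or to a neighbour of \<open>v\<close>, which leaves finitely
  many \<open>g\<close>.\<close>

lemma pact_proper:
  assumes y: "y \<in> product.points" and z: "z \<in> product.points"
  shows "\<exists>U V. open U \<and> open V \<and> y \<in> U \<and> z \<in> V \<and> finite {g \<in> carrier level_group. pact g ` (U \<inter> product.points) \<inter> V \<noteq> {}}"
proof -
  have "\<exists>u. u \<in> verts (fst (fst q) i)" if "q \<in> product.points" "i < m" for q i
    using points_parts(1)[OF that(1)] verts_tree(2) that(2) by (auto simp: tree_pow_def ex_in_conv)
  then have "\<forall>i. \<exists>u. i < m \<longrightarrow> u \<in> verts (fst (fst y) i)" "\<forall>i. \<exists>u. i < m \<longrightarrow> u \<in> verts (fst (fst z) i)" using y z by blast+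
  then obtain u v where u: "\<And>i. i < m \<Longrightarrow> u i \<in> verts (fst (fst y) i)" and v: "\<And>i. i < m \<Longrightarrow> v i \<in> verts (fst (fst z) i)"
    by metis
  define N :: "(nat \<Rightarrow> w2) \<Rightarrow> (cpoint \<times> (nat \<Rightarrow> real)) set" where "N w = {q. \<forall>i<m. w i \<in> verts (fst (fst q) i)}" for w
  have "open (N w)" for w
  proof -
    have "open {q :: cpoint \<times> (nat \<Rightarrow> real). 0 < fst (fst q) i (w i)}" for i
    proof (rule open_Collect_less[OF continuous_on_const])
      have "continuous_on UNIV (\<lambda>q :: cpoint \<times> (nat \<Rightarrow> real). fst (fst q))" by (intro continuous_on_fst continuous_on_id)
      then show "continuous_on UNIV (\<lambda>q :: cpoint \<times> (nat \<Rightarrow> real). fst (fst q) i (w i))"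
        by (rule continuous_on_product_then_coordinatewise[OF continuous_on_product_then_coordinatewise])
    qed
    then have "open (\<Inter>i<m. {q :: cpoint \<times> (nat \<Rightarrow> real). 0 < fst (fst q) i (w i)})" by (intro open_INT) auto
    also have "(\<Inter>i<m. {q :: cpoint \<times> (nat \<Rightarrow> real). 0 < fst (fst q) i (w i)}) = N w" by (auto simp: N_def verts_def)
    finally show ?thesis .
  qed
  moreover have "y \<in> N u" "z \<in> N v" using u v by (auto simp: N_def)
  moreover have "finite {g \<in> carrier level_group. pact g ` (N u \<inter> product.points) \<inter> N v \<noteq> {}}"
  proof (rule finite_subset)
    define P where "P = (\<Union>i<m. \<Union>\<epsilon>. (\<lambda>q. q \<cdot> winv (twist \<epsilon> (u i))) ` insert (v i) (range (\<lambda>l. v i \<cdot> [l])))"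
    show "finite ({w \<in> tuples. \<forall>i<m. w i \<in> P} \<times> (UNIV :: bool set))"
      by (intro finite_cartesian_product finite_tuples_in) (auto simp: P_def)
    show "{g \<in> carrier level_group. pact g ` (N u \<inter> product.points) \<inter> N v \<noteq> {}} \<subseteq> {w \<in> tuples. \<forall>i<m. w i \<in> P} \<times> UNIV"
    proof
      fix g assume "g \<in> {g \<in> carrier level_group. pact g ` (N u \<inter> product.points) \<inter> N v \<noteq> {}}"
      then obtain q where g: "g \<in> carrier level_group" and q: "q \<in> N u" "q \<in> product.points" "pact g q \<in> N v" by blast
      have "fst g i \<in> P" if i: "i < m" for i
      proof -
        define x where "x = fst (fst q) i"
        have x: "x \<in> tree" using points_parts(1)[OF q(2)] i by (simp add: x_def tree_pow_def)
        have ux: "u i \<in> verts x" using q(1) i by (simp add: N_def x_def)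
        have ur: "freely_reduced (u i)" using verts_tree(3)[OF x ux] .
        have gr: "freely_reduced (fst g i)" using g tuples_reduced by (simp add: level_group_mem)
        have "v i \<in> verts (tree_move (fst g i) (snd g) x)" using q(3) i by (simp add: N_def pact_def ymove_def x_def)
        then obtain u' where u': "u' \<in> verts x" "v i = fst g i \<cdot> twist (snd g) u'" unfolding verts_tree_move[OF x] by blast
        have "u i = u' \<or> (\<exists>l. u i = u' \<cdot> [l])" using tree_neighbours[OF x u'(1) ux] by auto
        then have "fst g i \<cdot> twist (snd g) (u i) \<in> insert (v i) (range (\<lambda>l. v i \<cdot> [l]))"
        proof
          assume "\<exists>l. u i = u' \<cdot> [l]"
          then obtain s e where "u i = u' \<cdot> [(s, e)]" by auto
          then have "fst g i \<cdot> twist (snd g) (u i) = v i \<cdot> [(s \<noteq> snd g, e)]" using u'(2) by (simp add: mul_assoc)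
          then show ?thesis by blast
        next
          assume "u i = u'"
          then show ?thesis using u' by simp
        qed
        moreover have "fst g i = (fst g i \<cdot> twist (snd g) (u i)) \<cdot> winv (twist (snd g) (u i))"
          using ur gr by (simp add: mul_assoc)
        ultimately show ?thesis unfolding P_def using i by blast
      qed
      then show "g \<in> {w \<in> tuples. \<forall>i<m. w i \<in> P} \<times> UNIV" using g by (cases g) (auto simp: level_group_mem)
    qed
  qed
  ultimately show ?thesis by blast
qed

lemma ycells_nonempty: "\<exists>c. c \<in> ycells"
proof -
  have "dirs (\<lambda>_. None) = {}" by (simp add: dirs_def)
  then have "cube_ok (\<lambda>_. []) (\<lambda>_. None)" using m_pos by (simp add: cube_ok_def tuples_def ht_def)
  then show ?thesis by (auto simp: ycells_def)
qed

text \<open>The orbit map chooses a representative of each orbit and codes it by \<open>enc\<close>,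
  so that the points of the quotient have the type \<open>'p\<close>.\<close>

lemma free_cell_action_level:
  fixes enc :: "cpoint \<times> (nat \<Rightarrow> real) \<Rightarrow> 'p"
  assumes enc: "inj enc"
  defines "p \<equiv> (\<lambda>y. enc (SOME z. \<exists>g\<in>carrier level_group. z = pact g y))"
  shows "free_cell_action pcells pdim pchar level_group pact p"
proof -
  interpret G: group level_group by (rule group_level_group)
  show ?thesis
  proof unfold_locales
    fix g i assume "g \<in> carrier level_group" "i \<in> pcells"
    then show "\<exists>j\<in>pcells. pdim j = pdim i \<and> (\<forall>x\<in>topspace (disc (pdim i)). pchar j x = pact g (pchar i x))"
      by (intro bexI[of _ "pmove g i"]) (simp_all add: pmove)
  next
    fix y assume y: "y \<in> product.points"
    then obtain i x where i: "i \<in> pcells" "y = pchar i x" using points_char by blast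
    show "pact \<one>\<^bsub>level_group\<^esub> y = y" using pmove(3)[OF G.one_closed i(1), of x] pmove_one[OF i(1)] i by simp
  next
    fix y z assume y: "y \<in> product.points" and z: "z \<in> product.points"
    obtain i x where i: "i \<in> pcells" "y = pchar i x" using points_char[OF y] by blast
    have one: "pact \<one>\<^bsub>level_group\<^esub> y = y" using pmove(3)[OF G.one_closed i(1), of x] pmove_one[OF i(1)] i by simp
    define orb where "orb y = {z. \<exists>g\<in>carrier level_group. z = pact g y}" for y
    have p: "p y = enc (SOME z. z \<in> orb y)" for y by (simp add: p_def orb_def)
    show "p y = p z \<longleftrightarrow> (\<exists>g\<in>carrier level_group. z = pact g y)"
    proof
      assume "p y = p z"
      then have "(SOME q. q \<in> orb y) = (SOME q. q \<in> orb z)" using enc by (simp add: p inj_eq)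
      moreover have "(SOME q. q \<in> orb y) \<in> orb y" "(SOME q. q \<in> orb z) \<in> orb z"
        by (rule someI[of _ "pact \<one>\<^bsub>level_group\<^esub> _"]; auto simp: orb_def)+
      ultimately obtain g h where gh: "g \<in> carrier level_group" "h \<in> carrier level_group" "pact g y = pact h z" by (auto simp: orb_def)
      obtain j x' where j: "j \<in> pcells" "z = pchar j x'" using points_char[OF z] by blast
      have "z = pact (inv\<^bsub>level_group\<^esub> h \<otimes>\<^bsub>level_group\<^esub> h) z"
        using pmove(3)[OF G.one_closed j(1), of x'] pmove_one[OF j(1)] j gh by simp
      also have "\<dots> = pact (inv\<^bsub>level_group\<^esub> h) (pact h z)" using gh z by (intro pact_mult) auto
      also have "\<dots> = pact (inv\<^bsub>level_group\<^esub> h \<otimes>\<^bsub>level_group\<^esub> g) y" using gh y by (simp add: pact_mult)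
      finally show "\<exists>g\<in>carrier level_group. z = pact g y" using gh by blast
    next
      assume "\<exists>g\<in>carrier level_group. z = pact g y"
      then obtain g where g: "g \<in> carrier level_group" "z = pact g y" by blast
      have "orb z \<subseteq> orb y"
      proof
        fix q assume "q \<in> orb z"
        then obtain h where h: "h \<in> carrier level_group" "q = pact h z" by (auto simp: orb_def)
        then have "q = pact (h \<otimes>\<^bsub>level_group\<^esub> g) y" using g pact_mult[OF h(1) g(1) y] by simp
        then show "q \<in> orb y" using h g unfolding orb_def by blast
      qed
      moreover have "orb y \<subseteq> orb z"
      proof
        fix q assume "q \<in> orb y"
        then obtain h where h: "h \<in> carrier level_group" "q = pact h y" by (auto simp: orb_def)
        have "q = pact ((h \<otimes>\<^bsub>level_group\<^esub> inv\<^bsub>level_group\<^esub> g) \<otimes>\<^bsub>level_group\<^esub> g) y" using h g by (simp add: G.m_assoc)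
        also have "\<dots> = pact (h \<otimes>\<^bsub>level_group\<^esub> inv\<^bsub>level_group\<^esub> g) z" unfolding g(2) using h g y by (intro pact_mult) auto
        finally show "q \<in> orb z" using h g unfolding orb_def by blast
      qed
      ultimately have "orb y = orb z" by blast
      then show "p y = p z" by (simp add: p)
    qed
  next
    show "pcells \<noteq> {}" using ycells_nonempty by (auto simp: pcells_def)
  next
    fix C D :: "(nat \<Rightarrow> real) set" and f F
    assume "compact C" "compact D" "C \<subseteq> D" "continuous_on C f" "finite F" "F \<subseteq> pcells" "f ` C \<subseteq> (\<Union>i\<in>F. product.closed_cell i)"
    then show "\<exists>g F'. continuous_on D g \<and> finite F' \<and> F' \<subseteq> pcells \<and> g ` D \<subseteq> (\<Union>i\<in>F'. product.closed_cell i) \<and> (\<forall>x\<in>C. g x = f x)"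
      by (rule pextension)
  qed (fact pact_mult pact_free pact_proper)+
qed

text \<open>Below dimension \<open>m\<close> there are only products of cubes with cells of the
  sphere. A translation of exponent sum 0 carries a standard vertex of the same height to the base
  vertex of the cube, and finitely many heights and directions occur.\<close>

lemma finite_cells_mod:
  obtains R where "finite R" "\<And>i. i \<in> pcells \<Longrightarrow> pdim i < m \<Longrightarrow> \<exists>g\<in>carrier level_group. \<exists>r\<in>R. r \<in> pcells \<and> i = pmove g r"
proof -
  define r where "r k = (\<lambda>i::nat. if i = 0 then replicate (nat k) (False, True) else [])" for k :: int
  have rt: "r k \<in> tuples" for k using m_pos by (auto simp: r_def tuples_def)
  have rh: "ht (r k) = k" if "0 \<le> k" for k
  proof -
    have "ht (r k) = (\<Sum>i<m. if i = 0 then k else 0)" unfolding ht_def r_def using that by (intro sum.cong) auto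
    then show ?thesis using m_pos by simp
  qed
  define opts where "opts = {d :: nat \<Rightarrow> bool option. \<forall>i\<ge>m. d i = None}"
  have "finite opts"
  proof (rule finite_subset)
    show "opts \<subseteq> (\<lambda>f i. if i < m then f i else None) ` PiE {..<m} (\<lambda>_. UNIV :: bool option set)"
    proof
      fix d assume "d \<in> opts"
      then have "d = (\<lambda>i. if i < m then restrict d {..<m} i else None)" by (auto simp: opts_def fun_eq_iff)
      then show "d \<in> (\<lambda>f i. if i < m then f i else None) ` PiE {..<m} (\<lambda>_. UNIV)"
        by (rule image_eqI[of _ _ "restrict d {..<m}"]) auto
    qed
  next
    show "finite ((\<lambda>f i. if i < m then f i else None) ` PiE {..<m} (\<lambda>_. UNIV :: bool option set))"
      by (intro finite_imageI finite_PiE) simp_all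
  qed
  define R where "R = (\<lambda>(k, d, \<sigma>, n). (Cube (r k) d, \<sigma>, n)) ` ({0..int m} \<times> opts \<times> (UNIV :: bool set) \<times> {..<m})"
  show thesis
  proof
    show "finite R" unfolding R_def using \<open>finite opts\<close> by (intro finite_imageI finite_cartesian_product) auto
    fix i assume i: "i \<in> pcells" "pdim i < m"
    obtain c \<sigma> n where ic: "i = (c, \<sigma>, n)" using prod_cases3 by blast
    have dim: "card (yJ c) + n < m" using i(2) by (simp add: ic pdim_eq)
    \<comment> \<open>A dome has dimension \<open>m\<close> and is excluded.\<close>
    then obtain w d where c: "c = Cube w d" by (cases c) auto
    have ok: "cube_ok w d" using i(1) by (auto simp: ic c pcells_def ycells_def)
    define g where "g = ((\<lambda>j. w j \<cdot> winv (r (ht w) j)), False)"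
    have wt: "w \<in> tuples" and h0: "0 \<le> ht w" "ht w + int (card (dirs d)) \<le> int m - 1" using ok by (auto simp: cube_ok_def)
    have "ht (fst g) = ht w - ht (r (ht w))" by (simp add: ht_def g_def sum_subtractf)
    moreover have "fst g \<in> tuples" using wt rt[of "ht w"] by (auto simp: g_def tuples_def winv_def[of "[]"])
    ultimately have g: "g \<in> carrier level_group" using rh[OF h0(1)] by (simp add: level_group_mem)
    have "gact g (r (ht w)) = w"
      using tuples_reduced[OF wt] tuples_reduced[OF rt] by (simp add: gact_def g_def mul_assoc)
    moreover have "map_option (\<lambda>s. s \<noteq> snd g) (d j) = d j" for j by (cases "d j") (auto simp: g_def)
    ultimately have "i = pmove g (Cube (r (ht w)) d, \<sigma>, n)" by (simp add: ic c) (simp add: g_def)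
    moreover have "(Cube (r (ht w)) d, \<sigma>, n) \<in> R"
      unfolding R_def using ok h0 dim by (intro image_eqI[of _ _ "(ht w, d, \<sigma>, n)"]) (auto simp: opts_def cube_ok_def)
    moreover have "(Cube (r (ht w)) d, \<sigma>, n) \<in> pcells"
      using ok rt rh[OF h0(1)] by (auto simp: pcells_def ycells_def cube_ok_def)
    ultimately show "\<exists>g\<in>carrier level_group. \<exists>r\<in>R. r \<in> pcells \<and> i = pmove g r" using g by blast
  qed
qed

text \<open>Cells in one orbit give the same element of \<open>quotient_cells\<close>, so the
  representatives from \<open>finite_cells_mod\<close> account for all cells of dimension below
  \<open>m\<close>.\<close>

theorem type_F_level_group:
  fixes enc :: "cpoint \<times> (nat \<Rightarrow> real) \<Rightarrow> 'p"
  assumes enc: "inj enc"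
  shows "\<exists>(X :: 'p topology) E. cw_complex X E \<and> Eilenberg_MacLane_1 level_group X \<and> (\<forall>i\<le>m - 1. finite (E i))"
proof -
  define p where "p = (\<lambda>y. enc (SOME z. \<exists>g\<in>carrier level_group. z = pact g y))"
  interpret free_cell_action pcells pdim pchar level_group pact p
    unfolding p_def by (rule free_cell_action_level[OF enc])
  have "finite (quotient_cells i)" if i: "i \<le> m - 1" for i
  proof -
    obtain R where R: "finite R" "\<And>i. i \<in> pcells \<Longrightarrow> pdim i < m \<Longrightarrow> \<exists>g\<in>carrier level_group. \<exists>r\<in>R. r \<in> pcells \<and> i = pmove g r"
      using finite_cells_mod by metis
    have "quotient_cells i \<subseteq> (\<lambda>j. restrict (p \<circ> pchar j) (topspace (disc i))) ` R"
    proof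
      fix \<psi> assume "\<psi> \<in> quotient_cells i"
      then obtain j where j: "j \<in> pcells" "pdim j = i" "\<psi> = restrict (p \<circ> pchar j) (topspace (disc i))"
        by (auto simp: quotient_cells_def)
      obtain g r where gr: "g \<in> carrier level_group" "r \<in> R" "r \<in> pcells" "j = pmove g r"
        using R(2)[OF j(1)] j(2) i m_pos by (metis Suc_pred' less_Suc_eq_le)
      have "p (pchar j x) = p (pchar r x)" if x: "x \<in> topspace (disc i)" for x
      proof -
        have "pchar r x \<in> product.points" "pchar j x \<in> product.points"
          using product.cell_in_points[of r x] product.cell_in_points[of j x] gr j x pmove(2)[OF gr(1,3)] by auto
        moreover have "pchar j x = pact g (pchar r x)" using pmove(3)[OF gr(1,3)] gr(4) by simp
        ultimately show ?thesis using c_fibres[of "pchar r x" "pchar j x"] gr(1) by auto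
      qed
      then have "\<psi> = restrict (p \<circ> pchar r) (topspace (disc i))" using j(3) by (auto simp: restrict_def fun_eq_iff)
      then show "\<psi> \<in> (\<lambda>j. restrict (p \<circ> pchar j) (topspace (disc i))) ` R" using gr(2) by blast
    qed
    then show ?thesis using R(1) finite_surj by blast
  qed
  then show ?thesis using type_F_quotient by blast
qed

end

section \<open>The embedding into the outer automorphism group\<close>

section \<open>Substitutions in free groups\<close>

definition letter_image :: "('s \<Rightarrow> 't word) \<Rightarrow> 's \<times> bool \<Rightarrow> 't word" where
  "letter_image f l = (if snd l then f (fst l) else winv (f (fst l)))"

definition subst :: "('s \<Rightarrow> 't word) \<Rightarrow> 's word \<Rightarrow> 't word" where
  "subst f w = foldr (\<lambda>l u. letter_image f l \<cdot> u) w []"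

lemma subst_Nil [simp]: "subst f [] = []" and subst_Cons: "subst f (l # w) = letter_image f l \<cdot> subst f w"
  by (simp_all add: subst_def)

lemma reduced_subst [simp]: "freely_reduced (subst f w)"
  by (induction w) (simp_all add: subst_Cons)

lemma letter_image_inv: "letter_image f (inv_letter l) = winv (letter_image f l)"
  by (simp add: letter_image_def inv_letter_def)

lemma subst_cons_reduce: "subst f (cons_reduce l w) = letter_image f l \<cdot> subst f w"
  by (cases w) (simp_all add: subst_Cons letter_image_inv)

lemma subst_mul: "subst f (u \<cdot> v) = subst f u \<cdot> subst f v"
  by (induction u) (simp_all add: subst_Cons subst_cons_reduce mul_assoc)

lemma subst_winv: "freely_reduced u \<Longrightarrow> subst f (winv u) = winv (subst f u)"
proof -
  assume u: "freely_reduced u"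
  have "subst f (winv u) \<cdot> subst f u = []" using u subst_mul[of f "winv u" u] by simp
  then have "(subst f (winv u) \<cdot> subst f u) \<cdot> winv (subst f u) = winv (subst f u)" by simp
  then show ?thesis by (simp add: mul_assoc)
qed

lemma subst_subst:
  assumes g: "\<And>s. freely_reduced (g s)"
  shows "subst f (subst g w) = subst (\<lambda>s. subst f (g s)) w"
proof (induction w)
  case (Cons l w)
  have "subst f (letter_image g l) = letter_image (\<lambda>s. subst f (g s)) l"
    using subst_winv[OF g, of f] by (simp add: letter_image_def)
  then show ?case using Cons by (simp add: subst_Cons subst_mul)
qed simp

lemma subst_id: "freely_reduced w \<Longrightarrow> subst (\<lambda>s. [(s, True)]) w = w"
proof (induction w)
  case (Cons l w)
  have "letter_image (\<lambda>s. [(s, True)]) l = [l]"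
    by (cases l) (auto simp: letter_image_def winv_def inv_letter_def)
  then show ?case using Cons reduced_ConsD[OF Cons.prems] by (simp add: subst_Cons cons_reduce_reduced)
qed simp

lemma subst_single: "freely_reduced (f s) \<Longrightarrow> subst f [(s, True)] = f s"
  by (simp add: subst_Cons letter_image_def)

lemma subst_letters:
  assumes "\<And>s. s \<in> A \<Longrightarrow> set (f s) \<subseteq> B \<times> UNIV" "set w \<subseteq> A \<times> UNIV"
  shows "set (subst f w) \<subseteq> B \<times> UNIV"
  using assms(2)
proof (induction w)
  case (Cons l w)
  have "set (winv u) \<subseteq> B \<times> UNIV" if "set u \<subseteq> B \<times> UNIV" for u :: "'b word"
    using that by (force simp: winv_def inv_letter_def)
  moreover have "set (f (fst l)) \<subseteq> B \<times> UNIV" using assms(1)[of "fst l"] Cons.prems by (cases l) simp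
  ultimately have "set (letter_image f l) \<subseteq> B \<times> UNIV" by (simp add: letter_image_def)
  moreover have "set (subst f w) \<subseteq> B \<times> UNIV" using Cons by simp
  ultimately show ?case using set_foldr[of "letter_image f l" "subst f w"] by (simp add: subst_Cons) blast
qed simp

definition expo :: "'s \<Rightarrow> 's word \<Rightarrow> int" where
  "expo s w = (\<Sum>l\<leftarrow>w. if fst l = s then if snd l then 1 else -1 else 0)"

lemma expo_simps [simp]: "expo s [] = 0" "expo s (l # w) = (if fst l = s then if snd l then 1 else -1 else 0) + expo s w"
  by (simp_all add: expo_def)

lemma expo_mul: "expo s (u \<cdot> v) = expo s u + expo s v"
proof -
  have "expo s (cons_reduce l w) = expo s (l # w)" for l w
    by (cases w) (auto simp: inv_letter_def)
  then show ?thesis by (induction u) simp_all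
qed

lemma expo_winv: "expo s (winv u) = - expo s u"
proof -
  have "expo s (u @ v) = expo s u + expo s v" for u v :: "'a word" by (simp add: expo_def)
  then show ?thesis by (induction u) (auto simp: winv_def inv_letter_def)
qed

section \<open>The transvections of a pair of generators\<close>

text \<open>On exponent sums these are the matrices with 1 on the diagonal and one further entry
  \<open>2\<close> or \<open>-2\<close>, Sanov's generators of a free group of rank 2 and their
  inverses. Exchanging the two generators interchanges them.\<close>

definition transv :: "bool \<times> bool \<Rightarrow> bool \<Rightarrow> w2" where
  "transv l r = (if r = fst l then [(r, True), (\<not> r, snd l), (\<not> r, snd l)] else [(r, True)])"

definition theta :: "w2 \<Rightarrow> bool \<Rightarrow> w2" where
  "theta w r = foldr (\<lambda>l. subst (transv l)) w [(r, True)]"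

lemma reduced_transv [simp]: "freely_reduced (transv l r)"
  by (auto simp: transv_def freely_reduced_def inv_letter_def)

lemma theta_simps: "theta [] r = [(r, True)]" "theta (l # w) r = subst (transv l) (theta w r)"
  by (simp_all add: theta_def)

lemma reduced_theta [simp]: "freely_reduced (theta w r)"
  by (cases w) (simp_all add: theta_simps)

lemma transv_inv:
  assumes "freely_reduced u" shows "subst (transv l) (subst (transv (inv_letter l)) u) = u"
proof -
  have "subst (transv l) (transv (inv_letter l) r) = [(r, True)]" for r
    by (cases l; cases "fst l"; cases "snd l"; cases r)
      (simp_all add: transv_def inv_letter_def subst_Cons letter_image_def winv_def)
  then show ?thesis using subst_id[OF assms] by (simp add: subst_subst)
qed

lemma theta_cons_reduce: "theta (cons_reduce l w) r = subst (transv l) (theta w r)"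
proof (cases w)
  case (Cons m v)
  then show ?thesis using transv_inv[of "theta v r" l] by (simp add: theta_simps)
qed (simp add: theta_simps)

lemma theta_mul: "theta (u \<cdot> v) r = subst (theta u) (theta v r)"
proof (induction u)
  case Nil
  have "theta [] = (\<lambda>s. [(s, True)])" by (simp add: theta_simps fun_eq_iff)
  then show ?case by (simp add: subst_id)
next
  case (Cons l u)
  have "theta (l # u) = (\<lambda>s. subst (transv l) (theta u s))" by (simp add: theta_simps fun_eq_iff)
  then show ?case using Cons by (simp add: theta_cons_reduce subst_subst)
qed

text \<open>Exchanging the two generators conjugates the transvection of a letter into that of the
  swapped letter. This is the relation of the semidirect product.\<close>

lemma theta_twist: "subst (\<lambda>r. [(r \<noteq> \<epsilon>, True)]) (theta w r) = theta (twist \<epsilon> w) (r \<noteq> \<epsilon>)"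
proof (induction w)
  case Nil then show ?case by (simp add: theta_simps subst_single)
next
  case (Cons l w)
  define l' where "l' = (fst l \<noteq> \<epsilon>, snd l)"
  have tw: "twist \<epsilon> (l # w) = l' # twist \<epsilon> w" by (auto simp: twist_def swap_def l'_def prod_eq_iff)
  have eq: "subst (\<lambda>r. [(r \<noteq> \<epsilon>, True)]) (transv l q) = subst (transv l') [(q \<noteq> \<epsilon>, True)]" for q
    by (cases l; cases "fst l"; cases "snd l"; cases \<epsilon>; cases q)
      (simp_all add: transv_def inv_letter_def subst_Cons letter_image_def winv_def l'_def)
  have "subst (\<lambda>r. [(r \<noteq> \<epsilon>, True)]) (theta (l # w) r) = subst (\<lambda>q. subst (\<lambda>r. [(r \<noteq> \<epsilon>, True)]) (transv l q)) (theta w r)"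
    by (simp add: theta_simps subst_subst)
  also have "\<dots> = subst (\<lambda>q. subst (transv l') [(q \<noteq> \<epsilon>, True)]) (theta w r)" unfolding eq ..
  also have "\<dots> = subst (transv l') (subst (\<lambda>q. [(q \<noteq> \<epsilon>, True)]) (theta w r))" by (simp add: subst_subst)
  finally show ?case using Cons tw by (simp add: theta_simps)
qed

lemma expo_transv: "expo s (subst (transv l) u) = expo s u + (if s \<noteq> fst l then (if snd l then 2 else -2) * expo (fst l) u else 0)"
proof (induction u)
  case (Cons x u)
  have "expo s (letter_image (transv l) x) = expo s [x] + (if s \<noteq> fst l then (if snd l then 2 else -2) * expo (fst l) [x] else 0)"
    by (cases x; cases l; cases s) (auto simp: letter_image_def transv_def expo_winv)
  then show ?case using Cons by (auto simp: subst_Cons expo_mul algebra_simps)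
qed simp

text \<open>Ping-pong on the exponent vectors: the transvection of the leading letter leaves the larger
  exponent sum at the other generator, with a definite sign.\<close>

lemma theta_ping_pong:
  assumes "freely_reduced w" "w \<noteq> []"
  defines "u \<equiv> expo (fst (hd w)) (theta w (fst (last w)))" and "v \<equiv> expo (\<not> fst (hd w)) (theta w (fst (last w)))"
  shows "0 < \<bar>u\<bar>" "\<bar>u\<bar> < \<bar>v\<bar>" "sgn u * sgn v = (if snd (hd w) then 1 else -1)"
proof -
  have "0 < \<bar>expo (fst (hd w)) (theta w (fst (last w)))\<bar> \<and>
    \<bar>expo (fst (hd w)) (theta w (fst (last w)))\<bar> < \<bar>expo (\<not> fst (hd w)) (theta w (fst (last w)))\<bar> \<and>
    sgn (expo (fst (hd w)) (theta w (fst (last w)))) * sgn (expo (\<not> fst (hd w)) (theta w (fst (last w)))) = (if snd (hd w) then 1 else -1)"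
    using assms(1,2)
  proof (induction w)
    case (Cons l w)
    show ?case
    proof (cases "w = []")
      case True
      then show ?thesis by (auto simp: theta_simps expo_transv)
    next
      case False
      define p where "p = expo (fst (hd w)) (theta w (fst (last w)))"
      define q where "q = expo (\<not> fst (hd w)) (theta w (fst (last w)))"
      have red: "freely_reduced w" "hd w \<noteq> inv_letter l" using Cons.prems False by (cases w; auto simp: freely_reduced_def)+
      have IH: "0 < \<bar>p\<bar>" "\<bar>p\<bar> < \<bar>q\<bar>" "sgn p * sgn q = (if snd (hd w) then 1 else -1)"
        using Cons.IH[OF red(1) False] by (simp_all add: p_def q_def)
      define e :: int where "e = (if snd l then 1 else -1)"
      have e: "e = 1 \<or> e = -1" by (simp add: e_def)
      show ?thesis
      \<comment> \<open>For the same generator reducedness forces the same sign, so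
        \<open>2 * e * p\<close> has the sign of \<open>q\<close> and the larger entry grows. For
        the other generator \<open>p\<close> and \<open>q\<close> change roles, and the factor 2
        makes \<open>p + 2 * e * q\<close> exceed \<open>q\<close> in absolute value, with the sign
        of \<open>e * q\<close>.\<close>
      proof (cases "fst l = fst (hd w)")
        case True
        then have "snd (hd w) = snd l" using red(2) by (auto simp: inv_letter_def prod_eq_iff)
        then have s: "sgn p * sgn q = e" using IH(3) by (simp add: e_def)
        have 1: "expo (fst (hd (l # w))) (theta (l # w) (fst (last (l # w)))) = p"
          "expo (\<not> fst (hd (l # w))) (theta (l # w) (fst (last (l # w)))) = q + 2 * e * p"
          using True False by (auto simp: theta_simps expo_transv p_def q_def e_def)
        show ?thesis
          unfolding 1 using IH(1,2) s e by (auto simp: sgn_if e_def split: if_splits)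
      next
        case F: False
        then have h: "(\<not> fst l) = fst (hd w)" "fst l = (\<not> fst (hd w))" by auto
        have 1: "expo (fst (hd (l # w))) (theta (l # w) (fst (last (l # w)))) = q"
          "expo (\<not> fst (hd (l # w))) (theta (l # w) (fst (last (l # w)))) = p + 2 * e * q"
          using h False by (auto simp: theta_simps expo_transv p_def q_def e_def)
        show ?thesis
          unfolding 1 using IH(1,2) e by (auto simp: sgn_if e_def split: if_splits)
      qed
    qed
  qed simp
  then show "0 < \<bar>u\<bar>" "\<bar>u\<bar> < \<bar>v\<bar>" "sgn u * sgn v = (if snd (hd w) then 1 else -1)"
    unfolding u_def v_def by simp_all
qed

text \<open>The generator \<open>fst (last w)\<close> is the one that the innermost transvection
  really moves; for it ping-pong bounds both exponent sums away from 0.\<close>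

lemma theta_expo_nonzero:
  assumes "freely_reduced w" "w \<noteq> []"
  obtains r where "\<And>s. expo s (theta w r) \<noteq> 0"
proof (rule that)
  fix s
  show "expo s (theta w (fst (last w))) \<noteq> 0"
    using theta_ping_pong(1,2)[OF assms] by (cases "s = fst (hd w)") auto
qed

section \<open>The level group acts on a free group\<close>

definition block :: "nat \<Rightarrow> bool \<Rightarrow> nat word" where
  "block i r = [(2 * i + of_bool r, True)]"

lemma reduced_block [simp]: "freely_reduced (block i r)"
  by (simp add: block_def)

lemma expo_block: "expo (2 * i + of_bool s) (subst (block i) u) = expo s u"
proof (induction u)
  case (Cons l u)
  have "expo (2 * i + of_bool s) (letter_image (block i) l) = expo s [l]"
    by (cases s; cases "fst l") (auto simp: letter_image_def block_def expo_winv)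
  then show ?case using Cons by (simp add: subst_Cons expo_mul)
qed simp

context tree_power
begin

text \<open>Parity distinguishes the two letters of a block. The swap enters as the exclusive or
  \<open>odd s \<noteq> snd g\<close> and is applied before the word acts.\<close>

definition gen_image :: "(nat \<Rightarrow> w2) \<times> bool \<Rightarrow> nat \<Rightarrow> nat word" where
  "gen_image g s = (if s < 2 * m then subst (block (s div 2)) (theta (fst g (s div 2)) (odd s \<noteq> snd g)) else [(s, True)])"

lemma reduced_gen_image [simp]: "freely_reduced (gen_image g s)"
  by (simp add: gen_image_def)

lemma gen_image_block: "i < m \<Longrightarrow> gen_image g (2 * i + of_bool r) = subst (block i) (theta (fst g i) (r \<noteq> snd g))"
  by (cases r) (simp_all add: gen_image_def)

text \<open>Moving the swap of \<open>g\<close> past the word of \<open>h\<close> twists that word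
  by \<open>theta_twist\<close>, which is the multiplication of \<open>level_group\<close>.\<close>

lemma gen_image_mult: "subst (gen_image g) (gen_image h s) = gen_image (g \<otimes>\<^bsub>level_group\<^esub> h) s"
proof (cases "s < 2 * m")
  case True
  define i where "i = s div 2"
  define \<epsilon> where "\<epsilon> = snd g"
  define q where "q = (odd s \<noteq> snd h)"
  have i: "i < m" using True by (simp add: i_def)
  have "subst (gen_image g) (gen_image h s) = subst (\<lambda>r. subst (gen_image g) (block i r)) (theta (fst h i) q)"
    using True by (simp add: gen_image_def[of h] subst_subst i_def q_def)
  also have "(\<lambda>r. subst (gen_image g) (block i r)) = (\<lambda>r. subst (block i) (subst (theta (fst g i)) [(r \<noteq> \<epsilon>, True)]))"
    using gen_image_block[OF i] by (simp add: block_def[of i] subst_single \<epsilon>_def fun_eq_iff)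
  also have "subst \<dots> (theta (fst h i) q) = subst (block i) (subst (theta (fst g i)) (subst (\<lambda>r. [(r \<noteq> \<epsilon>, True)]) (theta (fst h i) q)))"
    by (simp add: subst_subst)
  also have "\<dots> = subst (block i) (theta (fst g i \<cdot> twist \<epsilon> (fst h i)) (q \<noteq> \<epsilon>))"
    unfolding theta_twist theta_mul ..
  also have "\<dots> = gen_image (g \<otimes>\<^bsub>level_group\<^esub> h) s"
  proof -
    have "(q \<noteq> \<epsilon>) = (odd s \<noteq> (snd g \<noteq> snd h))" by (auto simp: q_def \<epsilon>_def)
    then show ?thesis using True by (simp add: gen_image_def i_def \<epsilon>_def level_group_def gact_def)
  qed
  finally show ?thesis .
next
  case False
  then show ?thesis by (simp add: gen_image_def subst_single)
qed

lemma gen_image_one: "gen_image \<one>\<^bsub>level_group\<^esub> s = [(s, True)]"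
proof (cases "s < 2 * m")
  case True
  then show ?thesis
    by (cases "odd s") (simp_all add: gen_image_def level_group_def theta_simps subst_single block_def)
qed (simp add: gen_image_def)

end

locale level_out = tree_power +
  fixes k :: nat
  assumes m_le: "2 * m \<le> k"
begin

abbreviation F :: "nat word monoid" where "F \<equiv> free_group {..<k}"

sublocale F: group F by (rule group_free_group)

definition gaut :: "(nat \<Rightarrow> w2) \<times> bool \<Rightarrow> nat word \<Rightarrow> nat word" where
  "gaut g = (\<lambda>x\<in>carrier F. subst (gen_image g) x)"

definition gout :: "(nat \<Rightarrow> w2) \<times> bool \<Rightarrow> (nat word \<Rightarrow> nat word) set" where
  "gout g = Inn F #>\<^bsub>AutoGroup F\<^esub> gaut g"

lemma carrier_F: "w \<in> carrier F \<longleftrightarrow> set w \<subseteq> {..<k} \<times> UNIV \<and> freely_reduced w"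
  by (simp add: free_group_def)

lemma mult_F: "u \<otimes>\<^bsub>F\<^esub> v = u \<cdot> v"
  by (simp add: free_group_def)

lemma gen_image_letters: "s < k \<Longrightarrow> set (gen_image g s) \<subseteq> {..<k} \<times> UNIV"
proof (cases "s < 2 * m")
  case True
  have "2 * (s div 2) + 1 < 2 * m" using True by presburger
  then have "2 * (s div 2) + 1 < k" using m_le by linarith
  then have "set (block (s div 2) r) \<subseteq> {..<k} \<times> UNIV" for r by (cases r) (auto simp: block_def)
  then show ?thesis using True subst_letters[of UNIV "block (s div 2)" "{..<k}"] by (simp add: gen_image_def)
qed (simp add: gen_image_def)

lemma subst_carrier: "w \<in> carrier F \<Longrightarrow> subst (gen_image g) w \<in> carrier F"
  using subst_letters[of "{..<k}" "gen_image g" "{..<k}" w] gen_image_letters by (simp add: carrier_F)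

lemma subst_gen_mult: "subst (gen_image g) (subst (gen_image h) w) = subst (gen_image (g \<otimes>\<^bsub>level_group\<^esub> h)) w"
  by (simp add: subst_subst gen_image_mult)

lemma subst_gen_one: "w \<in> carrier F \<Longrightarrow> subst (gen_image \<one>\<^bsub>level_group\<^esub>) w = w"
proof -
  have "gen_image \<one>\<^bsub>level_group\<^esub> = (\<lambda>s. [(s, True)])" by (simp add: gen_image_one fun_eq_iff)
  then show "w \<in> carrier F \<Longrightarrow> ?thesis" by (simp add: subst_id carrier_F)
qed

lemma gaut_auto: "g \<in> carrier level_group \<Longrightarrow> gaut g \<in> auto F"
proof -
  assume g: "g \<in> carrier level_group"
  interpret L: group level_group by (rule group_level_group)
  have "bij_betw (gaut g) (carrier F) (carrier F)"
  proof (rule bij_betw_byWitness[where f' = "subst (gen_image (inv\<^bsub>level_group\<^esub> g))"])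
    show "\<forall>w\<in>carrier F. subst (gen_image (inv\<^bsub>level_group\<^esub> g)) (gaut g w) = w"
      using g by (simp add: gaut_def subst_gen_mult subst_gen_one)
    show "\<forall>w\<in>carrier F. gaut g (subst (gen_image (inv\<^bsub>level_group\<^esub> g)) w) = w"
      using g by (simp add: gaut_def subst_carrier subst_gen_mult subst_gen_one)
  qed (auto simp: gaut_def subst_carrier)
  moreover have "gaut g \<in> hom F F"
    by (rule homI) (simp_all add: gaut_def subst_carrier F.m_closed, simp add: mult_F subst_mul)
  ultimately show ?thesis by (simp add: auto_def Bij_def gaut_def)
qed

lemma gaut_hom: "gaut \<in> hom level_group (AutoGroup F)"
proof (rule homI)
  fix g h assume g: "g \<in> carrier level_group" and h: "h \<in> carrier level_group"
  show "gaut g \<in> carrier (AutoGroup F)" using gaut_auto[OF g] by (simp add: carrier_AutoGroup)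
  show "gaut (g \<otimes>\<^bsub>level_group\<^esub> h) = gaut g \<otimes>\<^bsub>AutoGroup F\<^esub> gaut h"
    using gaut_auto[OF g] gaut_auto[OF h]
    by (simp add: mult_AutoGroup compose_def gaut_def subst_carrier subst_gen_mult cong: restrict_cong)
qed

lemma gout_hom: "gout \<in> hom level_group (Out F)"
  using hom_compose[OF gaut_hom normal.r_coset_hom_Mod[OF F.Inn_normal]]
  by (simp add: gout_def[abs_def] Out_def comp_def)

text \<open>Conjugation does not change exponent sums, so an inner \<open>gaut g\<close> acts on
  them as the identity matrix. Ping-pong excludes this for every nontrivial coordinate word.\<close>

lemma gaut_inner_trivial:
  assumes g: "g \<in> carrier level_group" and inn: "gaut g \<in> Inn F"
  shows "g = \<one>\<^bsub>level_group\<^esub>"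
proof -
  obtain c where c: "c \<in> carrier F" "gaut g = (\<lambda>x\<in>carrier F. c \<otimes>\<^bsub>F\<^esub> x \<otimes>\<^bsub>F\<^esub> inv\<^bsub>F\<^esub> c)" using inn by (auto simp: Inn_def)
  have ic: "expo s (inv\<^bsub>F\<^esub> c) = - expo s c" for s
  proof -
    have "c \<cdot> inv\<^bsub>F\<^esub> c = []" using F.r_inv[OF c(1)] by (simp add: free_group_def)
    then show ?thesis using expo_mul[of s c "inv\<^bsub>F\<^esub> c"] by simp
  qed
  have E: "expo s (gen_image g r) = (if r = s then 1 else 0)" if "r < k" for r s
  proof -
    have r: "[(r, True)] \<in> carrier F" using that by (simp add: carrier_F)
    then have "gaut g [(r, True)] = gen_image g r" by (simp add: gaut_def subst_single)
    moreover have "gaut g [(r, True)] = (c \<cdot> [(r, True)]) \<cdot> inv\<^bsub>F\<^esub> c" using c(2) r by (simp add: mult_F)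
    ultimately have "expo s (gen_image g r) = expo s ((c \<cdot> [(r, True)]) \<cdot> inv\<^bsub>F\<^esub> c)" by simp
    also have "\<dots> = expo s [(r, True)]" unfolding expo_mul ic by simp
    finally show ?thesis by simp
  qed
  have T: "expo s (theta (fst g i) (r \<noteq> snd g)) = (if r = s then 1 else 0)" if i: "i < m" for i r s
  proof -
    have "2 * i + of_bool r < k" using i m_le by (cases r) auto
    then have "expo (2 * i + of_bool s) (gen_image g (2 * i + of_bool r)) = (if r = s then 1 else 0)"
      using E by (cases r; cases s) auto
    then show ?thesis using gen_image_block[OF i] by (simp add: expo_block)
  qed
  have w: "fst g i = []" for i
  proof (cases "i < m")
    case True
    show ?thesis
    proof (rule ccontr)
      assume ne: "fst g i \<noteq> []"
      have "freely_reduced (fst g i)" using g tuples_reduced by (simp add: level_group_mem)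
      then obtain r where r: "\<And>s. expo s (theta (fst g i) r) \<noteq> 0" using theta_expo_nonzero ne by blast
      have "((r \<noteq> snd g) \<noteq> snd g) = r" by auto
      \<comment> \<open>This is the off-diagonal exponent; the generator that is sent to
        \<open>theta (fst g i) r\<close> is \<open>r\<close> with the swap undone.\<close>
      then have "expo (\<not> (r \<noteq> snd g)) (theta (fst g i) r) = 0" using T[OF True, of "\<not> (r \<noteq> snd g)" "r \<noteq> snd g"] by simp
      then show False using r by blast
    qed
  next
    case False
    then show ?thesis using g by (simp add: level_group_mem tuples_def)
  qed
  \<comment> \<open>With trivial words a swap would exchange the two generators of block 0.\<close>
  have "snd g = False"
    using T[OF m_pos, of False False] w by (cases "snd g") (simp_all add: theta_simps)
  then show ?thesis using w by (auto simp: level_group_def prod_eq_iff)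
qed

lemma gout_inj: "inj_on gout (carrier level_group)"
  unfolding inj_on_one_iff'[OF gout_hom group_level_group F.group_Out]
proof (intro allI impI)
  fix g assume g: "g \<in> carrier level_group" and one: "gout g = \<one>\<^bsub>Out F\<^esub>"
  interpret A: group "AutoGroup F" by (rule F.AutoGroup)
  have "gaut g \<in> Inn F #>\<^bsub>AutoGroup F\<^esub> gaut g"
    using A.rcos_self[of "gaut g" "Inn F"] gaut_auto[OF g] normal_imp_subgroup[OF F.Inn_normal] by (simp add: carrier_AutoGroup)
  then have "gaut g \<in> Inn F" using one by (simp add: gout_def Out_def)
  then show "g = \<one>\<^bsub>level_group\<^esub>" by (rule gaut_inner_trivial[OF g])
qed

definition H :: "(nat word \<Rightarrow> nat word) set set" where "H = gout ` carrier level_group"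

sublocale hom_out: group_hom level_group "Out F" gout
  by (rule group_hom.intro[OF group_level_group F.group_Out], unfold_locales) (rule gout_hom)

lemma subgroup_H: "subgroup H (Out F)"
  unfolding H_def by (rule hom_out.img_is_subgroup)

lemma group_H: "group (Out F\<lparr>carrier := H\<rparr>)"
  by (rule group.subgroup_imp_group[OF F.group_Out subgroup_H])

lemma gout_iso: "gout \<in> iso level_group (Out F\<lparr>carrier := H\<rparr>)"
  using gout_hom gout_inj by (auto simp: iso_def hom_def bij_betw_def H_def)

definition lpow :: "nat \<Rightarrow> bool \<Rightarrow> bool \<Rightarrow> w2" where
  "lpow n s e = replicate n (s, e)"

lemma lpow_simps [simp]:
  "freely_reduced (lpow n s e)" "winv (lpow n s e) = lpow n s (\<not> e)" "swap (lpow n s e) = lpow n (\<not> s) e"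
  "height (lpow n s e) = (if e then int n else - int n)"
  by (simp_all add: lpow_def winv_def swap_def inv_letter_def)

lemma lpow_cancel [simp]:
  "freely_reduced v \<Longrightarrow> lpow n s True \<cdot> (lpow n s False \<cdot> v) = v"
  "freely_reduced v \<Longrightarrow> lpow n s False \<cdot> (lpow n s True \<cdot> v) = v"
  "lpow n s True \<cdot> lpow n s False = []" "lpow n s False \<cdot> lpow n s True = []"
  using mul_winv[of v "lpow n s True"] mul_winv[of v "lpow n s False"]
    mul_winv_self[of "lpow n s True"] mul_winv_self[of "lpow n s False"] by simp_all

text \<open>With \<open>t\<close> the swap and \<open>u\<close> the power \<open>a^n\<close> of the
  letter \<open>a = False\<close> in coordinate 0, the element \<open>u t u^-1\<close> has the word
  \<open>a^n b^-n\<close>, because moving \<open>t\<close> past \<open>u^-1\<close> turns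
  \<open>a\<close> into \<open>b = True\<close>. Its exponent sum is 0 although that of
  \<open>u\<close> is \<open>n\<close>.\<close>

definition invol :: "nat \<Rightarrow> (nat \<Rightarrow> w2) \<times> bool" where
  "invol n = ((\<lambda>i. if i = 0 then lpow n False True \<cdot> lpow n True False else []), True)"

lemma invol_mem: "invol n \<in> carrier level_group"
proof -
  have "ht (fst (invol n)) = (\<Sum>i<m. 0)" unfolding ht_def invol_def by (intro sum.cong) auto
  then show ?thesis using m_pos by (auto simp: level_group_mem invol_def tuples_def)
qed

lemma invol_square: "invol n \<otimes>\<^bsub>level_group\<^esub> invol n = \<one>\<^bsub>level_group\<^esub>"
  by (auto simp: level_group_def gact_def invol_def twist_def mul_assoc fun_eq_iff)

text \<open>Up to powers of the generators, the coordinate at 0 of a conjugating element is invariant under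
  the swap, hence trivial; comparing heights shows that the two involutions are equal.\<close>

lemma invol_conj:
  assumes g: "g \<in> carrier level_group" and eq: "g \<otimes>\<^bsub>level_group\<^esub> invol n' = invol n \<otimes>\<^bsub>level_group\<^esub> g"
  shows "n = n'"
proof -
  define w where "w = fst g"
  define \<epsilon> where "\<epsilon> = snd g"
  have wt: "w \<in> tuples" "ht w = 0" using g by (simp_all add: level_group_mem w_def)
  have wr: "freely_reduced (w i)" for i using tuples_reduced[OF wt(1)] .
  have "gact g (fst (invol n')) = gact (invol n) (fst g)" using arg_cong[OF eq, of fst] by (simp add: level_group_def)
  then have "gact g (fst (invol n')) i = gact (invol n) (fst g) i" for i by simp
  then have E: "w i \<cdot> twist \<epsilon> (fst (invol n') i) = fst (invol n) i \<cdot> swap (w i)" for i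
    unfolding gact_def w_def \<epsilon>_def by (simp add: invol_def twist_def)
  have other: "w i = []" if "i \<noteq> 0" for i
    using E[of i] that wr[of i] swap_fixed[of "w i"] by (simp add: invol_def)
  have h0: "height (w 0) = 0"
  proof -
    have "ht w = (\<Sum>i<m. if i = 0 then height (w 0) else 0)" unfolding ht_def using other by (intro sum.cong) auto
    then show ?thesis using wt(2) m_pos by simp
  qed
  define z where "z = lpow n False False \<cdot> (w 0 \<cdot> twist \<epsilon> (lpow n' False True))"
  have zr: "freely_reduced z" by (simp add: z_def)
  have "lpow n False False \<cdot> (w 0 \<cdot> twist \<epsilon> (lpow n' False True \<cdot> lpow n' True False)) = lpow n True False \<cdot> swap (w 0)"
    using E[of 0] wr[of 0] by (simp add: invol_def mul_assoc)
  then have zeq: "z \<cdot> twist \<epsilon> (lpow n' True False) = lpow n True False \<cdot> swap (w 0)"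
    by (simp add: z_def mul_assoc)
  have inv: "twist \<epsilon> (lpow n' True False) \<cdot> twist \<epsilon> (lpow n' True True) = []"
    by (simp flip: twist_simps(6))
  have "z = (z \<cdot> twist \<epsilon> (lpow n' True False)) \<cdot> twist \<epsilon> (lpow n' True True)"
    using zr inv by (simp add: mul_assoc)
  also have "\<dots> = lpow n True False \<cdot> (swap (w 0) \<cdot> twist \<epsilon> (lpow n' True True))"
    unfolding zeq by (simp add: mul_assoc)
  also have "\<dots> = swap z"
    by (cases \<epsilon>) (simp_all add: z_def twist_def)
  finally have "z = []" using swap_fixed[of z] by simp
  then have "height z = 0" by simp
  then show ?thesis using h0 by (simp add: z_def)
qed

lemma infinite_involution_classes:
  "infinite {conjugacy_class (Out F\<lparr>carrier := H\<rparr>) x | x. x \<in> H \<and> group.ord (Out F\<lparr>carrier := H\<rparr>) x = 2}"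
proof -
  let ?G = "Out F\<lparr>carrier := H\<rparr>"
  interpret G: group ?G by (rule group_H)
  have mem: "gout (invol n) \<in> H" for n using invol_mem by (simp add: H_def)
  have memG: "gout (invol n) \<in> carrier ?G" for n using mem by simp
  have one: "\<one>\<^bsub>Out F\<^esub> \<otimes>\<^bsub>Out F\<^esub> gout (invol n) = gout (invol n)" for n
    using hom_out.H.l_one[OF hom_out.hom_closed[OF invol_mem]] .
  have "G.ord (gout (invol n)) = 2" for n
  proof -
    have sq: "gout (invol n) \<otimes>\<^bsub>Out F\<^esub> gout (invol n) = \<one>\<^bsub>Out F\<^esub>"
      using hom_out.hom_mult[OF invol_mem invol_mem, of n n] invol_square hom_out.hom_one by simp
    have "gout (invol n) [^]\<^bsub>?G\<^esub> (2::nat) = \<one>\<^bsub>?G\<^esub>" using sq mem one by (simp add: numeral_2_eq_2 G.nat_pow_Suc)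
    then have "G.ord (gout (invol n)) dvd 2" using G.pow_eq_id[of "gout (invol n)" 2] mem by simp
    moreover have "G.ord (gout (invol n)) \<noteq> 1"
    proof
      assume "G.ord (gout (invol n)) = 1"
      then have "gout (invol n) = \<one>\<^bsub>?G\<^esub>" using G.pow_ord_eq_1[of "gout (invol n)"] mem one by simp
      then have "gout (invol n) = gout \<one>\<^bsub>level_group\<^esub>" using hom_out.hom_one by simp
      then have "invol n = \<one>\<^bsub>level_group\<^esub>" using inj_onD[OF gout_inj] invol_mem by simp
      then show False by (simp add: invol_def level_group_def)
    qed
    ultimately show ?thesis by (metis dvd_antisym nat_dvd_1_iff_1 prime_nat_iff two_is_prime_nat)
  qed
  then have sub: "range (\<lambda>n. conjugacy_class ?G (gout (invol n))) \<subseteq> {conjugacy_class ?G x | x. x \<in> H \<and> G.ord x = 2}"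
    using mem by blast
  have "inj (\<lambda>n. conjugacy_class ?G (gout (invol n)))"
  proof (rule injI)
    fix n n' assume eq: "conjugacy_class ?G (gout (invol n)) = conjugacy_class ?G (gout (invol n'))"
    have "gout (invol n) = \<one>\<^bsub>?G\<^esub> \<otimes>\<^bsub>?G\<^esub> gout (invol n) \<otimes>\<^bsub>?G\<^esub> inv\<^bsub>?G\<^esub> \<one>\<^bsub>?G\<^esub>"
      by (simp only: G.l_one[OF memG] G.inv_one G.r_one[OF memG])
    then have "gout (invol n) \<in> conjugacy_class ?G (gout (invol n))" unfolding conjugacy_class_def using G.one_closed by blast
    then obtain x where x: "x \<in> carrier ?G" "gout (invol n) = x \<otimes>\<^bsub>?G\<^esub> gout (invol n') \<otimes>\<^bsub>?G\<^esub> inv\<^bsub>?G\<^esub> x"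
      unfolding eq by (auto simp: conjugacy_class_def)
    then obtain g where g: "g \<in> carrier level_group" "x = gout g" by (auto simp: H_def)
    have "gout (invol n) \<otimes>\<^bsub>?G\<^esub> x = x \<otimes>\<^bsub>?G\<^esub> gout (invol n')"
      unfolding x(2) using x(1) memG by (simp only: G.m_assoc G.m_closed G.inv_closed G.l_inv G.r_one)
    then have "gout (invol n) \<otimes>\<^bsub>Out F\<^esub> gout g = gout g \<otimes>\<^bsub>Out F\<^esub> gout (invol n')" using g by simp
    then have "gout (invol n \<otimes>\<^bsub>level_group\<^esub> g) = gout (g \<otimes>\<^bsub>level_group\<^esub> invol n')"
      using g invol_mem by simp
    then have "g \<otimes>\<^bsub>level_group\<^esub> invol n' = invol n \<otimes>\<^bsub>level_group\<^esub> g"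
      using inj_onD[OF gout_inj] g(1) invol_mem by (metis hom_out.G.m_closed)
    then show "n = n'" by (rule invol_conj[OF g(1)])
  qed
  then have "infinite (range (\<lambda>n. conjugacy_class ?G (gout (invol n))))" by (rule range_inj_infinite)
  then show ?thesis using sub finite_subset by blast
qed

end

section \<open>Coding of the points and conclusion\<close>

text \<open>A point of the complex is a family of reals with countable index set; its rational lower cuts
  are a set of natural numbers, which is written as a set of maps between words.\<close>

definition cuts :: "cpoint \<times> (nat \<Rightarrow> real) \<Rightarrow> (((nat \<times> w2) + w2 list + nat) \<times> rat) set" where
  "cuts y = {(i, q). of_rat q < (case i of Inl (j, u) \<Rightarrow> fst (fst y) j u | Inr (Inl l) \<Rightarrow> snd (fst y) l | Inr (Inr n) \<Rightarrow> snd y n)}"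

text \<open>The target is the point type that \<open>type_F\<close> prescribes for a subgroup of
  \<open>Out (free_group {..<k})\<close>: sets of maps between words, paired with a real number,
  here 0.\<close>

definition point_code :: "cpoint \<times> (nat \<Rightarrow> real) \<Rightarrow> (nat word \<Rightarrow> nat word) set \<times> real" where
  "point_code y = ((\<lambda>i _. replicate (to_nat i) (0, True)) ` cuts y, 0)"

lemma inj_point_code: "inj point_code"
proof (rule injI)
  fix y z assume "point_code y = point_code z"
  moreover have "inj (\<lambda>(i :: ((nat \<times> w2) + w2 list + nat) \<times> rat) (_ :: nat word). replicate (to_nat i) (0 :: nat, True))"
    by (rule injI) (metis length_replicate to_nat_split inj_to_nat injD)
  ultimately have "cuts y = cuts z" by (simp add: point_code_def inj_image_eq_iff)
  then have cut: "of_rat q < (case i of Inl (j, u) \<Rightarrow> fst (fst y) j u | Inr (Inl l) \<Rightarrow> snd (fst y) l | Inr (Inr n) \<Rightarrow> snd y n) \<longleftrightarrow>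
      of_rat q < (case i of Inl (j, u) \<Rightarrow> fst (fst z) j u | Inr (Inl l) \<Rightarrow> snd (fst z) l | Inr (Inr n) \<Rightarrow> snd z n)" for i q
    by (auto simp: cuts_def set_eq_iff)
  have eq: "a = b" if "\<And>q. of_rat q < a \<longleftrightarrow> of_rat q < b" for a b :: real
    using that of_rat_dense[of a b] of_rat_dense[of b a] by (metis linorder_neqE_linordered_idom order_less_asym)
  have "fst (fst y) j u = fst (fst z) j u" for j u using cut[of _ "Inl (j, u)"] by (intro eq) simp
  moreover have "snd (fst y) l = snd (fst z) l" for l using cut[of _ "Inr (Inl l)"] by (intro eq) simp
  moreover have "snd y n = snd z n" for n using cut[of _ "Inr (Inr n)"] by (intro eq) simp
  ultimately show "y = z" by (simp add: prod_eq_iff fun_eq_iff)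
qed

theorem theorem3p3:
  fixes k :: nat
  assumes "k \<ge> 2"
  shows "\<exists>H. subgroup H (Out (free_group {..<k})) \<and>
           type_F (k div 2 - 1) (Out (free_group {..<k}) \<lparr>carrier := H\<rparr>) \<and>
           infinite {conjugacy_class (Out (free_group {..<k}) \<lparr>carrier := H\<rparr>) x | x.
             x \<in> H \<and> group.ord (Out (free_group {..<k}) \<lparr>carrier := H\<rparr>) x = 2}"
proof -
  interpret level_out "k div 2" k by unfold_locales (use assms in auto)
  obtain X :: "((nat word \<Rightarrow> nat word) set \<times> real) topology" and E
    where X: "cw_complex X E" "Eilenberg_MacLane_1 level_group X" "\<forall>i\<le>k div 2 - 1. finite (E i)"
    using type_F_level_group[OF inj_point_code] by blast
  have iso: "level_group \<cong> Out F\<lparr>carrier := H\<rparr>" using gout_iso by (rule is_isoI)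
  \<comment> \<open>The group enters \<open>Eilenberg_MacLane_1\<close> only up to
    isomorphism.\<close>
  have "Eilenberg_MacLane_1 (Out F\<lparr>carrier := H\<rparr>) X"
    using X(2) iso_trans[OF _ iso] unfolding Eilenberg_MacLane_1_def by blast
  then have "type_F (k div 2 - 1) (Out F\<lparr>carrier := H\<rparr>)" unfolding type_F_def using X(1,3) by blast
  then show ?thesis using subgroup_H infinite_involution_classes by blast
qed

end
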